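(* Let $(a(\varepsilon),[\Psi^0_{\hat\varepsilon},\Psi^\infty_{\hat\varepsilon}])_{\hat\varepsilon\in V_{\rho,\delta}}$ be the modulus of a germ of prepared analytic family of diffeomorphisms, with representative normalized so that the compatibility condition is satisfied in the form $$\widetilde H^\infty\circ(\widetilde H^0)^{-1}=T_{2\pi i a}\circ\overline H^0\circ(\overline H^\infty)^{-1}\circ T_{D'_\varepsilon}.$$ Then the components $\Psi^0_{\hat\varepsilon}$ and $\Psi^\infty_{\hat\varepsilon}$ are $1/2$-summable in $\varepsilon$, and the direction of non-summability is the Glutsyuk direction $\mathbb{R}^+$.
   Context: Notation. $T_B(W)=W+B$. $\hat\varepsilon$ denotes a point of the universal covering of the $\varepsilon$-plane punctured at $0$, $\varepsilon$ its projection, and $\arg\sqrt{\hat\varepsilon}=\frac12\arg\hat\varepsilon$. $V_{\rho,\delta}=\{|\hat\varepsilon|<\rho,\ \arg\hat\varepsilon\in(-\delta,2\pi+\delta)\}\cup\{0\}$ with $\delta\in(0,\frac\pi2)$; $\rho$ and $\delta$ may be shrunk. Prepared family. A germ of family $f_\varepsilon(z)=z+(z^2-\varepsilon)(1+b(\varepsilon)+c(\varepsilon)z+(z^2-\varepsilon)Q(z,\varepsilon))$, analytic in $(z,\varepsilon)$, $b(0)=0$, with $\frac1{\sqrt\varepsilon}=\frac1{\ln f'_\varepsilon(\sqrt\varepsilon)}-\frac1{\ln f_\varepsilon'(-\sqrt\varepsilon)}$; $a(\varepsilon)=\frac1{\ln f'_\varepsilon(\sqrt\varepsilon)}+\frac1{\ln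 f_\varepsilon'(-\sqrt\varepsilon)}$. Modulus. Let $U$ be a small disk around $0$ containing $\pm\sqrt{\varepsilon}$, $Z=p_\varepsilon^{-1}(z)=\frac{1}{2\sqrt{\varepsilon}}\ln\frac{z-\sqrt\varepsilon}{z+\sqrt\varepsilon}$ ($Z=-1/z$ if $\varepsilon=0$). In the $Z$-coordinate $f_\varepsilon$ lifts to $F_\varepsilon$ close to $T_1$; $p_\varepsilon^{-1}(U)$ is the complement of holes around the points $k\pi i/\sqrt{\hat\varepsilon}$, $k\in\mathbb{Z}$; the principal hole is around $0$. A line $\ell$ is admissible if $\ell$ and $F_\varepsilon(\ell)$ are disjoint and bound a strip in $p_\varepsilon^{-1}(U)$; the saturation of this strip under $F_\varepsilon$ is a translation domain and carries a Fatou coordinate, an injective analytic $\Phi$ with $\Phi\circ F_\varepsilon=T_1\circ\Phi$, unique up to left composition with a translation. For $\hat\varepsilon\in V_{\rho,\delta}$ let $\Phi^+_{\hat\varepsilon}$ (resp. $\Phi^-_{\hat\varepsilon}$) be the Fatou coordinates for slanted admissible lines passing between the principal hole and the hole around $-\pi i/\sqrt{\hat\varepsilon}$ (resp. $\pi i/\sqrt{\hat\varepsilon}$), for instance of slope $-\tan(\frac12(\frac\pi2+\arg\sqrt{\hat\varepsilon}))$. Then $\Phi^-_{\hat\varepsilon}\circ(\Phi^+_{\hat\varepsilon})^{-1}$ gives maps commuting with $T_1$: $\Psi^0_{\hat\varepsilon}$ on $\{\mathrm{Im}\,W<-Y_0\}$ and $\Psi^\infty_{\hat\varepsilon}$ on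 $\{\mathrm{Im}\,W>Y_0\}$, with $\Psi^0_{\hat\varepsilon}(W)=W+o(1)$ as $\mathrm{Im}\,W\to-\infty$ and $\Psi^\infty_{\hat\varepsilon}(W)=W-2\pi i a(\varepsilon)+o(1)$ as $\mathrm{Im}\,W\to+\infty$, chosen analytic in $\hat\varepsilon\ne0$ with continuous limit at $0$. The bracket denotes the class modulo $\Psi^{0,\infty}_{\hat\varepsilon}\mapsto T_{-\gamma_{\hat\varepsilon}}\circ\Psi^{0,\infty}_{\hat\varepsilon}\circ T_{\gamma_{\hat\varepsilon}}$, $\gamma_{\hat\varepsilon}$ analytic in $\hat\varepsilon\neq0$ with a limit at $0$. The maps $H$. For $\varepsilon$ with $0<|\varepsilon|<\rho$, $\arg\varepsilon\in(-\delta,\delta)$, let $\bar\varepsilon$ be its lift with $\arg\bar\varepsilon\in(-\delta,\delta)$ and $\tilde\varepsilon=\bar\varepsilon e^{2\pi i}$; bars and tildes over $\Psi^{0,\infty}$, $\alpha^{0,\infty}$ mean evaluation at $\bar\varepsilon$, $\tilde\varepsilon$, where $\alpha^0=-\frac{2\pi i(1-a\sqrt{\hat\varepsilon})}{2\sqrt{\hat\varepsilon}}$, $\alpha^\infty=\alpha^0-2\pi i a$. The maps $\widetilde H^0,\overline H^0$ (near $\mathrm{Im}\,W=-\infty$) and $\widetilde H^\infty,\overline H^\infty$ (near $\mathrm{Im}\,W=+\infty$) are the unique analytic maps commuting with $T_1$, asymptotic to the identity there, with $$\widetilde H^0\circ T_{\tilde\alpha^0}\circ\widetilde\Psi^0=T_{\tilde\alpha^0}\circ\widetilde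 H^0,\quad \widetilde H^\infty\circ T_{\tilde\alpha^0}\circ\widetilde\Psi^\infty=T_{\tilde\alpha^\infty}\circ\widetilde H^\infty,\quad \overline H^0\circ\overline\Psi^0\circ T_{\bar\alpha^0}=T_{\bar\alpha^0}\circ\overline H^0,\quad \overline H^\infty\circ\overline\Psi^\infty\circ T_{\bar\alpha^0}=T_{\bar\alpha^\infty}\circ\overline H^\infty.$$ They extend analytically by these equations and by commutation with $T_1$ to domains on which the composites in the compatibility condition make sense; $D'_\varepsilon$ is a constant depending on $\varepsilon$. $1/2$-summability. A function on a sector is $s$-summable if it is the sum, in that sector of opening greater than $\pi/s$, of a formal series $\sum\beta_n\varepsilon^n$ with $|\beta_n|\le CA^n(n!)^{1/s}$, in the sense that on every subsector $S$ there are constants $A_S,C_S$ with $|\Psi-\sum_{n=0}^{N-1}\beta_n\varepsilon^n|<C_SA_S^N|\varepsilon|^N(N!)^{1/s}$ for all $N$. Here $s=1/2$, the sector is $V_{\rho,\delta}$ (of opening $2\pi+2\delta$, bisected by $\mathbb{R}^-$), the coefficients are analytic functions of $W$, and "direction of non-summability $\mathbb R^+$" means that summability holds in all directions except (possibly) $\mathbb{R}^+$. *)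

theory Defs
  imports "HOL-Complex_Analysis.Complex_Analysis"
begin

section \<open>Prepared families\<close>

definition analytic_on_bidisc :: "(complex \<Rightarrow> complex \<Rightarrow> complex) \<Rightarrow> real \<Rightarrow> real \<Rightarrow> bool" where
  "analytic_on_bidisc Q r \<rho> \<longleftrightarrow>
     (\<exists>q :: nat \<times> nat \<Rightarrow> complex. \<forall>z \<epsilon>. cmod z < r \<longrightarrow> cmod \<epsilon> < \<rho> \<longrightarrow>
        ((\<lambda>(m, n). q (m, n) * z ^ m * \<epsilon> ^ n) has_sum Q z \<epsilon>) UNIV)"

text \<open>
  \<open>f \<epsilon>\<close> is the map of the family at parameter \<open>\<epsilon>\<close>. The germ is represented on
  \<open>cmod z < r\<close>, \<open>cmod \<epsilon> < \<rho>\<close>; the condition \<open>\<rho> < r\<^sup>2\<close> puts the fixed points in the disc of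
  radius \<open>r\<close>. The last equation does not depend on the choice of the square root.
\<close>

definition prepared_family :: "(complex \<Rightarrow> complex \<Rightarrow> complex) \<Rightarrow> real \<Rightarrow> real \<Rightarrow> bool" where
  "prepared_family f r \<rho> \<longleftrightarrow>
     0 < r \<and> 0 < \<rho> \<and> \<rho> < r\<^sup>2 \<and>
     (\<exists>b c Q. b holomorphic_on ball 0 \<rho> \<and> c holomorphic_on ball 0 \<rho> \<and>
        analytic_on_bidisc Q r \<rho> \<and> b 0 = 0 \<and>
        (\<forall>z \<epsilon>. cmod z < r \<longrightarrow> cmod \<epsilon> < \<rho> \<longrightarrow>
           f \<epsilon> z = z + (z\<^sup>2 - \<epsilon>) * (1 + b \<epsilon> + c \<epsilon> * z + (z\<^sup>2 - \<epsilon>) * Q z \<epsilon>))) \<and>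
     (\<forall>\<epsilon>. \<epsilon> \<noteq> 0 \<longrightarrow> cmod \<epsilon> < \<rho> \<longrightarrow>
        1 / csqrt \<epsilon> = 1 / Ln (deriv (f \<epsilon>) (csqrt \<epsilon>)) - 1 / Ln (deriv (f \<epsilon>) (- csqrt \<epsilon>)))"

definition a_quot :: "(complex \<Rightarrow> complex \<Rightarrow> complex) \<Rightarrow> complex \<Rightarrow> complex" where
  "a_quot f \<epsilon> = 1 / Ln (deriv (f \<epsilon>) (csqrt \<epsilon>)) + 1 / Ln (deriv (f \<epsilon>) (- csqrt \<epsilon>))"

text \<open>The formal invariant \<open>a(\<epsilon>)\<close>; the singularity of the formula at \<open>\<epsilon> = 0\<close> is removable.\<close>

definition a_inv :: "(complex \<Rightarrow> complex \<Rightarrow> complex) \<Rightarrow> complex \<Rightarrow> complex" where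
  "a_inv f \<epsilon> = (if \<epsilon> = 0 then Lim (at 0) (a_quot f) else a_quot f \<epsilon>)"


section \<open>The covering of the parameter plane\<close>

text \<open>
  A point of the universal covering of the punctured plane is given by its logarithm: \<open>Some \<zeta>\<close>
  has projection \<open>exp \<zeta>\<close>, argument \<open>Im \<zeta>\<close> and square root \<open>exp (\<zeta> / 2)\<close>, and analyticity in the
  point is holomorphy in \<open>\<zeta>\<close>. \<open>None\<close> is the added point \<open>0\<close>.
\<close>

type_synonym cover = "complex option"

fun eps_of :: "cover \<Rightarrow> complex" where
  "eps_of None = 0"
| "eps_of (Some \<zeta>) = exp \<zeta>"

fun sqrt_of :: "cover \<Rightarrow> complex" where
  "sqrt_of None = 0"
| "sqrt_of (Some \<zeta>) = exp (\<zeta> / 2)"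

definition log_sector :: "real \<Rightarrow> real \<Rightarrow> real \<Rightarrow> complex set" where
  "log_sector \<rho> \<theta>\<^sub>1 \<theta>\<^sub>2 = {\<zeta>. cmod (exp \<zeta>) < \<rho> \<and> \<theta>\<^sub>1 < Im \<zeta> \<and> Im \<zeta> < \<theta>\<^sub>2}"

definition V_dom :: "real \<Rightarrow> real \<Rightarrow> cover set" where
  "V_dom \<rho> \<delta> = insert None (Some ` log_sector \<rho> (- \<delta>) (2 * pi + \<delta>))"


section \<open>The time coordinate and the lifted map\<close>

text \<open>
  \<open>z = pZ s Z\<close> is the solution of \<open>(z - s) / (z + s) = exp (2 * s * Z)\<close>, with \<open>s\<close> the square
  root of the parameter (\<open>Z = - 1 / z\<close> if \<open>s = 0\<close>). Its poles, the points \<open>k * pi * \<i> / s\<close>, lie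
  inside the holes; they are removed explicitly because of \<open>x / 0 = 0\<close>.
\<close>

definition pZ :: "complex \<Rightarrow> complex \<Rightarrow> complex" where
  "pZ s Z = (if s = 0 then - 1 / Z else s * (1 + exp (2 * s * Z)) / (1 - exp (2 * s * Z)))"

definition pZ_poles :: "complex \<Rightarrow> complex set" where
  "pZ_poles s = (if s = 0 then {0} else {Z. exp (2 * s * Z) = 1})"

lemma pZ_inverse:
  assumes "s \<noteq> 0" "Z \<notin> pZ_poles s"
  shows "pZ s Z + s \<noteq> 0" "(pZ s Z - s) / (pZ s Z + s) = exp (2 * s * Z)"
proof -
  have ne: "1 - exp (2 * s * Z) \<noteq> 0"
    using assms by (auto simp: pZ_poles_def)
  have p: "pZ s Z + s = 2 * s / (1 - exp (2 * s * Z))"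
    using assms ne by (simp add: pZ_def field_simps)
  have m: "pZ s Z - s = 2 * s * exp (2 * s * Z) / (1 - exp (2 * s * Z))"
    using assms ne by (simp add: pZ_def field_simps)
  show "pZ s Z + s \<noteq> 0"
    using assms ne by (simp add: p)
  show "(pZ s Z - s) / (pZ s Z + s) = exp (2 * s * Z)"
    unfolding p m using assms ne by simp
qed

text \<open>The preimage of \<open>U = ball 0 r\<close>, that is, the complement of the holes.\<close>

definition Z_dom :: "real \<Rightarrow> cover \<Rightarrow> complex set" where
  "Z_dom r e = {Z. Z \<notin> pZ_poles (sqrt_of e) \<and> pZ (sqrt_of e) Z \<in> ball 0 r}"

text \<open>
  The bound \<open>1 / 4\<close> expresses closeness to the translation by \<open>1\<close>. It singles out one lift, as
  two lifts differ by a multiple of \<open>pi * \<i> / sqrt_of e\<close>, which is large.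
\<close>

definition is_lift ::
  "(complex \<Rightarrow> complex \<Rightarrow> complex) \<Rightarrow> real \<Rightarrow> cover \<Rightarrow> (complex \<Rightarrow> complex) \<Rightarrow> bool" where
  "is_lift f r e F \<longleftrightarrow>
     F holomorphic_on Z_dom r e \<and>
     (\<forall>Z\<in>Z_dom r e. F Z \<notin> pZ_poles (sqrt_of e) \<and>
        pZ (sqrt_of e) (F Z) = f (eps_of e) (pZ (sqrt_of e) Z) \<and> cmod (F Z - (Z + 1)) < 1 / 4)"


section \<open>Admissible lines, translation domains and Fatou coordinates\<close>

definition line :: "complex \<Rightarrow> real \<Rightarrow> complex set" where
  "line P \<phi> = {P + of_real t * cis \<phi> | t. True}"

definition strip_between :: "complex set \<Rightarrow> complex set \<Rightarrow> complex set \<Rightarrow> bool" where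
  "strip_between L M S \<longleftrightarrow> S \<in> components (- (L \<union> M)) \<and> frontier S = L \<union> M"

definition admissible :: "complex set \<Rightarrow> (complex \<Rightarrow> complex) \<Rightarrow> complex set \<Rightarrow> complex set \<Rightarrow> bool" where
  "admissible D F L S \<longleftrightarrow>
     L \<subseteq> D \<and> L \<inter> F ` L = {} \<and> strip_between L (F ` L) S \<and> closure S \<subseteq> D"

inductive_set saturation :: "complex set \<Rightarrow> (complex \<Rightarrow> complex) \<Rightarrow> complex set \<Rightarrow> complex set"
  for D F S where
  base: "Z \<in> S \<Longrightarrow> Z \<in> saturation D F S"
| forward: "Z \<in> saturation D F S \<Longrightarrow> F Z \<in> D \<Longrightarrow> F Z \<in> saturation D F S"
| backward: "Z \<in> D \<Longrightarrow> F Z \<in> saturation D F S \<Longrightarrow> Z \<in> saturation D F S"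

text \<open>
  The directions \<open>cis \<phi>\<close> of slanted lines: upwards, and turned counterclockwise from the
  direction \<open>cis (pi / 2 - arg (sqrt_of e))\<close> of the row of holes by an angle between \<open>0\<close> and \<open>pi\<close>.
  A line of slope \<open>- tan ((pi / 2 + arg (sqrt_of e)) / 2)\<close> has \<open>\<phi> = 3 * pi / 4 - arg (sqrt_of e) / 2\<close>,
  halfway between the row of holes and the horizontal.
\<close>

fun slanted :: "cover \<Rightarrow> real \<Rightarrow> bool" where
  "slanted None \<phi> \<longleftrightarrow> 0 < \<phi> \<and> \<phi> < pi"
| "slanted (Some \<zeta>) \<phi> \<longleftrightarrow>
     0 < \<phi> \<and> \<phi> < pi \<and> pi / 2 - Im \<zeta> / 2 < \<phi> \<and> \<phi> < 3 * pi / 2 - Im \<zeta> / 2"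

text \<open>
  Centres of lines between the principal hole and the hole around \<open>- pi * \<i> / sqrt_of e\<close>; for
  parameter \<open>0\<close> the latter hole has moved to infinity and the lines pass to the left of the
  principal hole. The centres for the opposite hole are the negatives.
\<close>

fun gap_plus :: "cover \<Rightarrow> complex set" where
  "gap_plus None = {of_real x | x. x < 0}"
| "gap_plus (Some \<zeta>) = open_segment 0 (- (of_real pi * \<i> / sqrt_of (Some \<zeta>)))"

definition gap_minus :: "cover \<Rightarrow> complex set" where
  "gap_minus e = uminus ` gap_plus e"

definition translation_domain ::
  "real \<Rightarrow> cover \<Rightarrow> (complex \<Rightarrow> complex) \<Rightarrow> complex set \<Rightarrow> complex set \<Rightarrow> bool" where
  "translation_domain r e F G T \<longleftrightarrow>
     (\<exists>P\<in>G. \<exists>\<phi> S. slanted e \<phi> \<and> admissible (Z_dom r e) F (line P \<phi>) S \<and>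
        T = saturation (Z_dom r e) F (closure S))"

definition fatou_coordinate ::
  "(complex \<Rightarrow> complex) \<Rightarrow> complex set \<Rightarrow> (complex \<Rightarrow> complex) \<Rightarrow> bool" where
  "fatou_coordinate F T \<Phi> \<longleftrightarrow>
     \<Phi> holomorphic_on T \<and> inj_on \<Phi> T \<and> (\<forall>Z\<in>T. F Z \<in> T \<longrightarrow> \<Phi> (F Z) = \<Phi> Z + 1)"


section \<open>The modulus\<close>

definition lower_hp :: "real \<Rightarrow> complex set" where
  "lower_hp y = {W. Im W < y}"

definition upper_hp :: "real \<Rightarrow> complex set" where
  "upper_hp y = {W. Im W > y}"

text \<open>
  \<open>\<Psi>\<close> on the half plane \<open>D\<close> is the transition \<open>\<Phi>m \<circ> \<Phi>p\<inverse>\<close>, which is first defined on the image of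
  the intersection of the two translation domains and then extended by commutation with \<open>T\<^sub>1\<close>.
\<close>

definition transition_on ::
  "complex set \<Rightarrow> complex set \<Rightarrow> (complex \<Rightarrow> complex) \<Rightarrow> complex set \<Rightarrow> (complex \<Rightarrow> complex) \<Rightarrow>
   (complex \<Rightarrow> complex) \<Rightarrow> bool" where
  "transition_on D Tp \<Phi>p Tm \<Phi>m \<Psi> \<longleftrightarrow>
     \<Psi> holomorphic_on D \<and> (\<forall>W\<in>D. \<Psi> (W + 1) = \<Psi> W + 1) \<and>
     (\<forall>W\<in>D. \<exists>n :: int. W + of_int n \<in> \<Phi>p ` (Tp \<inter> Tm)) \<and>
     (\<forall>Z\<in>Tp \<inter> Tm. \<Phi>p Z \<in> D \<longrightarrow> \<Psi> (\<Phi>p Z) = \<Phi>m Z)"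

definition normalized_transition ::
  "(complex \<Rightarrow> complex \<Rightarrow> complex) \<Rightarrow> real \<Rightarrow> real \<Rightarrow> cover \<Rightarrow> (complex \<Rightarrow> complex) \<Rightarrow>
   (complex \<Rightarrow> complex) \<Rightarrow> bool" where
  "normalized_transition f r Y\<^sub>0 e \<psi>0 \<psi>inf \<longleftrightarrow>
     (\<exists>F Tp Tm \<Phi>p \<Phi>m.
        is_lift f r e F \<and>
        translation_domain r e F (gap_plus e) Tp \<and> fatou_coordinate F Tp \<Phi>p \<and>
        translation_domain r e F (gap_minus e) Tm \<and> fatou_coordinate F Tm \<Phi>m \<and>
        transition_on (lower_hp (- Y\<^sub>0)) Tp \<Phi>p Tm \<Phi>m \<psi>0 \<and>
        transition_on (upper_hp Y\<^sub>0) Tp \<Phi>p Tm \<Phi>m \<psi>inf) \<and>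
     ((\<lambda>W. \<psi>0 W - W) \<longlongrightarrow> 0) (filtercomap Im at_bot) \<and>
     ((\<lambda>W. \<psi>inf W - W) \<longlongrightarrow> - 2 * of_real pi * \<i> * a_inv f (eps_of e)) (filtercomap Im at_top)"

text \<open>Analytic dependence on the nonzero points of \<open>V_dom\<close>, with a continuous limit at \<open>0\<close>.\<close>

definition analytic_family ::
  "real \<Rightarrow> real \<Rightarrow> complex set \<Rightarrow> (cover \<Rightarrow> complex \<Rightarrow> complex) \<Rightarrow> bool" where
  "analytic_family \<rho> \<delta> D \<Psi> \<longleftrightarrow>
     (\<forall>W\<in>D. (\<lambda>\<zeta>. \<Psi> (Some \<zeta>) W) holomorphic_on log_sector \<rho> (- \<delta>) (2 * pi + \<delta>)) \<and>
     continuous_on (log_sector \<rho> (- \<delta>) (2 * pi + \<delta>) \<times> D) (\<lambda>(\<zeta>, W). \<Psi> (Some \<zeta>) W) \<and>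
     (\<forall>K. compact K \<longrightarrow> K \<subseteq> D \<longrightarrow>
        uniform_limit K (\<lambda>\<zeta>. \<Psi> (Some \<zeta>)) (\<Psi> None)
          (inf (filtercomap Re at_bot) (principal (log_sector \<rho> (- \<delta>) (2 * pi + \<delta>)))))"

text \<open>
  \<open>(\<Psi>0, \<Psi>inf)\<close> is a representative of the class in the modulus of \<open>f\<close>; the first component of
  the modulus is \<open>a_inv f\<close>.
\<close>

definition modulus_representative ::
  "(complex \<Rightarrow> complex \<Rightarrow> complex) \<Rightarrow> real \<Rightarrow> real \<Rightarrow> real \<Rightarrow> real \<Rightarrow>
   (cover \<Rightarrow> complex \<Rightarrow> complex) \<Rightarrow> (cover \<Rightarrow> complex \<Rightarrow> complex) \<Rightarrow> bool" where
  "modulus_representative f r \<rho> \<delta> Y\<^sub>0 \<Psi>0 \<Psi>inf \<longleftrightarrow>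
     0 < Y\<^sub>0 \<and>
     (\<forall>e\<in>V_dom \<rho> \<delta>. normalized_transition f r Y\<^sub>0 e (\<Psi>0 e) (\<Psi>inf e)) \<and>
     analytic_family \<rho> \<delta> (lower_hp (- Y\<^sub>0)) \<Psi>0 \<and>
     analytic_family \<rho> \<delta> (upper_hp Y\<^sub>0) \<Psi>inf"


section \<open>The compatibility condition\<close>

definition alpha0 :: "(complex \<Rightarrow> complex \<Rightarrow> complex) \<Rightarrow> cover \<Rightarrow> complex" where
  "alpha0 f e = - (2 * of_real pi * \<i> * (1 - a_inv f (eps_of e) * sqrt_of e) / (2 * sqrt_of e))"

definition alphainf :: "(complex \<Rightarrow> complex \<Rightarrow> complex) \<Rightarrow> cover \<Rightarrow> complex" where
  "alphainf f e = alpha0 f e - 2 * of_real pi * \<i> * a_inv f (eps_of e)"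

text \<open>
  Analytic maps on a half plane (to which they have been extended) that commute with \<open>T\<^sub>1\<close> and are
  asymptotic to the identity at the end of the half plane. Injectivity makes their inverses
  meaningful.
\<close>

definition tangent_lower :: "real \<Rightarrow> (complex \<Rightarrow> complex) \<Rightarrow> bool" where
  "tangent_lower y H \<longleftrightarrow>
     H holomorphic_on lower_hp y \<and> inj_on H (lower_hp y) \<and>
     (\<forall>W\<in>lower_hp y. H (W + 1) = H W + 1) \<and>
     ((\<lambda>W. H W - W) \<longlongrightarrow> 0) (filtercomap Im at_bot)"

definition tangent_upper :: "real \<Rightarrow> (complex \<Rightarrow> complex) \<Rightarrow> bool" where
  "tangent_upper y H \<longleftrightarrow>
     H holomorphic_on upper_hp y \<and> inj_on H (upper_hp y) \<and>
     (\<forall>W\<in>upper_hp y. H (W + 1) = H W + 1) \<and>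
     ((\<lambda>W. H W - W) \<longlongrightarrow> 0) (filtercomap Im at_top)"

text \<open>
  The condition at \<open>exp \<zeta>\<close>, \<open>Im \<zeta>\<close> near \<open>0\<close>, with \<open>eb\<close> and \<open>et\<close> the two lifts of \<open>exp \<zeta>\<close> to the
  covering. The functional equations hold near the relevant end and thereby wherever both sides
  are defined. Likewise the identity of composites is required on a horizontal strip on which
  all of them are defined.
\<close>

definition compatible_at ::
  "(complex \<Rightarrow> complex \<Rightarrow> complex) \<Rightarrow> (cover \<Rightarrow> complex \<Rightarrow> complex) \<Rightarrow>
   (cover \<Rightarrow> complex \<Rightarrow> complex) \<Rightarrow> complex \<Rightarrow> bool" where
  "compatible_at f \<Psi>0 \<Psi>inf \<zeta> \<longleftrightarrow>
     (let eb = Some \<zeta>; et = Some (\<zeta> + 2 * of_real pi * \<i>) in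
      \<exists>Ht0 Htinf Hb0 Hbinf yt0 ytinf yb0 ybinf D'.
        tangent_lower yt0 Ht0 \<and> tangent_upper ytinf Htinf \<and>
        tangent_lower yb0 Hb0 \<and> tangent_upper ybinf Hbinf \<and>
        (\<forall>\<^sub>F W in filtercomap Im at_bot.
           Ht0 (\<Psi>0 et W + alpha0 f et) = Ht0 W + alpha0 f et) \<and>
        (\<forall>\<^sub>F W in filtercomap Im at_top.
           Htinf (\<Psi>inf et W + alpha0 f et) = Htinf W + alphainf f et) \<and>
        (\<forall>\<^sub>F W in filtercomap Im at_bot.
           Hb0 (\<Psi>0 eb (W + alpha0 f eb)) = Hb0 W + alpha0 f eb) \<and>
        (\<forall>\<^sub>F W in filtercomap Im at_top.
           Hbinf (\<Psi>inf eb (W + alpha0 f eb)) = Hbinf W + alphainf f eb) \<and>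
        (\<exists>y\<^sub>1 y\<^sub>2. y\<^sub>1 < y\<^sub>2 \<and>
           (\<forall>W. y\<^sub>1 < Im W \<longrightarrow> Im W < y\<^sub>2 \<longrightarrow>
              W \<in> Ht0 ` (lower_hp yt0 \<inter> upper_hp ytinf) \<and>
              W + D' \<in> Hbinf ` (upper_hp ybinf \<inter> lower_hp yb0) \<and>
              Htinf (inv_into (lower_hp yt0) Ht0 W) =
                Hb0 (inv_into (upper_hp ybinf) Hbinf (W + D')) +
                  2 * of_real pi * \<i> * a_inv f (exp \<zeta>))))"


section \<open>Summability\<close>

text \<open>
  \<open>g \<zeta> W\<close>, with \<open>\<zeta>\<close> the logarithm of \<open>\<epsilon>\<close>, is the \<open>s\<close>-sum on the sector of the series
  \<open>\<Sum>n. \<beta> n W * \<epsilon> ^ n\<close>, whose coefficients are analytic in \<open>W \<in> D\<close>. The estimates are locally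
  uniform in \<open>W\<close>.
\<close>

definition gevrey_sum ::
  "real \<Rightarrow> real \<Rightarrow> real \<Rightarrow> real \<Rightarrow> complex set \<Rightarrow> (complex \<Rightarrow> complex \<Rightarrow> complex) \<Rightarrow>
   (nat \<Rightarrow> complex \<Rightarrow> complex) \<Rightarrow> bool" where
  "gevrey_sum s \<rho> \<theta>\<^sub>1 \<theta>\<^sub>2 D g \<beta> \<longleftrightarrow>
     \<theta>\<^sub>2 - \<theta>\<^sub>1 > pi / s \<and>
     (\<forall>n. \<beta> n holomorphic_on D) \<and>
     (\<forall>W\<in>D. (\<lambda>\<zeta>. g \<zeta> W) holomorphic_on log_sector \<rho> \<theta>\<^sub>1 \<theta>\<^sub>2) \<and>
     (\<forall>\<zeta>\<in>log_sector \<rho> \<theta>\<^sub>1 \<theta>\<^sub>2. g \<zeta> holomorphic_on D) \<and>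
     (\<forall>K. compact K \<longrightarrow> K \<subseteq> D \<longrightarrow>
        (\<exists>C>0. \<exists>A>0. \<forall>W\<in>K. \<forall>n. cmod (\<beta> n W) \<le> C * A ^ n * fact n powr (1 / s)) \<and>
        (\<forall>\<rho>' \<theta>\<^sub>1' \<theta>\<^sub>2'. 0 < \<rho>' \<longrightarrow> \<rho>' < \<rho> \<longrightarrow> \<theta>\<^sub>1 < \<theta>\<^sub>1' \<longrightarrow> \<theta>\<^sub>1' < \<theta>\<^sub>2' \<longrightarrow> \<theta>\<^sub>2' < \<theta>\<^sub>2 \<longrightarrow>
           (\<exists>C>0. \<exists>A>0. \<forall>\<zeta>\<in>log_sector \<rho>' \<theta>\<^sub>1' \<theta>\<^sub>2'. \<forall>W\<in>K. \<forall>N.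
              cmod (g \<zeta> W - (\<Sum>n<N. \<beta> n W * exp \<zeta> ^ n))
                < C * A ^ N * cmod (exp \<zeta>) ^ N * fact N powr (1 / s))))"

text \<open>The direction \<open>d\<close> bisects a sector of opening greater than \<open>pi / s\<close> carrying a sum.\<close>

definition summable_in_direction ::
  "real \<Rightarrow> real \<Rightarrow> complex set \<Rightarrow> (nat \<Rightarrow> complex \<Rightarrow> complex) \<Rightarrow> bool" where
  "summable_in_direction s d D \<beta> \<longleftrightarrow>
     (\<exists>\<eta>>0. \<exists>\<rho>>0. \<exists>g.
        gevrey_sum s \<rho> (d - (pi / (2 * s) + \<eta>)) (d + (pi / (2 * s) + \<eta>)) D g \<beta>)"

end

theory Submission
  imports Defs
begin

text \<open>
  Let \<open>A\<close> and \<open>A' = A - 2 * pi * \<i> * a\<close> be the translations \<open>alpha0\<close>, \<open>alphainf\<close> at the lift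
  \<open>\<zeta> + 2 * pi * \<i>\<close> of \<open>\<epsilon> = exp \<zeta>\<close>. Up to a bounded term \<open>A\<close> is \<open>pi * \<i> / sqrt \<epsilon>\<close>, so \<open>Im A\<close> is of size
  \<open>1 / sqrt \<bar>\<epsilon>\<bar>\<close> in every sector \<open>\<bar>Im \<zeta>\<bar> \<le> pi - \<kappa>\<close>. The maps \<open>H\<close> are Koenigs linearizations: near its end of
  the cylinder \<open>\<complex> / \<int>\<close> each of them conjugates a transition map followed or preceded by a large
  translation to a translation, and it differs from the identity by an exponentially small amount
  towards that end.

  The idea is to read the compatibility condition as an equation for the pair at one lift, the pair at
  the other lift being given. The composite of the two linearizations for the given pair is close to
  the identity on the annulus \<open>Y < Im W < Im A - Y\<close> of the cylinder. The condition asks to write it as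
  a quotient of a map holomorphic towards the lower end and a map holomorphic towards the upper end.
  This is a nonlinear Birkhoff factorization, which a contraction solves
  (\<open>annulus_factorization\<close>), and the factors are the linearizations of the other pair
  (\<open>exists_gluing_system\<close>). Four facts follow.

  \<^item> The glued pair depends holomorphically on the parameter, and it exists for all parameters for
    which the given pair exists and \<open>Im A\<close> is large, also outside the overlap of the two lifts.
  \<^item> Any pair that satisfies the condition is the glued pair (\<open>glued_unique\<close>). The condition is
    only known on some strip; the maximum principle brings this strip to the middle of the annulus
    (\<open>centre\<close>), where the factorization is unique.
  \<^item> On the middle line \<open>Im W = Im A / 2\<close> both linearizations are within a multiple of
    \<open>exp (- pi * Im A)\<close> of the identity. So are the factors away from this line,
    and hence the pairs at the two lifts differ by such a multiple (\<open>Qh_close\<close>, \<open>Ph_close\<close>). This is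
    \<open>exp (- c / sqrt \<bar>\<epsilon>\<bar>)\<close>, a flat function of Gevrey order two.
  \<^item> By reflection \<open>W \<mapsto> - W\<close> the roles of the two lifts can be exchanged.

  On the overlap the two values over the same \<open>\<epsilon>\<close> therefore differ by a flat function, and the
  Cauchy-Heine theorem (\<open>cauchy_heine\<close>, \<open>gevrey_sum_of_flat_difference\<close>) turns this into a Gevrey
  expansion of order two on a sector of opening greater than \<open>2 * pi\<close>, that is, \<open>1/2\<close>-summability in the
  direction of the negative axis. For the other directions the pair is continued to parameters
  below and above the given sector by gluing (\<open>continuation_below\<close>, \<open>continuation_above\<close>). The
  continued maps stay flatly close to the given maps over the same \<open>\<epsilon>\<close>, so they are sums of the
  same series (\<open>gevrey_sum_extend\<close>). As \<open>Im A\<close> must stay large, the continuation ends just before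
  \<open>Im \<zeta> = - pi\<close> and \<open>Im \<zeta> = 3 * pi\<close>. In this range each direction in \<open>0 < d < 2 * pi\<close> bisects a
  sector of opening greater than \<open>2 * pi\<close>, and the direction of the positive axis does not.
\<close>

section \<open>Holomorphic functions of two variables\<close>

lemma cauchy_deriv_bound:
 fixes f :: "complex => complex"
 assumes "f holomorphic_on S" "open S" "cball z r \<subseteq> S" "0 < r" "!!w. w \<in> cball z r ==> cmod (f w) <= B"
 shows "cmod (deriv f z) <= B / r"
proof -
 have "cmod ((deriv ^^ 1) f z) <= fact 1 * B / r ^ 1"
 proof (rule Cauchy_inequality)
  show "f holomorphic_on ball z r"
   using assms(1,3) by (meson ball_subset_cball holomorphic_on_subset order_trans)
  show "continuous_on (cball z r) f"
   using assms(1,3) holomorphic_on_imp_continuous_on holomorphic_on_subset by blast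
  show "cmod (f x) <= B" if "cmod (z - x) = r" for x
   using assms(5)[of x] that by (simp add: dist_norm)
 qed (rule assms(4))
 then show ?thesis by simp
qed

lemma cauchy_lipschitz:
 fixes f :: "complex => complex"
 assumes "f holomorphic_on S" "open S" "convex C" "0 < r" "!!z. z \<in> C ==> cball z r \<subseteq> S"
  and "!!w. w \<in> S ==> cmod (f w) <= B" "x \<in> C" "y \<in> C"
 shows "cmod (f x - f y) <= B / r * cmod (x - y)"
proof (rule field_differentiable_bound[OF assms(3)])
 fix z assume z: "z \<in> C"
 then have "z \<in> S" using assms(4) assms(5)[of z] by (auto simp: subset_iff dist_norm)
 then show "(f has_field_derivative deriv f z) (at z within C)"
  using assms(1,2) by (meson has_field_derivative_at_within holomorphic_derivI)
 show "cmod (deriv f z) <= B / r"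
  using assms(5)[OF z] assms(6) by (intro cauchy_deriv_bound[OF assms(1,2) assms(5)[OF z] assms(4)]) auto
qed (use assms in auto)

text \<open>
 Cauchy's estimate bounds the derivative of \<open>\<phi> t - \<phi> t'\<close> by the size of this difference on a circle,
 which is small by uniform continuity.
\<close>

lemma deriv_continuous_param:
 fixes \<phi> :: "'t::metric_space => complex => complex"
 assumes U: "open U" and c: "continuous_on (T \<times> U) (%p. \<phi> (fst p) (snd p))"
  and h: "!!t. t \<in> T ==> \<phi> t holomorphic_on U"
 shows "continuous_on (T \<times> U) (%p. deriv (\<phi> (fst p)) (snd p))"
 unfolding continuous_on_iff
proof (intro ballI allI impI)
 fix p :: "'t \<times> complex" and e :: real assume p: "p \<in> T \<times> U" and e: "0 < e"
 obtain t0 z0 where p_def: "p = (t0, z0)" by force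
 have t0: "t0 \<in> T" and z0: "z0 \<in> U" using p p_def by auto
 obtain r where r: "0 < r" "cball z0 r \<subseteq> U"
  using U z0 open_contains_cball by blast
 have c': "continuous_on (T \<times> cball z0 r) (%p. \<phi> (fst p) (snd p))"
  by (rule continuous_on_subset[OF c]) (use r in auto)
 obtain X0 where X0: "t0 \<in> X0" "open X0"
  "\<forall>t\<in>X0 \<inter> T. \<forall>z\<in>cball z0 r. dist (\<phi> t z) (\<phi> t0 z) <= e * r / 8"
  using continuous_on_prod_compactE[OF c' compact_cball t0, of "e * r / 8"] e r
  by (auto simp: zero_less_mult_iff)
 obtain d1 where d1: "0 < d1" "ball t0 d1 \<subseteq> X0" using X0 open_contains_ball by blast
 have dh: "deriv (\<phi> t0) holomorphic_on U" by (rule holomorphic_deriv[OF h[OF t0] U])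
 then have "continuous_on U (deriv (\<phi> t0))" by (rule holomorphic_on_imp_continuous_on)
 then obtain d2 where d2: "0 < d2" "!!z. z \<in> U ==> dist z z0 < d2 ==> dist (deriv (\<phi> t0) z) (deriv (\<phi> t0) z0) < e / 2"
  unfolding continuous_on_iff using z0 e by (metis half_gt_zero)
 define d where "d = min d1 (min d2 (r / 2))"
 have "dist (deriv (\<phi> t) z) (deriv (\<phi> t0) z0) < e" if t: "t \<in> T" and z: "z \<in> U" and dd: "dist (t, z) (t0, z0) < d" for t z
 proof -
  have dt: "dist t t0 < d" and dz: "dist z z0 < d"
   using dd by (smt (verit) dist_fst_le dist_snd_le fst_conv snd_conv)+
  have tX: "t \<in> X0 \<inter> T" using dt d1 t by (auto simp: d_def dist_commute subset_iff)
  have sub: "cball z (r / 2) \<subseteq> cball z0 r"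
  proof
   fix x assume "x \<in> cball z (r / 2)"
   then show "x \<in> cball z0 r" using dz dist_triangle[of z0 x z] by (auto simp: d_def dist_commute)
  qed
  have eq: "deriv (%w. \<phi> t w - \<phi> t0 w) z = deriv (\<phi> t) z - deriv (\<phi> t0) z"
   using h[OF t] h[OF t0] z U by (intro deriv_diff) (auto simp: holomorphic_on_imp_differentiable_at)
  have "cmod (deriv (%w. \<phi> t w - \<phi> t0 w) z) <= (e * r / 8) / (r / 2)"
  proof (rule cauchy_deriv_bound[of _ U])
   show "(%w. \<phi> t w - \<phi> t0 w) holomorphic_on U" using h t t0 by (intro holomorphic_intros) auto
   show "cball z (r / 2) \<subseteq> U" using sub r by auto
   show "cmod (\<phi> t w - \<phi> t0 w) <= e * r / 8" if "w \<in> cball z (r / 2)" for w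
    using X0(3) tX sub that by (auto simp: dist_norm)
  qed (use U r in auto)
  also have "\<dots> = e / 4" using r by simp
  finally have "dist (deriv (\<phi> t) z) (deriv (\<phi> t0) z) <= e / 4" using eq by (simp add: dist_norm)
  moreover have "dist (deriv (\<phi> t0) z) (deriv (\<phi> t0) z0) < e / 2"
   using d2(2)[OF z] dz by (simp add: d_def)
  ultimately show ?thesis
   using dist_triangle[of "deriv (\<phi> t) z" "deriv (\<phi> t0) z0" "deriv (\<phi> t0) z"] e by linarith
 qed
 moreover have "0 < d" using d1 d2 r by (simp add: d_def)
 ultimately show "\<exists>d>0. \<forall>x'\<in>T \<times> U. dist x' p < d -->
   dist (deriv (\<phi> (fst x')) (snd x')) (deriv (\<phi> (fst p)) (snd p)) < e"
  unfolding p_def by (intro exI[of _ d]) auto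
qed

lemma holomorphic_integral:
 fixes \<phi> :: "real => complex => complex"
 assumes U: "open U" and c: "continuous_on ({a..b} \<times> U) (%p. \<phi> (fst p) (snd p))"
  and h: "!!t. t \<in> {a..b} ==> \<phi> t holomorphic_on U"
 shows "(%z. integral {a..b} (%t. \<phi> t z)) holomorphic_on U"
proof (subst holomorphic_on_open[OF U], intro ballI)
 fix z0 assume "z0 \<in> U"
 then obtain r where r: "0 < r" "ball z0 r \<subseteq> U" using U open_contains_ball by blast
 let ?B = "ball z0 r"
 have 1: "((%z. \<phi> t z) has_field_derivative deriv (\<phi> t) x) (at x within ?B)"
  if "x \<in> ?B" "t \<in> cbox a b" for x t
 proof -
  have "t \<in> {a..b}" "x \<in> U" using that r by auto
  then show ?thesis by (rule has_field_derivative_at_within[OF holomorphic_derivI[OF h U]])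
 qed
 have 2: "(%t. \<phi> t x) integrable_on cbox a b" if x: "x \<in> ?B" for x
 proof -
  have "continuous_on {a..b} (%t. \<phi> (fst (t, x)) (snd (t, x)))"
   by (rule continuous_on_compose2[OF c]) (use x r in \<open>auto intro!: continuous_intros\<close>)
  then have "continuous_on (cbox a b) (%t. \<phi> t x)" by simp
  then show ?thesis by (rule integrable_continuous)
 qed
 have 3: "continuous_on (?B \<times> cbox a b) (%(x, t). deriv (\<phi> t) x)"
 proof -
  have "continuous_on (?B \<times> cbox a b) (%p. deriv (\<phi> (fst (snd p, fst p))) (snd (snd p, fst p)))"
   by (rule continuous_on_compose2[OF deriv_continuous_param[OF U c h]])
     (use r in \<open>auto intro!: continuous_intros\<close>)
  then show ?thesis unfolding case_prod_unfold by simp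
 qed
 have "(%z. integral (cbox a b) (%t. \<phi> t z)) holomorphic_on ?B"
  by (rule leibniz_rule_holomorphic[where f = "%z t. \<phi> t z", OF 1 2 3 convex_ball])
 then show "\<exists>f'. ((%z. integral {a..b} (%t. \<phi> t z)) has_field_derivative f') (at z0)"
  using r by (auto simp: holomorphic_on_open)
qed

text \<open>
 Joint continuity with holomorphy in each variable. These two conditions pass directly through
 integrals, compositions and locally uniform limits, the operations used to solve functional
 equations with parameters.
\<close>

definition hol2 :: "(complex \<times> complex) set => (complex => complex => complex) => bool" where
 "hol2 D f \<longleftrightarrow> open D & continuous_on D (%p. f (fst p) (snd p)) \<and>
   (\<forall>p\<in>D. (%z. f z (snd p)) field_differentiable at (fst p) & f (fst p) field_differentiable at (snd p))"

lemma hol2D: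
 assumes "hol2 D f"
 shows "open D" "continuous_on D (%p. f (fst p) (snd p))"
  "!!z w. (z, w) \<in> D ==> (%z. f z w) field_differentiable at z"
  "!!z w. (z, w) \<in> D ==> f z field_differentiable at w"
 using assms unfolding hol2_def by force+

lemma hol2_holomorphic:
 assumes "hol2 D f"
 shows "(!!z. z \<in> U ==> (z, w) \<in> D) ==> (%z. f z w) holomorphic_on U"
  "(!!w. w \<in> U ==> (z, w) \<in> D) ==> f z holomorphic_on U"
 using hol2D[OF assms] unfolding holomorphic_on_def
 by (meson field_differentiable_at_within)+

lemma hol2_subset: "hol2 D f ==> open E ==> E \<subseteq> D ==> hol2 E f"
 unfolding hol2_def by (meson continuous_on_subset subsetD)

text \<open>
 One partial derivative is continuous by Cauchy's estimate, which is enough for a total derivative.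
 It gives the chain rule for compositions \<open>f (u z) (v z)\<close>.
\<close>

lemma hol2_total_derivative:
 assumes f: "hol2 D f" and p: "(z0, w0) \<in> D"
 shows "\<exists>a b. ((%(z, w). f z w) has_derivative (%(x, y). a * x + b * y)) (at (z0, w0))"
proof -
 obtain A B where AB: "open A" "open B" "(z0, w0) \<in> A \<times> B" "A \<times> B \<subseteq> D"
  using hol2D(1)[OF f] p by (rule open_prod_elim)
 obtain r where r: "0 < r" "ball w0 r \<subseteq> B" using AB open_contains_ball by blast
 have sub: "A \<times> ball w0 r \<subseteq> D" using AB r by auto
 have hw: "f z holomorphic_on ball w0 r" if "z \<in> A" for z
  using hol2_holomorphic(2)[OF f] sub that by (metis SigmaI subsetD)
 have cd: "continuous_on (A \<times> ball w0 r) (%p. deriv (f (fst p)) (snd p))"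
  by (rule deriv_continuous_param[OF open_ball continuous_on_subset[OF hol2D(2)[OF f] sub] hw])
 obtain a where a: "((%z. f z w0) has_field_derivative a) (at z0)"
  using hol2D(3)[OF f p] by (auto simp: field_differentiable_def)
 have opn: "open (A \<times> ball w0 r)" using AB by (simp add: open_Times)
 have mem: "(z0, w0) \<in> A \<times> ball w0 r" using AB r by auto
 have "((%(x, y). f x y) has_derivative (%(tx, ty). a * tx + blinfun_mult_right (deriv (f z0) w0) ty))
   (at (z0, w0) within A \<times> ball w0 r)"
 proof (rule has_derivative_partialsI)
  show "((%x. f x w0) has_derivative (%tx. a * tx)) (at z0 within A)"
   using a by (auto intro: has_derivative_at_withinI simp: has_field_derivative_def)
  show "(f x has_derivative blinfun_apply (blinfun_mult_right (deriv (f x) y))) (at y within ball w0 r)"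
   if "x \<in> A" "y \<in> ball w0 r" for x y
   using holomorphic_derivI[OF hw[OF that(1)] open_ball that(2)]
   by (auto intro: has_derivative_at_withinI simp: has_field_derivative_def)
  have "continuous (at (z0, w0) within A \<times> ball w0 r) (%p. deriv (f (fst p)) (snd p))"
   using cd mem continuous_on_eq_continuous_within by blast
  then have "continuous (at (z0, w0) within A \<times> ball w0 r) (%p. blinfun_mult_right (deriv (f (fst p)) (snd p)))"
   by (rule bounded_linear.continuous[OF bounded_linear_blinfun_mult_right])
  then show "continuous (at (z0, w0) within A \<times> ball w0 r) (%(x, y). blinfun_mult_right (deriv (f x) y))"
   by (simp add: case_prod_unfold)
 qed (use r in auto)
 then show ?thesis
  using at_within_open[OF mem opn] by (auto simp: case_prod_unfold)
qed

lemma hol2_compose_curve: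
 assumes f: "hol2 D f" and u: "u field_differentiable at z" and v: "v field_differentiable at z"
  and p: "(u z, v z) \<in> D"
 shows "(%z. f (u z) (v z)) field_differentiable at z"
proof -
 obtain a b where "((%(z, w). f z w) has_derivative (%(x, y). a * x + b * y)) (at (u z, v z))"
  using hol2_total_derivative[OF f p] by blast
 then have d: "((%p. f (fst p) (snd p)) has_derivative (%h. a * fst h + b * snd h)) (at (u z, v z))"
  by (simp add: case_prod_unfold)
 obtain u' v' where uv: "(u has_field_derivative u') (at z)" "(v has_field_derivative v') (at z)"
  using u v by (auto simp: field_differentiable_def)
 have "((%z. (u z, v z)) has_derivative (%h. (u' * h, v' * h))) (at z)"
  using uv by (intro has_derivative_Pair) (auto simp: has_field_derivative_def)
 from has_derivative_compose[OF this d]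
 have "((%z. f (u z) (v z)) has_derivative (%h. a * (u' * h) + b * (v' * h))) (at z)" by simp
 moreover have "(%h. a * (u' * h) + b * (v' * h)) = (*) (a * u' + b * v')" by (auto simp: algebra_simps)
 ultimately show ?thesis
  unfolding field_differentiable_def has_field_derivative_def by auto
qed

lemma hol2_compose:
 assumes f: "hol2 D f" and u: "hol2 E u" and v: "hol2 E v"
  and sub: "!!z w. (z, w) \<in> E ==> (u z w, v z w) \<in> D"
 shows "hol2 E (%z w. f (u z w) (v z w))"
 unfolding hol2_def
proof (intro conjI ballI)
 show "open E" using hol2D(1)[OF u] .
 have "continuous_on E (%p. (%p. f (fst p) (snd p)) (u (fst p) (snd p), v (fst p) (snd p)))"
  by (rule continuous_on_compose2[OF hol2D(2)[OF f]])
    (use sub in \<open>auto intro!: continuous_on_Pair hol2D(2)[OF u] hol2D(2)[OF v]\<close>)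
 then show "continuous_on E (%p. f (u (fst p) (snd p)) (v (fst p) (snd p)))" by simp
 fix p assume "p \<in> E"
 then have p: "(fst p, snd p) \<in> E" by simp
 show "(%z. f (u z (snd p)) (v z (snd p))) field_differentiable at (fst p)"
  using hol2_compose_curve[OF f, of "%z. u z (snd p)" "fst p" "%z. v z (snd p)"] sub[OF p]
   hol2D(3)[OF u p] hol2D(3)[OF v p] by blast
 show "(%w. f (u (fst p) w) (v (fst p) w)) field_differentiable at (snd p)"
  using hol2_compose_curve[OF f hol2D(4)[OF u p] hol2D(4)[OF v p] sub[OF p]] .
qed

lemma hol2_const: "open D ==> hol2 D (%z w. c)"
 and hol2_fst: "open D ==> hol2 D (%z w. z)"
 and hol2_snd: "open D ==> hol2 D (%z w. w)"
 by (auto simp: hol2_def intro!: continuous_intros)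

lemma hol2_add: "hol2 D f ==> hol2 D g ==> hol2 D (%z w. f z w + g z w)"
 and hol2_diff: "hol2 D f ==> hol2 D g ==> hol2 D (%z w. f z w - g z w)"
 and hol2_mult: "hol2 D f ==> hol2 D g ==> hol2 D (%z w. f z w * g z w)"
 and hol2_minus: "hol2 D f ==> hol2 D (%z w. - f z w)"
 unfolding hol2_def
 by (auto intro!: continuous_intros field_differentiable_add field_differentiable_diff
   field_differentiable_mult field_differentiable_minus)

lemma hol2_divide:
 assumes "hol2 D f" "hol2 D g" "!!z w. (z, w) \<in> D ==> g z w \<noteq> 0"
 shows "hol2 D (%z w. f z w / g z w)"
 using assms unfolding hol2_def
 by (auto intro!: continuous_intros field_differentiable_divide)

lemma hol2_holo:
 assumes "f holomorphic_on S" "open S" "hol2 D u" "!!z w. (z, w) \<in> D ==> u z w \<in> S"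
 shows "hol2 D (%z w. f (u z w))"
proof -
 have "hol2 (S \<times> UNIV) (%z w. f z)"
  unfolding hol2_def using assms(1,2)
  by (auto intro!: open_Times continuous_on_compose2[OF holomorphic_on_imp_continuous_on[OF assms(1)]]
    continuous_intros simp: holomorphic_on_imp_differentiable_at)
 from hol2_compose[OF this assms(3,3)] assms(4) show ?thesis by auto
qed

lemma hol2_exp: "hol2 D f ==> hol2 D (%z w. exp (f z w))"
 by (rule hol2_holo[where S = UNIV]) (auto intro: holomorphic_intros)

lemma hol2_fst_holo: "f holomorphic_on S ==> open S ==> open D ==> D \<subseteq> S \<times> UNIV ==> hol2 D (%z w. f z)"
 by (rule hol2_holo[where S = S]) (auto intro: hol2_fst)

lemmas hol2_intros = hol2_const hol2_fst hol2_snd hol2_add hol2_diff hol2_mult hol2_minus hol2_exp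

lemma hol2_cong:
 assumes "hol2 D f" "!!z w. (z, w) \<in> D ==> f z w = g z w"
 shows "hol2 D g"
 unfolding hol2_def
proof (intro conjI ballI)
 show o: "open D" using hol2D(1)[OF assms(1)] .
 show "continuous_on D (%p. g (fst p) (snd p))"
  using hol2D(2)[OF assms(1)] by (rule continuous_on_eq) (use assms(2) in auto)
 fix p assume p: "p \<in> D"
 obtain A B where AB: "open A" "open B" "p \<in> A \<times> B" "A \<times> B \<subseteq> D"
  using o p by (rule open_prod_elim)
 have "(%z. f z (snd p)) field_differentiable at (fst p)" "f (fst p) field_differentiable at (snd p)"
  using hol2D(3,4)[OF assms(1), of "fst p" "snd p"] p by auto
 then obtain a b where "((%z. f z (snd p)) has_field_derivative a) (at (fst p))"
  "(f (fst p) has_field_derivative b) (at (snd p))"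
  by (auto simp: field_differentiable_def)
 moreover have "g z (snd p) = f z (snd p)" if "z \<in> A" for z using that AB assms(2) by auto
 moreover have "g (fst p) w = f (fst p) w" if "w \<in> B" for w using that AB assms(2) by auto
 ultimately have "((%z. g z (snd p)) has_field_derivative a) (at (fst p))"
  "(g (fst p) has_field_derivative b) (at (snd p))"
  using has_field_derivative_transform_within_open[of "%z. f z (snd p)" a "fst p" A "%z. g z (snd p)"]
   has_field_derivative_transform_within_open[of "f (fst p)" b "snd p" B "g (fst p)"] AB by auto
 then show "(%z. g z (snd p)) field_differentiable at (fst p)" "g (fst p) field_differentiable at (snd p)"
  by (auto simp: field_differentiable_def)
qed

lemma hol2_local:
 assumes "open D" "!!z w. (z, w) \<in> D ==> \<exists>E g. (z, w) \<in> E & hol2 E g & (\<forall>z w. (z, w) \<in> E --> f z w = g z w)"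
 shows "hol2 D f"
proof -
 have *: "\<exists>E. p \<in> E & hol2 E f" if "p \<in> D" for p
  using assms(2)[of "fst p" "snd p"] that by (metis hol2_cong prod.collapse)
 show ?thesis
  unfolding hol2_def
 proof (intro conjI ballI)
  show "continuous_on D (%p. f (fst p) (snd p))"
  proof (rule continuous_at_imp_continuous_on, rule ballI)
   fix p assume "p \<in> D"
   then obtain E where "p \<in> E" "hol2 E f" using * by blast
   then show "isCont (%p. f (fst p) (snd p)) p"
    using hol2D(1,2) continuous_on_eq_continuous_at by blast
  qed
  fix p assume "p \<in> D"
  then obtain E where "p \<in> E" "hol2 E f" using * by blast
  then show "(%z. f z (snd p)) field_differentiable at (fst p)" "f (fst p) field_differentiable at (snd p)"
   using hol2D(3,4)[of E f "fst p" "snd p"] by auto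
 qed (rule assms(1))
qed

text \<open>Weierstrass' theorem in each variable.\<close>

lemma hol2_uniform_limit:
 assumes f: "!!n. hol2 D (f n)" and D: "open D"
  and lim: "!!p. p \<in> D ==> \<exists>B. open B & p \<in> B & B \<subseteq> D \<and>
    uniform_limit B (%n p. f n (fst p) (snd p)) (%p. g (fst p) (snd p)) sequentially"
 shows "hol2 D g"
 unfolding hol2_def
proof (intro conjI ballI)
 show "open D" by fact
 show "continuous_on D (%p. g (fst p) (snd p))"
 proof (rule continuous_at_imp_continuous_on, rule ballI)
  fix p assume "p \<in> D"
  then obtain B where B: "open B" "p \<in> B" "B \<subseteq> D"
   "uniform_limit B (%n p. f n (fst p) (snd p)) (%p. g (fst p) (snd p)) sequentially"
   using lim by blast
  have "continuous_on B (%p. g (fst p) (snd p))"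
   by (rule uniform_limit_theorem[OF _ B(4)])
     (auto intro!: always_eventually continuous_on_subset[OF hol2D(2)[OF f] B(3)])
  then show "isCont (%p. g (fst p) (snd p)) p" using B continuous_on_eq_continuous_at by blast
 qed
 fix p assume "p \<in> D"
 then obtain B where B: "open B" "p \<in> B" "B \<subseteq> D"
   "uniform_limit B (%n p. f n (fst p) (snd p)) (%p. g (fst p) (snd p)) sequentially"
  using lim by blast
 obtain X Y where XY: "open X" "open Y" "p \<in> X \<times> Y" "X \<times> Y \<subseteq> B"
  using B(1,2) by (rule open_prod_elim)
 have mX: "(z, snd p) \<in> B" if "z \<in> X" for z using XY(3,4) that by (cases p) auto
 have mY: "(fst p, w) \<in> B" if "w \<in> Y" for w using XY(3,4) that by (cases p) auto
 have u1: "uniform_limit X (%n z. f n z (snd p)) (%z. g z (snd p)) sequentially"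
 proof (rule uniform_limitI)
  fix e :: real assume "0 < e"
  from uniform_limitD[OF B(4) this]
  show "\<forall>\<^sub>F n in sequentially. \<forall>x\<in>X. dist (f n x (snd p)) (g x (snd p)) < e"
   by (rule eventually_mono) (use mX in fastforce)
 qed
 have u2: "uniform_limit Y (%n w. f n (fst p) w) (g (fst p)) sequentially"
 proof (rule uniform_limitI)
  fix e :: real assume "0 < e"
  from uniform_limitD[OF B(4) this]
  show "\<forall>\<^sub>F n in sequentially. \<forall>x\<in>Y. dist (f n (fst p) x) (g (fst p) x) < e"
   by (rule eventually_mono) (use mY in fastforce)
 qed
 have "(%z. g z (snd p)) holomorphic_on X"
 proof (rule holomorphic_uniform_sequence[OF XY(1), of "%n z. f n z (snd p)"])
  show "(%z. f n z (snd p)) holomorphic_on X" for n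
   by (rule hol2_holomorphic(1)[OF f]) (use mX B(3) in blast)
  show "\<exists>d>0. cball x d \<subseteq> X & uniform_limit (cball x d) (%n z. f n z (snd p)) (%z. g z (snd p)) sequentially"
   if x: "x \<in> X" for x
  proof -
   obtain d where d: "0 < d" "cball x d \<subseteq> X" using XY(1)[unfolded open_contains_cball, THEN bspec, OF x] by blast
   show ?thesis by (intro exI[of _ d] conjI d uniform_limit_on_subset[OF u1])
  qed
 qed
 then show "(%z. g z (snd p)) field_differentiable at (fst p)"
  by (rule holomorphic_on_imp_differentiable_at) (use XY(1-3) in \<open>auto simp: mem_Times_iff\<close>)
 have "g (fst p) holomorphic_on Y"
 proof (rule holomorphic_uniform_sequence[OF XY(2), of "%n. f n (fst p)"])
  show "f n (fst p) holomorphic_on Y" for n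
   by (rule hol2_holomorphic(2)[OF f]) (use mY B(3) in blast)
  show "\<exists>d>0. cball x d \<subseteq> Y & uniform_limit (cball x d) (%n. f n (fst p)) (g (fst p)) sequentially"
   if x: "x \<in> Y" for x
  proof -
   obtain d where d: "0 < d" "cball x d \<subseteq> Y" using XY(2)[unfolded open_contains_cball, THEN bspec, OF x] by blast
   show ?thesis by (intro exI[of _ d] conjI d uniform_limit_on_subset[OF u2])
  qed
 qed
 then show "g (fst p) field_differentiable at (snd p)"
  by (rule holomorphic_on_imp_differentiable_at) (use XY(1-3) in \<open>auto simp: mem_Times_iff\<close>)
qed

lemma hol2_integral:
 fixes \<phi> :: "real => complex => complex => complex"
 assumes D: "open D"
  and c: "continuous_on ({a..b} \<times> D) (%p. \<phi> (fst p) (fst (snd p)) (snd (snd p)))"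
  and h: "!!t. t \<in> {a..b} ==> hol2 D (\<phi> t)"
 shows "hol2 D (%z w. integral {a..b} (%t. \<phi> t z w))"
 unfolding hol2_def
proof (intro conjI ballI)
 show "open D" by fact
 have "continuous_on (D \<times> cbox a b) (%q. (%p. \<phi> (fst p) (fst (snd p)) (snd (snd p))) (snd q, fst q))"
  by (rule continuous_on_compose2[OF c]) (auto intro!: continuous_intros simp: cbox_interval)
 then have "continuous_on (D \<times> cbox a b) (%(p, t). \<phi> t (fst p) (snd p))"
  unfolding case_prod_unfold fst_conv snd_conv .
 from integral_continuous_on_param[OF this]
 show "continuous_on D (%p. integral {a..b} (%t. \<phi> t (fst p) (snd p)))" unfolding cbox_interval .
 fix p assume p: "p \<in> D"
 obtain X Y where XY: "open X" "open Y" "p \<in> X \<times> Y" "X \<times> Y \<subseteq> D"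
  using D p by (rule open_prod_elim)
 have mX: "(z, snd p) \<in> D" if "z \<in> X" for z using XY(3,4) that by (cases p) auto
 have mY: "(fst p, w) \<in> D" if "w \<in> Y" for w using XY(3,4) that by (cases p) auto
 have "continuous_on ({a..b} \<times> X) (%q. (%p. \<phi> (fst p) (fst (snd p)) (snd (snd p))) (fst q, (snd q, snd p)))"
  by (rule continuous_on_compose2[OF c]) (use mX in \<open>auto intro!: continuous_intros\<close>)
 then have "(%z. integral {a..b} (%t. \<phi> t z (snd p))) holomorphic_on X"
  by (intro holomorphic_integral[OF XY(1)]) (use mX in \<open>auto intro!: hol2_holomorphic(1)[OF h]\<close>)
 then show "(%z. integral {a..b} (%t. \<phi> t z (snd p))) field_differentiable at (fst p)"
  by (rule holomorphic_on_imp_differentiable_at) (use XY(1-3) in \<open>auto simp: mem_Times_iff\<close>)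
 have "continuous_on ({a..b} \<times> Y) (%q. (%p. \<phi> (fst p) (fst (snd p)) (snd (snd p))) (fst q, (fst p, snd q)))"
  by (rule continuous_on_compose2[OF c]) (use mY in \<open>auto intro!: continuous_intros\<close>)
 then have "(%w. integral {a..b} (%t. \<phi> t (fst p) w)) holomorphic_on Y"
  by (intro holomorphic_integral[OF XY(2)]) (use mY in \<open>auto intro!: hol2_holomorphic(2)[OF h]\<close>)
 then show "(%w. integral {a..b} (%t. \<phi> t (fst p) w)) field_differentiable at (snd p)"
  by (rule holomorphic_on_imp_differentiable_at) (use XY(1-3) in \<open>auto simp: mem_Times_iff\<close>)
qed

section \<open>Periodic functions on horizontal strips\<close>

definition hstrip :: "real => real => complex set" where
 "hstrip y1 y2 = {W. y1 < Im W & Im W < y2}"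

lemma mem_hstrip [simp]: "W \<in> hstrip y1 y2 \<longleftrightarrow> y1 < Im W & Im W < y2"
 by (simp add: hstrip_def)
lemma mem_lower_hp [simp]: "W \<in> lower_hp y \<longleftrightarrow> Im W < y"
 by (simp add: lower_hp_def)
lemma mem_upper_hp [simp]: "W \<in> upper_hp y \<longleftrightarrow> y < Im W"
 by (simp add: upper_hp_def)

lemma hstrip_open [simp, intro]: "open (hstrip y1 y2)" "open (lower_hp y)" "open (upper_hp y)"
 unfolding hstrip_def lower_hp_def upper_hp_def
 by (auto intro!: open_Collect_conj open_Collect_less continuous_intros)

lemma convex_hstrip [simp, intro]: "convex (hstrip y1 y2)" "convex (lower_hp y)" "convex (upper_hp y)"
proof -
 have 1: "convex (lower_hp y)" and 2: "convex (upper_hp y)" for y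
  unfolding lower_hp_def upper_hp_def by (rule convex_halfspace_Im_lt convex_halfspace_Im_gt)+
 have "hstrip y1 y2 = upper_hp y1 \<inter> lower_hp y2" by auto
 with 1 2 show "convex (hstrip y1 y2)" "convex (lower_hp y)" "convex (upper_hp y)"
  by (auto intro: convex_Int)
qed

lemma connected_hstrip [simp, intro]: "connected (hstrip y1 y2)" "connected (lower_hp y)" "connected (upper_hp y)"
 by (auto intro: convex_connected)

text \<open>
 The integral over a period, the zeroth Fourier coefficient. For a periodic holomorphic function it
 does not depend on the height of the segment.
\<close>

definition pmean :: "complex => (complex => complex) => complex" where
 "pmean c f = integral {0..1} (%x. f (of_real x + c))"

lemma pmean_primitive:
 assumes "convex B" "open B" "c \<in> B" "c + 1 \<in> B" "!!x. x \<in> B ==> (g has_field_derivative f x) (at x)"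
 shows "pmean c f = g (c + 1) - g c"
proof -
 have inB: "of_real x + c \<in> B" if "x \<in> {0..1}" for x
 proof -
  have "(1 - x) *\<^sub>R c + x *\<^sub>R (c + 1) \<in> B"
   using assms(1,3,4) that by (intro convexD) auto
  moreover have "(1 - x) *\<^sub>R c + x *\<^sub>R (c + 1) = of_real x + c"
   by (simp add: scaleR_conv_of_real algebra_simps)
  ultimately show ?thesis by metis
 qed
 have "((%x. f (of_real x + c)) has_integral (g (of_real 1 + c) - g (of_real 0 + c))) {0..1}"
 proof (rule fundamental_theorem_of_calculus)
  fix x :: real assume x: "x \<in> {0..1}"
  have "((%x. of_real x + c) has_vector_derivative (1 + 0)) (at x within {0..1})"
   using has_vector_derivative_add[OF has_vector_derivative_of_real[OF DERIV_ident]
     has_vector_derivative_const] by simp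
  from field_vector_diff_chain_within[OF this, of g "f (of_real x + c)"]
  have "(g \<circ> (%x. of_real x + c) has_vector_derivative (1 + 0) * f (of_real x + c)) (at x within {0..1})"
   using assms(5)[OF inB[OF x]] by (auto intro: has_field_derivative_at_within)
  then show "((%x. g (of_real x + c)) has_vector_derivative f (of_real x + c)) (at x within {0..1})"
   by (simp add: o_def)
 qed simp
 then show ?thesis unfolding pmean_def by (simp add: integral_unique add.commute)
qed

lemma pmean_indep_gen:
 assumes f: "f holomorphic_on B" and B: "convex B" "open B"
  and N: "convex N" "open N" "N \<subseteq> B" "!!w. w \<in> N ==> w + 1 \<in> B"
  and per: "!!w. w \<in> N ==> f (w + 1) = f w" and c: "c \<in> N" "c' \<in> N"
 shows "pmean c f = pmean c' f"
proof -
 obtain g where g: "!!x. x \<in> B ==> (g has_field_derivative f x) (at x)"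
  using holomorphic_convex_primitive'[OF B f] B by (metis at_within_open)
 have "((%w. g (w + 1) - g w) has_field_derivative 0) (at w within N)" if w: "w \<in> N" for w
 proof -
  have 1: "(g has_field_derivative f (w + 1)) (at (w + 1))" using g N(4) w by blast
  have 2: "((%w. w + 1) has_field_derivative 1) (at w)" by (auto intro!: derivative_eq_intros)
  have "((%w. g (w + 1)) has_field_derivative f (w + 1) * 1) (at w)"
   using DERIV_chain2[OF 1 2] .
  then have "((%w. g (w + 1) - g w) has_field_derivative f (w + 1) * 1 - f w) (at w)"
   using g N(3) w by (intro DERIV_diff) auto
  then show ?thesis using per[OF w] by (simp add: has_field_derivative_at_within)
 qed
 then have "g (c + 1) - g c = g (c' + 1) - g c'"
  using has_field_derivative_zero_constant[OF N(1), of "%w. g (w + 1) - g w"] c by metis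
 moreover have "pmean c f = g (c + 1) - g c" "pmean c' f = g (c' + 1) - g c'"
  using pmean_primitive[OF B] g N(3,4) c by (auto simp: subset_iff)
 ultimately show ?thesis by simp
qed

lemma pmean_indep:
 assumes "f holomorphic_on hstrip y1 y2" "!!w. w \<in> hstrip y1 y2 ==> f (w + 1) = f w"
  "c \<in> hstrip y1 y2" "c' \<in> hstrip y1 y2"
 shows "pmean c f = pmean c' f"
 by (rule pmean_indep_gen[OF assms(1), where N = "hstrip y1 y2"]) (use assms in auto)

lemma pmean_cont:
 assumes "f holomorphic_on S" "!!x. x \<in> {0..1} ==> of_real x + c \<in> S"
 shows "continuous_on {0..1} (%x. f (of_real x + c))"
 by (rule continuous_on_compose2[OF holomorphic_on_imp_continuous_on[OF assms(1)]])
   (use assms(2) in \<open>auto intro!: continuous_intros\<close>)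

lemma pmean_bound:
 assumes "f holomorphic_on S" "!!x. x \<in> {0..1} ==> of_real x + c \<in> S"
  and "!!w. Im w = Im c ==> cmod (f w) <= B"
 shows "cmod (pmean c f) <= B"
 unfolding pmean_def
 using integral_bound[of 0 1 "%x. f (of_real x + c)" B] pmean_cont[OF assms(1,2)] assms(3) by simp

lemma pmean_diff:
 assumes "f holomorphic_on S" "g holomorphic_on S" "!!x. x \<in> {0..1} ==> of_real x + c \<in> S"
 shows "pmean c (%w. f w - g w) = pmean c f - pmean c g"
 unfolding pmean_def
 using assms by (intro integral_diff integrable_continuous_real pmean_cont) auto

lemma pmean_cmul: "pmean c (%w. a * f w) = a * pmean c f"
 unfolding pmean_def by simp

lemma pmean_cong: "(!!w. Im w = Im c ==> f w = g w) ==> pmean c f = pmean c g"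
 unfolding pmean_def by (intro integral_cong) auto

text \<open>
 The Cauchy kernel of the cylinder \<open>\<complex> / \<int>\<close>. As a function of \<open>w\<close> it has one simple pole, at \<open>W\<close>, and it tends
 to \<open>1\<close> at the lower and to \<open>0\<close> at the upper end.
\<close>

definition kern :: "complex => complex => complex" where
 "kern W w = 1 / (1 - exp (2 * of_real pi * \<i> * (W - w)))"

lemma norm_expi: "cmod (exp (2 * of_real pi * \<i> * z)) = exp (- (2 * pi * Im z))"
 by (simp add: norm_exp_eq_Re)

lemma exp_small: "d \<ge> 1 / 4 ==> exp (- (2 * pi * d)) <= 1 / (2::real)"
proof -
 assume d: "d \<ge> 1 / 4"
 have "2 * pi * d \<ge> 2 * pi * (1 / 4)" using d by (intro mult_left_mono) auto
 then have "exp (2 * pi * d) \<ge> 1 + 2 * pi * (1 / 4)" using exp_ge_add_one_self[of "2 * pi * d"] by linarith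
 also have "1 + 2 * pi * (1 / 4) \<ge> 2" using pi_gt3 by linarith
 finally show ?thesis by (simp add: exp_minus field_simps)
qed

lemma kern_periodic: "kern W (w + 1) = kern W w"
proof -
 have "exp (2 * of_real pi * \<i> * (W - (w + 1))) = exp (2 * of_real pi * \<i> * (W - w) - 2 * of_real pi * \<i>)"
  by (simp add: algebra_simps)
 also have "\<dots> = exp (2 * of_real pi * \<i> * (W - w))" by (simp add: exp_diff)
 finally show ?thesis by (simp add: kern_def)
qed

lemma kern_ne: "Im w \<noteq> Im W ==> exp (2 * of_real pi * \<i> * (W - w)) \<noteq> 1"
proof
 assume w: "Im w \<noteq> Im W" and "exp (2 * of_real pi * \<i> * (W - w)) = 1"
 then have "exp (- (2 * pi * Im (W - w))) = 1" using norm_expi[of "W - w"] by simp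
 then have "Im (W - w) = 0" by simp
 with w show False by simp
qed

lemma kern_holomorphic: "(!!w. w \<in> S ==> Im w \<noteq> Im W) ==> kern W holomorphic_on S"
 unfolding kern_def using kern_ne by (fastforce intro!: holomorphic_intros)

lemma kern_bounds_below:
 assumes "Im W - Im w \<ge> 1 / 4"
 shows "cmod (kern W w) <= 2" "cmod (kern W w - 1) <= 2 * exp (- (2 * pi * (Im W - Im w)))"
proof -
 define E where "E = exp (2 * of_real pi * \<i> * (W - w))"
 have nE: "cmod E = exp (- (2 * pi * (Im W - Im w)))" unfolding E_def by (subst norm_expi) simp
 then have E: "cmod E <= 1 / 2" using exp_small[OF assms] by simp
 have d: "cmod (1 - E) \<ge> 1 / 2" using norm_triangle_ineq2[of 1 E] E by simp
 then have ne: "1 - E \<noteq> 0" by auto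
 show "cmod (kern W w) <= 2" unfolding kern_def E_def[symmetric] norm_divide
  using d by (simp add: divide_simps)
 have "kern W w - 1 = E / (1 - E)" unfolding kern_def E_def[symmetric] using ne by (simp add: field_simps)
 then have "cmod (kern W w - 1) = cmod E / cmod (1 - E)" by (simp add: norm_divide)
 also have "\<dots> <= cmod E / (1 / 2)" by (intro divide_left_mono) (use d in auto)
 finally show "cmod (kern W w - 1) <= 2 * exp (- (2 * pi * (Im W - Im w)))" using nE by simp
qed

lemma kern_bounds_above:
 assumes "Im w - Im W \<ge> 1 / 4"
 shows "cmod (kern W w) <= 2 * exp (- (2 * pi * (Im w - Im W)))" "cmod (kern W w) <= 1"
proof -
 define E where "E = exp (2 * of_real pi * \<i> * (w - W))"
 have nE: "cmod E = exp (- (2 * pi * (Im w - Im W)))" unfolding E_def by (subst norm_expi) simp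
 then have E: "cmod E <= 1 / 2" using exp_small[OF assms] by simp
 have d: "cmod (1 - E) \<ge> 1 / 2" using norm_triangle_ineq2[of 1 E] E by simp
 then have ne: "1 - E \<noteq> 0" by auto
 have e: "exp (2 * of_real pi * \<i> * (W - w)) = 1 / E"
 proof -
  have "2 * of_real pi * \<i> * (W - w) = - (2 * of_real pi * \<i> * (w - W))" by (simp add: algebra_simps)
  then show ?thesis unfolding E_def by (metis exp_minus inverse_eq_divide)
 qed
 have "E \<noteq> 0" by (simp add: E_def)
 then have "kern W w = - (E / (1 - E))" unfolding kern_def e using ne by (simp add: field_simps)
 then have "cmod (kern W w) = cmod E / cmod (1 - E)" by (simp add: norm_divide)
 also have "\<dots> <= cmod E / (1 / 2)" by (intro divide_left_mono) (use d in auto)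
 finally show *: "cmod (kern W w) <= 2 * exp (- (2 * pi * (Im w - Im W)))" using nE by simp
 show "cmod (kern W w) <= 1" using * exp_small[OF assms] by linarith
qed

lemma exp_neg_eventually_small:
 assumes "0 < e" shows "\<exists>X\<ge>(X0::real). K * exp (- (2 * pi * X)) < e"
proof -
 have "((%X. K * exp (- (2 * pi * X))) \<longlongrightarrow> 0) at_top"
  using pi_gt_zero by real_asymp
 then have "\<forall>\<^sub>F X in at_top. K * exp (- (2 * pi * X)) < e" using assms by (rule order_tendstoD)
 then have "\<forall>\<^sub>F X in at_top. X \<ge> X0 & K * exp (- (2 * pi * X)) < e"
  using eventually_ge_at_top by (rule eventually_conj[rotated])
 then show ?thesis using eventually_happens'[OF trivial_limit_at_top_linorder] by blast
qed

lemma eq_by_exp_small: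
 fixes z :: complex
 assumes "!!X. X \<ge> X0 ==> cmod z <= K * exp (- (2 * pi * X))"
 shows "z = 0"
proof (rule ccontr)
 assume "z \<noteq> 0"
 then obtain X where "X \<ge> X0" "K * exp (- (2 * pi * X)) < cmod z"
  using exp_neg_eventually_small[of "cmod z" X0 K] by auto
 with assms[of X] show False by simp
qed

text \<open>
 The mean does not change when the segment is moved to the end of the cylinder on its own side
 of the pole, where the kernel is constant in the limit.
\<close>

lemma pmean_kern:
 shows "Im c < Im W ==> pmean c (kern W) = 1" "Im c > Im W ==> pmean c (kern W) = 0"
proof -
 assume c: "Im c < Im W"
 have "pmean c (kern W) - 1 = 0"
 proof (rule eq_by_exp_small[of "max 1 (Im W - Im c)" _ 2])
  fix X :: real assume X: "X \<ge> max 1 (Im W - Im c)"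
  define c' where "c' = \<i> * of_real (Im W - X)"
  have hol: "kern W holomorphic_on hstrip (Im W - X - 1) (Im W)" by (rule kern_holomorphic) auto
  have "pmean c (kern W) = pmean c' (kern W)"
   by (rule pmean_indep[OF hol]) (use X c in \<open>auto simp: c'_def kern_periodic\<close>)
  also have "\<dots> - 1 = pmean c' (%w. kern W w - 1)"
   by (subst pmean_diff[OF hol holomorphic_on_const]) (use X in \<open>auto simp: c'_def pmean_def\<close>)
  also have "cmod \<dots> <= 2 * exp (- (2 * pi * X))"
  proof (rule pmean_bound)
   show "(%w. kern W w - 1) holomorphic_on hstrip (Im W - X - 1) (Im W)"
    using hol by (intro holomorphic_intros)
   show "cmod (kern W w - 1) <= 2 * exp (- (2 * pi * X))" if "Im w = Im c'" for w
   proof -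
    have d: "Im W - Im w = X" using that by (simp add: c'_def)
    have "1 / 4 <= Im W - Im w" unfolding d using X by simp
    from kern_bounds_below(2)[OF this] show ?thesis unfolding d .
   qed
  qed (use X in \<open>auto simp: c'_def\<close>)
  finally show "cmod (pmean c (kern W) - 1) <= 2 * exp (- (2 * pi * X))" .
 qed
 then show "pmean c (kern W) = 1" by simp
next
 assume c: "Im c > Im W"
 show "pmean c (kern W) = 0"
 proof (rule eq_by_exp_small[of "max 1 (Im c - Im W)" _ 2])
  fix X :: real assume X: "X \<ge> max 1 (Im c - Im W)"
  define c' where "c' = \<i> * of_real (Im W + X)"
  have hol: "kern W holomorphic_on hstrip (Im W) (Im W + X + 1)" by (rule kern_holomorphic) auto
  have "pmean c (kern W) = pmean c' (kern W)"
   by (rule pmean_indep[OF hol]) (use X c in \<open>auto simp: c'_def kern_periodic\<close>)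
  also have "cmod \<dots> <= 2 * exp (- (2 * pi * X))"
  proof (rule pmean_bound[OF hol])
   show "cmod (kern W w) <= 2 * exp (- (2 * pi * X))" if "Im w = Im c'" for w
   proof -
    have d: "Im w - Im W = X" using that by (simp add: c'_def)
    have "1 / 4 <= Im w - Im W" unfolding d using X by simp
    from kern_bounds_above(1)[OF this] show ?thesis unfolding d .
   qed
  qed (use X in \<open>auto simp: c'_def\<close>)
  finally show "cmod (pmean c (kern W)) <= 2 * exp (- (2 * pi * X))" .
 qed
qed

text \<open>Cauchy's integral formula on the cylinder, for the circles below and above \<open>W\<close>.\<close>

lemma pmean_split:
 assumes f: "f holomorphic_on hstrip y1 y2" and per: "!!w. w \<in> hstrip y1 y2 ==> f (w + 1) = f w"
  and c1: "y1 < Im c1" "Im c1 < Im W" and c2: "Im W < Im c2" "Im c2 < y2"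
 shows "f W = pmean c1 (%w. f w * kern W w) - pmean c2 (%w. f w * kern W w)"
proof -
 have W: "y1 < Im W" "Im W < y2" using c1 c2 by auto
 define B where "B = {w. Re W - 3 / 4 < Re w & Re w < Re W + 3 / 4} \<inter> hstrip y1 y2"
 define N where "N = {w. Re W - 3 / 4 < Re w & Re w < Re W - 1 / 4} \<inter> hstrip y1 y2"
 have cvx: "convex {w. a < Re w & Re w < b}" and opn: "open {w. a < Re w & Re w < b}" for a b
 proof -
  have e: "{w. a < Re w & Re w < b} = {w. Re w < b} \<inter> {w. Re w > a}" by auto
  show "convex {w. a < Re w & Re w < b}" "open {w. a < Re w & Re w < b}" unfolding e
   by (auto intro!: convex_Int convex_halfspace_Re_lt convex_halfspace_Re_gt
     open_Int open_halfspace_Re_lt open_halfspace_Re_gt)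
 qed
 have B: "convex B" "open B" and N: "convex N" "open N"
  unfolding B_def N_def by (intro convex_Int open_Int cvx opn convex_hstrip hstrip_open)+
 have WB: "W \<in> B" using W by (auto simp: B_def)
 let ?e = "%w. 1 - exp (2 * of_real pi * \<i> * (W - w))"
 define h1 where "h1 w = (if w = W then deriv f W else (f w - f W) / (w - W))" for w
 define h2 where "h2 w = (if w = W then deriv ?e W else (?e w - ?e W) / (w - W))" for w
 have "f holomorphic_on B" by (rule holomorphic_on_subset[OF f]) (auto simp: B_def)
 then have h1: "h1 holomorphic_on B" unfolding h1_def using pole_lemma_open B by blast
 have eh: "?e holomorphic_on B" by (intro holomorphic_intros)
 have h2: "h2 holomorphic_on B" unfolding h2_def using pole_lemma_open[OF eh B(2), of W] by simp
 have ez: "?e w \<noteq> 0" if w: "w \<in> B" "w \<noteq> W" for w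
 proof
  assume "?e w = 0"
  then have "exp (2 * of_real pi * \<i> * (W - w)) = 1" by simp
  then obtain n :: int where n: "Im (2 * of_real pi * \<i> * (W - w)) = of_int (2 * n) * pi"
    and z: "Re (2 * of_real pi * \<i> * (W - w)) = 0"
   unfolding exp_eq_1 by blast
  have re: "Re W - Re w = of_int n" using n by simp
  have "Im W = Im w" using z by simp
  moreover have "\<bar>Re W - Re w\<bar> < 1" using w(1) unfolding B_def by auto
  ultimately have "\<bar>real_of_int n\<bar> < 1" unfolding re by simp
  then have "n = 0" by linarith
  then show False using \<open>Re W - Re w = of_int n\<close> \<open>Im W = Im w\<close> w by (simp add: complex_eq_iff)
 qed
 have dW: "(?e has_field_derivative 2 * of_real pi * \<i>) (at W)"
  by (auto intro!: derivative_eq_intros)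
 then have h2W: "h2 W \<noteq> 0" by (simp add: h2_def DERIV_imp_deriv)
 have h2ne: "h2 w \<noteq> 0" if "w \<in> B" for w
  using ez[OF that] h2W by (auto simp: h2_def)
 define G where "G w = h1 w / h2 w" for w
 have G: "G holomorphic_on B" unfolding G_def using h1 h2 h2ne by (intro holomorphic_intros) auto
 have Geq: "G w = f w * kern W w - f W * kern W w" if "w \<noteq> W" for w
 proof -
  have "G w = (f w - f W) / ?e w" using that by (simp add: G_def h1_def h2_def)
  then show ?thesis by (simp add: kern_def diff_divide_distrib)
 qed
 let ?d1 = "Complex (Re W - 1 / 2) (Im c1)" and ?d2 = "Complex (Re W - 1 / 2) (Im c2)"
 have "pmean ?d1 G = pmean ?d2 G"
 proof (rule pmean_indep_gen[OF G B N])
  show "N \<subseteq> B" by (auto simp: N_def B_def abs_less_iff)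
  show "w + 1 \<in> B" if "w \<in> N" for w using that by (auto simp: N_def B_def abs_less_iff)
  show "G (w + 1) = G w" if w: "w \<in> N" for w
  proof -
   have "w \<noteq> W" "w + 1 \<noteq> W" using w by (auto simp: N_def)
   moreover have "f (w + 1) = f w" using w per by (auto simp: N_def)
   ultimately show ?thesis by (simp add: Geq kern_periodic)
  qed
 qed (use c1 c2 in \<open>auto simp: N_def abs_less_iff\<close>)
 moreover have "pmean d G = pmean c (%w. f w * kern W w) - f W * pmean c (kern W)"
  if d: "Im d = Im c" and c: "y1 < Im c" "Im c < y2" "Im c \<noteq> Im W" for c d
 proof -
  obtain a b where ab: "a < Im c" "Im c < b" "y1 <= a" "b <= y2" "\<not> (a < Im W & Im W < b)"
  proof (cases "Im c < Im W")
   case True then show ?thesis using that[of y1 "Im W"] c c1 c2 by auto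
  next
   case False then show ?thesis using that[of "Im W" y2] c c1 c2 by auto
  qed
  have k: "kern W holomorphic_on hstrip a b" by (rule kern_holomorphic) (use ab in auto)
  have f': "f holomorphic_on hstrip a b" by (rule holomorphic_on_subset[OF f]) (use ab in auto)
  have per': "f (w + 1) = f w" if "w \<in> hstrip a b" for w using that ab per by auto
  have 1: "pmean d (%w. f w * kern W w) = pmean c (%w. f w * kern W w)"
   by (rule pmean_indep[where ?y1.0 = a and ?y2.0 = b])
     (use k f' d ab in \<open>auto intro!: holomorphic_intros simp: kern_periodic per'\<close>)
  have 2: "pmean d (kern W) = pmean c (kern W)"
   by (rule pmean_indep[OF k]) (use d ab in \<open>auto simp: kern_periodic\<close>)
  have "pmean d G = pmean d (%w. f w * kern W w - f W * kern W w)"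
   using d c by (intro pmean_cong Geq) auto
  also have "\<dots> = pmean d (%w. f w * kern W w) - pmean d (%w. f W * kern W w)"
   by (rule pmean_diff[where S = "hstrip a b"]) (use k f' d ab in \<open>auto intro!: holomorphic_intros\<close>)
  finally show ?thesis using 1 2 by (simp add: pmean_cmul)
 qed
 from this[of ?d1 c1] this[of ?d2 c2]
 have "pmean ?d1 G = pmean c1 (%w. f w * kern W w) - f W" "pmean ?d2 G = pmean c2 (%w. f w * kern W w)"
  using c1 c2 pmean_kern by auto
 ultimately show ?thesis by (simp add: algebra_simps)
qed

definition per1 :: "complex set => (complex => complex) => bool" where
 "per1 S f \<longleftrightarrow> f holomorphic_on S & (\<forall>W\<in>S. f (W + 1) = f W)"

lemma per1D: "per1 S f ==> f holomorphic_on S" "per1 S f ==> W \<in> S ==> f (W + 1) = f W"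
 by (auto simp: per1_def)

lemma per1_subset: "per1 S f ==> T \<subseteq> S ==> per1 T f"
 by (auto simp: per1_def intro: holomorphic_on_subset)

lemma per1_kern:
 assumes "per1 S f" "!!w. w \<in> S ==> Im w \<noteq> Im W"
 shows "per1 S (%w. f w * kern W w)"
 using assms by (auto simp: per1_def kern_periodic intro!: holomorphic_intros kern_holomorphic)

lemma kern_periodic1: "kern (W + 1) w = kern W w"
proof -
 have "exp (2 * of_real pi * \<i> * (W + 1 - w)) = exp (2 * of_real pi * \<i> * (W - w) + 2 * of_real pi * \<i>)"
  by (simp add: algebra_simps)
 also have "\<dots> = exp (2 * of_real pi * \<i> * (W - w))" by (simp add: exp_add)
 finally show ?thesis by (simp add: kern_def)
qed

lemma per1_pmean_indep:
 assumes "per1 (hstrip a b) f" "a < Im c" "Im c < b" "a < Im c'" "Im c' < b"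
 shows "pmean c f = pmean c' f"
 by (rule pmean_indep[of _ a b]) (use assms in \<open>auto simp: per1_def\<close>)

lemma per1_pmean_bound:
 assumes "per1 (hstrip a b) f" "a < Im c" "Im c < b" "!!w. Im w = Im c ==> cmod (f w) <= B"
 shows "cmod (pmean c f) <= B"
 by (rule pmean_bound[OF per1D(1)[OF assms(1)]]) (use assms in auto)

text \<open>
 The Laurent splitting of a periodic function on a strip: \<open>upart\<close> is its part on the upper half
 plane, with the constant term, and \<open>lpart\<close> the part on the lower half plane, which tends to \<open>0\<close> at
 the lower end. The height of the contour lies in the strip and below (above) \<open>W\<close>, for all \<open>W\<close> in the half
 plane.
\<close>

definition upart :: "real => real => (complex => complex) => complex => complex" where
 "upart y1 y2 f W = pmean (\<i> * of_real ((y1 + min (Im W) y2) / 2)) (%w. f w * kern W w)"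

definition lpart :: "real => real => (complex => complex) => complex => complex" where
 "lpart y1 y2 f W = - pmean (\<i> * of_real ((y2 + max (Im W) y1) / 2)) (%w. f w * kern W w)"

lemma upart_eq:
 assumes "per1 (hstrip y1 y2) f" "y1 < Im c" "Im c < y2" "Im c < Im W"
 shows "upart y1 y2 f W = pmean c (%w. f w * kern W w)"
 unfolding upart_def
proof (rule per1_pmean_indep[of y1 "min (Im W) y2"])
 show "per1 (hstrip y1 (min (Im W) y2)) (%w. f w * kern W w)"
  by (rule per1_kern[OF per1_subset[OF assms(1)]]) auto
qed (use assms in auto)

lemma lpart_eq:
 assumes "per1 (hstrip y1 y2) f" "y1 < Im c" "Im c < y2" "Im W < Im c"
 shows "lpart y1 y2 f W = - pmean c (%w. f w * kern W w)"
 unfolding lpart_def neg_equal_iff_equal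
proof (rule per1_pmean_indep[of "max (Im W) y1" y2])
 show "per1 (hstrip (max (Im W) y1) y2) (%w. f w * kern W w)"
  by (rule per1_kern[OF per1_subset[OF assms(1)]]) auto
qed (use assms in auto)

lemma upart_lpart:
 assumes "per1 (hstrip y1 y2) f" "y1 < Im W" "Im W < y2"
 shows "upart y1 y2 f W + lpart y1 y2 f W = f W"
proof -
 define c1 c2 where "c1 = \<i> * of_real ((y1 + Im W) / 2)" and "c2 = \<i> * of_real ((y2 + Im W) / 2)"
 have "f W = pmean c1 (%w. f w * kern W w) - pmean c2 (%w. f w * kern W w)"
  by (rule pmean_split[of f y1 y2]) (use assms in \<open>auto simp: per1_def c1_def c2_def\<close>)
 then show ?thesis
  using upart_eq[OF assms(1), of c1 W] lpart_eq[OF assms(1), of c2 W] assms by (simp add: c1_def c2_def)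
qed

lemma upart_periodic: "upart y1 y2 f (W + 1) = upart y1 y2 f W"
 and lpart_periodic: "lpart y1 y2 f (W + 1) = lpart y1 y2 f W"
 by (simp_all add: upart_def lpart_def kern_periodic1)

text \<open>Above the contour the kernel differs from its limit \<open>1\<close> by an exponentially small amount.\<close>

lemma upart_mean:
 assumes f: "per1 (hstrip y1 y2) f" and c: "y1 < c" "c < y2" "c + 1 / 4 <= Im W"
  and B: "!!w. Im w = c ==> cmod (f w) <= B"
 shows "cmod (upart y1 y2 f W) <= 2 * B"
  "cmod (upart y1 y2 f W - pmean (\<i> * of_real c) f) <= 2 * B * exp (- (2 * pi * (Im W - c)))"
proof -
 have p: "per1 (hstrip y1 (min (Im W) y2)) (%w. f w * kern W w)"
  by (rule per1_kern[OF per1_subset[OF f]]) auto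
 have f': "per1 (hstrip y1 (min (Im W) y2)) f" by (rule per1_subset[OF f]) auto
 have p': "per1 (hstrip y1 (min (Im W) y2)) (%w. f w * kern W w - f w)"
  using p f' by (auto simp: per1_def intro!: holomorphic_intros)
 have eq: "upart y1 y2 f W = pmean (\<i> * of_real c) (%w. f w * kern W w)"
  using c by (intro upart_eq f) auto
 have B0: "0 <= B" using B[of "\<i> * of_real c"] by (simp add: order_trans[OF norm_ge_zero])
 show "cmod (upart y1 y2 f W) <= 2 * B"
  unfolding eq
 proof (rule per1_pmean_bound[OF p])
  fix w assume w: "Im w = Im (\<i> * of_real c)"
  then have "cmod (f w) * cmod (kern W w) <= B * 2"
   using c B0 by (intro mult_mono B kern_bounds_below) auto
  then show "cmod (f w * kern W w) <= 2 * B" by (simp add: norm_mult mult.commute)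
 qed (use c in auto)
 have "upart y1 y2 f W - pmean (\<i> * of_real c) f = pmean (\<i> * of_real c) (%w. f w * kern W w - f w)"
  unfolding eq
  by (rule pmean_diff[symmetric, OF per1D(1)[OF p] per1D(1)[OF f']]) (use c in auto)
 also have "cmod \<dots> <= 2 * B * exp (- (2 * pi * (Im W - c)))"
 proof (rule per1_pmean_bound[OF p'])
  fix w assume w: "Im w = Im (\<i> * of_real c)"
  have d: "Im W - Im w = Im W - c" using w by simp
  have k: "cmod (kern W w - 1) <= 2 * exp (- (2 * pi * (Im W - c)))"
   using kern_bounds_below(2)[where W = W and w = w] c unfolding d by simp
  have "cmod (f w * kern W w - f w) = cmod (f w) * cmod (kern W w - 1)"
   by (simp add: norm_mult[symmetric] algebra_simps)
  also have "\<dots> <= B * (2 * exp (- (2 * pi * (Im W - c))))"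
   using w B0 by (intro mult_mono B k) auto
  finally show "cmod (f w * kern W w - f w) <= 2 * B * exp (- (2 * pi * (Im W - c)))" by simp
 qed (use c in auto)
 finally show "cmod (upart y1 y2 f W - pmean (\<i> * of_real c) f) <= 2 * B * exp (- (2 * pi * (Im W - c)))" .
qed

lemma lpart_decay:
 assumes f: "per1 (hstrip y1 y2) f" and c: "y1 < c" "c < y2" "Im W <= c - 1 / 4"
  and B: "!!w. Im w = c ==> cmod (f w) <= B"
 shows "cmod (lpart y1 y2 f W) <= B"
  "cmod (lpart y1 y2 f W) <= 2 * B * exp (- (2 * pi * (c - Im W)))"
proof -
 have p: "per1 (hstrip (max (Im W) y1) y2) (%w. f w * kern W w)"
  by (rule per1_kern[OF per1_subset[OF f]]) auto
 have eq: "lpart y1 y2 f W = - pmean (\<i> * of_real c) (%w. f w * kern W w)"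
  using c by (intro lpart_eq f) auto
 have B0: "0 <= B" using B[of "\<i> * of_real c"] by (simp add: order_trans[OF norm_ge_zero])
 show "cmod (lpart y1 y2 f W) <= B"
  unfolding eq norm_minus_cancel
 proof (rule per1_pmean_bound[OF p])
  fix w assume w: "Im w = Im (\<i> * of_real c)"
  then have "cmod (f w) * cmod (kern W w) <= B * 1"
   using c B0 by (intro mult_mono B kern_bounds_above) auto
  then show "cmod (f w * kern W w) <= B" by (simp add: norm_mult mult.commute)
 qed (use c in auto)
 show "cmod (lpart y1 y2 f W) <= 2 * B * exp (- (2 * pi * (c - Im W)))"
  unfolding eq norm_minus_cancel
 proof (rule per1_pmean_bound[OF p])
  fix w assume w: "Im w = Im (\<i> * of_real c)"
  have d: "Im w - Im W = c - Im W" using w by simp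
  have k: "cmod (kern W w) <= 2 * exp (- (2 * pi * (c - Im W)))"
   using kern_bounds_above(1)[where W = W and w = w] c unfolding d by simp
  have "cmod (f w) * cmod (kern W w) <= B * (2 * exp (- (2 * pi * (c - Im W))))"
   using w B0 by (intro mult_mono B k) auto
  then show "cmod (f w * kern W w) <= 2 * B * exp (- (2 * pi * (c - Im W)))" by (simp add: norm_mult)
 qed (use c in auto)
qed

text \<open>
 At distance \<open>1 / 4\<close> from the contour the kernel is bounded by \<open>2\<close>. A point too close to the edge for
 such a contour has distance \<open>1 / 4\<close> from a contour for the other part, and the two parts add up to \<open>f\<close>.
\<close>

lemma part_bounds:
 assumes f: "per1 (hstrip y1 y2) f" and y: "y1 + 1 <= y2"
  and B: "!!w. y1 < Im w ==> Im w < y2 ==> cmod (f w) <= B"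
 shows "y1 < Im W ==> cmod (upart y1 y2 f W) <= 3 * B"
  "Im W < y2 ==> cmod (lpart y1 y2 f W) <= 3 * B"
proof -
 have B0: "0 <= B" using B[of "\<i> * of_real ((y1 + y2) / 2)"] y by (simp add: order_trans[OF norm_ge_zero])
 show "cmod (upart y1 y2 f W) <= 3 * B" if W: "y1 < Im W"
 proof (cases "Im W > y1 + 1 / 2")
  case True
  define c where "c = min (Im W) y2 - 1 / 4"
  have "cmod (upart y1 y2 f W) <= 2 * B"
   using True y by (intro upart_mean(1)[OF f, of c] B) (auto simp: c_def)
  then show ?thesis using B0 by simp
 next
  case False
  have "cmod (lpart y1 y2 f W) <= B"
   using False W y by (intro lpart_decay(1)[OF f, of "Im W + 1 / 4"] B) auto
  moreover have "upart y1 y2 f W = f W - lpart y1 y2 f W"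
   using upart_lpart[OF f W] False y by (simp add: algebra_simps)
  moreover have "cmod (f W) <= B" using False W y by (intro B) auto
  ultimately show ?thesis using norm_triangle_ineq4[of "f W" "lpart y1 y2 f W"] B0 by simp
 qed
 show "cmod (lpart y1 y2 f W) <= 3 * B" if W: "Im W < y2"
 proof (cases "Im W < y2 - 1 / 2")
  case True
  define c where "c = max (Im W) y1 + 1 / 4"
  have "cmod (lpart y1 y2 f W) <= B"
   using True y by (intro lpart_decay(1)[OF f, of c] B) (auto simp: c_def)
  then show ?thesis using B0 by simp
 next
  case False
  have "cmod (upart y1 y2 f W) <= 2 * B"
   using False W y by (intro upart_mean(1)[OF f, of "Im W - 1 / 4"] B) auto
  moreover have "lpart y1 y2 f W = f W - upart y1 y2 f W"
   using upart_lpart[OF f, of W] W False y by (simp add: algebra_simps)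
  moreover have "cmod (f W) <= B" using False W y by (intro B) auto
  ultimately show ?thesis using norm_triangle_ineq4[of "f W" "upart y1 y2 f W"] B0 by simp
 qed
qed

lemma upart_diff:
 assumes f: "per1 (hstrip y1 y2) f" and g: "per1 (hstrip y1 y2) g" and W: "y1 < Im W" "y1 < y2"
 shows "upart y1 y2 (%w. f w - g w) W = upart y1 y2 f W - upart y1 y2 g W"
proof -
 have "per1 (hstrip y1 (min (Im W) y2)) (%w. f w * kern W w)" "per1 (hstrip y1 (min (Im W) y2)) (%w. g w * kern W w)"
  by (rule per1_kern[OF per1_subset[OF f]] per1_kern[OF per1_subset[OF g]]; auto)+
 then show ?thesis
  unfolding upart_def left_diff_distrib
  by (intro pmean_diff per1D(1)) (use W in auto)
qed

lemma upart_upper: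
 assumes f: "per1 (upper_hp y1) f" and B: "!!w. y1 < Im w ==> cmod (f w) <= B" and W: "y1 < Im W" "y1 < y2"
 shows "upart y1 y2 f W = f W"
proof -
 define c where "c = \<i> * of_real ((y1 + min (Im W) y2) / 2)"
 have c: "y1 < Im c" "Im c < y2" "Im c < Im W" using W by (auto simp: c_def)
 have "upart y1 y2 f W - f W = 0"
 proof (rule eq_by_exp_small[of 1 _ "2 * B"])
  fix X :: real assume X: "X \<ge> 1"
  define Y where "Y = Im W + X + 1"
  have fY: "per1 (hstrip y1 Y) f" by (rule per1_subset[OF f]) auto
  have "upart y1 Y f W + lpart y1 Y f W = f W" using W X by (intro upart_lpart[OF fY]) (auto simp: Y_def)
  moreover have "upart y1 Y f W = upart y1 y2 f W"
  proof -
   have "upart y1 Y f W = pmean c (%w. f w * kern W w)"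
    using c X by (intro upart_eq[OF fY]) (auto simp: Y_def)
   moreover have "upart y1 y2 f W = pmean c (%w. f w * kern W w)"
    using c by (intro upart_eq per1_subset[OF f]) auto
   ultimately show ?thesis by simp
  qed
  ultimately have "upart y1 y2 f W - f W = - lpart y1 Y f W" by (simp add: algebra_simps)
  moreover have "cmod (lpart y1 Y f W) <= 2 * B * exp (- (2 * pi * ((Im W + X) - Im W)))"
   using W X by (intro lpart_decay(2)[OF fY] B) (auto simp: Y_def)
  ultimately show "cmod (upart y1 y2 f W - f W) <= 2 * B * exp (- (2 * pi * X))" by simp
 qed
 then show ?thesis by simp
qed

lemma lower_decay:
 assumes f: "per1 (lower_hp y) f" and lim: "(f \<longlongrightarrow> 0) (filtercomap Im at_bot)"
  and c: "c < y" "Im W <= c - 1 / 4" and B: "!!w. Im w = c ==> cmod (f w) <= B"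
 shows "cmod (f W) <= 2 * B * exp (- (2 * pi * (c - Im W)))"
proof (rule field_le_epsilon)
 fix e :: real assume e: "0 < e"
 have "\<forall>\<^sub>F w in filtercomap Im at_bot. cmod (f w) < e / 2"
  using tendstoD[OF lim, of "e / 2"] e by simp
 then obtain b where b: "!!w. Im w <= b ==> cmod (f w) < e / 2"
  unfolding eventually_filtercomap eventually_at_bot_linorder by blast
 define c1 where "c1 = min b (Im W - 1)"
 have bc: "cmod (f w) <= e / 2" if "Im w = c1" for w using b[of w] that by (simp add: c1_def)
 have fc: "per1 (hstrip (c1 - 1) y) f" by (rule per1_subset[OF f]) auto
 have "cmod (upart (c1 - 1) y f W) <= 2 * (e / 2)"
  using c by (intro upart_mean(1)[OF fc, of c1] bc) (auto simp: c1_def)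
 moreover have "cmod (lpart (c1 - 1) y f W) <= 2 * B * exp (- (2 * pi * (c - Im W)))"
  using c by (intro lpart_decay(2)[OF fc] B) (auto simp: c1_def)
 moreover have "f W = upart (c1 - 1) y f W + lpart (c1 - 1) y f W"
  using c by (intro upart_lpart[OF fc, symmetric]) (auto simp: c1_def)
 ultimately show "cmod (f W) <= 2 * B * exp (- (2 * pi * (c - Im W))) + e"
  using norm_triangle_ineq[of "upart (c1 - 1) y f W" "lpart (c1 - 1) y f W"] by simp
qed

lemma upart_lower:
 assumes f: "per1 (lower_hp y2) f" and lim: "(f \<longlongrightarrow> 0) (filtercomap Im at_bot)"
  and W: "y1 < Im W" "y1 < y2"
 shows "upart y1 y2 f W = 0"
proof -
 define c where "c = \<i> * of_real ((y1 + min (Im W) y2) / 2)"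
 have c: "y1 < Im c" "Im c < y2" "Im c < Im W" using W by (auto simp: c_def)
 have "cmod (upart y1 y2 f W) <= 0 + e" if e: "0 < e" for e
 proof -
  have "\<forall>\<^sub>F w in filtercomap Im at_bot. cmod (f w) < e / 2"
   using tendstoD[OF lim, of "e / 2"] e by simp
  then obtain b where b: "!!w. Im w <= b ==> cmod (f w) < e / 2"
   unfolding eventually_filtercomap eventually_at_bot_linorder by blast
  define c1 where "c1 = min b (y1 - 1)"
  have bc: "cmod (f w) <= e / 2" if "Im w = c1" for w using b[of w] that by (simp add: c1_def)
  have fc: "per1 (hstrip (c1 - 1) y2) f" by (rule per1_subset[OF f]) auto
  have "upart (c1 - 1) y2 f W = pmean c (%w. f w * kern W w)"
   using c by (intro upart_eq[OF fc]) (auto simp: c1_def)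
  moreover have "upart y1 y2 f W = pmean c (%w. f w * kern W w)"
   using c by (intro upart_eq per1_subset[OF f]) auto
  moreover have "cmod (upart (c1 - 1) y2 f W) <= 2 * (e / 2)"
   using W by (intro upart_mean(1)[OF fc, of c1] bc) (auto simp: c1_def)
  ultimately show ?thesis by simp
 qed
 then have "cmod (upart y1 y2 f W) <= 0" by (rule field_le_epsilon)
 then show ?thesis by simp
qed

lemma per1_int:
 assumes "per1 (hstrip a b) f" "W \<in> hstrip a b"
 shows "f (W + of_int n) = f W"
proof (induction n rule: int_induct[where k = 0])
 case (step1 i)
 have "f (W + of_int i + 1) = f (W + of_int i)" using assms by (intro per1D(2)[OF assms(1)]) auto
 then show ?case using step1 by (simp add: add.assoc)
next
 case (step2 i)
 have "f (W + of_int (i - 1) + 1) = f (W + of_int (i - 1))" using assms by (intro per1D(2)[OF assms(1)]) auto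
 then show ?case using step2 by simp
qed simp

text \<open>By periodicity this is the maximum principle on a compact rectangle.\<close>

lemma strip_max_modulus:
 assumes f: "per1 (hstrip a b) f" and y: "a < y1" "y1 <= y2" "y2 < b"
  and B: "!!w. Im w = y1 ==> cmod (f w) <= B" "!!w. Im w = y2 ==> cmod (f w) <= B"
  and W: "y1 <= Im W" "Im W <= y2"
 shows "cmod (f W) <= B"
proof -
 define K where "K = cbox (Complex 0 y1) (Complex 1 y2)"
 have memK: "w \<in> K \<longleftrightarrow> 0 <= Re w & Re w <= 1 & y1 <= Im w & Im w <= y2" for w
  by (auto simp: K_def in_cbox_complex_iff)
 have "continuous_on (hstrip a b) f" using per1D(1)[OF f] by (rule holomorphic_on_imp_continuous_on)
 then have "continuous_on K (%w. cmod (f w))"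
  by (intro continuous_on_norm) (erule continuous_on_subset, use y memK in auto)
 moreover have "compact K" "K \<noteq> {}" using memK[of "Complex 0 y1"] y by (auto simp: K_def)
 ultimately obtain x where x: "x \<in> K" "!!w. w \<in> K ==> cmod (f w) <= cmod (f x)"
  using continuous_attains_sup[of K "%w. cmod (f w)"] by blast
 have max: "cmod (f w) <= cmod (f x)" if w: "y1 <= Im w" "Im w <= y2" for w
 proof -
  define w' where "w' = w + of_int (- \<lfloor>Re w\<rfloor>)"
  have "w' \<in> K" unfolding memK using w by (auto simp: w'_def) linarith+
  moreover have "f w' = f w" unfolding w'_def using w y by (intro per1_int[OF f]) auto
  ultimately show ?thesis using x(2) by metis
 qed
 have "cmod (f x) <= B"
 proof (cases "Im x = y1 \<or> Im x = y2")
  case True then show ?thesis using B by auto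
 next
  case False
  then have xi: "x \<in> hstrip y1 y2" using x(1) memK by auto
  have "f constant_on hstrip a b"
  proof (rule maximum_modulus_principle[where U = "hstrip y1 y2" and \<xi> = x])
   show "cmod (f z) <= cmod (f x)" if "z \<in> hstrip y1 y2" for z using that max by auto
  qed (use per1D(1)[OF f] xi y in auto)
  then obtain k where "!!w. w \<in> hstrip a b ==> f w = k" by (auto simp: constant_on_def)
  then have "f x = f (Complex 0 y1)" using x(1) y memK by auto
  then show ?thesis using B(1)[of "Complex 0 y1"] by simp
 qed
 then show ?thesis using max[OF W] by simp
qed

text \<open>The maximum principle for \<open>exp (2 * pi * \<i> * f W)\<close> and its inverse, which are periodic.\<close>

lemma strip_Im_bounds:
 assumes f: "f holomorphic_on hstrip a b" "!!w. w \<in> hstrip a b ==> f (w + 1) = f w + 1"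
  and y: "a < y1" "y1 <= y2" "y2 < b" and W: "y1 <= Im W" "Im W <= y2"
 shows "(!!w. Im w = y1 \<or> Im w = y2 ==> Im (f w) <= m) ==> Im (f W) <= m"
  "(!!w. Im w = y1 \<or> Im w = y2 ==> m <= Im (f w)) ==> m <= Im (f W)"
proof -
 have e1: "cmod (exp (- (2 * of_real pi * \<i> * z))) = exp (2 * pi * Im z)"
  and e2: "cmod (exp (2 * of_real pi * \<i> * z)) = exp (- (2 * pi * Im z))" for z
  by (simp_all add: norm_exp_eq_Re)
 have p1: "per1 (hstrip a b) (%w. exp (- (2 * of_real pi * \<i> * f w)))"
  and p2: "per1 (hstrip a b) (%w. exp (2 * of_real pi * \<i> * f w))"
  unfolding per1_def using f by (auto intro!: holomorphic_intros simp: ring_distribs exp_add exp_diff)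
 show "Im (f W) <= m" if m: "!!w. Im w = y1 \<or> Im w = y2 ==> Im (f w) <= m"
 proof -
  have "cmod (exp (- (2 * of_real pi * \<i> * f W))) <= exp (2 * pi * m)"
   using m by (intro strip_max_modulus[OF p1 y _ _ W]) (auto simp: e1)
  then show ?thesis by (simp add: e1)
 qed
 show "m <= Im (f W)" if m: "!!w. Im w = y1 \<or> Im w = y2 ==> m <= Im (f w)"
 proof -
  have "cmod (exp (2 * of_real pi * \<i> * f W)) <= exp (- (2 * pi * m))"
   using m by (intro strip_max_modulus[OF p2 y _ _ W]) (auto simp: e2)
  then show ?thesis by (simp add: e2)
 qed
qed

definition lowdom :: "complex set => (complex => real) => (complex \<times> complex) set" where
 "lowdom \<Omega> y = {p. fst p \<in> \<Omega> & Im (snd p) < y (fst p)}"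
definition updom :: "complex set => (complex => real) => (complex \<times> complex) set" where
 "updom \<Omega> y = {p. fst p \<in> \<Omega> & y (fst p) < Im (snd p)}"
definition stripdom :: "complex set => (complex => real) => (complex => real) => (complex \<times> complex) set" where
 "stripdom \<Omega> y1 y2 = {p. fst p \<in> \<Omega> & y1 (fst p) < Im (snd p) & Im (snd p) < y2 (fst p)}"

lemma mem_dom [simp]:
 "(\<zeta>, W) \<in> lowdom \<Omega> y \<longleftrightarrow> \<zeta> \<in> \<Omega> & Im W < y \<zeta>"
 "(\<zeta>, W) \<in> updom \<Omega> y \<longleftrightarrow> \<zeta> \<in> \<Omega> & y \<zeta> < Im W"
 "(\<zeta>, W) \<in> stripdom \<Omega> y1 y2 \<longleftrightarrow> \<zeta> \<in> \<Omega> & y1 \<zeta> < Im W & Im W < y2 \<zeta>"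
 by (auto simp: lowdom_def updom_def stripdom_def)

lemma open_dom:
 assumes "open \<Omega>" "continuous_on \<Omega> y1" "continuous_on \<Omega> y2"
 shows "open (lowdom \<Omega> y2)" "open (updom \<Omega> y1)" "open (stripdom \<Omega> y1 y2)"
proof -
 have o: "open (\<Omega> \<times> (UNIV::complex set))" using assms(1) by (simp add: open_Times)
 have c: "continuous_on (\<Omega> \<times> (UNIV::complex set)) (%p. y (fst p))" if "continuous_on \<Omega> y" for y :: "complex => real"
  by (rule continuous_on_compose2[OF that]) (auto intro!: continuous_intros)
 have "continuous_on (\<Omega> \<times> UNIV) (%p. y2 (fst p) - Im (snd p))" "continuous_on (\<Omega> \<times> UNIV) (%p. Im (snd p) - y1 (fst p))"
  using c assms by (auto intro!: continuous_intros)
 from continuous_open_preimage[OF this(1) o, of "{0<..}"] continuous_open_preimage[OF this(2) o, of "{0<..}"]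
 have 1: "open (\<Omega> \<times> UNIV \<inter> (%p. y2 (fst p) - Im (snd p)) -` {0<..})"
  and 2: "open (\<Omega> \<times> UNIV \<inter> (%p. Im (snd p) - y1 (fst p)) -` {0<..})" by auto
 have "lowdom \<Omega> y2 = \<Omega> \<times> UNIV \<inter> (%p. y2 (fst p) - Im (snd p)) -` {0<..}"
  "updom \<Omega> y1 = \<Omega> \<times> UNIV \<inter> (%p. Im (snd p) - y1 (fst p)) -` {0<..}"
  by (auto simp: lowdom_def updom_def)
 with 1 2 show 3: "open (lowdom \<Omega> y2)" "open (updom \<Omega> y1)" by auto
 have "stripdom \<Omega> y1 y2 = lowdom \<Omega> y2 \<inter> updom \<Omega> y1" by (auto simp: lowdom_def updom_def stripdom_def)
 then show "open (stripdom \<Omega> y1 y2)" using 3 by auto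
qed

lemma hol2_pmean_kern:
 assumes f: "hol2 E f" and D: "open D" and c: "!!\<zeta> W w. (\<zeta>, W) \<in> D ==> Im w = c ==> (\<zeta>, w) \<in> E & Im W \<noteq> c"
 shows "hol2 D (%\<zeta> W. pmean (\<i> * of_real c) (%w. f \<zeta> w * kern W w))"
 unfolding pmean_def
proof (rule hol2_integral[OF D])
 let ?w = "%x::real. complex_of_real x + \<i> * of_real c"
 have ne: "exp (2 * of_real pi * \<i> * (W - ?w x)) \<noteq> 1" if "(\<zeta>, W) \<in> D" for \<zeta> W x
  using c[OF that, of "?w x"] by (intro kern_ne) auto
 show "hol2 D (%z W. f z (?w x) * kern W (?w x))" for x
 proof (rule hol2_mult)
  show "hol2 D (%z W. f z (?w x))"
   by (rule hol2_compose[OF f hol2_fst[OF D] hol2_const[OF D]]) (use c in auto)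
  show "hol2 D (%z W. kern W (?w x))" unfolding kern_def
   by (intro hol2_divide hol2_intros D) (use ne in \<open>auto simp: eq_commute[of 1]\<close>)
 qed
 have "continuous_on ({0..1} \<times> D) (%p. (%q. f (fst q) (snd q)) (fst (snd p), ?w (fst p)))"
  by (rule continuous_on_compose2[OF hol2D(2)[OF f]]) (use c in \<open>auto intro!: continuous_intros\<close>)
 then show "continuous_on ({0..1} \<times> D) (%p. f (fst (snd p)) (?w (fst p)) * kern (snd (snd p)) (?w (fst p)))"
  unfolding kern_def using ne by (intro continuous_intros) (auto simp: eq_commute[of 1])
qed

lemma hol2_parts:
 assumes \<Omega>: "open \<Omega>" "continuous_on \<Omega> y1" "continuous_on \<Omega> y2" and y: "!!\<zeta>. \<zeta> \<in> \<Omega> ==> y1 \<zeta> < y2 \<zeta>"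
  and f: "hol2 (stripdom \<Omega> y1 y2) f" and per: "!!\<zeta>. \<zeta> \<in> \<Omega> ==> per1 (hstrip (y1 \<zeta>) (y2 \<zeta>)) (f \<zeta>)"
 shows "hol2 (updom \<Omega> y1) (%\<zeta>. upart (y1 \<zeta>) (y2 \<zeta>) (f \<zeta>))"
  "hol2 (lowdom \<Omega> y2) (%\<zeta>. lpart (y1 \<zeta>) (y2 \<zeta>) (f \<zeta>))"
proof -
 have o: "open (updom \<Omega> y1)" "open (lowdom \<Omega> y2)" using open_dom[OF \<Omega>] by auto
 have os: "open (stripdom \<Omega> y1 y2)" using open_dom[OF \<Omega>] by auto
 show "hol2 (updom \<Omega> y1) (%\<zeta>. upart (y1 \<zeta>) (y2 \<zeta>) (f \<zeta>))"
 proof (rule hol2_local[OF o(1)])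
  fix z W assume zW: "(z, W) \<in> updom \<Omega> y1"
  define c where "c = (y1 z + min (Im W) (y2 z)) / 2"
  have c: "y1 z < c" "c < y2 z" "c < Im W" using zW y[of z] by (auto simp: c_def)
  define \<Omega>' where "\<Omega>' = {\<zeta>. (\<zeta>, \<i> * of_real c) \<in> stripdom \<Omega> y1 y2}"
  have "open ((%\<zeta>. (\<zeta>, \<i> * of_real c)) -` stripdom \<Omega> y1 y2)"
   by (rule open_vimage[OF os]) (intro continuous_intros)
  then have o': "open \<Omega>'" by (simp add: \<Omega>'_def vimage_def)
  let ?D = "updom \<Omega>' (%_. c)"
  have oD: "open ?D" using open_dom(2)[OF o', of "%_. c" "%_. c"] by auto
  have "hol2 ?D (%\<zeta> W. pmean (\<i> * of_real c) (%w. f \<zeta> w * kern W w))"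
   by (rule hol2_pmean_kern[OF f oD]) (auto simp: \<Omega>'_def)
  moreover have "(z, W) \<in> ?D" using zW c by (auto simp: \<Omega>'_def)
  moreover have "upart (y1 \<zeta>) (y2 \<zeta>) (f \<zeta>) W' = pmean (\<i> * of_real c) (%w. f \<zeta> w * kern W' w)"
   if "(\<zeta>, W') \<in> ?D" for \<zeta> W'
   using that by (intro upart_eq per) (auto simp: \<Omega>'_def)
  ultimately show "\<exists>E g. (z, W) \<in> E & hol2 E g & (\<forall>\<zeta> W'. (\<zeta>, W') \<in> E --> upart (y1 \<zeta>) (y2 \<zeta>) (f \<zeta>) W' = g \<zeta> W')"
   by blast
 qed
 show "hol2 (lowdom \<Omega> y2) (%\<zeta>. lpart (y1 \<zeta>) (y2 \<zeta>) (f \<zeta>))"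
 proof (rule hol2_local[OF o(2)])
  fix z W assume zW: "(z, W) \<in> lowdom \<Omega> y2"
  define c where "c = (y2 z + max (Im W) (y1 z)) / 2"
  have c: "y1 z < c" "c < y2 z" "Im W < c" using zW y[of z] by (auto simp: c_def)
  define \<Omega>' where "\<Omega>' = {\<zeta>. (\<zeta>, \<i> * of_real c) \<in> stripdom \<Omega> y1 y2}"
  have "open ((%\<zeta>. (\<zeta>, \<i> * of_real c)) -` stripdom \<Omega> y1 y2)"
   by (rule open_vimage[OF os]) (intro continuous_intros)
  then have o': "open \<Omega>'" by (simp add: \<Omega>'_def vimage_def)
  let ?D = "lowdom \<Omega>' (%_. c)"
  have oD: "open ?D" using open_dom(1)[OF o', of "%_. c" "%_. c"] by auto
  have "hol2 ?D (%\<zeta> W. - pmean (\<i> * of_real c) (%w. f \<zeta> w * kern W w))"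
   by (rule hol2_minus[OF hol2_pmean_kern[OF f oD]]) (auto simp: \<Omega>'_def)
  moreover have "(z, W) \<in> ?D" using zW c by (auto simp: \<Omega>'_def)
  moreover have "lpart (y1 \<zeta>) (y2 \<zeta>) (f \<zeta>) W' = - pmean (\<i> * of_real c) (%w. f \<zeta> w * kern W' w)"
   if "(\<zeta>, W') \<in> ?D" for \<zeta> W'
   using that by (intro lpart_eq per) (auto simp: \<Omega>'_def)
  ultimately show "\<exists>E g. (z, W) \<in> E & hol2 E g & (\<forall>\<zeta> W'. (\<zeta>, W') \<in> E --> lpart (y1 \<zeta>) (y2 \<zeta>) (f \<zeta>) W' = g \<zeta> W')"
   by blast
 qed
qed

section \<open>Fixed points in classes of holomorphic families\<close>

text \<open>
 Balls of holomorphic families of periodic functions, with a weight in place of a radius. They are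
 complete under locally uniform convergence, and the weights record the decay at an end of the
 cylinder.
\<close>

definition pclass :: "(complex \<times> complex) set => (complex => complex => real) => (complex => complex => complex) => bool" where
 "pclass D w u \<longleftrightarrow> hol2 D u \<and>
   (\<forall>z W. (z, W) \<in> D --> (z, W + 1) \<in> D & u z (W + 1) = u z W & cmod (u z W) <= w z W)"

lemma pclassD:
 assumes "pclass D w u"
 shows "hol2 D u" "(z, W) \<in> D ==> (z, W + 1) \<in> D" "(z, W) \<in> D ==> u z (W + 1) = u z W"
  "(z, W) \<in> D ==> cmod (u z W) <= w z W"
 using assms by (auto simp: pclass_def)

text \<open>
 Banach's fixed point theorem in a weighted ball. The iterates converge locally uniformly, as the
 weight is continuous, so the limit is again a holomorphic family.
\<close>

lemma contraction_fixpoint: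
 assumes D: "open D" "!!z W. (z, W) \<in> D ==> (z, W + 1) \<in> D"
  and w: "continuous_on D (%p. w (fst p) (snd p))" "!!z W. (z, W) \<in> D ==> 0 <= w z W"
  and self: "!!u. pclass D w u ==> pclass D w (T u)"
  and contr: "!!u v L z W. pclass D w u ==> pclass D w v ==> 0 <= L ==>
    (!!z W. (z, W) \<in> D ==> cmod (u z W - v z W) <= L * w z W) ==> (z, W) \<in> D ==>
    cmod (T u z W - T v z W) <= L / 2 * w z W"
 shows "\<exists>u. pclass D w u & (\<forall>z W. (z, W) \<in> D --> T u z W = u z W)"
proof -
 define u where "u n = (T ^^ n) (%z W. 0)" for n
 have u: "pclass D w (u n)" for n
 proof (induction n)
  case 0
  show ?case using D w(2) by (auto simp: u_def pclass_def intro: hol2_const)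
 next
  case (Suc n) then show ?case using self by (simp add: u_def)
 qed
 have step: "cmod (u (Suc n) z W - u n z W) <= (1 / 2) ^ n * w z W" if "(z, W) \<in> D" for n z W
  using that
 proof (induction n arbitrary: z W)
  case 0
  then show ?case using pclassD(4)[OF u[of 1]] by (simp add: u_def)
 next
  case (Suc n)
  have "cmod (T (u (Suc n)) z W - T (u n) z W) <= (1 / 2) ^ n / 2 * w z W"
   by (rule contr[OF u u _ Suc.IH Suc.prems]) auto
  then show ?case by (simp add: u_def)
 qed
 have far: "cmod (u (n + m) z W - u n z W) <= 2 * (1 / 2) ^ n * w z W" if p: "(z, W) \<in> D" for n m z W
 proof -
  have "cmod (u (n + m) z W - u n z W) <= 2 * (1 / 2) ^ n * (1 - (1 / 2) ^ m) * w z W"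
  proof (induction m)
   case (Suc m)
   have "cmod (u (n + Suc m) z W - u n z W) <= cmod (u (n + m) z W - u n z W) + cmod (u (Suc (n + m)) z W - u (n + m) z W)"
    using norm_triangle_ineq[of "u (n + m) z W - u n z W" "u (Suc (n + m)) z W - u (n + m) z W"] by (simp add: add.commute)
   also have "\<dots> <= 2 * (1 / 2) ^ n * (1 - (1 / 2) ^ m) * w z W + (1 / 2) ^ (n + m) * w z W"
    using Suc step[OF p] by (intro add_mono) auto
   also have "\<dots> = 2 * (1 / 2) ^ n * (1 - (1 / 2) ^ Suc m) * w z W" by (simp add: power_add algebra_simps)
   finally show ?case .
  qed simp
  also have "\<dots> <= 2 * (1 / 2) ^ n * 1 * w z W"
   using w(2)[OF p] by (intro mult_right_mono mult_left_mono) auto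
  finally show ?thesis by simp
 qed
 define g where "g z W = lim (%n. u n z W)" for z W
 have conv: "(%n. u n z W) \<longlonglongrightarrow> g z W" if p: "(z, W) \<in> D" for z W
 proof -
  have "Cauchy (%n. u n z W)"
  proof (rule metric_CauchyI)
   fix e :: real assume "0 < e"
   have "(%n. 4 * (1 / 2) ^ n * w z W) \<longlonglongrightarrow> 4 * 0 * w z W"
    by (intro tendsto_intros LIMSEQ_realpow_zero) auto
   then have "\<forall>\<^sub>F n in sequentially. 4 * (1 / 2) ^ n * w z W < e"
    using \<open>0 < e\<close> by (intro order_tendstoD) auto
   then obtain N where N: "4 * (1 / 2) ^ N * w z W < e" using eventually_happens'[OF sequentially_bot] by blast
   have "dist (u m z W) (u n z W) < e" if "m \<ge> N" "n \<ge> N" for m n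
   proof -
    have "cmod (u m z W - u N z W) <= 2 * (1 / 2) ^ N * w z W" "cmod (u n z W - u N z W) <= 2 * (1 / 2) ^ N * w z W"
     using far[OF p, of N "m - N"] far[OF p, of N "n - N"] that by auto
    then show ?thesis using norm_triangle_ineq4[of "u m z W - u N z W" "u n z W - u N z W"] N
     by (simp add: dist_norm)
   qed
   then show "\<exists>M. \<forall>m\<ge>M. \<forall>n\<ge>M. dist (u m z W) (u n z W) < e" by blast
  qed
  then show ?thesis unfolding g_def using Cauchy_convergent convergent_LIMSEQ_iff by blast
 qed
 have near: "cmod (g z W - u n z W) <= 2 * (1 / 2) ^ n * w z W" if p: "(z, W) \<in> D" for n z W
 proof (rule LIMSEQ_le_const2)
  show "(%m. cmod (u (n + m) z W - u n z W)) \<longlonglongrightarrow> cmod (g z W - u n z W)"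
   using LIMSEQ_ignore_initial_segment[OF conv[OF p], of n] by (intro tendsto_intros) (simp add: add.commute)
  show "\<exists>N. \<forall>m\<ge>N. cmod (u (n + m) z W - u n z W) <= 2 * (1 / 2) ^ n * w z W" using far[OF p] by blast
 qed
 have hol: "hol2 D g"
 proof (rule hol2_uniform_limit[OF pclassD(1)[OF u] D(1)])
  fix p assume p: "p \<in> D"
  have "isCont (%p. w (fst p) (snd p)) p" using w(1) D(1) p continuous_on_eq_continuous_at by blast
  then have "\<forall>\<^sub>F q in at p. w (fst q) (snd q) < w (fst p) (snd p) + 1"
   unfolding isCont_def by (rule order_tendstoD) simp
  then obtain B where B: "open B" "p \<in> B"
    and B': "\<forall>q\<in>B. q \<noteq> p --> q \<in> UNIV --> w (fst q) (snd q) < w (fst p) (snd p) + 1"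
   unfolding eventually_at_topological by blast
  have B3: "w (fst q) (snd q) < w (fst p) (snd p) + 1" if "q \<in> B" for q
   using B' that by (cases "q = p") auto
  define C where "C = w (fst p) (snd p) + 1"
  have "uniform_limit (B \<inter> D) (%n p. u n (fst p) (snd p)) (%p. g (fst p) (snd p)) sequentially"
  proof (rule uniform_limitI)
   fix e :: real assume "0 < e"
   have "(%n. 2 * (1 / 2) ^ n * C) \<longlonglongrightarrow> 2 * 0 * C"
    by (intro tendsto_intros LIMSEQ_realpow_zero) auto
   then have "\<forall>\<^sub>F n in sequentially. 2 * (1 / 2) ^ n * C < e"
    using \<open>0 < e\<close> by (intro order_tendstoD) auto
   then show "\<forall>\<^sub>F n in sequentially. \<forall>q\<in>B \<inter> D. dist (u n (fst q) (snd q)) (g (fst q) (snd q)) < e"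
   proof (rule eventually_mono, intro ballI)
    fix n q assume n: "2 * (1 / 2) ^ n * C < e" and q: "q \<in> B \<inter> D"
    have "cmod (g (fst q) (snd q) - u n (fst q) (snd q)) <= 2 * (1 / 2) ^ n * w (fst q) (snd q)"
     using q by (intro near) auto
    also have "\<dots> <= 2 * (1 / 2) ^ n * C"
     using B3[of q] q by (intro mult_left_mono) (auto simp: C_def)
    finally show "dist (u n (fst q) (snd q)) (g (fst q) (snd q)) < e" using n by (simp add: dist_norm norm_minus_commute)
   qed
  qed
  then show "\<exists>B. open B & p \<in> B & B \<subseteq> D & uniform_limit B (%n p. u n (fst p) (snd p)) (%p. g (fst p) (snd p)) sequentially"
   using B D(1) p by (intro exI[of _ "B \<inter> D"]) auto
 qed
 have g: "pclass D w g"
  unfolding pclass_def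
 proof (intro conjI allI impI hol)
  fix z W assume p: "(z, W) \<in> D"
  then show p1: "(z, W + 1) \<in> D" using D by blast
  have "(%n. u n z (W + 1)) = (%n. u n z W)" using pclassD(3)[OF u p] by auto
  then show "g z (W + 1) = g z W" using conv[OF p] conv[OF p1] LIMSEQ_unique by metis
  show "cmod (g z W) <= w z W"
   by (rule LIMSEQ_le_const2[OF tendsto_norm[OF conv[OF p]]]) (use pclassD(4)[OF u p] in blast)
 qed
 have "T g z W = g z W" if p: "(z, W) \<in> D" for z W
 proof -
  have "cmod (T g z W - g z W) <= 2 * (1 / 2) ^ n * w z W" for n
  proof -
   have "cmod (T g z W - T (u n) z W) <= (2 * (1 / 2) ^ n) / 2 * w z W"
    by (rule contr[OF g u _ _ p]) (use near in auto)
   moreover have "T (u n) = u (Suc n)" by (simp add: u_def)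
   moreover have "cmod (g z W - u (Suc n) z W) <= 2 * (1 / 2) ^ Suc n * w z W" by (rule near[OF p])
   ultimately show ?thesis
    using norm_triangle_ineq4[of "T g z W - u (Suc n) z W" "g z W - u (Suc n) z W"] by (simp add: algebra_simps)
  qed
  moreover have "(%n. 2 * (1 / 2) ^ n * w z W) \<longlonglongrightarrow> 2 * 0 * w z W"
   by (intro tendsto_intros LIMSEQ_realpow_zero) auto
  ultimately have "cmod (T g z W - g z W) <= 2 * 0 * w z W"
   by (intro LIMSEQ_le_const) auto
  then show ?thesis by simp
 qed
 with g show ?thesis by blast
qed

lemma slice_open: "open D ==> open {v. (z, v) \<in> D}"
proof -
 assume "open D"
 then have "open ((%v. (z, v)) -` D)" by (rule open_vimage) (intro continuous_intros)
 then show ?thesis by (simp add: vimage_def)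
qed

lemma slice_lipschitz:
 assumes f: "hol2 D f" and B: "!!v. (z, v) \<in> D ==> cmod (f z v) <= B"
  and sub: "!!v. cmod (v - W) <= d + 1 / 2 ==> (z, v) \<in> D" and x: "cmod (x - W) <= d" "cmod (y - W) <= d"
 shows "cmod (f z x - f z y) <= 2 * B * cmod (x - y)"
proof -
 have "cmod (f z x - f z y) <= B / (1 / 2) * cmod (x - y)"
 proof (rule cauchy_lipschitz[of "f z" "{v. (z, v) \<in> D}" "cball W d"])
  show "f z holomorphic_on {v. (z, v) \<in> D}" by (rule hol2_holomorphic(2)[OF f]) auto
  show "open {v. (z, v) \<in> D}" by (rule slice_open[OF hol2D(1)[OF f]])
  show "cball v (1 / 2) \<subseteq> {v. (z, v) \<in> D}" if "v \<in> cball W d" for v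
  proof
   fix t assume "t \<in> cball v (1 / 2)"
   then have "cmod (t - W) <= d + 1 / 2"
    using that norm_triangle_ineq[of "t - v" "v - W"] by (simp add: dist_norm norm_minus_commute)
   then show "t \<in> {v. (z, v) \<in> D}" using sub by blast
  qed
 qed (use B x in \<open>auto simp: dist_norm norm_minus_commute\<close>)
 then show ?thesis by (simp add: mult.commute)
qed

lemma Im_close: "cmod (v - W) <= d ==> Im v <= Im W + d & Im W - d <= Im v"
 using abs_Im_le_cmod[of "v - W"] by auto

text \<open>
 The inverse of \<open>W \<mapsto> W + f z W\<close> is \<open>W \<mapsto> W + r z W\<close>. By Cauchy's estimate \<open>f z\<close> is a contraction where the
 fixed point equation uses it.
\<close>

lemma inverse_near_identity:
 assumes f: "pclass D (%_ _. 1 / 8) f" and D1: "open D1" "!!z W. (z, W) \<in> D1 ==> (z, W + 1) \<in> D1"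
  and sub: "!!z W v. (z, W) \<in> D1 ==> cmod (v - W) <= 3 / 4 ==> (z, v) \<in> D"
 shows "\<exists>r. pclass D1 (%_ _. 1 / 8) r & (\<forall>z W. (z, W) \<in> D1 --> r z W = - f z (W + r z W))"
proof -
 note hf = pclassD(1)[OF f]
 have "\<exists>r. pclass D1 (%_ _. 1 / 8) r & (\<forall>z W. (z, W) \<in> D1 --> - f z (W + r z W) = r z W)"
 proof (rule contraction_fixpoint[where T = "%r z W. - f z (W + r z W)"])
  fix r assume r: "pclass D1 (%_ _. 1 / 8) r"
  have in1: "(z, W + r z W) \<in> D" if "(z, W) \<in> D1" for z W
   using sub[OF that, of "W + r z W"] pclassD(4)[OF r that] by simp
  show "pclass D1 (%_ _. 1 / 8) (%z W. - f z (W + r z W))"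
   unfolding pclass_def
  proof (intro conjI allI impI)
   show "hol2 D1 (%z W. - f z (W + r z W))"
    by (intro hol2_minus hol2_compose[OF hf] hol2_intros D1(1) pclassD(1)[OF r] in1)
   fix z W assume p: "(z, W) \<in> D1"
   show "(z, W + 1) \<in> D1" using D1 p by blast
   show "- f z (W + 1 + r z (W + 1)) = - f z (W + r z W)"
    using pclassD(3)[OF f in1[OF p]] pclassD(3)[OF r p] by (simp add: algebra_simps)
   show "cmod (- f z (W + r z W)) <= 1 / 8" using pclassD(4)[OF f in1[OF p]] by simp
  qed
 next
  fix u v L z W assume u: "pclass D1 (%_ _. 1 / 8) u" and v: "pclass D1 (%_ _. 1 / 8) v" and L: "(0::real) <= L"
   and uv: "!!z W. (z, W) \<in> D1 ==> cmod (u z W - v z W) <= L * (1 / 8)" and p: "(z, W) \<in> D1"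
  have "cmod (f z (W + v z W) - f z (W + u z W)) <= 2 * (1 / 8) * cmod ((W + v z W) - (W + u z W))"
   by (rule slice_lipschitz[OF hf, where W = W and d = "1 / 8"])
     (use pclassD(4)[OF f] sub[OF p] pclassD(4)[OF u p] pclassD(4)[OF v p] in auto)
  also have "\<dots> = 1 / 4 * cmod (u z W - v z W)" by (simp add: norm_minus_commute)
  also have "\<dots> <= 1 / 4 * (L * (1 / 8))" using uv[OF p] by simp
  finally show "cmod (- f z (W + u z W) - - f z (W + v z W)) <= L / 2 * (1 / 8)" using L by simp
 qed (use D1 in auto)
 then show ?thesis by metis
qed

lemma exp_small4: "d \<ge> 1 / 2 ==> exp (- (2 * pi * d)) <= 1 / (4::real)"
proof -
 assume d: "d \<ge> 1 / 2"
 have "exp (- (2 * pi * d)) = exp (- (2 * pi * (d / 2))) * exp (- (2 * pi * (d / 2)))"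
  by (simp add: exp_add[symmetric])
 also have "\<dots> <= 1 / 2 * (1 / 2)" using d by (intro mult_mono exp_small) auto
 finally show ?thesis by simp
qed

lemma exp_2pi_small: "d <= 1 / 16 ==> exp (2 * pi * d) <= (2::real)"
proof -
 assume "d <= 1 / 16"
 then have "2 * pi * d <= 2 * pi * (1 / 16)" by (intro mult_left_mono) auto
 also have "\<dots> <= 1 / 2" using pi_less_4 by simp
 finally have "exp (2 * pi * d) <= exp (1 / 2)" by simp
 also have "\<dots> <= 2" by (rule exp_half_le2)
 finally show ?thesis .
qed

text \<open>
 The map \<open>W + h\<close> conjugates \<open>W + A + p\<close> to the translation by \<open>A\<close>. This is Koenigs' linearization:
 \<open>W + A + p\<close> moves points up by at least \<open>1 / 2\<close>, which divides the weight by at least \<open>4\<close>, so the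
 functional equation is a contraction.
\<close>

lemma koenigs_upper:
 assumes \<Omega>: "open \<Omega>" and A: "A holomorphic_on \<Omega>" "!!z. z \<in> \<Omega> ==> 1 <= Im (A z)"
  and p: "pclass (updom \<Omega> (%_. Y)) (%z W. \<eta> * exp (- (2 * pi * (Im W - Y)))) p" and \<eta>: "0 <= \<eta>" "\<eta> <= 1 / 100"
 shows "\<exists>h. pclass (updom \<Omega> (%_. Y)) (%z W. 2 * \<eta> * exp (- (2 * pi * (Im W - Y)))) h \<and>
   (\<forall>z W. z \<in> \<Omega> --> Y < Im W --> h z W = p z W + h z (W + A z + p z W))"
proof -
 let ?D = "updom \<Omega> (%_. Y)"
 let ?w = "%z W. 2 * \<eta> * exp (- (2 * pi * (Im W - Y)))"
 have D: "open ?D" using open_dom(2)[OF \<Omega>, of "%_. Y" "%_. Y"] by auto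
 have pb: "cmod (p z W) <= 1 / 100" if "(z, W) \<in> ?D" for z W
 proof -
  have "exp (- (2 * pi * (Im W - Y))) <= 1" using that by simp
  then have "\<eta> * exp (- (2 * pi * (Im W - Y))) <= 1 / 100 * 1" using \<eta> by (intro mult_mono) auto
  then show ?thesis using pclassD(4)[OF p that] by linarith
 qed
 have Imp: "Im W + 1 / 2 <= Im (W + A z + p z W)" if "(z, W) \<in> ?D" for z W
  using A(2)[of z] that pb[OF that] abs_Im_le_cmod[of "p z W"] by auto
 have nx: "(z, W + A z + p z W) \<in> ?D" if "(z, W) \<in> ?D" for z W
  using Imp[OF that] that by auto
 have wd: "?w z (W + A z + p z W) <= 1 / 4 * ?w z W" if "(z, W) \<in> ?D" for z W
 proof -
  have "exp (- (2 * pi * (Im (W + A z + p z W) - Y))) <= exp (- (2 * pi * (1 / 2))) * exp (- (2 * pi * (Im W - Y)))"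
   unfolding exp_add[symmetric] exp_le_cancel_iff
   using mult_left_mono[OF Imp[OF that], of "2 * pi"] by (simp add: algebra_simps)
  also have "\<dots> <= 1 / 4 * exp (- (2 * pi * (Im W - Y)))" by (intro mult_right_mono exp_small4) auto
  finally have "2 * \<eta> * exp (- (2 * pi * (Im (W + A z + p z W) - Y))) <= 2 * \<eta> * (1 / 4 * exp (- (2 * pi * (Im W - Y))))"
   using \<eta> by (intro mult_left_mono) auto
  then show ?thesis by simp
 qed
 have "\<exists>h. pclass ?D ?w h & (\<forall>z W. (z, W) \<in> ?D --> p z W + h z (W + A z + p z W) = h z W)"
 proof (rule contraction_fixpoint[where T = "%h z W. p z W + h z (W + A z + p z W)"])
  show "continuous_on ?D (%p. ?w (fst p) (snd p))" by (intro continuous_intros)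
  fix h assume h: "pclass ?D ?w h"
  show "pclass ?D ?w (%z W. p z W + h z (W + A z + p z W))"
   unfolding pclass_def
  proof (intro conjI allI impI)
   show "hol2 ?D (%z W. p z W + h z (W + A z + p z W))"
    by (intro hol2_add pclassD(1)[OF p] hol2_compose[OF pclassD(1)[OF h]] hol2_fst_holo[OF A(1) \<Omega>]
      hol2_fst hol2_snd D nx) auto
   fix z W assume q: "(z, W) \<in> ?D"
   show "(z, W + 1) \<in> ?D" using q by auto
   have "h z (W + A z + p z W + 1) = h z (W + A z + p z W)" using pclassD(3)[OF h nx[OF q]] .
   then show "p z (W + 1) + h z (W + 1 + A z + p z (W + 1)) = p z W + h z (W + A z + p z W)"
    using pclassD(3)[OF p q] by (simp add: algebra_simps)
   have "cmod (p z W) <= 1 / 2 * ?w z W" using pclassD(4)[OF p q] by simp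
   moreover have "cmod (h z (W + A z + p z W)) <= 1 / 4 * ?w z W"
    using pclassD(4)[OF h nx[OF q]] wd[OF q] by linarith
   moreover have "0 <= ?w z W" using \<eta> by simp
   ultimately show "cmod (p z W + h z (W + A z + p z W)) <= ?w z W"
    using norm_triangle_ineq[of "p z W" "h z (W + A z + p z W)"] by linarith
  qed
 next
  fix u v L z W assume L: "(0::real) <= L"
   and uv: "!!z W. (z, W) \<in> ?D ==> cmod (u z W - v z W) <= L * ?w z W" and q: "(z, W) \<in> ?D"
  have "cmod (u z (W + A z + p z W) - v z (W + A z + p z W)) <= L * ?w z (W + A z + p z W)"
   by (rule uv[OF nx[OF q]])
  also have "\<dots> <= L * (1 / 4 * ?w z W)" using L wd[OF q] by (intro mult_left_mono) auto
  also have "\<dots> <= L / 2 * ?w z W" using L \<eta> by simp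
  finally show "cmod (p z W + u z (W + A z + p z W) - (p z W + v z (W + A z + p z W))) <= L / 2 * ?w z W" by simp
 qed (use D \<eta> in auto)
 then show ?thesis by (metis mem_dom(2))
qed

text \<open>
 The dual statement at the lower end, for the inverse \<open>W + f\<close> of the linearization of \<open>W + q\<close> followed
 by the translation by \<open>A\<close>. The inverse is the natural unknown: its equation at \<open>W\<close> uses \<open>f\<close> only
 at \<open>W - A\<close>, so \<open>f\<close> is defined up to almost \<open>A\<close> above the domain of \<open>q\<close>.
\<close>

lemma koenigs_lower_inverse:
 assumes \<Omega>: "open \<Omega>" and A: "A holomorphic_on \<Omega>" "!!z. z \<in> \<Omega> ==> 1 <= Im (A z)"
  and q: "pclass (lowdom \<Omega> (%_. - Y)) (%z W. \<eta> * exp (2 * pi * (Im W + Y))) q" and \<eta>: "0 <= \<eta>" "\<eta> <= 1 / 100"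
 shows "\<exists>f. pclass (lowdom \<Omega> (%z. Im (A z) - Y - 1)) (%z W. 4 * \<eta> * exp (2 * pi * (Im W - Im (A z) + Y))) f \<and>
   (\<forall>z W. z \<in> \<Omega> --> Im W < Im (A z) - Y - 1 --> f z W = f z (W - A z) + q z (W - A z + f z (W - A z)))"
proof -
 let ?y = "%z. Im (A z) - Y - 1"
 let ?D = "lowdom \<Omega> ?y"
 let ?w = "%z W. 4 * \<eta> * exp (2 * pi * (Im W - Im (A z) + Y))"
 have cA: "continuous_on \<Omega> A" by (rule holomorphic_on_imp_continuous_on[OF A(1)])
 then have D: "open ?D" by (intro open_dom(1)[OF \<Omega>, of "%_. 0"] continuous_intros)
 have sh: "(z, W - A z) \<in> ?D" if "(z, W) \<in> ?D" for z W using that A(2)[of z] by auto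
 have w4: "?w z (W - A z) <= 1 / 4 * ?w z W" if "(z, W) \<in> ?D" for z W
 proof -
  have "exp (2 * pi * (Im (W - A z) - Im (A z) + Y)) = exp (- (2 * pi * Im (A z))) * exp (2 * pi * (Im W - Im (A z) + Y))"
   unfolding exp_add[symmetric] by (simp add: algebra_simps)
  also have "\<dots> <= 1 / 4 * exp (2 * pi * (Im W - Im (A z) + Y))"
   using A(2)[of z] that by (intro mult_right_mono exp_small4) auto
  finally have "4 * \<eta> * exp (2 * pi * (Im (W - A z) - Im (A z) + Y)) <= 4 * \<eta> * (1 / 4 * exp (2 * pi * (Im W - Im (A z) + Y)))"
   using \<eta> by (intro mult_left_mono) auto
  then show ?thesis by simp
 qed
 have w1: "?w z W <= 1 / 25" if "(z, W) \<in> ?D" for z W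
 proof -
  have "exp (2 * pi * (Im W - Im (A z) + Y)) <= exp 0"
   unfolding exp_le_cancel_iff using that by (simp add: mult_le_0_iff)
  then have "4 * \<eta> * exp (2 * pi * (Im W - Im (A z) + Y)) <= 4 * (1 / 100) * 1"
   using \<eta> by (intro mult_mono) auto
  then show ?thesis by simp
 qed
 have fb: "cmod (f z (W - A z)) <= 1 / 100" if f: "pclass ?D ?w f" and zW: "(z, W) \<in> ?D" for f z W
  using pclassD(4)[OF f sh[OF zW]] w4[OF zW] w1[OF zW] by linarith
 have qd: "(z, v) \<in> lowdom \<Omega> (%_. - Y)" if "(z, W) \<in> ?D" "cmod (v - (W - A z)) <= 1 / 100 + 1 / 2" for z W v
  using Im_close[OF that(2)] that(1) by auto
 have qin: "(z, W - A z + f z (W - A z)) \<in> lowdom \<Omega> (%_. - Y)" if f: "pclass ?D ?w f" and zW: "(z, W) \<in> ?D" for f z W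
  using qd[OF zW, of "W - A z + f z (W - A z)"] fb[OF f zW] by simp
 have qb: "cmod (q z v) <= 1 / 100" if "(z, v) \<in> lowdom \<Omega> (%_. - Y)" for z v
 proof -
  have "exp (2 * pi * (Im v + Y)) <= exp 0"
   unfolding exp_le_cancel_iff using that by (simp add: mult_le_0_iff)
  then have "\<eta> * exp (2 * pi * (Im v + Y)) <= 1 / 100 * 1" using \<eta> by (intro mult_mono) auto
  then show ?thesis using pclassD(4)[OF q that] by linarith
 qed
 have "\<exists>f. pclass ?D ?w f & (\<forall>z W. (z, W) \<in> ?D --> f z (W - A z) + q z (W - A z + f z (W - A z)) = f z W)"
 proof (rule contraction_fixpoint[where T = "%f z W. f z (W - A z) + q z (W - A z + f z (W - A z))"])
  show "continuous_on ?D (%p. ?w (fst p) (snd p))"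
   by (intro continuous_intros continuous_on_compose2[OF cA]) (auto simp: lowdom_def)
  fix f assume f: "pclass ?D ?w f"
  have hA: "hol2 ?D (%z W. A z)" by (rule hol2_fst_holo[OF A(1) \<Omega> D]) (auto simp: lowdom_def)
  have hf: "hol2 ?D (%z W. f z (W - A z))"
   by (rule hol2_compose[OF pclassD(1)[OF f] hol2_fst[OF D] hol2_diff[OF hol2_snd[OF D] hA] sh])
  show "pclass ?D ?w (%z W. f z (W - A z) + q z (W - A z + f z (W - A z)))"
   unfolding pclass_def
  proof (intro conjI allI impI)
   show "hol2 ?D (%z W. f z (W - A z) + q z (W - A z + f z (W - A z)))"
    by (intro hol2_add hf hol2_compose[OF pclassD(1)[OF q]] hol2_diff hol2_fst hol2_snd D hA qin[OF f])
   fix z W assume p: "(z, W) \<in> ?D"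
   show "(z, W + 1) \<in> ?D" using p by auto
   have "f z (W - A z + 1) = f z (W - A z)" using pclassD(3)[OF f sh[OF p]] .
   moreover have "q z (W - A z + f z (W - A z) + 1) = q z (W - A z + f z (W - A z))" using pclassD(3)[OF q qin[OF f p]] .
   ultimately show "f z (W + 1 - A z) + q z (W + 1 - A z + f z (W + 1 - A z)) = f z (W - A z) + q z (W - A z + f z (W - A z))"
    by (simp add: algebra_simps)
   have "cmod (f z (W - A z)) <= 1 / 4 * ?w z W" using pclassD(4)[OF f sh[OF p]] w4[OF p] by linarith
   moreover have "cmod (q z (W - A z + f z (W - A z))) <= 1 / 2 * ?w z W"
   proof -
    have i: "Im (f z (W - A z)) <= 1 / 16" using fb[OF f p] abs_Im_le_cmod[of "f z (W - A z)"] by linarith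
    have "exp (2 * pi * (Im (W - A z + f z (W - A z)) + Y)) = exp (2 * pi * Im (f z (W - A z))) * exp (2 * pi * (Im W - Im (A z) + Y))"
     unfolding exp_add[symmetric] by (simp add: algebra_simps)
    also have "\<dots> <= 2 * exp (2 * pi * (Im W - Im (A z) + Y))"
     by (intro mult_right_mono exp_2pi_small i) auto
    finally have "\<eta> * exp (2 * pi * (Im (W - A z + f z (W - A z)) + Y)) <= \<eta> * (2 * exp (2 * pi * (Im W - Im (A z) + Y)))"
     using \<eta> by (intro mult_left_mono) auto
    then show ?thesis using pclassD(4)[OF q qin[OF f p]] by simp
   qed
   moreover have "0 <= ?w z W" using \<eta> by simp
   ultimately show "cmod (f z (W - A z) + q z (W - A z + f z (W - A z))) <= ?w z W"
    using norm_triangle_ineq[of "f z (W - A z)" "q z (W - A z + f z (W - A z))"] by linarith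
  qed
 next
  fix u v L z W assume u: "pclass ?D ?w u" and v: "pclass ?D ?w v" and L: "(0::real) <= L"
   and uv: "!!z W. (z, W) \<in> ?D ==> cmod (u z W - v z W) <= L * ?w z W" and p: "(z, W) \<in> ?D"
  let ?u = "u z (W - A z)" and ?v = "v z (W - A z)"
  have d: "cmod (?u - ?v) <= L * (1 / 4 * ?w z W)"
   using uv[OF sh[OF p]] mult_left_mono[OF w4[OF p] L] by linarith
  have "cmod (q z (W - A z + ?u) - q z (W - A z + ?v)) <= 2 * (1 / 100) * cmod ((W - A z + ?u) - (W - A z + ?v))"
   by (rule slice_lipschitz[OF pclassD(1)[OF q], where W = "W - A z" and d = "1 / 100"])
     (use qb qd[OF p] fb[OF u p] fb[OF v p] in auto)
  also have "(W - A z + ?u) - (W - A z + ?v) = ?u - ?v" by simp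
  also have "2 * (1 / 100) * cmod (?u - ?v) <= 1 * cmod (?u - ?v)" by (intro mult_right_mono) auto
  finally have "cmod (q z (W - A z + ?u) - q z (W - A z + ?v)) <= cmod (?u - ?v)" by simp
  then have "cmod (?u + q z (W - A z + ?u) - (?v + q z (W - A z + ?v))) <= 2 * cmod (?u - ?v)"
   using norm_triangle_ineq[of "?u - ?v" "q z (W - A z + ?u) - q z (W - A z + ?v)"] by (simp add: algebra_simps)
  also have "\<dots> <= L / 2 * ?w z W" using d by simp
  finally show "cmod (?u + q z (W - A z + ?u) - (?v + q z (W - A z + ?v))) <= L / 2 * ?w z W" .
 qed (use D \<eta> in auto)
 then show ?thesis by (metis mem_dom(1))
qed

text \<open>
 The nonlinear Birkhoff factorization: \<open>(W + g) \<circ> (W + k) = W + h\<close>, where \<open>k\<close> is holomorphic above and \<open>h\<close>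
 below. Taking upper parts eliminates \<open>h\<close>, which has none, and leaves the fixed point equation for
 \<open>k\<close>. It is a contraction for small \<open>g\<close>, by Cauchy's estimate and the bound \<open>3\<close> for the parts.
\<close>

lemma annulus_factorization:
 assumes \<Omega>: "open \<Omega>" and b: "continuous_on \<Omega> b" "!!z. z \<in> \<Omega> ==> a + 3 <= b z"
  and g: "pclass (stripdom \<Omega> (%_. a) b) (%_ _. \<epsilon>) g" and \<epsilon>: "0 <= \<epsilon>" "\<epsilon> <= 1 / 24"
 shows "\<exists>k h. pclass (updom \<Omega> (%_. a + 1)) (%_ _. 3 * \<epsilon>) k & pclass (lowdom \<Omega> (%z. b z - 1)) (%_ _. 3 * \<epsilon>) h \<and>
   (\<forall>z W. z \<in> \<Omega> --> a + 1 < Im W --> Im W < b z - 1 --> k z W + g z (W + k z W) = h z W) \<and>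
   (\<forall>z W. z \<in> \<Omega> --> a + 1 < Im W --> k z W = - upart (a + 1) (b z - 1) (%w. g z (w + k z w)) W) \<and>
   (\<forall>z W. z \<in> \<Omega> --> Im W < b z - 1 --> h z W = lpart (a + 1) (b z - 1) (%w. g z (w + k z w)) W)"
proof -
 let ?y = "%z. b z - 1"
 let ?D = "stripdom \<Omega> (%_. a + 1) ?y"
 have cy: "continuous_on \<Omega> ?y" "continuous_on \<Omega> (%_. a + 1)" using b by (auto intro!: continuous_intros)
 note od = open_dom[OF \<Omega> cy(2,1)]
 have gin: "(z, v) \<in> stripdom \<Omega> (%_. a) b" if "(z, W) \<in> ?D" "cmod (v - W) <= 3 * \<epsilon> + 1 / 2" for z W v
  using Im_close[OF that(2)] that(1) \<epsilon> by auto
 have kin: "(z, W + k z W) \<in> stripdom \<Omega> (%_. a) b" if "pclass ?D (%_ _. 3 * \<epsilon>) k" "(z, W) \<in> ?D" for k z W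
  using gin[OF that(2), of "W + k z W"] pclassD(4)[OF that] by simp
 have G: "hol2 ?D (%z w. g z (w + k z w))" if k: "pclass ?D (%_ _. 3 * \<epsilon>) k" for k
  by (intro hol2_compose[OF pclassD(1)[OF g]] hol2_add hol2_fst hol2_snd od pclassD(1)[OF k] kin[OF k])
 have P: "per1 (hstrip (a + 1) (b z - 1)) (%w. g z (w + k z w))" if k: "pclass ?D (%_ _. 3 * \<epsilon>) k" and z: "z \<in> \<Omega>" for k z
  unfolding per1_def
 proof (intro conjI ballI)
  show "(%w. g z (w + k z w)) holomorphic_on hstrip (a + 1) (b z - 1)"
   by (rule hol2_holomorphic(2)[OF G[OF k]]) (use z in auto)
  fix W assume "W \<in> hstrip (a + 1) (b z - 1)"
  then have p: "(z, W) \<in> ?D" using z by auto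
  show "g z (W + 1 + k z (W + 1)) = g z (W + k z W)"
   using pclassD(3)[OF g kin[OF k p]] pclassD(3)[OF k p] by (simp add: algebra_simps)
 qed
 have Gb: "cmod (g z (w + k z w)) <= \<epsilon>" if k: "pclass ?D (%_ _. 3 * \<epsilon>) k" and p: "(z, w) \<in> ?D" for k z w
  using pclassD(4)[OF g kin[OF k p]] .
 have U: "pclass (updom \<Omega> (%_. a + 1)) (%_ _. 3 * \<epsilon>) (%z W. - upart (a + 1) (b z - 1) (%w. g z (w + k z w)) W)"
  and Lo: "pclass (lowdom \<Omega> ?y) (%_ _. 3 * \<epsilon>) (%z. lpart (a + 1) (b z - 1) (%w. g z (w + k z w)))"
  if k: "pclass ?D (%_ _. 3 * \<epsilon>) k" for k
 proof -
  have y: "a + 1 < b z - 1" "a + 1 + 1 <= b z - 1" if "z \<in> \<Omega>" for z using b(2)[OF that] by auto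
  note H = hol2_parts[OF \<Omega> cy(2,1) y(1) G[OF k] P[OF k]]
  note B = part_bounds[OF P[OF k] y(2)]
  show "pclass (updom \<Omega> (%_. a + 1)) (%_ _. 3 * \<epsilon>) (%z W. - upart (a + 1) (b z - 1) (%w. g z (w + k z w)) W)"
   unfolding pclass_def using Gb[OF k] by (auto intro!: hol2_minus H(1) B(1) simp: upart_periodic)
  show "pclass (lowdom \<Omega> ?y) (%_ _. 3 * \<epsilon>) (%z. lpart (a + 1) (b z - 1) (%w. g z (w + k z w)))"
   unfolding pclass_def using Gb[OF k] by (auto intro!: H(2) B(2) simp: lpart_periodic)
 qed
 have "\<exists>k. pclass ?D (%_ _. 3 * \<epsilon>) k & (\<forall>z W. (z, W) \<in> ?D --> - upart (a + 1) (b z - 1) (%w. g z (w + k z w)) W = k z W)"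
 proof (rule contraction_fixpoint[where T = "%k z W. - upart (a + 1) (b z - 1) (%w. g z (w + k z w)) W"])
  fix k assume k: "pclass ?D (%_ _. 3 * \<epsilon>) k"
  show "pclass ?D (%_ _. 3 * \<epsilon>) (%z W. - upart (a + 1) (b z - 1) (%w. g z (w + k z w)) W)"
   using U[OF k] unfolding pclass_def by (auto intro: hol2_subset od(3) simp: subset_iff)
 next
  fix u v L z W assume u: "pclass ?D (%_ _. 3 * \<epsilon>) u" and v: "pclass ?D (%_ _. 3 * \<epsilon>) v" and L: "(0::real) <= L"
   and uv: "!!z W. (z, W) \<in> ?D ==> cmod (u z W - v z W) <= L * (3 * \<epsilon>)" and p: "(z, W) \<in> ?D"
  have z: "z \<in> \<Omega>" using p by auto
  have d: "cmod (g z (w + u z w) - g z (w + v z w)) <= 2 * \<epsilon> * (L * (3 * \<epsilon>))" if "(z, w) \<in> ?D" for w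
  proof -
   have "cmod (g z (w + u z w) - g z (w + v z w)) <= 2 * \<epsilon> * cmod ((w + u z w) - (w + v z w))"
    by (rule slice_lipschitz[OF pclassD(1)[OF g], where W = w and d = "3 * \<epsilon>"])
      (use pclassD(4)[OF g] gin[OF that] pclassD(4)[OF u that] pclassD(4)[OF v that] in auto)
   also have "\<dots> <= 2 * \<epsilon> * (L * (3 * \<epsilon>))" using uv[OF that] \<epsilon> by (intro mult_left_mono) auto
   finally show ?thesis .
  qed
  have pd: "per1 (hstrip (a + 1) (b z - 1)) (%w. g z (w + u z w) - g z (w + v z w))"
   using P[OF u z] P[OF v z] by (auto simp: per1_def intro!: holomorphic_intros)
  have "cmod (upart (a + 1) (b z - 1) (%w. g z (w + u z w) - g z (w + v z w)) W) <= 3 * (2 * \<epsilon> * (L * (3 * \<epsilon>)))"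
   by (rule part_bounds(1)[OF pd]) (use b(2)[OF z] d z p in auto)
  also have "upart (a + 1) (b z - 1) (%w. g z (w + u z w) - g z (w + v z w)) W =
    upart (a + 1) (b z - 1) (%w. g z (w + u z w)) W - upart (a + 1) (b z - 1) (%w. g z (w + v z w)) W"
   using p b(2)[OF z] by (intro upart_diff P u v z) auto
  finally have "cmod (- upart (a + 1) (b z - 1) (%w. g z (w + u z w)) W - - upart (a + 1) (b z - 1) (%w. g z (w + v z w)) W)
    <= (6 * \<epsilon>) * (L * (3 * \<epsilon>))" by (simp add: norm_minus_commute)
  also have "\<dots> <= (1 / 2) * (L * (3 * \<epsilon>))" using L \<epsilon> by (intro mult_right_mono) auto
  finally show "cmod (- upart (a + 1) (b z - 1) (%w. g z (w + u z w)) W - - upart (a + 1) (b z - 1) (%w. g z (w + v z w)) W)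
    <= L / 2 * (3 * \<epsilon>)" by simp
 qed (use od \<epsilon> in auto)
 then obtain k where k: "pclass ?D (%_ _. 3 * \<epsilon>) k"
  and fp: "!!z W. (z, W) \<in> ?D ==> - upart (a + 1) (b z - 1) (%w. g z (w + k z w)) W = k z W" by blast
 define k' where "k' z W = - upart (a + 1) (b z - 1) (%w. g z (w + k z w)) W" for z W
 define h where "h z W = lpart (a + 1) (b z - 1) (%w. g z (w + k z w)) W" for z W
 have kk: "k' z w = k z w" if "z \<in> \<Omega>" "a + 1 < Im w" "Im w < b z - 1" for z w
  using fp that by (simp add: k'_def)
 have up: "upart (a + 1) (b z - 1) (%w. g z (w + k' z w)) W = upart (a + 1) (b z - 1) (%w. g z (w + k z w)) W"
  if "z \<in> \<Omega>" "a + 1 < Im W" for z W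
  unfolding upart_def by (intro pmean_cong) (use that b(2)[OF that(1)] kk in auto)
 have lp: "lpart (a + 1) (b z - 1) (%w. g z (w + k' z w)) W = lpart (a + 1) (b z - 1) (%w. g z (w + k z w)) W"
  if "z \<in> \<Omega>" "Im W < b z - 1" for z W
  unfolding lpart_def by (intro arg_cong[where f = uminus] pmean_cong) (use that b(2)[OF that(1)] kk in auto)
 show ?thesis
 proof (rule exI[of _ k'], rule exI[of _ h], intro conjI allI impI)
  show "pclass (updom \<Omega> (%_. a + 1)) (%_ _. 3 * \<epsilon>) k'" unfolding k'_def by (rule U[OF k])
  show "pclass (lowdom \<Omega> (%z. b z - 1)) (%_ _. 3 * \<epsilon>) h"
   using Lo[OF k] by (simp add: h_def[abs_def])
  fix z W assume z: "z \<in> \<Omega>"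
  show "k' z W = - upart (a + 1) (b z - 1) (%w. g z (w + k' z w)) W" if "a + 1 < Im W"
   using up[OF z that] by (simp add: k'_def)
  show "h z W = lpart (a + 1) (b z - 1) (%w. g z (w + k' z w)) W" if "Im W < b z - 1"
   using lp[OF z that] by (simp add: h_def)
  show "k' z W + g z (W + k' z W) = h z W" if W: "a + 1 < Im W" "Im W < b z - 1"
  proof -
   define u l where "u = upart (a + 1) (b z - 1) (%w. g z (w + k z w)) W"
    and "l = lpart (a + 1) (b z - 1) (%w. g z (w + k z w)) W"
   have "u + l = g z (W + k z W)" "- u = k z W" "h z W = l" "k' z W = k z W"
    using upart_lpart[OF P[OF k z] W] fp[of z W] z W kk[OF z W] by (auto simp: u_def l_def h_def)
   then show ?thesis by (metis add.commute add_diff_cancel_right' diff_conv_add_uminus)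
  qed
 qed
qed

section \<open>Passing from one chain of transition maps to the other\<close>

text \<open>The constant \<open>1 / 1000\<close> leaves room for all contractions below.\<close>

abbreviation wlow :: "real => complex => complex => real" where
 "wlow Y \<equiv> %z W. 1 / 1000 * exp (2 * pi * (Im W + Y))"
abbreviation wup :: "real => complex => complex => real" where
 "wup Y \<equiv> %z W. 1 / 1000 * exp (- (2 * pi * (Im W - Y)))"

text \<open>
 \<open>Q\<close> is \<open>\<Psi>\<^sup>0\<close> at one lift, and \<open>P\<close> is \<open>\<Psi>\<^sup>\<infinity>\<close> there, followed by the translation which makes it tangent to
 the identity. \<open>A\<close> and \<open>A'\<close> are the translations in the compatibility condition.
\<close>

locale transition_data =
 fixes \<Omega> :: "complex set" and A A' :: "complex => complex" and Y M :: real
  and Q P :: "complex => complex => complex"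
 assumes open_params: "open \<Omega>"
  and hol_A: "A holomorphic_on \<Omega>" and hol_A': "A' holomorphic_on \<Omega>"
  and A_close: "!!z. z \<in> \<Omega> ==> cmod (A z - A' z) <= M"
  and A_large: "!!z. z \<in> \<Omega> ==> 2 * Y + 2 * M + 40 <= Im (A z)"
  and Y0: "0 <= Y" and M0: "0 <= M"
  and Q: "pclass (lowdom \<Omega> (%_. - Y)) (wlow Y) (%z W. Q z W - W)"
  and P: "pclass (updom \<Omega> (%_. Y)) (wup Y) (%z W. P z W - W)"

text \<open>
 \<open>W + f\<close> is the inverse of the linearization for \<open>Q\<close>, and \<open>W + h\<close> is the linearization for \<open>P\<close>. The
 factorization \<open>(W + h) \<circ> (W + f) \<circ> (W + k) = W + u\<close> makes \<open>W + k\<close> and \<open>W + u\<close> the linearizations at the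
 other lift. \<open>Ph\<close> and \<open>Qh\<close> are the transition maps there: \<open>W + k\<close> conjugates \<open>Ph\<close> preceded by the
 translation by \<open>- A\<close> to that translation, and likewise \<open>W + u\<close> for \<open>Qh\<close> and \<open>- A'\<close>.
\<close>

locale gluing_system = transition_data +
 fixes f h k u Qh Ph :: "complex => complex => complex"
 assumes f: "pclass (lowdom \<Omega> (%z. Im (A z) - Y - 1)) (%z W. 4 * (1 / 1000) * exp (2 * pi * (Im W - Im (A z) + Y))) f"
  and f_eq: "!!z W. z \<in> \<Omega> ==> Im W < Im (A z) - Y - 1 ==> W + f z W = A z + Q z (W - A z + f z (W - A z))"
  and h: "pclass (updom \<Omega> (%_. Y)) (%z W. 2 * (1 / 1000) * exp (- (2 * pi * (Im W - Y)))) h"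
  and h_eq: "!!z W. z \<in> \<Omega> ==> Y < Im W ==> W + h z W = P z W + h z (P z W + A' z)"
  and k: "pclass (updom \<Omega> (%_. Y + 2)) (%_ _. 18 / 1000) k"
  and u: "pclass (lowdom \<Omega> (%z. Im (A z) - Y - 2)) (%_ _. 18 / 1000) u"
  and ku: "!!z W. z \<in> \<Omega> ==> Y + 2 < Im W ==> Im W < Im (A z) - Y - 2 ==>
    k z W + (f z (W + k z W) + h z (W + k z W + f z (W + k z W))) = u z W"
  and k_upart: "!!z W. z \<in> \<Omega> ==> Y + 2 < Im W ==>
    k z W = - upart (Y + 2) (Im (A z) - Y - 2) (%w. f z (w + k z w) + h z (w + k z w + f z (w + k z w))) W"
  and u_lpart: "!!z W. z \<in> \<Omega> ==> Im W < Im (A z) - Y - 2 ==>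
    u z W = lpart (Y + 2) (Im (A z) - Y - 2) (%w. f z (w + k z w) + h z (w + k z w + f z (w + k z w))) W"
  and Qh: "pclass (lowdom \<Omega> (%_. - (Y + M + 4))) (%_ _. 1 / 4) (%z W. Qh z W - W)"
  and Qh_eq: "!!z W. z \<in> \<Omega> ==> Im W < - (Y + M + 4) ==>
    Qh z W + u z (Qh z W) = W + u z (W + A' z)"
  and Ph: "pclass (updom \<Omega> (%_. Y + M + 4)) (%_ _. 1 / 4) (%z W. Ph z W - W)"
  and Ph_eq: "!!z W. z \<in> \<Omega> ==> Y + M + 4 < Im W ==>
    Ph z W + k z (Ph z W) = W + k z (W + A z)"

lemma pclass_mono:
 assumes "pclass D w u" "!!z W. (z, W) \<in> D ==> w z W <= w' z W"
 shows "pclass D w' u"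
 using assms unfolding pclass_def by (meson order_trans)

context transition_data
begin

lemma A'_bounds: assumes "z \<in> \<Omega>" shows "Im (A z) - M <= Im (A' z)" "Im (A' z) <= Im (A z) + M"
 using A_close[OF assms] abs_Im_le_cmod[of "A z - A' z"] by auto

lemma cont_ImA: "continuous_on \<Omega> (%z. Im (A z) + c)"
 by (intro continuous_intros holomorphic_on_imp_continuous_on[OF hol_A])

lemma open_low: "open (lowdom \<Omega> (%z. Im (A z) - c))" "open (lowdom \<Omega> (%z. c))"
 using open_dom(1)[OF open_params, of "%_. 0" "%z. Im (A z) + - c"] cont_ImA[of "- c"]
  open_dom(1)[OF open_params, of "%_. 0" "%z. c"] by auto
lemma open_up: "open (updom \<Omega> (%z. c))"
 using open_dom(2)[OF open_params, of "%_. c" "%z. c"] by auto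
lemma open_strip: "open (stripdom \<Omega> (%_. c) (%z. Im (A z) - d))"
 using open_dom(3)[OF open_params, of "%_. c" "%z. Im (A z) + - d"] cont_ImA[of "- d"] by auto

text \<open>
 The linearizations for the given pair, the factorization of their composite, and then the
 equations of the other pair, solved with the inverses of the factors.
\<close>

lemma exists_gluing_system: "\<exists>f h k u Qh Ph. gluing_system \<Omega> A A' Y M Q P f h k u Qh Ph"
proof -
 have "\<exists>f. pclass (lowdom \<Omega> (%z. Im (A z) - Y - 1)) (%z W. 4 * (1 / 1000) * exp (2 * pi * (Im W - Im (A z) + Y))) f \<and>
   (\<forall>z W. z \<in> \<Omega> --> Im W < Im (A z) - Y - 1 --> f z W = f z (W - A z) + (Q z (W - A z + f z (W - A z)) - (W - A z + f z (W - A z))))"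
  by (rule koenigs_lower_inverse[OF open_params hol_A _ Q]) (use A_large Y0 M0 in force)+
 then obtain f where f: "pclass (lowdom \<Omega> (%z. Im (A z) - Y - 1)) (%z W. 4 * (1 / 1000) * exp (2 * pi * (Im W - Im (A z) + Y))) f"
  and f_eq: "!!z W. z \<in> \<Omega> ==> Im W < Im (A z) - Y - 1 ==> W + f z W = A z + Q z (W - A z + f z (W - A z))"
  by (auto simp: algebra_simps)
 have "\<exists>h. pclass (updom \<Omega> (%_. Y)) (%z W. 2 * (1 / 1000) * exp (- (2 * pi * (Im W - Y)))) h \<and>
   (\<forall>z W. z \<in> \<Omega> --> Y < Im W --> h z W = (P z W - W) + h z (W + A' z + (P z W - W)))"
 proof (rule koenigs_upper[OF open_params hol_A' _ P])
  show "1 <= Im (A' z)" if "z \<in> \<Omega>" for z using A_large[OF that] A'_bounds(1)[OF that] Y0 M0 by simp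
 qed auto
 then obtain h where h: "pclass (updom \<Omega> (%_. Y)) (%z W. 2 * (1 / 1000) * exp (- (2 * pi * (Im W - Y)))) h"
  and h_eq0: "!!z W. z \<in> \<Omega> ==> Y < Im W ==> h z W = (P z W - W) + h z (W + A' z + (P z W - W))"
  by blast
 have h_eq: "W + h z W = P z W + h z (P z W + A' z)" if "z \<in> \<Omega>" "Y < Im W" for z W
  using h_eq0[OF that] by (simp add: algebra_simps)
 let ?S = "stripdom \<Omega> (%_. Y + 1) (%z. Im (A z) - (Y + 1))"
 define g where "g z W = f z W + h z (W + f z W)" for z W
 have fS: "(z, W) \<in> lowdom \<Omega> (%z. Im (A z) - Y - 1)" if "(z, W) \<in> ?S" for z W using that by auto
 have fb: "cmod (f z W) <= 4 / 1000" if "(z, W) \<in> lowdom \<Omega> (%z. Im (A z) - Y - 1)" for z W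
 proof -
  have "exp (2 * pi * (Im W - Im (A z) + Y)) <= 1" using that by (simp add: mult_le_0_iff)
  then show ?thesis using pclassD(4)[OF f that] by linarith
 qed
 have hS: "(z, W + f z W) \<in> updom \<Omega> (%_. Y)" if "(z, W) \<in> ?S" for z W
  using that Im_close[of "W + f z W" W "4 / 1000"] fb[OF fS[OF that]] by auto
 have hb: "cmod (h z W) <= 2 / 1000" if "(z, W) \<in> updom \<Omega> (%_. Y)" for z W
  using pclassD(4)[OF h that] that by (auto elim!: order_trans)
 have g: "pclass ?S (%_ _. 6 / 1000) g"
  unfolding pclass_def
 proof (intro conjI allI impI)
  have hf: "hol2 ?S f" by (rule hol2_subset[OF pclassD(1)[OF f] open_strip]) (use fS in auto)
  have "hol2 ?S (%z W. f z W + h z (W + f z W))"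
   by (intro hol2_add hf hol2_compose[OF pclassD(1)[OF h]] hol2_fst hol2_snd open_strip hS)
  then show "hol2 ?S g" by (simp add: g_def[abs_def])
  fix z W assume p: "(z, W) \<in> ?S"
  then show "(z, W + 1) \<in> ?S" by simp
  have "f z (W + 1) = f z W" by (rule pclassD(3)[OF f fS[OF p]])
  moreover have "h z (W + f z W + 1) = h z (W + f z W)" by (rule pclassD(3)[OF h hS[OF p]])
  ultimately show "g z (W + 1) = g z W" by (simp add: g_def algebra_simps)
  show "cmod (g z W) <= 6 / 1000"
   using fb[OF fS[OF p]] hb[OF hS[OF p]] norm_triangle_ineq[of "f z W" "h z (W + f z W)"] by (simp add: g_def)
 qed
 have "\<exists>k u. pclass (updom \<Omega> (%_. Y + 1 + 1)) (%_ _. 3 * (6 / 1000)) k & pclass (lowdom \<Omega> (%z. Im (A z) - (Y + 1) - 1)) (%_ _. 3 * (6 / 1000)) u \<and>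
   (\<forall>z W. z \<in> \<Omega> --> Y + 1 + 1 < Im W --> Im W < Im (A z) - (Y + 1) - 1 --> k z W + g z (W + k z W) = u z W) \<and>
   (\<forall>z W. z \<in> \<Omega> --> Y + 1 + 1 < Im W --> k z W = - upart (Y + 1 + 1) (Im (A z) - (Y + 1) - 1) (%w. g z (w + k z w)) W) \<and>
   (\<forall>z W. z \<in> \<Omega> --> Im W < Im (A z) - (Y + 1) - 1 --> u z W = lpart (Y + 1 + 1) (Im (A z) - (Y + 1) - 1) (%w. g z (w + k z w)) W)"
 proof (rule annulus_factorization[OF open_params _ _ g])
  show "continuous_on \<Omega> (%z. Im (A z) - (Y + 1))" by (intro continuous_intros holomorphic_on_imp_continuous_on[OF hol_A])
  show "Y + 1 + 3 <= Im (A z) - (Y + 1)" if "z \<in> \<Omega>" for z using A_large[OF that] M0 by simp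
 qed auto
 then obtain k u where k: "pclass (updom \<Omega> (%_. Y + 2)) (%_ _. 18 / 1000) k" and u: "pclass (lowdom \<Omega> (%z. Im (A z) - Y - 2)) (%_ _. 18 / 1000) u"
  and kg: "!!z W. z \<in> \<Omega> ==> Y + 2 < Im W ==> Im W < Im (A z) - Y - 2 ==> k z W + g z (W + k z W) = u z W"
  and kup: "!!z W. z \<in> \<Omega> ==> Y + 2 < Im W ==> k z W = - upart (Y + 2) (Im (A z) - Y - 2) (%w. g z (w + k z w)) W"
  and ulp: "!!z W. z \<in> \<Omega> ==> Im W < Im (A z) - Y - 2 ==> u z W = lpart (Y + 2) (Im (A z) - Y - 2) (%w. g z (w + k z w)) W"
 proof -
  have *: "Y + 1 + 1 = Y + 2" "!!z. Im (A z) - (Y + 1) - 1 = Im (A z) - Y - 2" "3 * (6 / 1000) = (18 / 1000 :: real)" by auto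
  assume "!!k u. pclass (updom \<Omega> (%_. Y + 2)) (%_ _. 18 / 1000) k ==> pclass (lowdom \<Omega> (%z. Im (A z) - Y - 2)) (%_ _. 18 / 1000) u ==>
   (!!z W. z \<in> \<Omega> ==> Y + 2 < Im W ==> Im W < Im (A z) - Y - 2 ==> k z W + g z (W + k z W) = u z W) ==>
   (!!z W. z \<in> \<Omega> ==> Y + 2 < Im W ==> k z W = - upart (Y + 2) (Im (A z) - Y - 2) (%w. g z (w + k z w)) W) ==>
   (!!z W. z \<in> \<Omega> ==> Im W < Im (A z) - Y - 2 ==> u z W = lpart (Y + 2) (Im (A z) - Y - 2) (%w. g z (w + k z w)) W) ==> thesis"
   and "\<exists>k u. pclass (updom \<Omega> (%_. Y + 1 + 1)) (%_ _. 3 * (6 / 1000)) k & pclass (lowdom \<Omega> (%z. Im (A z) - (Y + 1) - 1)) (%_ _. 3 * (6 / 1000)) u \<and>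
   (\<forall>z W. z \<in> \<Omega> --> Y + 1 + 1 < Im W --> Im W < Im (A z) - (Y + 1) - 1 --> k z W + g z (W + k z W) = u z W) \<and>
   (\<forall>z W. z \<in> \<Omega> --> Y + 1 + 1 < Im W --> k z W = - upart (Y + 1 + 1) (Im (A z) - (Y + 1) - 1) (%w. g z (w + k z w)) W) \<and>
   (\<forall>z W. z \<in> \<Omega> --> Im W < Im (A z) - (Y + 1) - 1 --> u z W = lpart (Y + 1 + 1) (Im (A z) - (Y + 1) - 1) (%w. g z (w + k z w)) W)"
  then show thesis unfolding * by blast
 qed
 \<comment> \<open>the inverses of the two factors\<close>
 have u8: "pclass (lowdom \<Omega> (%z. Im (A z) - Y - 2)) (%_ _. 1 / 8) u" by (rule pclass_mono[OF u]) auto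
 have k8: "pclass (updom \<Omega> (%_. Y + 2)) (%_ _. 1 / 8) k" by (rule pclass_mono[OF k]) auto
 have "\<exists>r. pclass (lowdom \<Omega> (%z. Im (A z) - (Y + 3))) (%_ _. 1 / 8) r & (\<forall>z W. (z, W) \<in> lowdom \<Omega> (%z. Im (A z) - (Y + 3)) --> r z W = - u z (W + r z W))"
  by (rule inverse_near_identity[OF u8 open_low(1)]) (use Im_close in \<open>fastforce+\<close>)
 then obtain r where r: "pclass (lowdom \<Omega> (%z. Im (A z) - (Y + 3))) (%_ _. 1 / 8) r"
  and r_eq: "!!z W. (z, W) \<in> lowdom \<Omega> (%z. Im (A z) - (Y + 3)) ==> r z W = - u z (W + r z W)" by blast
 have "\<exists>s. pclass (updom \<Omega> (%_. Y + 3)) (%_ _. 1 / 8) s & (\<forall>z W. (z, W) \<in> updom \<Omega> (%_. Y + 3) --> s z W = - k z (W + s z W))"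
  by (rule inverse_near_identity[OF k8 open_up]) (use Im_close in \<open>fastforce+\<close>)
 then obtain s where s: "pclass (updom \<Omega> (%_. Y + 3)) (%_ _. 1 / 8) s"
  and s_eq: "!!z W. (z, W) \<in> updom \<Omega> (%_. Y + 3) ==> s z W = - k z (W + s z W)" by blast
 define Qh where "Qh z W = W + u z (W + A' z) + r z (W + u z (W + A' z))" for z W
 define Ph where "Ph z W = W + k z (W + A z) + s z (W + k z (W + A z))" for z W
 let ?L = "lowdom \<Omega> (%_. - (Y + M + 4))" and ?U = "updom \<Omega> (%_. Y + M + 4)"
 have q1: "(z, W + A' z) \<in> lowdom \<Omega> (%z. Im (A z) - Y - 2)" if "(z, W) \<in> ?L" for z W
  using that A'_bounds[of z] by auto
 have q2: "(z, W + u z (W + A' z)) \<in> lowdom \<Omega> (%z. Im (A z) - (Y + 3))" if "(z, W) \<in> ?L" for z W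
  using that Im_close[of "W + u z (W + A' z)" W "18 / 1000"] pclassD(4)[OF u q1[OF that]] A_large[of z] Y0 M0 by auto
 have p1: "(z, W + A z) \<in> updom \<Omega> (%_. Y + 2)" if "(z, W) \<in> ?U" for z W
  using that A_large[of z] Y0 M0 by auto
 have p2: "(z, W + k z (W + A z)) \<in> updom \<Omega> (%_. Y + 3)" if "(z, W) \<in> ?U" for z W
  using that Im_close[of "W + k z (W + A z)" W "18 / 1000"] pclassD(4)[OF k p1[OF that]] M0 by auto
 have hA: "hol2 D (%z W. A z)" "hol2 D (%z W. A' z)" if "open D" "D \<subseteq> \<Omega> \<times> UNIV" for D
  using hol2_fst_holo[OF hol_A open_params that] hol2_fst_holo[OF hol_A' open_params that] .
 have Ls: "?L \<subseteq> \<Omega> \<times> UNIV" "?U \<subseteq> \<Omega> \<times> UNIV" by (auto simp: lowdom_def updom_def)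
 have Qh: "pclass ?L (%_ _. 1 / 4) (%z W. Qh z W - W)"
  unfolding pclass_def
 proof (intro conjI allI impI)
  have "hol2 ?L (%z W. u z (W + A' z))"
   by (intro hol2_compose[OF pclassD(1)[OF u]] hol2_add hol2_fst hol2_snd open_low hA Ls q1)
  then show "hol2 ?L (%z W. Qh z W - W)" unfolding Qh_def
   by (intro hol2_add hol2_diff hol2_compose[OF pclassD(1)[OF r]] hol2_fst hol2_snd open_low q2)
  fix z W assume p: "(z, W) \<in> ?L"
  then show "(z, W + 1) \<in> ?L" by simp
  have "u z (W + A' z + 1) = u z (W + A' z)" by (rule pclassD(3)[OF u q1[OF p]])
  moreover have "r z (W + u z (W + A' z) + 1) = r z (W + u z (W + A' z))" by (rule pclassD(3)[OF r q2[OF p]])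
  ultimately show "Qh z (W + 1) - (W + 1) = Qh z W - W" by (simp add: Qh_def algebra_simps)
  show "cmod (Qh z W - W) <= 1 / 4"
   using pclassD(4)[OF u q1[OF p]] pclassD(4)[OF r q2[OF p]]
    norm_triangle_ineq[of "u z (W + A' z)" "r z (W + u z (W + A' z))"] by (simp add: Qh_def)
 qed
 have Ph: "pclass ?U (%_ _. 1 / 4) (%z W. Ph z W - W)"
  unfolding pclass_def
 proof (intro conjI allI impI)
  have "hol2 ?U (%z W. k z (W + A z))"
   by (intro hol2_compose[OF pclassD(1)[OF k]] hol2_add hol2_fst hol2_snd open_up hA Ls p1)
  then show "hol2 ?U (%z W. Ph z W - W)" unfolding Ph_def
   by (intro hol2_add hol2_diff hol2_compose[OF pclassD(1)[OF s]] hol2_fst hol2_snd open_up p2)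
  fix z W assume p: "(z, W) \<in> ?U"
  then show "(z, W + 1) \<in> ?U" by simp
  have "k z (W + A z + 1) = k z (W + A z)" by (rule pclassD(3)[OF k p1[OF p]])
  moreover have "s z (W + k z (W + A z) + 1) = s z (W + k z (W + A z))" by (rule pclassD(3)[OF s p2[OF p]])
  ultimately show "Ph z (W + 1) - (W + 1) = Ph z W - W" by (simp add: Ph_def algebra_simps)
  show "cmod (Ph z W - W) <= 1 / 4"
   using pclassD(4)[OF k p1[OF p]] pclassD(4)[OF s p2[OF p]]
    norm_triangle_ineq[of "k z (W + A z)" "s z (W + k z (W + A z))"] by (simp add: Ph_def)
 qed
 have aux: "q + t = v" if "q = v + r" "r = - t" for q v r t :: complex using that by simp
 have Qh_eq: "Qh z W + u z (Qh z W) = W + u z (W + A' z)" if "z \<in> \<Omega>" "Im W < - (Y + M + 4)" for z W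
 proof -
  have *: "(z, W) \<in> ?L" using that by simp
  show ?thesis
   by (rule aux[OF Qh_def[of z W]]) (use r_eq[OF q2[OF *]] in \<open>simp add: Qh_def\<close>)
 qed
 have Ph_eq: "Ph z W + k z (Ph z W) = W + k z (W + A z)" if "z \<in> \<Omega>" "Y + M + 4 < Im W" for z W
 proof -
  have *: "(z, W) \<in> ?U" using that by simp
  show ?thesis
   by (rule aux[OF Ph_def[of z W]]) (use s_eq[OF p2[OF *]] in \<open>simp add: Ph_def\<close>)
 qed
 have "gluing_system \<Omega> A A' Y M Q P f h k u Qh Ph"
  by unfold_locales
    (use f f_eq h h_eq k u kg kup ulp Qh Qh_eq Ph Ph_eq in \<open>auto simp: g_def\<close>)
 then show ?thesis by blast
qed

lemma Q_lipschitz: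
 assumes "z \<in> \<Omega>" "Im x < - Y - 1" "Im y < - Y - 1"
 shows "cmod (Q z x - Q z y) <= 2 * cmod (x - y)"
proof -
 have "cmod ((Q z x - x) - (Q z y - y)) <= 1 / 1000 / 1 * cmod (x - y)"
 proof (rule cauchy_lipschitz[where f = "%W. Q z W - W" and S = "lower_hp (- Y)" and C = "lower_hp (- Y - 1)"])
  show "(%W. Q z W - W) holomorphic_on lower_hp (- Y)"
   by (rule hol2_holomorphic(2)[OF pclassD(1)[OF Q]]) (use assms in auto)
  show "cball w 1 \<subseteq> lower_hp (- Y)" if "w \<in> lower_hp (- Y - 1)" for w
   using that Im_close[of _ w 1] by (fastforce simp: dist_norm norm_minus_commute)
  show "cmod (Q z w - w) <= 1 / 1000" if "w \<in> lower_hp (- Y)" for w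
  proof -
   have "exp (2 * pi * (Im w + Y)) <= 1" using that by (simp add: mult_le_0_iff)
   moreover have "(z, w) \<in> lowdom \<Omega> (%_. - Y)" using that assms by simp
   ultimately show ?thesis using pclassD(4)[OF Q, of z w] by linarith
  qed
 qed (use assms in auto)
 then have "cmod ((Q z x - x) - (Q z y - y)) <= cmod (x - y)" using norm_ge_zero[of "x - y"] by linarith
 then show ?thesis using norm_triangle_ineq[of "(Q z x - x) - (Q z y - y)" "x - y"] by simp
qed

lemma P_lipschitz:
 assumes "z \<in> \<Omega>" "Y + 1 < Im x" "Y + 1 < Im y"
 shows "cmod (P z x - P z y) <= 2 * cmod (x - y)"
proof -
 have "cmod ((P z x - x) - (P z y - y)) <= 1 / 1000 / 1 * cmod (x - y)"
 proof (rule cauchy_lipschitz[where f = "%W. P z W - W" and S = "upper_hp Y" and C = "upper_hp (Y + 1)"])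
  show "(%W. P z W - W) holomorphic_on upper_hp Y"
   by (rule hol2_holomorphic(2)[OF pclassD(1)[OF P]]) (use assms in auto)
  show "cball w 1 \<subseteq> upper_hp Y" if "w \<in> upper_hp (Y + 1)" for w
   using that Im_close[of _ w 1] by (fastforce simp: dist_norm norm_minus_commute)
  show "cmod (P z w - w) <= 1 / 1000" if "w \<in> upper_hp Y" for w
   using pclassD(4)[OF P, of z w] that assms by (auto elim!: order_trans)
 qed (use assms in auto)
 then have "cmod ((P z x - x) - (P z y - y)) <= cmod (x - y)" using norm_ge_zero[of "x - y"] by linarith
 then show ?thesis using norm_triangle_ineq[of "(P z x - x) - (P z y - y)" "x - y"] by simp
qed

end

section \<open>Closeness of the glued pair\<close>

lemma le_add_coeff:
 fixes x a b e :: real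
 assumes "x <= a * e \<or> x <= b * e" "0 <= a" "0 <= b" "0 <= e"
 shows "x <= (a + b) * e"
proof -
 have "0 <= a * e" "0 <= b * e" using assms by auto
 then show ?thesis using assms(1) unfolding ring_distribs by linarith
qed

context gluing_system
begin

lemma f_bound:
 assumes "z \<in> \<Omega>" "Im W < Im (A z) - Y - 1"
 shows "cmod (f z W) <= 4 / 1000 * exp (2 * pi * (Im W - Im (A z) + Y))" "cmod (f z W) <= 4 / 1000"
proof -
 show *: "cmod (f z W) <= 4 / 1000 * exp (2 * pi * (Im W - Im (A z) + Y))"
  using pclassD(4)[OF f, of z W] assms by simp
 have "exp (2 * pi * (Im W - Im (A z) + Y)) <= 1" using assms by (simp add: mult_le_0_iff)
 then show "cmod (f z W) <= 4 / 1000" using * by linarith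
qed

lemma h_bound:
 assumes "z \<in> \<Omega>" "Y < Im W"
 shows "cmod (h z W) <= 2 / 1000 * exp (- (2 * pi * (Im W - Y)))" "cmod (h z W) <= 2 / 1000"
proof -
 show *: "cmod (h z W) <= 2 / 1000 * exp (- (2 * pi * (Im W - Y)))"
  using pclassD(4)[OF h, of z W] assms by simp
 have "exp (- (2 * pi * (Im W - Y))) <= 1" using assms by simp
 then show "cmod (h z W) <= 2 / 1000" using * by linarith
qed

lemma k_bound: "z \<in> \<Omega> ==> Y + 2 < Im W ==> cmod (k z W) <= 18 / 1000"
 and u_bound: "z \<in> \<Omega> ==> Im W < Im (A z) - Y - 2 ==> cmod (u z W) <= 18 / 1000"
 using pclassD(4)[OF k, of z W] pclassD(4)[OF u, of z W] by auto

lemma per1_slices: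
 assumes z: "z \<in> \<Omega>"
 shows "per1 (lower_hp (Im (A z) - Y - 1)) (f z)" "per1 (upper_hp Y) (h z)"
  "per1 (upper_hp (Y + 2)) (k z)" "per1 (lower_hp (Im (A z) - Y - 2)) (u z)"
 unfolding per1_def
 using z hol2_holomorphic(2)[OF pclassD(1)[OF f], of "lower_hp (Im (A z) - Y - 1)" z] pclassD(3)[OF f, of z]
  hol2_holomorphic(2)[OF pclassD(1)[OF h], of "upper_hp Y" z] pclassD(3)[OF h, of z]
  hol2_holomorphic(2)[OF pclassD(1)[OF k], of "upper_hp (Y + 2)" z] pclassD(3)[OF k, of z]
  hol2_holomorphic(2)[OF pclassD(1)[OF u], of "lower_hp (Im (A z) - Y - 2)" z] pclassD(3)[OF u, of z]
 by auto

lemma per1_defect: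
 assumes z: "z \<in> \<Omega>"
 shows "per1 (hstrip (Y + 2) (Im (A z) - Y - 2)) (%w. f z (w + k z w) + h z (w + k z w + f z (w + k z w)))"
proof -
 let ?S = "hstrip (Y + 2) (Im (A z) - Y - 2)"
 have 1: "per1 ?S (k z)" "per1 ?S (u z)"
  by (rule per1_subset[OF per1_slices(3)[OF z]] per1_subset[OF per1_slices(4)[OF z]]; auto)+
 have eq: "u z w - k z w = f z (w + k z w) + h z (w + k z w + f z (w + k z w))" if "w \<in> ?S" for w
  using ku[OF z, of w] that by (simp add: algebra_simps)
 have d: "per1 ?S (%w. u z w - k z w)" using 1 by (auto simp: per1_def intro!: holomorphic_intros)
 show ?thesis
  unfolding per1_def
 proof (intro conjI ballI)
  show "(%w. f z (w + k z w) + h z (w + k z w + f z (w + k z w))) holomorphic_on ?S"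
   by (rule holomorphic_transform[OF per1D(1)[OF d] eq])
  fix W assume W: "W \<in> ?S"
  then have "W + 1 \<in> ?S" by simp
  with per1D(2)[OF d W] eq[OF W] eq[of "W + 1"]
  show "f z (W + 1 + k z (W + 1)) + h z (W + 1 + k z (W + 1) + f z (W + 1 + k z (W + 1))) =
    f z (W + k z W) + h z (W + k z W + f z (W + k z W))" by simp
 qed
qed

text \<open>The size of the linearizations on the middle line.\<close>

abbreviation E :: "complex => real" where "E z \<equiv> exp (2 * pi * (Y + 1)) * exp (- (pi * Im (A z)))"

lemma defect_middle:
 assumes z: "z \<in> \<Omega>" and w: "Im w = Im (A z) / 2"
 shows "cmod (f z (w + k z w) + h z (w + k z w + f z (w + k z w))) <= E z"
proof -
 let ?V = "w + k z w"
 have L: "2 * Y + 2 * M + 40 <= Im (A z)" by (rule A_large[OF z])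
 have kb: "cmod (k z w) <= 18 / 1000" by (rule k_bound[OF z]) (use w L M0 Y0 in linarith)
 have V: "Im (A z) / 2 - 18 / 1000 <= Im ?V" "Im ?V <= Im (A z) / 2 + 18 / 1000"
  using Im_close[of ?V w "18 / 1000"] kb w by auto
 have V': "Im ?V < Im (A z) - Y - 1" using V L M0 Y0 by linarith
 have f1: "cmod (f z ?V) <= 4 / 1000 * exp (2 * pi * (Im ?V - Im (A z) + Y))" and f2: "cmod (f z ?V) <= 4 / 1000"
  by (rule f_bound[OF z V'])+
 have W: "Im (A z) / 2 - 22 / 1000 <= Im (?V + f z ?V)"
  using Im_close[of "?V + f z ?V" ?V "4 / 1000"] f2 V by auto
 have W': "Y < Im (?V + f z ?V)" using W L M0 Y0 by linarith
 have h1: "cmod (h z (?V + f z ?V)) <= 2 / 1000 * exp (- (2 * pi * (Im (?V + f z ?V) - Y)))" by (rule h_bound(1)[OF z W'])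
 have Eeq: "E z = exp (2 * pi * (Y + 1 - Im (A z) / 2))"
  by (simp add: exp_add[symmetric] exp_diff[symmetric] algebra_simps)
 have "exp (2 * pi * (Im ?V - Im (A z) + Y)) <= E z"
  unfolding Eeq exp_le_cancel_iff using V by (intro mult_left_mono) auto
 moreover have "exp (2 * pi * (- (Im (?V + f z ?V) - Y))) <= E z"
  unfolding Eeq exp_le_cancel_iff by (rule mult_left_mono) (use W in linarith, simp)
 moreover have "exp (2 * pi * (- (Im (?V + f z ?V) - Y))) = exp (- (2 * pi * (Im (?V + f z ?V) - Y)))" by (simp add: algebra_simps)
 ultimately show ?thesis
  using f1 h1 norm_triangle_ineq[of "f z ?V" "h z (?V + f z ?V)"] exp_gt_zero[of "2 * pi * (Y + 1 - Im (A z) / 2)"] Eeq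
  by linarith
qed

text \<open>
 Away from the middle line the parts of a Laurent splitting are controlled by the function on this
 line.
\<close>

lemma u_small:
 assumes z: "z \<in> \<Omega>" and W: "Im W <= Im (A z) / 2 - 1 / 4"
 shows "cmod (u z W) <= E z"
proof -
 have L: "2 * Y + 2 * M + 40 <= Im (A z)" by (rule A_large[OF z])
 have "Im W < Im (A z) - Y - 2" using W L M0 Y0 by linarith
 from u_lpart[OF z this] show ?thesis
  using lpart_decay(1)[OF per1_defect[OF z], of "Im (A z) / 2" W "E z"] defect_middle[OF z] W L M0 Y0 by simp
qed

lemma k_small:
 assumes z: "z \<in> \<Omega>" and W: "Im (A z) / 2 + 1 / 4 <= Im W"
 shows "cmod (k z W) <= 2 * E z"
proof -
 have L: "2 * Y + 2 * M + 40 <= Im (A z)" by (rule A_large[OF z])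
 have "Y + 2 < Im W" using W L M0 Y0 by linarith
 from k_upart[OF z this] show ?thesis
  using upart_mean(1)[OF per1_defect[OF z], of "Im (A z) / 2" W "E z"] defect_middle[OF z] W L M0 Y0 by simp
qed

lemma exp_E:
 assumes "z \<in> \<Omega>" "x <= y"
 shows "exp (2 * pi * (x - Im (A z))) <= exp (2 * pi * y) * exp (- (pi * Im (A z)))"
proof -
 have "0 <= Im (A z)" using A_large[OF assms(1)] M0 Y0 by linarith
 then have 1: "0 <= pi * Im (A z)" by simp
 have 2: "pi * (2 * x) <= pi * (2 * y)" using assms(2) by (intro mult_left_mono) auto
 have "2 * pi * (x - Im (A z)) = pi * (2 * x) - 2 * (pi * Im (A z))" "2 * pi * y = pi * (2 * y)"
  by (auto simp: algebra_simps)
 with 1 2 have "2 * pi * (x - Im (A z)) <= 2 * pi * y + - (pi * Im (A z))" by linarith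
 then show ?thesis unfolding exp_add[symmetric] exp_le_cancel_iff .
qed

text \<open>
 \<open>Q\<close> and \<open>Qh\<close> are connected by the factorization at the point \<open>W + A'\<close>. Its height is close to
 \<open>Im A\<close>, so \<open>h\<close> and \<open>k\<close> are small there, while \<open>W + f\<close> turns into \<open>Q\<close> by its functional equation. For
 bounded \<open>Im A\<close> there is nothing to show but boundedness.
\<close>

lemma Qh_close:
 assumes "0 <= Z0"
 shows "\<exists>C>0. \<forall>z\<in>\<Omega>. \<forall>W. - Z0 <= Im W --> Im W < - (Y + M + 4) -->
   cmod (Qh z W - (Q z (W - (A z - A' z)) + (A z - A' z))) <= C * exp (- (pi * Im (A z)))"
proof -
 define K where "K = exp (2 * pi * (Y + M + Z0 + 3))"
 \<comment> \<open>if \<open>L \<le> Im (A z)\<close>, then \<open>W + A' z\<close> lies above the middle line and \<open>W\<close> below it\<close>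
 define L where "L = 2 * (Z0 + M + Y + 10)"
 have K0: "0 < K" by (simp add: K_def)
 have main: "cmod (Qh z W - (Q z (W - (A z - A' z)) + (A z - A' z))) <= 8 * (K * exp (- (pi * Im (A z))))"
  if z: "z \<in> \<Omega>" and W: "- Z0 <= Im W" "Im W < - (Y + M + 4)" and big: "L <= Im (A z)" for z W
 proof -
  define e where "e = K * exp (- (pi * Im (A z)))"
  define b where "b = A z - A' z"
  define k' where "k' = k z (W + A' z)"
  define Z where "Z = W + A' z + k'"
  note A'b = A'_bounds[OF z]
  have E: "E z <= e" unfolding e_def K_def using M0 assms by (intro mult_right_mono) auto
  have e0: "0 <= e" unfolding e_def K_def by simp
  have k': "cmod k' <= 2 * e" "cmod k' <= 18 / 1000"
   unfolding k'_def using k_small[OF z, of "W + A' z"] k_bound[OF z, of "W + A' z"] E A'b W big M0 Y0 by (auto simp: L_def)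
  have ImZ: "Im Z <= Im W + Im (A' z) + 18 / 1000" "Im W + Im (A' z) - 18 / 1000 <= Im Z"
   using Im_close[of Z "W + A' z" "18 / 1000"] k' by (auto simp: Z_def)
  have ku': "k' + (f z Z + h z (Z + f z Z)) = u z (W + A' z)"
   unfolding Z_def k'_def using A'b W big M0 Y0 by (intro ku[OF z]) (auto simp: L_def)
  have Zl: "Im Z < Im (A z) - Y - 1" using ImZ A'b W by linarith
  define x where "x = Z - A z + f z (Z - A z)"
  have fe: "Z + f z Z = A z + Q z x" unfolding x_def by (rule f_eq[OF z Zl])
  have ZA: "Im (Z - A z) <= - (Y + 3)" using ImZ A'b W by simp
  have fZA: "Im (Z - A z) < Im (A z) - Y - 1" using ZA A_large[OF z] M0 Y0 by linarith
  have f'': "cmod (f z (Z - A z)) <= e"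
  proof -
   have "cmod (f z (Z - A z)) <= 4 / 1000 * exp (2 * pi * (Im (Z - A z) - Im (A z) + Y))" by (rule f_bound(1)[OF z fZA])
   also have "Im (Z - A z) - Im (A z) + Y = (Im (Z - A z) + Y) - Im (A z)" by simp
   also have "exp (2 * pi * (Im (Z - A z) + Y - Im (A z))) <= e"
    unfolding e_def K_def by (rule exp_E[OF z]) (use ZA M0 Y0 assms in linarith)
   finally show ?thesis using e0 by simp
  qed
  have fZ: "cmod (f z Z) <= 4 / 1000" by (rule f_bound(2)[OF z Zl])
  have ImZf: "Im W + Im (A' z) - 1 <= Im (Z + f z Z)" using Im_close[of "Z + f z Z" Z "4 / 1000"] fZ ImZ by auto
  have "2 * Z0 + 2 * M + 2 * Y + 20 <= Im (A z)" using big by (simp add: L_def)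
  then have "Y < Im W + Im (A' z) - 1" using A'b(1) W(1) M0 Y0 assms by linarith
  then have Zu: "Y < Im (Z + f z Z)" using ImZf by linarith
  have h'': "cmod (h z (Z + f z Z)) <= e"
  proof -
   have "cmod (h z (Z + f z Z)) <= 2 / 1000 * exp (- (2 * pi * (Im (Z + f z Z) - Y)))" by (rule h_bound(1)[OF z Zu])
   also have "- (2 * pi * (Im (Z + f z Z) - Y)) = 2 * pi * ((Y + Im (A z) - Im (Z + f z Z)) - Im (A z))" by (simp add: algebra_simps)
   also have "exp (2 * pi * ((Y + Im (A z) - Im (Z + f z Z)) - Im (A z))) <= e"
    unfolding e_def K_def by (rule exp_E[OF z]) (use ImZf A'b W in linarith)
   finally show ?thesis using e0 by simp
  qed
  have x: "x - (W - b) = k' + f z (Z - A z)" by (simp add: x_def Z_def b_def)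
  have xn: "cmod (x - (W - b)) <= 3 * e" unfolding x using norm_triangle_ineq[of k' "f z (Z - A z)"] k' f'' by linarith
  have fs: "cmod (f z (Z - A z)) <= 4 / 1000" by (rule f_bound(2)[OF z fZA])
  have "Im x <= Im (Z - A z) + 4 / 1000" using Im_close[of x "Z - A z" "4 / 1000"] fs by (simp add: x_def)
  then have xl: "Im x < - Y - 1" using ZA by linarith
  have Wb: "Im (W - b) < - Y - 1" using W A'b by (simp add: b_def)
  have Ql: "cmod (Q z x - Q z (W - b)) <= 6 * e" using Q_lipschitz[OF z xl Wb] xn by linarith
  define V1 where "V1 = W + u z (W + A' z)"
  have V1: "V1 - (Q z (W - b) + b) = (Q z x - Q z (W - b)) + h z (Z + f z Z)"
  proof -
   have aux: "v1 - (qw + (a - a')) = (qx - qw) + hh"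
    if "v1 = w + (k + (ff + hh))" "ff = a + qx - z" "z = w + a' + k"
    for v1 qw a a' qx hh w k ff z :: complex
    using that by (simp add: algebra_simps)
   show ?thesis unfolding b_def
    by (rule aux[OF _ _ Z_def, of _ "f z Z"]) (use ku' fe in \<open>auto simp: V1_def algebra_simps\<close>)
  qed
  have V1n: "cmod (V1 - (Q z (W - b) + b)) <= 7 * e"
   unfolding V1 using norm_triangle_ineq[of "Q z x - Q z (W - b)" "h z (Z + f z Z)"] Ql h'' by linarith
  have q: "Qh z W + u z (Qh z W) = V1" unfolding V1_def using W by (intro Qh_eq z) auto
  have "cmod (Qh z W - W) <= 1 / 4" using pclassD(4)[OF Qh, of z W] z W by simp
  then have "Im (Qh z W) <= Im W + 1 / 4" using Im_close by blast
  then have "Im (Qh z W) <= Im (A z) / 2 - 1 / 4" using W A_large[OF z] M0 Y0 by linarith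
  from u_small[OF z this] have "cmod (u z (Qh z W)) <= e" using E by linarith
  moreover have eq: "Qh z W - (Q z (W - b) + b) = (V1 - (Q z (W - b) + b)) - u z (Qh z W)" using q by (simp add: algebra_simps)
  ultimately have "cmod (Qh z W - (Q z (W - b) + b)) <= 8 * e"
   unfolding eq using norm_triangle_ineq4[of "V1 - (Q z (W - b) + b)" "u z (Qh z W)"] V1n by linarith
  then show ?thesis by (simp add: b_def e_def)
 qed
 have triv: "cmod (Qh z W - (Q z (W - (A z - A' z)) + (A z - A' z))) <= exp (pi * L) * exp (- (pi * Im (A z)))"
  if z: "z \<in> \<Omega>" and W: "Im W < - (Y + M + 4)" and small: "Im (A z) <= L" for z W
 proof -
  have 1: "cmod (Qh z W - W) <= 1 / 4" using pclassD(4)[OF Qh, of z W] z W by simp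
  define x where "x = W - (A z - A' z)"
  have x: "Im x < - Y" using W A'_bounds[OF z] by (simp add: x_def)
  have "exp (2 * pi * (Im x + Y)) <= 1" using x by (simp add: mult_le_0_iff)
  moreover have "(z, x) \<in> lowdom \<Omega> (%_. - Y)" using x z by simp
  ultimately have 2: "cmod (Q z x - x) <= 1 / 4" using pclassD(4)[OF Q, of z x] by linarith
  have eq: "Qh z W - (Q z (W - (A z - A' z)) + (A z - A' z)) = (Qh z W - W) - (Q z x - x)" by (simp add: x_def)
  have "cmod (Qh z W - (Q z (W - (A z - A' z)) + (A z - A' z))) <= 1"
   unfolding eq using 1 2 norm_triangle_ineq4[of "Qh z W - W" "Q z x - x"] by linarith
  also have "1 <= exp (pi * L) * exp (- (pi * Im (A z)))" using small by (simp add: exp_add[symmetric])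
  finally show ?thesis .
 qed
 have "cmod (Qh z W - (Q z (W - (A z - A' z)) + (A z - A' z))) <= (8 * K + exp (pi * L)) * exp (- (pi * Im (A z)))"
  if "z \<in> \<Omega>" "- Z0 <= Im W" "Im W < - (Y + M + 4)" for z W
  by (rule le_add_coeff) (use main[OF that] triv[OF that(1,3)] K0 linear[of L "Im (A z)"] in \<open>auto simp: mult.assoc\<close>)
 then show ?thesis using K0 exp_gt_zero[of "pi * L"] by (intro exI[of _ "8 * K + exp (pi * L)"]) (auto intro: add_pos_pos)
qed

text \<open>
 The same argument at a point of bounded height, where now \<open>f\<close> and \<open>u\<close> are small and the functional
 equation of \<open>W + h\<close> produces \<open>P\<close>.
\<close>

lemma Ph_close:
 assumes "0 <= Z0"
 shows "\<exists>C>0. \<forall>z\<in>\<Omega>. \<forall>W. Im W <= Z0 --> Y + M + 4 < Im W -->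
   cmod (Ph z W - P z W) <= C * exp (- (pi * Im (A z)))"
proof -
 define K where "K = exp (2 * pi * (Y + M + Z0 + 3))"
 \<comment> \<open>if \<open>L \<le> Im (A z)\<close>, then \<open>W + A z\<close> lies above the middle line and \<open>W\<close> below it\<close>
 define L where "L = 2 * (Z0 + M + Y + 10)"
 have K0: "0 < K" by (simp add: K_def)
 have main: "cmod (Ph z W - P z W) <= 12 * (K * exp (- (pi * Im (A z))))"
  if z: "z \<in> \<Omega>" and W: "Im W <= Z0" "Y + M + 4 < Im W" and big: "L <= Im (A z)" for z W
 proof -
  define e where "e = K * exp (- (pi * Im (A z)))"
  define W1 where "W1 = W + k z (W + A z)"
  define V where "V = Ph z W"
  note A'b = A'_bounds[OF z]
  have E: "E z <= e" unfolding e_def K_def using M0 assms by (intro mult_right_mono) auto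
  have e0: "0 <= e" unfolding e_def K_def by simp
  have k1: "cmod (k z (W + A z)) <= 2 * e" "cmod (k z (W + A z)) <= 18 / 1000"
   using k_small[OF z, of "W + A z"] k_bound[OF z, of "W + A z"] E W big M0 Y0 by (auto simp: L_def)
  have W1: "cmod (W1 - W) <= 2 * e" "Im W - 1 <= Im W1" "Im W1 <= Im W + 1"
   using Im_close[of W1 W "18 / 1000"] k1 by (auto simp: W1_def)
  have "cmod (V - W) <= 1 / 4" unfolding V_def using pclassD(4)[OF Ph, of z W] z W by simp
  then have V: "Im W - 1 / 4 <= Im V" "Im V <= Im W + 1 / 4" using Im_close by blast+
  have Veq: "V + k z V = W1" unfolding V_def W1_def by (rule Ph_eq[OF z W(2)])
  have "k z V + (f z (V + k z V) + h z (V + k z V + f z (V + k z V))) = u z V"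
   using V W big M0 Y0 by (intro ku[OF z]) (auto simp: L_def)
  then have "(V + k z V) + (f z (V + k z V) + h z (V + k z V + f z (V + k z V))) = V + u z V" by (simp add: add.assoc)
  then have key: "W1 + f z W1 + h z (W1 + f z W1) = V + u z V" unfolding Veq by (simp add: add.assoc)
  have W1l: "Im W1 < Im (A z) - Y - 1" using W1 W big M0 Y0 by (simp add: L_def)
  have f1: "cmod (f z W1) <= e"
  proof -
   have "cmod (f z W1) <= 4 / 1000 * exp (2 * pi * (Im W1 - Im (A z) + Y))" by (rule f_bound(1)[OF z W1l])
   also have "Im W1 - Im (A z) + Y = (Im W1 + Y) - Im (A z)" by simp
   also have "exp (2 * pi * (Im W1 + Y - Im (A z))) <= e"
    unfolding e_def K_def by (rule exp_E[OF z]) (use W1 W M0 in linarith)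
   finally show ?thesis using e0 by simp
  qed
  define W2 where "W2 = W1 + f z W1"
  have W2: "Im W1 - 4 / 1000 <= Im W2" "Im W2 <= Im W1 + 4 / 1000"
   using Im_close[of W2 W1 "4 / 1000"] f_bound(2)[OF z W1l] by (auto simp: W2_def)
  have W2u: "Y + 1 < Im W2" using W2 W1 W M0 by linarith
  have W2W: "cmod (W2 - W) <= 3 * e"
   using W1(1) f1 norm_triangle_ineq[of "W1 - W" "f z W1"] by (simp add: W2_def algebra_simps)
  have Pl: "cmod (P z W2 - P z W) <= 6 * e"
   using P_lipschitz[OF z W2u, of W] W M0 W2W by simp
  have he: "W2 + h z W2 = P z W2 + h z (P z W2 + A' z)" using W2u by (intro h_eq z) simp
  have "exp (- (2 * pi * (Im W2 - Y))) <= 1" using W2u by simp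
  moreover have "(z, W2) \<in> updom \<Omega> (%_. Y)" using z W2u by simp
  ultimately have "cmod (P z W2 - W2) <= 1" using pclassD(4)[OF P, of z W2] by linarith
  then have P2: "Im W2 - 1 <= Im (P z W2)" using Im_close by blast
  have big': "Im (A z) - M - 1 <= Im (P z W2 + A' z)" using P2 W2u A'b Y0 by simp
  have Pu: "Y < Im (P z W2 + A' z)" using big' A_large[OF z] Y0 M0 by linarith
  have h2: "cmod (h z (P z W2 + A' z)) <= e"
  proof -
   have "cmod (h z (P z W2 + A' z)) <= 2 / 1000 * exp (- (2 * pi * (Im (P z W2 + A' z) - Y)))" by (rule h_bound(1)[OF z Pu])
   also have "- (2 * pi * (Im (P z W2 + A' z) - Y)) = 2 * pi * ((Y + Im (A z) - Im (P z W2 + A' z)) - Im (A z))" by (simp add: algebra_simps)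
   also have "exp (2 * pi * ((Y + Im (A z) - Im (P z W2 + A' z)) - Im (A z))) <= e"
    unfolding e_def K_def by (rule exp_E[OF z]) (use big' assms in linarith)
   finally show ?thesis using e0 by simp
  qed
  have uV: "cmod (u z V) <= e"
  proof -
   have "Im V <= Im (A z) / 2 - 1 / 4" using V W big M0 Y0 by (simp add: L_def)
   from u_small[OF z this] E show ?thesis by linarith
  qed
  have eq: "V - P z W = (P z W2 - P z W) + h z (P z W2 + A' z) - u z V"
   using key he unfolding W2_def by (simp add: algebra_simps)
  have "cmod (V - P z W) <= 12 * e"
   unfolding eq using norm_triangle_ineq4[of "(P z W2 - P z W) + h z (P z W2 + A' z)" "u z V"]
    norm_triangle_ineq[of "P z W2 - P z W" "h z (P z W2 + A' z)"] Pl h2 uV e0 by linarith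
  then show ?thesis by (simp add: V_def e_def)
 qed
 have triv: "cmod (Ph z W - P z W) <= exp (pi * L) * exp (- (pi * Im (A z)))"
  if z: "z \<in> \<Omega>" and W: "Y + M + 4 < Im W" and small: "Im (A z) <= L" for z W
 proof -
  have 1: "cmod (Ph z W - W) <= 1 / 4" using pclassD(4)[OF Ph, of z W] z W by simp
  have "exp (- (2 * pi * (Im W - Y))) <= 1" using W M0 by simp
  moreover have "(z, W) \<in> updom \<Omega> (%_. Y)" using W z M0 by simp
  ultimately have 2: "cmod (P z W - W) <= 1 / 4" using pclassD(4)[OF P, of z W] by linarith
  have "cmod (Ph z W - P z W) <= 1"
   using 1 2 norm_triangle_ineq4[of "Ph z W - W" "P z W - W"] by simp
  also have "1 <= exp (pi * L) * exp (- (pi * Im (A z)))" using small by (simp add: exp_add[symmetric])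
  finally show ?thesis .
 qed
 have "cmod (Ph z W - P z W) <= (12 * K + exp (pi * L)) * exp (- (pi * Im (A z)))"
  if "z \<in> \<Omega>" "Im W <= Z0" "Y + M + 4 < Im W" for z W
  by (rule le_add_coeff) (use main[OF that] triv[OF that(1,3)] K0 linear[of L "Im (A z)"] in \<open>auto simp: mult.assoc\<close>)
 then show ?thesis using K0 exp_gt_zero[of "pi * L"] by (intro exI[of _ "12 * K + exp (pi * L)"]) (auto intro: add_pos_pos)
qed

end

section \<open>Linearizations near the ends\<close>

lemma ev_bot: "(\<forall>\<^sub>F W in filtercomap Im at_bot. R W) \<longleftrightarrow> (\<exists>b. \<forall>W. Im W <= b --> R W)"
proof
 assume "\<forall>\<^sub>F W in filtercomap Im at_bot. R W"
 then obtain T where "eventually T at_bot" "!!W. T (Im W) ==> R W" unfolding eventually_filtercomap by blast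
 then show "\<exists>b. \<forall>W. Im W <= b --> R W" unfolding eventually_at_bot_linorder by blast
next
 assume "\<exists>b. \<forall>W. Im W <= b --> R W"
 then obtain b where "\<forall>W. Im W <= b --> R W" by blast
 then show "\<forall>\<^sub>F W in filtercomap Im at_bot. R W"
  unfolding eventually_filtercomap by (intro exI[of _ "%y. y <= b"]) (auto simp: eventually_le_at_bot)
qed

lemma ev_top: "(\<forall>\<^sub>F W in filtercomap Im at_top. R W) \<longleftrightarrow> (\<exists>b. \<forall>W. b <= Im W --> R W)"
proof
 assume "\<forall>\<^sub>F W in filtercomap Im at_top. R W"
 then obtain T where "eventually T at_top" "!!W. T (Im W) ==> R W" unfolding eventually_filtercomap by blast
 then show "\<exists>b. \<forall>W. b <= Im W --> R W" unfolding eventually_at_top_linorder by blast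
next
 assume "\<exists>b. \<forall>W. b <= Im W --> R W"
 then obtain b where "\<forall>W. b <= Im W --> R W" by blast
 then show "\<forall>\<^sub>F W in filtercomap Im at_top. R W"
  unfolding eventually_filtercomap by (intro exI[of _ "%y. b <= y"]) (auto simp: eventually_ge_at_top)
qed

lemma tendsto_bot: "(g \<longlongrightarrow> (0::complex)) (filtercomap Im at_bot) \<longleftrightarrow> (\<forall>e>0. \<exists>b. \<forall>W. Im W <= b --> cmod (g W) < e)"
 unfolding tendsto_iff ev_bot by simp
lemma tendsto_top: "(g \<longlongrightarrow> (0::complex)) (filtercomap Im at_top) \<longleftrightarrow> (\<forall>e>0. \<exists>b. \<forall>W. b <= Im W --> cmod (g W) < e)"
 unfolding tendsto_iff ev_top by simp

text \<open>Conjugation by the reflection in \<open>c / 2\<close>, which exchanges the two ends of the cylinder.\<close>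

definition flip :: "complex => (complex => complex) => complex => complex" where
 "flip c H W = c - H (c - W)"


lemma flip_periodic: "H (c - (W + 1) + 1) = H (c - (W + 1)) + 1 ==> flip c H (W + 1) = flip c H W + 1"
 by (simp add: flip_def algebra_simps)

lemma tangentD:
 shows "tangent_lower y H ==> H holomorphic_on lower_hp y"
  "tangent_lower y H ==> inj_on H (lower_hp y)"
  "tangent_lower y H ==> Im W < y ==> H (W + 1) = H W + 1"
  "tangent_lower y H ==> ((%W. H W - W) \<longlongrightarrow> 0) (filtercomap Im at_bot)"
  "tangent_upper y H ==> H holomorphic_on upper_hp y"
  "tangent_upper y H ==> inj_on H (upper_hp y)"
  "tangent_upper y H ==> y < Im W ==> H (W + 1) = H W + 1"
  "tangent_upper y H ==> ((%W. H W - W) \<longlongrightarrow> 0) (filtercomap Im at_top)"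
 unfolding tangent_lower_def tangent_upper_def by auto

lemma eq_of_inverse_correction: "q = v + r ==> r = - t ==> q + t = v" for q v r t :: complex
 by simp

lemma tangent_flip:
 shows "tangent_lower y H ==> tangent_upper (Im c - y) (flip c H)"
  "tangent_upper y H ==> tangent_lower (Im c - y) (flip c H)"
proof -
 have hol: "(%W. c - H (c - W)) holomorphic_on T" if "H holomorphic_on S" "!!W. W \<in> T ==> c - W \<in> S" for S T
  by (rule holomorphic_on_diff[OF holomorphic_on_const holomorphic_on_compose_gen[OF _ that(1), of "%W. c - W", unfolded o_def]])
    (use that(2) in \<open>auto intro!: holomorphic_intros\<close>)
 show "tangent_upper (Im c - y) (flip c H)" if H: "tangent_lower y H"
  unfolding tangent_upper_def
 proof (intro conjI ballI)
  show "flip c H holomorphic_on upper_hp (Im c - y)"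
   unfolding flip_def[abs_def] by (rule hol[of "lower_hp y"]) (use H in \<open>auto simp: tangent_lower_def\<close>)
  show "inj_on (flip c H) (upper_hp (Im c - y))"
   using H unfolding tangent_lower_def inj_on_def flip_def by fastforce
  show "flip c H (W + 1) = flip c H W + 1" if "W \<in> upper_hp (Im c - y)" for W
   by (rule flip_periodic, rule tangentD(3)[OF H]) (use that in auto)
  show "((%W. flip c H W - W) \<longlongrightarrow> 0) (filtercomap Im at_top)"
   unfolding tendsto_top
  proof (intro allI impI)
   fix e :: real assume "0 < e"
   then obtain b where b: "!!W. Im W <= b ==> cmod (H W - W) < e"
    using H unfolding tangent_lower_def tendsto_bot by blast
   have "cmod (flip c H W - W) < e" if "Im c - b <= Im W" for W
    using b[of "c - W"] that by (simp add: flip_def norm_minus_commute algebra_simps)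
   then show "\<exists>b. \<forall>W. b <= Im W --> cmod (flip c H W - W) < e" by blast
  qed
 qed
 show "tangent_lower (Im c - y) (flip c H)" if H: "tangent_upper y H"
  unfolding tangent_lower_def
 proof (intro conjI ballI)
  show "flip c H holomorphic_on lower_hp (Im c - y)"
   unfolding flip_def[abs_def] by (rule hol[of "upper_hp y"]) (use H in \<open>auto simp: tangent_upper_def\<close>)
  show "inj_on (flip c H) (lower_hp (Im c - y))"
   using H unfolding tangent_upper_def inj_on_def flip_def by fastforce
  show "flip c H (W + 1) = flip c H W + 1" if "W \<in> lower_hp (Im c - y)" for W
   by (rule flip_periodic, rule tangentD(7)[OF H]) (use that in auto)
  show "((%W. flip c H W - W) \<longlongrightarrow> 0) (filtercomap Im at_bot)"
   unfolding tendsto_bot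
  proof (intro allI impI)
   fix e :: real assume "0 < e"
   then obtain b where b: "!!W. b <= Im W ==> cmod (H W - W) < e"
    using H unfolding tangent_upper_def tendsto_top by blast
   have "cmod (flip c H W - W) < e" if "Im W <= Im c - b" for W
    using b[of "c - W"] that by (simp add: flip_def norm_minus_commute algebra_simps)
   then show "\<exists>b. \<forall>W. Im W <= b --> cmod (flip c H W - W) < e" by blast
  qed
 qed
qed

lemma identity_lower:
 assumes "f holomorphic_on lower_hp y" "g holomorphic_on lower_hp y" "!!W. Im W <= b ==> Im W < y ==> f W = g W" "Im W < y"
 shows "f W = g W"
proof (rule analytic_continuation_open[of "lower_hp (min y b)" "lower_hp y" f g])
 have "\<i> * of_real (min y b - 1) \<in> lower_hp (min y b)" by (simp add: min_def)
 then show "lower_hp (min y b) \<noteq> {}" by blast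
qed (use assms in auto)

lemma identity_upper:
 assumes "f holomorphic_on upper_hp y" "g holomorphic_on upper_hp y" "!!W. b <= Im W ==> y < Im W ==> f W = g W" "y < Im W"
 shows "f W = g W"
proof (rule analytic_continuation_open[of "upper_hp (max y b)" "upper_hp y" f g])
 have "\<i> * of_real (max y b + 1) \<in> upper_hp (max y b)" by (simp add: max_def)
 then show "upper_hp (max y b) \<noteq> {}" by blast
qed (use assms in auto)

context gluing_system
begin

text \<open>
 A linearization that is only known near the end of the cylinder is the constructed one: after
 composition with \<open>W + f\<close> it commutes with the translation by \<open>A\<close>, so its distance to the identity is
 invariant under this translation, and it tends to \<open>0\<close>. The constructed one continues it to a
 domain independent of \<open>H\<close>.
\<close>

lemma std_lower:
 assumes z: "z \<in> \<Omega>" and H: "tangent_lower y H" and eq: "\<forall>\<^sub>F W in filtercomap Im at_bot. H (Q z W + A z) = H W + A z"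
 shows "\<exists>H' y'. tangent_lower y' H' & Im (A z) - Y - 2 <= y' & y <= y' & (\<forall>W. Im W < y --> H' W = H W) \<and>
   (\<forall>W. Im W < Im (A z) - Y - 2 --> cmod (H' W - W) <= 1 / 8 & H' W + f z (H' W) = W)"
proof -
 let ?a = "Im (A z) - Y - 2"
 have L: "40 <= Im (A z)" using A_large[OF z] Y0 M0 by linarith
 have f8: "pclass (lowdom \<Omega> (%z. Im (A z) - Y - 1)) (%_ _. 1 / 8) f"
  unfolding pclass_def using pclassD(1-3)[OF f] f_bound(2) by (force simp: order_trans[of _ "4 / 1000" "1 / 8"])
 have "\<exists>r. pclass (lowdom \<Omega> (%z. Im (A z) - (Y + 2))) (%_ _. 1 / 8) r & (\<forall>z W. (z, W) \<in> lowdom \<Omega> (%z. Im (A z) - (Y + 2)) --> r z W = - f z (W + r z W))"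
  by (rule inverse_near_identity[OF f8 open_low(1)]) (use Im_close in \<open>fastforce+\<close>)
 then obtain r where r: "pclass (lowdom \<Omega> (%z. Im (A z) - (Y + 2))) (%_ _. 1 / 8) r"
  and r_eq0: "!!z W. (z, W) \<in> lowdom \<Omega> (%z. Im (A z) - (Y + 2)) ==> r z W = - f z (W + r z W)" by blast
 define Hs where "Hs W = W + r z W" for W
 have rin: "(z, W) \<in> lowdom \<Omega> (%z. Im (A z) - (Y + 2))" if "Im W < ?a" for W using that z by simp
 have rb: "cmod (Hs W - W) <= 1 / 8" if "Im W < ?a" for W
  using pclassD(4)[OF r rin[OF that]] by (simp add: Hs_def)
 have FHs: "Hs W + f z (Hs W) = W" if "Im W < ?a" for W
 proof -
  have "r z W = - f z (Hs W)" using r_eq0[OF rin[OF that]] by (simp add: Hs_def)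
  then show ?thesis by (rule eq_of_inverse_correction[OF Hs_def])
 qed
 have HsIm: "Im (Hs W) <= Im W + 1 / 8" if "Im W < ?a" for W using Im_close[OF rb[OF that]] by blast
 have ftend: "\<exists>b. \<forall>W. Im W <= b --> cmod (f z W) < e" if e: "0 < e" for e
 proof -
  obtain X where X: "X \<ge> 2 + Y" "exp (- (2 * pi * X)) < e"
   using exp_neg_eventually_small[OF e, of "2 + Y" 1] by auto
  have "cmod (f z W) < e" if W: "Im W <= Im (A z) - Y - X" for W
  proof -
   have "cmod (f z W) <= 4 / 1000 * exp (2 * pi * (Im W - Im (A z) + Y))" using W X Y0 by (intro f_bound(1)[OF z]) auto
   also have "\<dots> <= 1 * exp (- (2 * pi * X))"
   proof (intro mult_mono)
    have "2 * pi * (Im W - Im (A z) + Y) <= 2 * pi * (- X)" using W by (intro mult_left_mono) auto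
    then show "exp (2 * pi * (Im W - Im (A z) + Y)) <= exp (- (2 * pi * X))" by simp
   qed auto
   finally show ?thesis using X by simp
  qed
  then show ?thesis by blast
 qed
 have hHs: "Hs holomorphic_on lower_hp ?a"
  unfolding Hs_def[abs_def] using z
  by (intro holomorphic_intros hol2_holomorphic(2)[OF pclassD(1)[OF r]]) auto
 have tHs: "tangent_lower ?a Hs"
  unfolding tangent_lower_def
 proof (intro conjI ballI hHs)
  show "inj_on Hs (lower_hp ?a)" using FHs by (intro inj_onI) (metis mem_lower_hp)
  show "Hs (W + 1) = Hs W + 1" if "W \<in> lower_hp ?a" for W
   using pclassD(3)[OF r rin[of W]] that by (simp add: Hs_def)
  show "((%W. Hs W - W) \<longlongrightarrow> 0) (filtercomap Im at_bot)"
   unfolding tendsto_bot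
  proof (intro allI impI)
   fix e :: real assume "0 < e"
   then obtain b where b: "!!W. Im W <= b ==> cmod (f z W) < e" using ftend by blast
   have "cmod (Hs W - W) < e" if W: "Im W <= min (b - 1) (?a - 1)" for W
   proof -
    have W': "Im W < ?a" using W by simp
    have "Hs W - W = - f z (Hs W)" using FHs[OF W'] by (simp add: algebra_simps eq_neg_iff_add_eq_0)
    moreover have "cmod (f z (Hs W)) < e" using HsIm[OF W'] W by (intro b) auto
    ultimately show ?thesis by simp
   qed
   then show "\<exists>b. \<forall>W. Im W <= b --> cmod (Hs W - W) < e" by blast
  qed
 qed
 obtain b0 where b0: "!!W. Im W <= b0 ==> H (Q z W + A z) = H W + A z" using eq unfolding ev_bot by blast
 define b1 where "b1 = min b0 (?a - 1)"
 define Er where "Er W = H (W + f z W) - W" for W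
 have fs: "cmod (f z W) <= 4 / 1000" if "Im W <= b1" for W using that by (intro f_bound(2)[OF z]) (auto simp: b1_def)
 have Estep: "Er W = Er (W - A z)" if W: "Im W <= b1" for W
 proof -
  have W': "Im (W - A z) <= b1" using W L by simp
  have "W + f z W = A z + Q z (W - A z + f z (W - A z))" using W by (intro f_eq[OF z]) (auto simp: b1_def)
  moreover have "Im (W - A z + f z (W - A z)) <= b0"
   using Im_close[of "W - A z + f z (W - A z)" "W - A z" "4 / 1000"] fs[OF W'] W L by (auto simp: b1_def)
  ultimately have "H (W + f z W) = H (W - A z + f z (W - A z)) + A z"
   using b0[of "W - A z + f z (W - A z)"] by (simp add: add.commute)
  then show ?thesis by (simp add: Er_def)
 qed
 have En: "Er W = Er (W - of_nat n * A z)" if W: "Im W <= b1" for W n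
 proof (induction n)
  case (Suc n)
  have "Im (W - of_nat n * A z) <= b1"
  proof -
   have "0 <= real n * Im (A z)" using L by simp
   then show ?thesis using W by simp
  qed
  from Estep[OF this] Suc show ?case by (simp add: algebra_simps)
 qed simp
 have E0: "Er W = 0" if W: "Im W <= b1" for W
 proof -
  have "cmod (Er W) <= 0 + e" if e: "0 < e" for e
  proof -
   obtain b where b: "!!W. Im W <= b ==> cmod (f z W) < e / 2" using ftend[of "e / 2"] e by auto
   obtain c where c: "!!W. Im W <= c ==> cmod (H W - W) < e / 2"
    using tangentD(4)[OF H] e unfolding tendsto_bot by (metis half_gt_zero)
   obtain n :: nat where n: "Im W - min b (c - 1) < real n" using reals_Archimedean2 by blast
   define V where "V = W - of_nat n * A z"
   have "real n <= real n * Im (A z)" using L mult_left_mono[of 1 "Im (A z)" "real n"] by simp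
   then have V: "Im V <= b" "Im V <= c - 1" "Im V <= b1" using n W by (auto simp: V_def min_def split: if_splits)
   have fV: "cmod (f z V) <= 4 / 1000" by (rule fs[OF V(3)])
   have "Im (V + f z V) <= c" using Im_close[of "V + f z V" V "4 / 1000"] fV V(2) by simp
   then have "cmod (H (V + f z V) - (V + f z V)) < e / 2" by (rule c)
   moreover have "Er V = (H (V + f z V) - (V + f z V)) + f z V" by (simp add: Er_def)
   ultimately have "cmod (Er V) <= e" using b[OF V(1)] norm_triangle_ineq[of "H (V + f z V) - (V + f z V)" "f z V"] by simp
   moreover have "Er W = Er V" unfolding V_def by (rule En[OF W])
   ultimately show ?thesis by simp
  qed
  then have "cmod (Er W) <= 0" by (rule field_le_epsilon)
  then show ?thesis by simp
 qed
 have deep: "H W = Hs W" if W: "Im W <= b1 - 1" for W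
 proof -
  have a: "Im W < ?a" using W by (auto simp: b1_def)
  have "Im (Hs W) <= b1" using HsIm[OF a] W by simp
  from E0[OF this] show ?thesis using FHs[OF a] by (simp add: Er_def)
 qed
 have agree: "H W = Hs W" if W: "Im W < min y ?a" for W
  by (rule identity_lower[of H "min y ?a" Hs "b1 - 1"])
    (use W deep holomorphic_on_subset[OF tangentD(1)[OF H]] holomorphic_on_subset[OF hHs] in \<open>auto simp: subset_iff\<close>)
 show ?thesis
 proof (cases "?a <= y")
  case True
  then show ?thesis using H rb FHs agree by (intro exI[of _ H] exI[of _ y]) auto
 next
  case False
  then show ?thesis using tHs rb FHs agree by (intro exI[of _ Hs] exI[of _ ?a]) auto
 qed
qed

lemma h_lipschitz:
 assumes "z \<in> \<Omega>" "Y + 1 < Im x" "Y + 1 < Im y"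
 shows "cmod (h z x - h z y) <= 1 / 2 * cmod (x - y)"
proof -
 have "cmod (h z x - h z y) <= 2 / 1000 / 1 * cmod (x - y)"
 proof (rule cauchy_lipschitz[where S = "upper_hp Y" and C = "upper_hp (Y + 1)"])
  show "h z holomorphic_on upper_hp Y" by (rule per1D(1)[OF per1_slices(2)[OF assms(1)]])
  show "cball w 1 \<subseteq> upper_hp Y" if "w \<in> upper_hp (Y + 1)" for w
   using that Im_close[of _ w 1] by (fastforce simp: dist_norm norm_minus_commute)
 qed (use assms h_bound(2)[OF assms(1)] in auto)
 also have "\<dots> <= 1 / 2 * cmod (x - y)" by (intro mult_right_mono) auto
 finally show ?thesis .
qed

lemma std_upper:
 assumes z: "z \<in> \<Omega>" and H: "tangent_upper y H" and eq: "\<forall>\<^sub>F W in filtercomap Im at_top. H (P z W + A' z) = H W + A' z"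
 shows "\<exists>H' y'. tangent_upper y' H' & y' <= Y + 1 & y' <= y & (\<forall>W. y < Im W --> H' W = H W) \<and>
   (\<forall>W. Y + 1 < Im W --> cmod (H' W - W) <= 1 / 8 & H' W = W + h z W)"
proof -
 let ?a = "Y + 1"
 have L: "40 <= Im (A' z)" using A_large[OF z] A'_bounds(1)[OF z] Y0 M0 by linarith
 define Hs where "Hs W = W + h z W" for W
 have hb: "cmod (h z W) <= 2 / 1000" if "Y < Im W" for W using h_bound(2)[OF z that] .
 have htend: "\<exists>b. \<forall>W. b <= Im W --> cmod (h z W) < e" if e: "0 < e" for e
 proof -
  obtain X where X: "X \<ge> 1" "exp (- (2 * pi * X)) < e" using exp_neg_eventually_small[OF e, of 1 1] by auto
  have "cmod (h z W) < e" if W: "Y + X <= Im W" for W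
  proof -
   have "cmod (h z W) <= 2 / 1000 * exp (- (2 * pi * (Im W - Y)))" using W X by (intro h_bound(1)[OF z]) auto
   also have "\<dots> <= 1 * exp (- (2 * pi * X))" using W by (intro mult_mono) auto
   finally show ?thesis using X by simp
  qed
  then show ?thesis by blast
 qed
 have hHs: "Hs holomorphic_on upper_hp ?a"
  unfolding Hs_def[abs_def]
  by (intro holomorphic_intros holomorphic_on_subset[OF per1D(1)[OF per1_slices(2)[OF z]]]) auto
 have tHs: "tangent_upper ?a Hs"
  unfolding tangent_upper_def
 proof (intro conjI ballI hHs)
  show "inj_on Hs (upper_hp ?a)"
  proof (rule inj_onI)
   fix x v assume xv: "x \<in> upper_hp ?a" "v \<in> upper_hp ?a" "Hs x = Hs v"
   have "cmod (h z v - h z x) <= 1 / 2 * cmod (v - x)" using xv by (intro h_lipschitz[OF z]) auto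
   moreover have "h z v - h z x = x - v" using xv(3) by (simp add: Hs_def algebra_simps)
   ultimately have "cmod (x - v) <= 1 / 2 * cmod (x - v)" by (simp add: norm_minus_commute)
   then show "x = v" by simp
  qed
  show "Hs (W + 1) = Hs W + 1" if "W \<in> upper_hp ?a" for W
   using per1D(2)[OF per1_slices(2)[OF z], of W] that by (simp add: Hs_def)
  show "((%W. Hs W - W) \<longlongrightarrow> 0) (filtercomap Im at_top)"
   unfolding tendsto_top using htend by (simp add: Hs_def)
 qed
 obtain b0 where b0: "!!W. b0 <= Im W ==> H (P z W + A' z) = H W + A' z" using eq unfolding ev_top by blast
 define b1 where "b1 = max b0 (?a + 1)"
 define Er where "Er W = H W - Hs W" for W
 define s where "s W = P z W + A' z" for W
 have sIm: "Im W + 1 <= Im (s W)" if W: "b1 <= Im W" for W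
 proof -
  have WY: "Y < Im W" using W by (auto simp: b1_def)
  have "exp (- (2 * pi * (Im W - Y))) <= 1" using WY by simp
  moreover have "cmod (P z W - W) <= 1 / 1000 * exp (- (2 * pi * (Im W - Y)))" using pclassD(4)[OF P, of z W] z WY by simp
  ultimately have "cmod (P z W - W) <= 1" by linarith
  then show ?thesis using Im_close[of "P z W" W 1] L by (simp add: s_def)
 qed
 have Estep: "Er (s W) = Er W" if W: "b1 <= Im W" for W
 proof -
  have "H (s W) = H W + A' z" unfolding s_def using W by (intro b0) (auto simp: b1_def)
  moreover have "Hs (s W) = Hs W + A' z" using h_eq[OF z, of W] W by (simp add: Hs_def s_def b1_def algebra_simps)
  ultimately show ?thesis by (simp add: Er_def)
 qed
 have En: "Er ((s ^^ n) W) = Er W & Im W + real n <= Im ((s ^^ n) W)" if W: "b1 <= Im W" for W n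
 proof (induction n)
  case (Suc n)
  then have "b1 <= Im ((s ^^ n) W)" using W by linarith
  from Estep[OF this] sIm[OF this] Suc show ?case by simp
 qed simp
 have E0: "H W = Hs W" if W: "b1 <= Im W" for W
 proof -
  have "cmod (Er W) <= 0 + e" if e: "0 < e" for e
  proof -
   obtain b where b: "!!W. b <= Im W ==> cmod (h z W) < e / 2" using htend[of "e / 2"] e by auto
   obtain c where c: "!!W. c <= Im W ==> cmod (H W - W) < e / 2"
    using tangentD(8)[OF H] e unfolding tendsto_top by (metis half_gt_zero)
   obtain n :: nat where n: "max b c - Im W < real n" using reals_Archimedean2 by blast
   define V where "V = (s ^^ n) W"
   have V: "b <= Im V" "c <= Im V" using n En[OF W, of n] by (auto simp: V_def)
   have "Er V = (H V - V) - h z V" by (simp add: Er_def Hs_def)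
   then have "cmod (Er V) <= e" using b[OF V(1)] c[OF V(2)] norm_triangle_ineq4[of "H V - V" "h z V"] by simp
   then show ?thesis using En[OF W, of n] by (simp add: V_def)
  qed
  then have "cmod (Er W) <= 0" by (rule field_le_epsilon)
  then show ?thesis by (simp add: Er_def)
 qed
 have agree: "H W = Hs W" if W: "max y ?a < Im W" for W
  by (rule identity_upper[of H "max y ?a" Hs b1])
    (use W E0 holomorphic_on_subset[OF tangentD(5)[OF H]] holomorphic_on_subset[OF hHs] in \<open>auto simp: subset_iff\<close>)
 have hb': "cmod (Hs W - W) <= 1 / 8" if "?a < Im W" for W using hb[of W] that by (simp add: Hs_def)
 show ?thesis
 proof (cases "y <= ?a")
  case True
  then show ?thesis using H hb' agree by (intro exI[of _ H] exI[of _ y]) (auto simp: Hs_def)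
 next
  case False
  then show ?thesis using tHs hb' agree by (intro exI[of _ Hs] exI[of _ ?a]) (auto simp: Hs_def)
 qed
qed

end

section \<open>Moving the gluing strip to the middle\<close>

text \<open>
 The identity of composites at the point \<open>V\<close>, in terms of preimages \<open>w\<close> and \<open>v\<close>. This avoids inverse
 functions whose domains would depend on the four maps.
\<close>

definition linked ::
 "(complex => complex) => (complex => complex) => (complex => complex) => (complex => complex) \<Rightarrow>
  complex set => complex set => complex => complex => bool" where
 "linked Ht0 Hti Hb0 Hbi S S' D V \<longleftrightarrow>
   (\<exists>w v. w \<in> S & v \<in> S' & Ht0 w = V - D & Hbi v = V & Hti w = Hb0 v)"

lemma near_inverse_single:
 assumes H: "H holomorphic_on S" "open S" and n: "!!W. W \<in> S ==> cmod (H W - W) <= 1 / 8"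
  and per: "!!W. W \<in> S ==> W + 1 \<in> S & H (W + 1) = H W + 1"
  and T: "open T" "!!W. W \<in> T ==> W + 1 \<in> T" "!!W v. W \<in> T ==> cmod (v - W) <= 3 / 4 ==> v \<in> S"
 shows "\<exists>R. R holomorphic_on T & (\<forall>W\<in>T. R (W + 1) = R W + 1 & cmod (R W - W) <= 1 / 8 & H (R W) = W)"
proof -
 have S': "hol2 (UNIV \<times> S) (%z W. H W - W)"
  by (rule hol2_diff[OF hol2_holo[OF H(1,2) hol2_snd] hol2_snd]) (use H(2) in \<open>auto intro: open_Times\<close>)
 have c: "pclass (UNIV \<times> S) (%_ _. 1 / 8) (%z W. H W - W)"
  unfolding pclass_def using S' n per by auto
 have "\<exists>r. pclass (UNIV \<times> T) (%_ _. 1 / 8) r & (\<forall>z W. (z, W) \<in> UNIV \<times> T --> r z W = - (H (W + r z W) - (W + r z W)))"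
  by (rule inverse_near_identity[OF c]) (use T in \<open>auto intro: open_Times\<close>)
 then obtain r where r: "pclass (UNIV \<times> T) (%_ _. 1 / 8) r"
  and req: "!!W. W \<in> T ==> r 0 W = - (H (W + r 0 W) - (W + r 0 W))" by blast
 have "H (W + r 0 W) = W" if "W \<in> T" for W using req[OF that] by (simp add: algebra_simps eq_diff_eq)
 moreover have "(%W. W + r 0 W) holomorphic_on T"
  by (intro holomorphic_intros hol2_holomorphic(2)[OF pclassD(1)[OF r]]) auto
 moreover have "W + 1 + r 0 (W + 1) = W + r 0 W + 1" if "W \<in> T" for W using pclassD(3)[OF r, of 0 W] that by simp
 moreover have "cmod (W + r 0 W - W) <= 1 / 8" if "W \<in> T" for W using pclassD(4)[OF r, of 0 W] that by simp
 ultimately show ?thesis by (intro exI[of _ "%W. W + r 0 W"]) auto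
qed

text \<open>The supremum over a line is attained, by periodicity, so a strict inequality on it is uniform.\<close>

lemma line_max:
 assumes g: "g holomorphic_on hstrip a b" "!!W. W \<in> hstrip a b ==> g (W + 1) = g W + 1"
  and y: "a < y" "y < b" and lt: "!!W. Im W = y ==> Im (g W) < c"
 shows "\<exists>M<c. \<forall>W. Im W = y --> Im (g W) <= M"
proof -
 let ?l = "%x::real. complex_of_real x + \<i> * of_real y"
 have per: "per1 (hstrip a b) (%W. g W - W)"
  unfolding per1_def using g by (auto intro!: holomorphic_intros)
 have "continuous_on {0..1} (%x. Im (g (?l x)))"
  by (intro continuous_intros continuous_on_compose2[OF holomorphic_on_imp_continuous_on[OF g(1)]]) (use y in auto)
 then obtain x0 where x0: "x0 \<in> {0..1}" "!!x. x \<in> {0..1} ==> Im (g (?l x)) <= Im (g (?l x0))"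
  using continuous_attains_sup[of "{0..1::real}" "%x. Im (g (?l x))"] by auto
 have "Im (g W) <= Im (g (?l x0))" if W: "Im W = y" for W
 proof -
  define n where "n = - \<lfloor>Re W\<rfloor>"
  have "g (W + of_int n) - (W + of_int n) = g W - W"
   using per1_int[OF per, of W n] W y by simp
  then have "Im (g (W + of_int n)) = Im (g W)" by (simp add: complex_eq_iff)
  moreover have "W + of_int n = ?l (Re W + of_int n)" using W by (simp add: complex_eq_iff)
  moreover have "Re W + of_int n \<in> {0..1}" by (auto simp: n_def) linarith+
  ultimately show ?thesis using x0(2) by metis
 qed
 moreover have "Im (g (?l x0)) < c" by (rule lt) simp
 ultimately show ?thesis by blast
qed

text \<open>
 All four maps are near the identity within \<open>L\<close> of the line \<open>Im W = m\<close>. The identity of composites may be given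
 elsewhere, where the lower maps are defined above \<open>m + L\<close> or the upper maps below \<open>m - L\<close>.
\<close>

locale four_maps =
 fixes Ht0 Hti Hb0 Hbi :: "complex => complex" and yt0 yti yb0 ybi m L :: real
 assumes t: "tangent_lower yt0 Ht0" "tangent_upper yti Hti" "tangent_lower yb0 Hb0" "tangent_upper ybi Hbi"
  and y: "m + L <= yt0" "yti <= m - L" "m + L <= yb0" "ybi <= m - L"
  and near_lower: "!!W. Im W < m + L ==> cmod (Ht0 W - W) <= 1 / 8 & cmod (Hb0 W - W) <= 1 / 8"
  and near_upper: "!!W. m - L < Im W ==> cmod (Hti W - W) <= 1 / 8 & cmod (Hbi W - W) <= 1 / 8"
begin

abbreviation "link \<equiv> linked Ht0 Hti Hb0 Hbi (hstrip yti yt0) (hstrip ybi yb0)"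

text \<open>The identity of composites near the middle line, with preimages \<open>w\<close> and \<open>v\<close> close to \<open>V\<close>.\<close>

definition central :: "complex => bool" where
 "central D \<longleftrightarrow> (\<exists>s. \<bar>s - m\<bar> <= 9 & cmod D <= 1 / 2 & (\<forall>V. s - 1 < Im V --> Im V < s + 1 -->
   (\<exists>w v. Ht0 w = V - D & Hbi v = V & Hti w = Hb0 v & cmod (v - V) <= 1 / 8 & cmod (w - v) <= 1 / 4)))"

text \<open>
 In terms of inverses the identity is \<open>Ht0 \<circ> inv Hti \<circ> Hb0 \<circ> inv Hbi = T_{- D}\<close>. It holds on a strip
 above the middle line and is carried down to this line by analytic continuation. The intermediate
 values stay in the domains of the maps: their imaginary parts are bounded on the two edges of
 the region in between, by the given identity on the upper and closeness to the identity on the lower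
 edge, and thus in it. Near the middle all four maps are within \<open>1 / 8\<close> of the identity, whence
 \<open>cmod D \<le> 1 / 2\<close>.
\<close>

lemma descend:
 assumes L: "12 <= L" and a: "a < b"
  and lk: "!!V. a < Im V ==> Im V < b ==>
    \<exists>w v. w \<in> hstrip yti yt0 & v \<in> hstrip ybi yb0 & m - 1 < Im w & m - 2 < Im v & Ht0 w = V - D & Hbi v = V & Hti w = Hb0 v"
 shows "\<exists>s. s = m - 5 & cmod D <= 1 / 2 & (\<forall>V. s - 2 < Im V --> Im V < s + 2 -->
   (\<exists>w v. Ht0 w = V - D & Hbi v = V & Hti w = Hb0 v & cmod (v - V) <= 1 / 8 & cmod (w - v) <= 1 / 4))"
proof -
 let ?T = "upper_hp (m - L + 1)" and ?S = "upper_hp (m - L)"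
 have cl: "v \<in> ?S" if "W \<in> ?T" "cmod (v - W) <= 3 / 4" for W v using Im_close[OF that(2)] that(1) by auto
 have "\<exists>R. R holomorphic_on ?T & (\<forall>W\<in>?T. R (W + 1) = R W + 1 & cmod (R W - W) <= 1 / 8 & Hbi (R W) = W)"
  by (rule near_inverse_single[where S = ?S])
    (use holomorphic_on_subset[OF tangentD(5)[OF t(4)]] near_upper tangentD(7)[OF t(4)] y(4) cl in \<open>auto simp: subset_iff\<close>)
 then obtain R where R: "R holomorphic_on ?T" and R': "!!W. m - L + 1 < Im W ==> R (W + 1) = R W + 1 & cmod (R W - W) <= 1 / 8 & Hbi (R W) = W"
  by auto
 have "\<exists>S. S holomorphic_on ?T & (\<forall>W\<in>?T. S (W + 1) = S W + 1 & cmod (S W - W) <= 1 / 8 & Hti (S W) = W)"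
  by (rule near_inverse_single[where S = ?S])
    (use holomorphic_on_subset[OF tangentD(5)[OF t(2)]] near_upper tangentD(7)[OF t(2)] y(2) cl in \<open>auto simp: subset_iff\<close>)
 then obtain S where S: "S holomorphic_on ?T" and S': "!!W. m - L + 1 < Im W ==> S (W + 1) = S W + 1 & cmod (S W - W) <= 1 / 8 & Hti (S W) = W"
  by auto
 have RIm: "Im W - 1 / 8 <= Im (R W) & Im (R W) <= Im W + 1 / 8" if "m - L + 1 < Im W" for W
  using R'[OF that] Im_close[of "R W" W "1 / 8"] by auto
 have SIm: "Im W - 1 / 8 <= Im (S W) & Im (S W) <= Im W + 1 / 8" if "m - L + 1 < Im W" for W
  using S'[OF that] Im_close[of "S W" W "1 / 8"] by auto
 have lk': "m - 3 < Im V & R V \<in> hstrip ybi yb0 & Hb0 (R V) \<in> upper_hp (m - 2) & S (Hb0 (R V)) \<in> hstrip yti yt0 \<and>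
   m - 2 < Im (R V) & Ht0 (S (Hb0 (R V))) = V - D" if V: "a < Im V" "Im V < b" for V
 proof -
  obtain w v where wv: "w \<in> hstrip yti yt0" "v \<in> hstrip ybi yb0" "m - 1 < Im w" "m - 2 < Im v" "Ht0 w = V - D" "Hbi v = V" "Hti w = Hb0 v"
   using lk[OF V] by blast
  have "cmod (V - v) <= 1 / 8" using near_upper[of v] wv L by auto
  then have ImV: "m - 3 < Im V" using Im_close[of V v "1 / 8"] wv(4) by auto
  then have VT: "m - L + 1 < Im V" using L by linarith
  have "R V = v"
  proof (rule inj_onD[OF tangentD(6)[OF t(4)]])
   show "Hbi (R V) = Hbi v" using R'[OF VT] wv(6) by simp
   show "R V \<in> upper_hp ybi" using RIm[OF VT] ImV y(4) L by auto
  qed (use wv in auto)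
  have "cmod (Hti w - w) <= 1 / 8" using near_upper[of w] wv(3) L by auto
  then have Z: "m - 2 < Im (Hti w)" using Im_close[of "Hti w" w "1 / 8"] wv(3) by auto
  then have ZT: "m - L + 1 < Im (Hti w)" using L by linarith
  have "S (Hti w) = w"
  proof (rule inj_onD[OF tangentD(6)[OF t(2)]])
   show "Hti (S (Hti w)) = Hti w" using S'[OF ZT] by simp
   show "S (Hti w) \<in> upper_hp yti" using SIm[OF ZT] Z y(2) L by auto
  qed (use wv in auto)
  then show ?thesis using ImV \<open>R V = v\<close> wv Z by auto
 qed
 have am: "m - 3 <= a"
 proof (rule ccontr)
  assume "\<not> m - 3 <= a"
  define V where "V = \<i> * of_real ((a + min b (m - 3)) / 2)"
  have "a < Im V" "Im V < b" "Im V < m - 3" using a \<open>\<not> m - 3 \<le> a\<close> by (auto simp: V_def min_def)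
  with lk' show False by force
 qed
 define y1 where "y1 = (a + b) / 2"
 have y1: "a < y1" "y1 < b" using a by (auto simp: y1_def)
 let ?U = "hstrip (m - 8) b"
 have UT: "m - L + 1 < Im V" if "V \<in> ?U" for V using that L by auto
 have RU: "R holomorphic_on ?U" by (rule holomorphic_on_subset[OF R]) (use UT in auto)
 obtain M0 where M0: "M0 < yb0" "!!W. Im W = y1 ==> Im (R W) <= M0"
  using line_max[OF RU, of y1 yb0] R' UT y1 am lk' by force
 have Rb: "Im (R V) < yb0" if V: "V \<in> ?U" for V
 proof -
  consider "Im V <= m - 7" | "m - 7 <= Im V" "Im V <= y1" | "y1 < Im V" by linarith
  then show ?thesis
  proof cases
   case 1 then show ?thesis using RIm[OF UT[OF V]] y(3) L by linarith
  next
   case 2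
   have "Im (R V) <= max M0 (m - 6)"
   proof (rule strip_Im_bounds(1)[OF RU _ _ _ _ 2])
    show "Im (R w) <= max M0 (m - 6)" if "Im w = m - 7 \<or> Im w = y1" for w
     using that M0(2)[of w] RIm[of w] L by (auto simp: le_max_iff_disj)
   qed (use R' UT y1 am in auto)
   then show ?thesis using M0(1) y(3) L by linarith
  next
   case 3 then show ?thesis using lk'[of V] V y1 by auto
  qed
 qed
 define Z where "Z V = Hb0 (R V)" for V
 have ZU: "Z holomorphic_on ?U"
  unfolding Z_def[abs_def]
  by (rule holomorphic_on_compose_gen[OF RU tangentD(1)[OF t(3)], unfolded o_def]) (use Rb in auto)
 have Zper: "Z (V + 1) = Z V + 1" if "V \<in> ?U" for V
  using R'[OF UT[OF that]] tangentD(3)[OF t(3) Rb[OF that]] by (simp add: Z_def)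
 have Zlow: "cmod (Z V - R V) <= 1 / 8 & Im V - 1 / 4 <= Im (Z V) & Im (Z V) <= Im V + 1 / 4" if "V \<in> ?U" "Im V <= m - 3" for V
 proof -
  have "Im (R V) < m + L" using RIm[OF UT[OF that(1)]] that(2) L by linarith
  then have "cmod (Z V - R V) <= 1 / 8" using near_lower by (auto simp: Z_def)
  then show ?thesis using Im_close[of "Z V" "R V" "1 / 8"] RIm[OF UT[OF that(1)]] by auto
 qed
 have Zb: "m - 9 < Im (Z V)" if V: "V \<in> ?U" for V
 proof -
  consider "Im V <= m - 7" | "m - 7 <= Im V" "Im V <= y1" | "y1 < Im V" by linarith
  then show ?thesis
  proof cases
   case 1 then show ?thesis using Zlow[OF V] V by auto
  next
   case 2
   have "m - 8 <= Im (Z V)"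
   proof (rule strip_Im_bounds(2)[OF ZU Zper _ _ _ 2])
    show "m - 8 <= Im (Z w)" if "Im w = m - 7 \<or> Im w = y1" for w
     using that
    proof
     assume "Im w = m - 7" then show ?thesis using Zlow[of w] y1 am by auto
    next
     assume "Im w = y1" then show ?thesis using lk'[of w] y1 by (auto simp: Z_def)
    qed
   qed (use y1 am in auto)
   then show ?thesis by linarith
  next
   case 3 then show ?thesis using lk'[of V] V y1 by (auto simp: Z_def)
  qed
 qed
 have ZT: "m - L + 1 < Im (Z V)" if "V \<in> ?U" for V using Zb[OF that] L by linarith
 define \<theta> where "\<theta> V = S (Z V)" for V
 have tU: "\<theta> holomorphic_on ?U"
  unfolding \<theta>_def[abs_def]
  by (rule holomorphic_on_compose_gen[OF ZU S, unfolded o_def]) (use ZT in auto)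
 have tper: "\<theta> (V + 1) = \<theta> V + 1" if "V \<in> ?U" for V
  using Zper[OF that] S'[OF ZT[OF that]] by (simp add: \<theta>_def)
 have tlow: "Im (\<theta> V) <= Im V + 1 / 2" if "V \<in> ?U" "Im V <= m - 3" for V
  using SIm[OF ZT[OF that(1)]] Zlow[OF that] by (auto simp: \<theta>_def)
 have "\<exists>M<yt0. \<forall>W. Im W = y1 --> Im (\<theta> W) <= M"
  by (rule line_max[OF tU tper]) (use lk' y1 am in \<open>auto simp: \<theta>_def Z_def\<close>)
 then obtain M1 where M1: "M1 < yt0" "!!W. Im W = y1 ==> Im (\<theta> W) <= M1" by blast
 have tb: "Im (\<theta> V) < yt0" if V: "V \<in> ?U" for V
 proof -
  consider "Im V <= m - 7" | "m - 7 <= Im V" "Im V <= y1" | "y1 < Im V" by linarith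
  then show ?thesis
  proof cases
   case 1 then show ?thesis using tlow[OF V] y(1) L by linarith
  next
   case 2
   have "Im (\<theta> V) <= max M1 (m - 6)"
   proof (rule strip_Im_bounds(1)[OF tU tper _ _ _ 2])
    show "Im (\<theta> w) <= max M1 (m - 6)" if "Im w = m - 7 \<or> Im w = y1" for w
     using that
    proof
     assume "Im w = m - 7" then show ?thesis using tlow[of w] y1 am by auto
    next
     assume "Im w = y1" then show ?thesis using M1(2)[of w] by auto
    qed
   qed (use y1 am in auto)
   then show ?thesis using M1(1) y(1) L by linarith
  next
   case 3 then show ?thesis using lk'[of V] V y1 by (auto simp: \<theta>_def Z_def)
  qed
 qed
 have key: "Ht0 (\<theta> V) = V - D" if V: "V \<in> ?U" for V
 proof (rule analytic_continuation_open[of "hstrip a b" ?U "%V. Ht0 (\<theta> V)" "%V. V - D"])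
  have "\<i> * of_real y1 \<in> hstrip a b" using y1 by auto
  then show "hstrip a b \<noteq> {}" by blast
  show "(%V. Ht0 (\<theta> V)) holomorphic_on ?U"
   by (rule holomorphic_on_compose_gen[OF tU tangentD(1)[OF t(1)], unfolded o_def]) (use tb in auto)
  show "Ht0 (\<theta> V) = V - D" if "V \<in> hstrip a b" for V using lk'[of V] that by (auto simp: \<theta>_def Z_def)
 qed (use am V in \<open>auto intro!: holomorphic_intros\<close>)
 have res: "Ht0 (\<theta> V) = V - D & Hbi (R V) = V & Hti (\<theta> V) = Hb0 (R V) & cmod (R V - V) <= 1 / 8 & cmod (\<theta> V - R V) <= 1 / 4 & cmod D <= 1 / 2"
  if V: "m - 7 < Im V" "Im V < m - 3" for V
 proof -
  have VU: "V \<in> ?U" using V am a by auto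
  have 1: "cmod (Z V - R V) <= 1 / 8" using Zlow[OF VU] V by simp
  have 2: "cmod (\<theta> V - Z V) <= 1 / 8" "Hti (\<theta> V) = Z V" using S'[OF ZT[OF VU]] by (auto simp: \<theta>_def)
  have 3: "cmod (R V - V) <= 1 / 8" "Hbi (R V) = V" using R'[OF UT[OF VU]] by auto
  have 4: "cmod (\<theta> V - R V) <= 1 / 4" using norm_triangle_ineq[of "\<theta> V - Z V" "Z V - R V"] 1 2 by simp
  have "Im (\<theta> V) < m + L" using tlow[OF VU] V L by simp
  then have 5: "cmod (Ht0 (\<theta> V) - \<theta> V) <= 1 / 8" using near_lower by blast
  have D: "D = - ((Ht0 (\<theta> V) - \<theta> V) + (\<theta> V - R V) + (R V - V))" using key[OF VU] by simp
  have "cmod D <= 1 / 2"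
   unfolding D norm_minus_cancel
   using norm_triangle_ineq[of "(Ht0 (\<theta> V) - \<theta> V) + (\<theta> V - R V)" "R V - V"]
    norm_triangle_ineq[of "Ht0 (\<theta> V) - \<theta> V" "\<theta> V - R V"] 3 4 5 by linarith
  with key[OF VU] 2 3 4 show ?thesis by (simp add: Z_def)
 qed
 have "cmod D <= 1 / 2" using res[of "\<i> * of_real (m - 5)"] by simp
 moreover have "\<exists>w v. Ht0 w = V - D & Hbi v = V & Hti w = Hb0 v & cmod (v - V) <= 1 / 8 & cmod (w - v) <= 1 / 4"
  if "(m - 5) - 2 < Im V" "Im V < (m - 5) + 2" for V
  by (rule exI[of _ "\<theta> V"], rule exI[of _ "R V"]) (use res[of V] that in auto)
 ultimately show ?thesis by blast
qed

end

lemma four_maps_flip: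
 assumes "four_maps Ht0 Hti Hb0 Hbi yt0 yti yb0 ybi m L" "L' <= L - \<bar>m' + m\<bar>"
 shows "four_maps (flip 0 Hbi) (flip 0 Hb0) (flip 0 Hti) (flip 0 Ht0) (- ybi) (- yb0) (- yti) (- yt0) m' L'"
proof -
 interpret four_maps Ht0 Hti Hb0 Hbi yt0 yti yb0 ybi m L by fact
 have n: "cmod (flip 0 H W - W) = cmod (H (- W) - (- W))" for H W
 proof -
  have "flip 0 H W - W = - (H (- W) - - W)" by (simp add: flip_def)
  then show ?thesis by (metis norm_minus_cancel)
 qed
 have d: "m - L <= - m' - L'" "- m' + L' <= m + L"
  using assms(2) abs_ge_self[of "m' + m"] abs_ge_minus_self[of "m' + m"] by linarith+
 show ?thesis
 proof unfold_locales
  show "tangent_lower (- ybi) (flip 0 Hbi)" "tangent_lower (- yti) (flip 0 Hti)"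
   using tangent_flip(2)[OF t(4), of 0] tangent_flip(2)[OF t(2), of 0] by auto
  show "tangent_upper (- yb0) (flip 0 Hb0)" "tangent_upper (- yt0) (flip 0 Ht0)"
   using tangent_flip(1)[OF t(3), of 0] tangent_flip(1)[OF t(1), of 0] by auto
  show "cmod (flip 0 Hbi W - W) <= 1 / 8 & cmod (flip 0 Hti W - W) <= 1 / 8" if "Im W < m' + L'" for W
   unfolding n using near_upper[of "- W"] that d by auto
  show "cmod (flip 0 Hb0 W - W) <= 1 / 8 & cmod (flip 0 Ht0 W - W) <= 1 / 8" if "m' - L' < Im W" for W
   unfolding n using near_lower[of "- W"] that d by auto
 qed (use y d in auto)
qed

context four_maps
begin

text \<open>
 A strip that reaches above the middle line is moved down. One that lies below it becomes a strip
 above by reflection.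
\<close>

lemma centre:
 assumes L: "16 <= L" and y12: "y1 < y2" and lk: "!!W. y1 < Im W ==> Im W < y2 ==> link D (W + D)"
 shows "central D"
proof -
 have lk1: "\<exists>w v. w \<in> hstrip yti yt0 & v \<in> hstrip ybi yb0 & Ht0 w = W & Hbi v = W + D & Hti w = Hb0 v"
  if "y1 < Im W" "Im W < y2" for W
  using lk[OF that] unfolding linked_def by simp
 show ?thesis
 proof (cases "m < y2")
  case True
  define a where "a = max y1 m"
  have a: "a + Im D < y2 + Im D" using True y12 by (auto simp: a_def)
  have "\<exists>s. s = m - 5 & cmod D <= 1 / 2 & (\<forall>V. s - 2 < Im V --> Im V < s + 2 -->
   (\<exists>w v. Ht0 w = V - D & Hbi v = V & Hti w = Hb0 v & cmod (v - V) <= 1 / 8 & cmod (w - v) <= 1 / 4))"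
  proof (rule descend[OF _ a])
   fix V assume V: "a + Im D < Im V" "Im V < y2 + Im D"
   then obtain w v where wv: "w \<in> hstrip yti yt0" "v \<in> hstrip ybi yb0" "Ht0 w = V - D" "Hbi v = V" "Hti w = Hb0 v"
   proof -
    have "y1 < Im (V - D)" "Im (V - D) < y2" using V by (auto simp: a_def max_def split: if_splits)
    from lk1[OF this] show ?thesis using that by auto
   qed
   have W: "m < Im (Ht0 w)" using V wv by (auto simp: a_def)
   have w: "m - 1 < Im w"
   proof (rule ccontr)
    assume *: "\<not> m - 1 < Im w"
    then have "cmod (Ht0 w - w) <= 1 / 8" using near_lower[of w] L by auto
    then show False using Im_close[of "Ht0 w" w "1 / 8"] W * by auto
   qed
   have "cmod (Hti w - w) <= 1 / 8" using near_upper[of w] w L by auto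
   then have Z: "m - 9 / 8 < Im (Hb0 v)" using Im_close[of "Hti w" w "1 / 8"] w wv by auto
   have "m - 2 < Im v"
   proof (rule ccontr)
    assume *: "\<not> m - 2 < Im v"
    then have "cmod (Hb0 v - v) <= 1 / 8" using near_lower[of v] L by auto
    then show False using Im_close[of "Hb0 v" v "1 / 8"] Z * by auto
   qed
   with w wv show "\<exists>w v. w \<in> hstrip yti yt0 & v \<in> hstrip ybi yb0 & m - 1 < Im w & m - 2 < Im v & Ht0 w = V - D & Hbi v = V & Hti w = Hb0 v"
    by blast
  qed (use L in auto)
  then show ?thesis unfolding central_def by (intro exI[of _ "m - 5"]) auto
 next
  case False
  have cl: "v \<in> lower_hp (m + L)" if "W \<in> lower_hp (m + L - 1)" "cmod (v - W) <= 3 / 4" for W v using Im_close[OF that(2)] that(1) by auto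
  have clu: "v \<in> upper_hp (m - L)" if "W \<in> upper_hp (m - L + 1)" "cmod (v - W) <= 3 / 4" for W v using Im_close[OF that(2)] that(1) by auto
  have "\<exists>R. R holomorphic_on lower_hp (m + L - 1) & (\<forall>W\<in>lower_hp (m + L - 1). R (W + 1) = R W + 1 & cmod (R W - W) <= 1 / 8 & Ht0 (R W) = W)"
   by (rule near_inverse_single[where S = "lower_hp (m + L)"])
     (use holomorphic_on_subset[OF tangentD(1)[OF t(1)]] near_lower tangentD(3)[OF t(1)] y(1) cl in \<open>auto simp: subset_iff\<close>)
  then obtain R1 where "\<forall>W\<in>lower_hp (m + L - 1). R1 (W + 1) = R1 W + 1 & cmod (R1 W - W) <= 1 / 8 & Ht0 (R1 W) = W" by blast
  then have R1: "cmod (R1 W - W) <= 1 / 8 & Ht0 (R1 W) = W" if "Im W < m + L - 1" for W using that by auto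
  have "\<exists>R. R holomorphic_on lower_hp (m + L - 1) & (\<forall>W\<in>lower_hp (m + L - 1). R (W + 1) = R W + 1 & cmod (R W - W) <= 1 / 8 & Hb0 (R W) = W)"
   by (rule near_inverse_single[where S = "lower_hp (m + L)"])
     (use holomorphic_on_subset[OF tangentD(1)[OF t(3)]] near_lower tangentD(3)[OF t(3)] y(3) cl in \<open>auto simp: subset_iff\<close>)
  then obtain R2 where "\<forall>W\<in>lower_hp (m + L - 1). R2 (W + 1) = R2 W + 1 & cmod (R2 W - W) <= 1 / 8 & Hb0 (R2 W) = W" by blast
  then have R2: "cmod (R2 W - W) <= 1 / 8 & Hb0 (R2 W) = W" if "Im W < m + L - 1" for W using that by auto
  have "\<exists>R. R holomorphic_on upper_hp (m - L + 1) & (\<forall>W\<in>upper_hp (m - L + 1). R (W + 1) = R W + 1 & cmod (R W - W) <= 1 / 8 & Hti (R W) = W)"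
   by (rule near_inverse_single[where S = "upper_hp (m - L)"])
     (use holomorphic_on_subset[OF tangentD(5)[OF t(2)]] near_upper tangentD(7)[OF t(2)] y(2) clu in \<open>auto simp: subset_iff\<close>)
  then obtain R3 where "\<forall>W\<in>upper_hp (m - L + 1). R3 (W + 1) = R3 W + 1 & cmod (R3 W - W) <= 1 / 8 & Hti (R3 W) = W" by blast
  then have R3: "cmod (R3 W - W) <= 1 / 8 & Hti (R3 W) = W" if "m - L + 1 < Im W" for W using that by auto
  let ?m = "- (m + 3)"
  interpret F: four_maps "flip 0 Hbi" "flip 0 Hb0" "flip 0 Hti" "flip 0 Ht0" "- ybi" "- yb0" "- yti" "- yt0" ?m "L - 3"
   by (rule four_maps_flip[OF four_maps_axioms]) auto
  have y12': "- y2 < - y1" using y12 by simp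
  have "\<exists>s. s = ?m - 5 & cmod D <= 1 / 2 & (\<forall>V. s - 2 < Im V --> Im V < s + 2 -->
   (\<exists>w v. flip 0 Hbi w = V - D & flip 0 Ht0 v = V & flip 0 Hb0 w = flip 0 Hti v & cmod (v - V) <= 1 / 8 & cmod (w - v) <= 1 / 4))"
  proof (rule F.descend[OF _ y12'])
   fix V assume V: "- y2 < Im V" "Im V < - y1"
   then obtain w v where wv: "w \<in> hstrip yti yt0" "v \<in> hstrip ybi yb0" "Ht0 w = - V" "Hbi v = - V + D" "Hti w = Hb0 v"
    using lk1[of "- V"] by auto
   have Vm: "Im (- V) < m" using V False by auto
   have "R1 (- V) = w"
   proof (rule inj_onD[OF tangentD(2)[OF t(1)]])
    show "Ht0 (R1 (- V)) = Ht0 w" using R1[of "- V"] Vm wv L by auto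
    show "R1 (- V) \<in> lower_hp yt0" using R1[of "- V"] Im_close[of "R1 (- V)" "- V" "1 / 8"] Vm L y by auto
   qed (use wv in auto)
   then have w: "Im w <= m + 1 / 8" using R1[of "- V"] Im_close[of "R1 (- V)" "- V" "1 / 8"] Vm L by auto
   have Z: "Im (Hti w) < m + 3"
   proof (rule ccontr)
    assume *: "\<not> Im (Hti w) < m + 3"
    have "R3 (Hti w) = w"
    proof (rule inj_onD[OF tangentD(6)[OF t(2)]])
     show "Hti (R3 (Hti w)) = Hti w" using R3[of "Hti w"] * L by auto
     show "R3 (Hti w) \<in> upper_hp yti" using R3[of "Hti w"] Im_close[of "R3 (Hti w)" "Hti w" "1 / 8"] * L y by auto
    qed (use wv in auto)
    then show False using R3[of "Hti w"] Im_close[of "R3 (Hti w)" "Hti w" "1 / 8"] * L w by auto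
   qed
   have "R2 (Hti w) = v"
   proof (rule inj_onD[OF tangentD(2)[OF t(3)]])
    show "Hb0 (R2 (Hti w)) = Hb0 v" using R2[of "Hti w"] Z wv L by auto
    show "R2 (Hti w) \<in> lower_hp yb0" using R2[of "Hti w"] Im_close[of "R2 (Hti w)" "Hti w" "1 / 8"] Z L y by auto
   qed (use wv in auto)
   then have v: "Im v <= m + 3 + 1 / 8" using R2[of "Hti w"] Im_close[of "R2 (Hti w)" "Hti w" "1 / 8"] Z L by auto
   show "\<exists>w v. w \<in> hstrip (- yb0) (- ybi) & v \<in> hstrip (- yt0) (- yti) & ?m - 1 < Im w & ?m - 2 < Im v \<and>
     flip 0 Hbi w = V - D & flip 0 Ht0 v = V & flip 0 Hb0 w = flip 0 Hti v"
    by (rule exI[of _ "- v"], rule exI[of _ "- w"]) (use wv w v in \<open>auto simp: flip_def\<close>)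
  qed (use L in auto)
  then have D: "cmod D <= 1 / 2" and lkF: "!!V. ?m - 7 < Im V ==> Im V < ?m - 3 ==>
   \<exists>w v. flip 0 Hbi w = V - D & flip 0 Ht0 v = V & flip 0 Hb0 w = flip 0 Hti v & cmod (v - V) <= 1 / 8 & cmod (w - v) <= 1 / 4"
   by auto
  have ImD: "\<bar>Im D\<bar> <= 1 / 2" using D abs_Im_le_cmod[of D] by linarith
  have "\<exists>w v. Ht0 w = V - D & Hbi v = V & Hti w = Hb0 v & cmod (v - V) <= 1 / 8 & cmod (w - v) <= 1 / 4"
   if V: "m + 8 - 1 < Im V" "Im V < m + 8 + 1" for V
  proof -
   obtain w v where wv: "flip 0 Hbi w = (D - V) - D" "flip 0 Ht0 v = D - V" "flip 0 Hb0 w = flip 0 Hti v" "cmod (v - (D - V)) <= 1 / 8" "cmod (w - v) <= 1 / 4"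
   proof -
    have "?m - 7 < Im (D - V)" "Im (D - V) < ?m - 3" using V ImD by (auto simp: abs_le_iff)
    from lkF[OF this] show ?thesis using that by blast
   qed
   have Iv: "Im (D - V) - 1 / 8 <= Im v" "Im v <= Im (D - V) + 1 / 8" using Im_close[OF wv(4)] by auto
   have Iw: "Im v - 1 / 4 <= Im w" "Im w <= Im v + 1 / 4" using Im_close[OF wv(5)] by auto
   have "m - L < Im (- w)" using Iv Iw V ImD L by (simp add: abs_le_iff)
   then have "cmod (Hbi (- w) - (- w)) <= 1 / 8" using near_upper by blast
   moreover have "Hbi (- w) = V" using wv(1) by (simp add: flip_def)
   ultimately have "cmod (- w - V) <= 1 / 8" by (simp add: norm_minus_commute)
   moreover have "Ht0 (- v) = V - D" using wv(2) by (simp add: flip_def minus_equation_iff eq_commute[of "D - V"] algebra_simps)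
   moreover have "Hti (- v) = Hb0 (- w)" using wv(3) by (simp add: flip_def)
   moreover have "cmod (- v - - w) <= 1 / 4" using wv(5) by simp
   ultimately show ?thesis using \<open>Hbi (- w) = V\<close> by blast
  qed
  then show ?thesis unfolding central_def using D by (intro exI[of _ "m + 8"]) auto
 qed
qed

end

section \<open>Uniqueness of the glued pair\<close>

text \<open>
 The compatibility condition for abstract pairs \<open>(Q, P)\<close> and \<open>(Qg, Pg)\<close>, all normalized to be tangent to
 the identity.
\<close>

definition glued ::
 "complex => complex => (complex => complex) => (complex => complex) => (complex => complex) => (complex => complex) => bool" where
 "glued A A' Q P Qg Pg \<longleftrightarrow> (\<exists>Ht0 Hti Hb0 Hbi yt0 yti yb0 ybi D y1 y2.
   tangent_lower yt0 Ht0 & tangent_upper yti Hti & tangent_lower yb0 Hb0 & tangent_upper ybi Hbi \<and>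
   (\<forall>\<^sub>F W in filtercomap Im at_bot. Ht0 (Q W + A) = Ht0 W + A) \<and>
   (\<forall>\<^sub>F W in filtercomap Im at_top. Hti (P W + A') = Hti W + A') \<and>
   (\<forall>\<^sub>F W in filtercomap Im at_bot. Hb0 (Qg (W - A')) = Hb0 W - A') \<and>
   (\<forall>\<^sub>F W in filtercomap Im at_top. Hbi (Pg (W - A)) = Hbi W - A) \<and>
   y1 < y2 & (\<forall>W. y1 < Im W --> Im W < y2 --> linked Ht0 Hti Hb0 Hbi (hstrip yti yt0) (hstrip ybi yb0) D (W + D)))"

text \<open>
 Reflection exchanges the ends of the cylinder, hence also the two pairs: the second pair, reflected, is
 the given one in the reflected condition. The translations by \<open>A - A'\<close> restore its form.
\<close>

lemma glued_flip:
 assumes "glued A A' Q P Qg Pg"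
 shows "glued A A' (%W. - Pg (- W - (A - A')) - (A - A')) (flip 0 Qg) (flip 0 P) (%W. - Q (- W - (A - A')) - (A - A'))"
proof -
 obtain Ht0 Hti Hb0 Hbi yt0 yti yb0 ybi D y1 y2 where
  t: "tangent_lower yt0 Ht0" "tangent_upper yti Hti" "tangent_lower yb0 Hb0" "tangent_upper ybi Hbi"
  and eq: "\<forall>\<^sub>F W in filtercomap Im at_bot. Ht0 (Q W + A) = Ht0 W + A"
   "\<forall>\<^sub>F W in filtercomap Im at_top. Hti (P W + A') = Hti W + A'"
   "\<forall>\<^sub>F W in filtercomap Im at_bot. Hb0 (Qg (W - A')) = Hb0 W - A'"
   "\<forall>\<^sub>F W in filtercomap Im at_top. Hbi (Pg (W - A)) = Hbi W - A"
  and y: "y1 < y2" and lk: "!!W. y1 < Im W ==> Im W < y2 ==> linked Ht0 Hti Hb0 Hbi (hstrip yti yt0) (hstrip ybi yb0) D (W + D)"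
  using assms unfolding glued_def by blast
 obtain b1 b2 b3 b4 where b: "!!W. Im W <= b1 ==> Ht0 (Q W + A) = Ht0 W + A" "!!W. b2 <= Im W ==> Hti (P W + A') = Hti W + A'"
   "!!W. Im W <= b3 ==> Hb0 (Qg (W - A')) = Hb0 W - A'" "!!W. b4 <= Im W ==> Hbi (Pg (W - A)) = Hbi W - A"
  using eq unfolding ev_bot ev_top by metis
 let ?x = "Im A'"
 note F = tangent_flip[where c = A']
 show ?thesis
  unfolding glued_def
 proof (rule exI[of _ "flip A' Hbi"], rule exI[of _ "flip A' Hb0"], rule exI[of _ "flip A' Hti"], rule exI[of _ "flip A' Ht0"],
   rule exI[of _ "?x - ybi"], rule exI[of _ "?x - yb0"], rule exI[of _ "?x - yti"], rule exI[of _ "?x - yt0"],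
   rule exI[of _ D], rule exI[of _ "?x - y2 - Im D"], rule exI[of _ "?x - y1 - Im D"], intro conjI)
  show "tangent_lower (?x - ybi) (flip A' Hbi)" "tangent_upper (?x - yb0) (flip A' Hb0)"
   "tangent_lower (?x - yti) (flip A' Hti)" "tangent_upper (?x - yt0) (flip A' Ht0)"
   using F t by auto
  show "\<forall>\<^sub>F W in filtercomap Im at_bot. flip A' Hbi (- Pg (- W - (A - A')) - (A - A') + A) = flip A' Hbi W + A"
   unfolding ev_bot
  proof (intro exI[of _ "?x - b4"] allI impI)
   fix W assume "Im W <= ?x - b4"
   then have "Hbi (Pg (A' - W - A)) = Hbi (A' - W) - A" by (intro b(4)) auto
   then show "flip A' Hbi (- Pg (- W - (A - A')) - (A - A') + A) = flip A' Hbi W + A"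
    by (simp add: flip_def algebra_simps)
  qed
  show "\<forall>\<^sub>F W in filtercomap Im at_top. flip A' Hb0 (flip 0 Qg W + A') = flip A' Hb0 W + A'"
   unfolding ev_top
  proof (intro exI[of _ "?x - b3"] allI impI)
   fix W assume "?x - b3 <= Im W"
   then have "Hb0 (Qg (A' - W - A')) = Hb0 (A' - W) - A'" by (intro b(3)) auto
   then show "flip A' Hb0 (flip 0 Qg W + A') = flip A' Hb0 W + A'"
    by (simp add: flip_def algebra_simps)
  qed
  show "\<forall>\<^sub>F W in filtercomap Im at_bot. flip A' Hti (flip 0 P (W - A')) = flip A' Hti W - A'"
   unfolding ev_bot
  proof (intro exI[of _ "?x - b2"] allI impI)
   fix W assume "Im W <= ?x - b2"
   then have "Hti (P (A' - W) + A') = Hti (A' - W) + A'" by (intro b(2)) auto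
   then show "flip A' Hti (flip 0 P (W - A')) = flip A' Hti W - A'"
    by (simp add: flip_def algebra_simps)
  qed
  show "\<forall>\<^sub>F W in filtercomap Im at_top. flip A' Ht0 (- Q (- (W - A) - (A - A')) - (A - A')) = flip A' Ht0 W - A"
   unfolding ev_top
  proof (intro exI[of _ "?x - b1"] allI impI)
   fix W assume "?x - b1 <= Im W"
   then have "Ht0 (Q (A' - W) + A) = Ht0 (A' - W) + A" by (intro b(1)) auto
   then show "flip A' Ht0 (- Q (- (W - A) - (A - A')) - (A - A')) = flip A' Ht0 W - A"
    by (simp add: flip_def algebra_simps)
  qed
  show "?x - y2 - Im D < ?x - y1 - Im D" using y by simp
  show "\<forall>W. ?x - y2 - Im D < Im W --> Im W < ?x - y1 - Im D -->
    linked (flip A' Hbi) (flip A' Hb0) (flip A' Hti) (flip A' Ht0) (hstrip (?x - yb0) (?x - ybi)) (hstrip (?x - yt0) (?x - yti)) D (W + D)"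
  proof (intro allI impI)
   fix W assume W: "?x - y2 - Im D < Im W" "Im W < ?x - y1 - Im D"
   define V where "V = A' - D - W"
   have "y1 < Im V" "Im V < y2" using W by (auto simp: V_def)
   from lk[OF this] obtain w v where wv: "w \<in> hstrip yti yt0" "v \<in> hstrip ybi yb0" "Ht0 w = V" "Hbi v = V + D" "Hti w = Hb0 v"
    unfolding linked_def by auto
   show "linked (flip A' Hbi) (flip A' Hb0) (flip A' Hti) (flip A' Ht0) (hstrip (?x - yb0) (?x - ybi)) (hstrip (?x - yt0) (?x - yti)) D (W + D)"
    unfolding linked_def
    by (rule exI[of _ "A' - v"], rule exI[of _ "A' - w"]) (use wv in \<open>auto simp: flip_def V_def\<close>)
  qed
 qed
qed

lemma upart_cong:
 assumes "!!w. y1 < Im w ==> Im w < y2 ==> f w = g w" "y1 < Im W" "y1 < y2"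
 shows "upart y1 y2 f W = upart y1 y2 g W"
 unfolding upart_def by (intro pmean_cong) (use assms in auto)

lemma pclass_flip:
 shows "pclass (lowdom \<Omega> (%_. - Y)) (wlow Y) (%z W. Q z W - W) ==> pclass (updom \<Omega> (%_. Y)) (wup Y) (%z W. flip 0 (Q z) W - W)"
  "pclass (updom \<Omega> (%_. Y)) (wup Y) (%z W. P z W - W) ==> pclass (lowdom \<Omega> (%_. - Y)) (wlow Y) (%z W. flip 0 (P z) W - W)"
proof -
 have main: "pclass E w' (%z W. flip 0 (Q z) W - W)"
  if Q: "pclass D w (%z W. Q z W - W)" and o: "open E" and DE: "!!z W. (z, W) \<in> E \<longleftrightarrow> (z, - W) \<in> D"
   and w: "!!z W. (z, W) \<in> E ==> w z (- W) = w' z W" and s: "!!z W. (z, W) \<in> D ==> (z, W - 1) \<in> D" for D E w w' Q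
  unfolding pclass_def
 proof (intro conjI allI impI)
  have *: "flip 0 (Q z) W - W = - (Q z (- W) - (- W))" for z W by (simp add: flip_def)
  show "hol2 E (%z W. flip 0 (Q z) W - W)"
   unfolding * using DE by (intro hol2_minus hol2_compose[OF pclassD(1)[OF Q]] hol2_fst hol2_snd o) auto
  fix z W assume p: "(z, W) \<in> E"
  then have p': "(z, - W) \<in> D" using DE by auto
  have p1: "(z, - W - 1) \<in> D" by (rule s[OF p'])
  then show "(z, W + 1) \<in> E" using DE by simp
  have "Q z (- W - 1 + 1) - (- W - 1 + 1) = Q z (- W - 1) - (- W - 1)" by (rule pclassD(3)[OF Q p1])
  then show "flip 0 (Q z) (W + 1) - (W + 1) = flip 0 (Q z) W - W" by (simp add: flip_def)
  show "cmod (flip 0 (Q z) W - W) <= w' z W"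
   unfolding * norm_minus_cancel using pclassD(4)[OF Q p'] w[OF p] by simp
 qed
 have om: "open ((%p. (fst p, - snd p)) -` D)" if "open D" for D :: "(complex \<times> complex) set"
  by (rule open_vimage[OF that]) (intro continuous_intros)
 have e1: "(%p. (fst p, - snd p)) -` (lowdom \<Omega> (%_. - Y)) = updom \<Omega> (%_. Y)"
  and e2: "(%p. (fst p, - snd p)) -` (updom \<Omega> (%_. Y)) = lowdom \<Omega> (%_. - Y)"
  by (auto simp: lowdom_def updom_def)
 show "pclass (updom \<Omega> (%_. Y)) (wup Y) (%z W. flip 0 (Q z) W - W)"
  if Q: "pclass (lowdom \<Omega> (%_. - Y)) (wlow Y) (%z W. Q z W - W)"
  by (rule main[OF Q]) (use om[OF hol2D(1)[OF pclassD(1)[OF Q]]] e1 in \<open>auto simp: algebra_simps\<close>)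
 show "pclass (lowdom \<Omega> (%_. - Y)) (wlow Y) (%z W. flip 0 (P z) W - W)"
  if P: "pclass (updom \<Omega> (%_. Y)) (wup Y) (%z W. P z W - W)"
  by (rule main[OF P]) (use om[OF hol2D(1)[OF pclassD(1)[OF P]]] e2 in \<open>auto simp: algebra_simps\<close>)
qed

context gluing_system
begin

lemma u_tendsto:
 assumes z: "z \<in> \<Omega>"
 shows "(u z \<longlongrightarrow> 0) (filtercomap Im at_bot)"
 unfolding tendsto_bot
proof (intro allI impI)
 fix e :: real assume "0 < e"
 then obtain X where X: "X \<ge> 1" "2 * E z * exp (- (2 * pi * X)) < e" using exp_neg_eventually_small by blast
 have L: "2 * Y + 2 * M + 40 <= Im (A z)" by (rule A_large[OF z])
 have "cmod (u z W) < e" if W: "Im W <= Im (A z) / 2 - X" for W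
 proof -
  have W': "Im W < Im (A z) - Y - 2" using W X L M0 Y0 by linarith
  have "cmod (u z W) <= 2 * E z * exp (- (2 * pi * (Im (A z) / 2 - Im W)))"
   unfolding u_lpart[OF z W']
   by (rule lpart_decay(2)[OF per1_defect[OF z]]) (use defect_middle[OF z] L M0 Y0 W X in auto)
  also have "\<dots> <= 2 * E z * exp (- (2 * pi * X))" using W by (intro mult_left_mono) auto
  finally show ?thesis using X by simp
 qed
 then show "\<exists>b. \<forall>W. Im W <= b --> cmod (u z W) < e" by blast
qed

lemma lipschitz_bounds:
 assumes z: "z \<in> \<Omega>"
 shows "Im x < Im (A z) - Y - 2 ==> Im y < Im (A z) - Y - 2 ==> cmod (f z x - f z y) <= 4 / 1000 * cmod (x - y)"
  "Y + 1 < Im x ==> Y + 1 < Im y ==> cmod (h z x - h z y) <= 2 / 1000 * cmod (x - y)"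
  "Y + 3 < Im x ==> Y + 3 < Im y ==> cmod (k z x - k z y) <= 18 / 1000 * cmod (x - y)"
  "Im x < Im (A z) - Y - 3 ==> Im y < Im (A z) - Y - 3 ==> cmod (u z x - u z y) <= 18 / 1000 * cmod (x - y)"
proof -
 have up: "cball w 1 \<subseteq> upper_hp c" if "w \<in> upper_hp (c + 1)" for w c
  using that Im_close[of _ w 1] by (fastforce simp: dist_norm norm_minus_commute)
 have lo: "cball w 1 \<subseteq> lower_hp c" if "w \<in> lower_hp (c - 1)" for w c
  using that Im_close[of _ w 1] by (fastforce simp: dist_norm norm_minus_commute)
 show "cmod (f z x - f z y) <= 4 / 1000 * cmod (x - y)" if "Im x < Im (A z) - Y - 2" "Im y < Im (A z) - Y - 2"
  using cauchy_lipschitz[OF per1D(1)[OF per1_slices(1)[OF z]] hstrip_open(2) convex_hstrip(2) zero_less_one lo f_bound(2)[OF z], where x = x and y = y] that by auto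
 show "cmod (h z x - h z y) <= 2 / 1000 * cmod (x - y)" if "Y + 1 < Im x" "Y + 1 < Im y"
  using cauchy_lipschitz[OF per1D(1)[OF per1_slices(2)[OF z]] hstrip_open(3) convex_hstrip(3) zero_less_one up h_bound(2)[OF z], where x = x and y = y] that by auto
 show "cmod (k z x - k z y) <= 18 / 1000 * cmod (x - y)" if "Y + 3 < Im x" "Y + 3 < Im y"
  using cauchy_lipschitz[OF per1D(1)[OF per1_slices(3)[OF z]] hstrip_open(3) convex_hstrip(3) zero_less_one up k_bound[OF z], where x = x and y = y] that by auto
 show "cmod (u z x - u z y) <= 18 / 1000 * cmod (x - y)" if "Im x < Im (A z) - Y - 3" "Im y < Im (A z) - Y - 3"
  using cauchy_lipschitz[OF per1D(1)[OF per1_slices(4)[OF z]] hstrip_open(2) convex_hstrip(2) zero_less_one lo u_bound[OF z], where x = x and y = y] that by auto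
qed

lemma defect_lipschitz:
 assumes z: "z \<in> \<Omega>" and x: "Y + 2 < Im x" "Im x < Im (A z) - Y - 2" and y: "Y + 2 < Im y" "Im y < Im (A z) - Y - 2"
 shows "cmod ((f z x + h z (x + f z x)) - (f z y + h z (y + f z y))) <= 1 / 100 * cmod (x - y)"
proof -
 have f1: "cmod (f z x) <= 4 / 1000" "cmod (f z y) <= 4 / 1000"
  by (rule f_bound(2)[OF z]; use x y in auto)+
 have i: "Y + 1 < Im (x + f z x)" "Y + 1 < Im (y + f z y)"
  using Im_close[of "x + f z x" x "4 / 1000"] Im_close[of "y + f z y" y "4 / 1000"] f1 x y by auto
 have a: "cmod (f z x - f z y) <= 4 / 1000 * cmod (x - y)" by (rule lipschitz_bounds(1)[OF z x(2) y(2)])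
 have "cmod (h z (x + f z x) - h z (y + f z y)) <= 2 / 1000 * cmod ((x + f z x) - (y + f z y))" by (rule lipschitz_bounds(2)[OF z i])
 moreover have "cmod ((x + f z x) - (y + f z y)) <= cmod (x - y) + cmod (f z x - f z y)"
  using norm_triangle_ineq[of "x - y" "f z x - f z y"] by (simp add: algebra_simps)
 moreover have eq: "(f z x + h z (x + f z x)) - (f z y + h z (y + f z y)) = (f z x - f z y) + (h z (x + f z x) - h z (y + f z y))" by simp
 ultimately show ?thesis unfolding eq using a norm_triangle_ineq[of "f z x - f z y" "h z (x + f z x) - h z (y + f z y)"] norm_ge_zero[of "x - y"] by linarith
qed

text \<open>
 The upper part of the factorization, in which \<open>ug\<close> does not appear, says that \<open>kg\<close> and \<open>k\<close> are fixed points
 of one contraction. The constant term of \<open>kg\<close> is free, as it belongs to the upper part.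
\<close>

lemma factor_unique:
 assumes z: "z \<in> \<Omega>" and s: "Y + 4 < s" "s < Im (A z) - Y - 4"
  and kg: "per1 (upper_hp c1) kg" "c1 <= s - 1 / 2" "!!W. s - 1 / 2 < Im W ==> cmod (kg W) <= 1"
  and ug: "per1 (lower_hp c2) ug" "s + 1 / 2 <= c2" "(ug \<longlongrightarrow> 0) (filtercomap Im at_bot)"
  and rel: "!!W. s - 1 / 2 < Im W ==> Im W < s + 1 / 2 ==> kg W + (f z (W + kg W) + h z (W + kg W + f z (W + kg W))) = ug W"
  and W: "s - 1 / 2 < Im W" "Im W < s + 1 / 2"
 shows "kg W = k z W" "ug W = u z W"
proof -
 let ?T = "hstrip (s - 1 / 2) (s + 1 / 2)"
 define \<phi> where "\<phi> \<kappa> w = f z (w + \<kappa> w) + h z (w + \<kappa> w + f z (w + \<kappa> w))" for \<kappa> :: "complex => complex" and w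
 have kT: "per1 ?T kg" "per1 ?T ug" "per1 ?T (k z)" "per1 ?T (u z)"
  using per1_subset[OF kg(1), of ?T] per1_subset[OF ug(1), of ?T] per1_subset[OF per1_slices(3)[OF z], of ?T]
   per1_subset[OF per1_slices(4)[OF z], of ?T] kg(2) ug(2) s by (auto simp: subset_iff)
 have up: "upart (s - 1 / 2) (s + 1 / 2) (\<phi> \<kappa>) v = - \<kappa> v" and pf: "per1 ?T (\<phi> \<kappa>)"
  if \<kappa>: "per1 (upper_hp (s - 1 / 2)) \<kappa>" "!!w. s - 1 / 2 < Im w ==> cmod (\<kappa> w) <= 1"
   and \<upsilon>: "per1 (lower_hp (s + 1 / 2)) \<upsilon>" "(\<upsilon> \<longlongrightarrow> 0) (filtercomap Im at_bot)"
   and r: "!!w. w \<in> ?T ==> \<kappa> w + \<phi> \<kappa> w = \<upsilon> w" and v: "v \<in> ?T" for \<kappa> \<upsilon> v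
 proof -
  have e: "\<phi> \<kappa> w = \<upsilon> w - \<kappa> w" if "w \<in> ?T" for w using r[OF that] by (simp add: algebra_simps)
  have p1: "per1 ?T \<kappa>" "per1 ?T \<upsilon>" by (rule per1_subset[OF \<kappa>(1)] per1_subset[OF \<upsilon>(1)]; auto)+
  have "upart (s - 1 / 2) (s + 1 / 2) (\<phi> \<kappa>) v = upart (s - 1 / 2) (s + 1 / 2) (%w. \<upsilon> w - \<kappa> w) v"
   by (rule upart_cong) (use e v in auto)
  also have "\<dots> = upart (s - 1 / 2) (s + 1 / 2) \<upsilon> v - upart (s - 1 / 2) (s + 1 / 2) \<kappa> v"
   by (rule upart_diff[OF p1(2,1)]) (use v in auto)
  also have "upart (s - 1 / 2) (s + 1 / 2) \<upsilon> v = 0" by (rule upart_lower[OF \<upsilon>]) (use v in auto)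
  also have "upart (s - 1 / 2) (s + 1 / 2) \<kappa> v = \<kappa> v" by (rule upart_upper[OF \<kappa>]) (use v in auto)
  finally show "upart (s - 1 / 2) (s + 1 / 2) (\<phi> \<kappa>) v = - \<kappa> v" by simp
  have "per1 ?T (%w. \<upsilon> w - \<kappa> w)" using p1 by (auto simp: per1_def intro!: holomorphic_intros)
  then show "per1 ?T (\<phi> \<kappa>)"
   unfolding per1_def using e by (auto intro: holomorphic_transform)
 qed
 have kb: "cmod (k z w) <= 1" if "s - 1 / 2 < Im w" for w using k_bound[OF z, of w] that s by auto
 have g: "per1 (upper_hp (s - 1 / 2)) kg" "per1 (lower_hp (s + 1 / 2)) ug" "per1 (upper_hp (s - 1 / 2)) (k z)" "per1 (lower_hp (s + 1 / 2)) (u z)"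
  using per1_subset[OF kg(1), of "upper_hp (s - 1 / 2)"] per1_subset[OF ug(1), of "lower_hp (s + 1 / 2)"]
   per1_subset[OF per1_slices(3)[OF z], of "upper_hp (s - 1 / 2)"] per1_subset[OF per1_slices(4)[OF z], of "lower_hp (s + 1 / 2)"]
   kg(2) ug(2) s by (auto simp: subset_iff)
 have rk: "k z w + \<phi> (k z) w = u z w" if "w \<in> ?T" for w unfolding \<phi>_def using that s by (intro ku[OF z]) auto
 have rg: "kg w + \<phi> kg w = ug w" if "w \<in> ?T" for w unfolding \<phi>_def using that by (intro rel) auto
 have U1: "upart (s - 1 / 2) (s + 1 / 2) (\<phi> kg) v = - kg v" if "v \<in> ?T" for v
  using up[OF g(1) kg(3) g(2) ug(3) rg that] by simp
 have U2: "upart (s - 1 / 2) (s + 1 / 2) (\<phi> (k z)) v = - k z v" if "v \<in> ?T" for v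
  using up[OF g(3) kb g(4) u_tendsto[OF z] rk that] by simp
 have WT: "W \<in> ?T" using W by simp
 have P1: "per1 ?T (\<phi> kg)" using pf[OF g(1) kg(3) g(2) ug(3) rg WT] by simp
 have P2: "per1 ?T (\<phi> (k z))" using pf[OF g(3) kb g(4) u_tendsto[OF z] rk WT] by simp
 have close: "cmod (kg v - k z v) <= 2 * (1 / 2) ^ n" if "v \<in> ?T" for n v
  using that
 proof (induction n arbitrary: v)
  case 0
  then show ?case using norm_triangle_ineq4[of "kg v" "k z v"] kg(3)[of v] kb[of v] by auto
 next
  case (Suc n)
  have d: "cmod (\<phi> kg w - \<phi> (k z) w) <= 1 / 100 * (2 * (1 / 2) ^ n)" if w: "s - 1 / 2 < Im w" "Im w < s + 1 / 2" for w
  proof -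
   have "cmod (\<phi> kg w - \<phi> (k z) w) <= 1 / 100 * cmod ((w + kg w) - (w + k z w))"
    unfolding \<phi>_def using Im_close[of "w + kg w" w 1] Im_close[of "w + k z w" w 1] kg(3)[OF w(1)] kb[OF w(1)] w s
    by (intro defect_lipschitz[OF z]) auto
   then show ?thesis using Suc.IH[of w] w by auto
  qed
  have "cmod (upart (s - 1 / 2) (s + 1 / 2) (%w. \<phi> kg w - \<phi> (k z) w) v) <= 3 * (1 / 100 * (2 * (1 / 2) ^ n))"
   by (rule part_bounds(1)) (use P1 P2 d Suc.prems in \<open>auto simp: per1_def intro!: holomorphic_intros\<close>)
  also have "upart (s - 1 / 2) (s + 1 / 2) (%w. \<phi> kg w - \<phi> (k z) w) v = - kg v - - k z v"
   using upart_diff[OF P1 P2, of v] U1[OF Suc.prems] U2[OF Suc.prems] Suc.prems by simp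
  finally have "cmod (kg v - k z v) <= 3 * (1 / 100 * (2 * (1 / 2) ^ n))" by (simp add: norm_minus_commute)
  also have "\<dots> <= 2 * (1 / 2) ^ Suc n" by simp
  finally show ?case .
 qed
 have "(%n. 2 * (1 / 2) ^ n) \<longlonglongrightarrow> 2 * (0::real)" by (intro tendsto_intros LIMSEQ_realpow_zero) auto
 then have "cmod (kg W - k z W) <= 2 * 0" by (rule LIMSEQ_le_const) (use close[OF WT] in blast)
 then show *: "kg W = k z W" by simp
 show "ug W = u z W" using rg[OF WT] rk[OF WT] * by (simp add: \<phi>_def)
qed

text \<open>
 The linearizations for the given pair are the constructed ones, and so are those for the other pair,
 as one sees after reflection. Thus all four maps are near the identity in the middle, and
 the identity of composites holds there. Up to the translation by \<open>D\<close>, which goes into the constant term of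
 \<open>kg\<close> and leaves \<open>Pg\<close> unchanged, it is the factorization that defines \<open>k\<close> and \<open>u\<close>.
\<close>

lemma glued_unique:
 assumes z: "z \<in> \<Omega>"
  and Qg: "pclass (lowdom UNIV (%_. - Y)) (wlow Y) (%_ W. Qg W - W)"
  and Pg: "pclass (updom UNIV (%_. Y)) (wup Y) (%_ W. Pg W - W)"
  and gl: "glued (A z) (A' z) (Q z) (P z) Qg Pg"
 shows "!!W. Im W < - (Y + M + 4) ==> Qg W = Qh z W" "!!W. Y + M + 4 < Im W ==> Pg W = Ph z W"
proof -
 have L: "2 * Y + 2 * M + 40 <= Im (A z)" by (rule A_large[OF z])
 note Ab = A'_bounds[OF z]
 obtain Ht0 Hti Hb0 Hbi yt0 yti yb0 ybi D y1 y2 where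
  t: "tangent_lower yt0 Ht0" "tangent_upper yti Hti" "tangent_lower yb0 Hb0" "tangent_upper ybi Hbi"
  and eq: "\<forall>\<^sub>F W in filtercomap Im at_bot. Ht0 (Q z W + A z) = Ht0 W + A z"
   "\<forall>\<^sub>F W in filtercomap Im at_top. Hti (P z W + A' z) = Hti W + A' z"
   "\<forall>\<^sub>F W in filtercomap Im at_bot. Hb0 (Qg (W - A' z)) = Hb0 W - A' z"
   "\<forall>\<^sub>F W in filtercomap Im at_top. Hbi (Pg (W - A z)) = Hbi W - A z"
  and y12: "y1 < y2" and lk: "!!W. y1 < Im W ==> Im W < y2 ==> linked Ht0 Hti Hb0 Hbi (hstrip yti yt0) (hstrip ybi yb0) D (W + D)"
  using gl unfolding glued_def by blast
 obtain b3 b4 where b3: "!!W. Im W <= b3 ==> Hb0 (Qg (W - A' z)) = Hb0 W - A' z" and b4: "!!W. b4 <= Im W ==> Hbi (Pg (W - A z)) = Hbi W - A z"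
  using eq(3,4) unfolding ev_bot ev_top by metis
 \<comment> \<open>the reflected second pair has linearizations of its own, to which \<open>flip 0 Hbi\<close>, \<open>flip 0 Hb0\<close> are compared\<close>
 have td: "transition_data UNIV (%_. A z) (%_. A' z) Y M (%_. flip 0 Pg) (%_. flip 0 Qg)"
  by unfold_locales (use A_close[OF z] L Y0 M0 pclass_flip(2)[OF Pg] pclass_flip(1)[OF Qg] in auto)
 obtain f2 h2 k2 u2 Qh2 Ph2 where "gluing_system UNIV (%_. A z) (%_. A' z) Y M (%_. flip 0 Pg) (%_. flip 0 Qg) f2 h2 k2 u2 Qh2 Ph2"
  using transition_data.exists_gluing_system[OF td] by blast
 then interpret G2: gluing_system UNIV "%_. A z" "%_. A' z" Y M "%_. flip 0 Pg" "%_. flip 0 Qg" f2 h2 k2 u2 Qh2 Ph2 .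
 obtain Ht0' yt0' where T1: "tangent_lower yt0' Ht0'" "Im (A z) - Y - 2 <= yt0'" "yt0 <= yt0'" "!!W. Im W < yt0 ==> Ht0' W = Ht0 W"
   "!!W. Im W < Im (A z) - Y - 2 ==> cmod (Ht0' W - W) <= 1 / 8" "!!W. Im W < Im (A z) - Y - 2 ==> Ht0' W + f z (Ht0' W) = W"
  using std_lower[OF z t(1) eq(1)] by blast
 obtain Hti' yti' where T2: "tangent_upper yti' Hti'" "yti' <= Y + 1" "yti' <= yti" "!!W. yti < Im W ==> Hti' W = Hti W"
   "!!W. Y + 1 < Im W ==> cmod (Hti' W - W) <= 1 / 8" "!!W. Y + 1 < Im W ==> Hti' W = W + h z W"
  using std_upper[OF z t(2) eq(2)] by blast
 have e3: "\<forall>\<^sub>F W in filtercomap Im at_bot. flip (A z) Hbi (flip 0 Pg W + A z) = flip (A z) Hbi W + A z"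
  unfolding ev_bot
 proof (intro exI[of _ "Im (A z) - b4"] allI impI)
  fix W assume "Im W <= Im (A z) - b4"
  then have "Hbi (Pg (A z - W - A z)) = Hbi (A z - W) - A z" by (intro b4) auto
  then show "flip (A z) Hbi (flip 0 Pg W + A z) = flip (A z) Hbi W + A z" by (simp add: flip_def)
 qed
 have e4: "\<forall>\<^sub>F W in filtercomap Im at_top. flip (A' z) Hb0 (flip 0 Qg W + A' z) = flip (A' z) Hb0 W + A' z"
  unfolding ev_top
 proof (intro exI[of _ "Im (A' z) - b3"] allI impI)
  fix W assume "Im (A' z) - b3 <= Im W"
  then have "Hb0 (Qg (A' z - W - A' z)) = Hb0 (A' z - W) - A' z" by (intro b3) auto
  then show "flip (A' z) Hb0 (flip 0 Qg W + A' z) = flip (A' z) Hb0 W + A' z" by (simp add: flip_def)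
 qed
 obtain S3 y3 where S3: "tangent_lower y3 S3" "Im (A z) - Y - 2 <= y3" "Im (A z) - ybi <= y3" "!!W. Im W < Im (A z) - ybi ==> S3 W = flip (A z) Hbi W"
   "!!W. Im W < Im (A z) - Y - 2 ==> cmod (S3 W - W) <= 1 / 8"
  using G2.std_lower[OF UNIV_I tangent_flip(2)[OF t(4)] e3] by blast
 obtain S4 y4 where S4: "tangent_upper y4 S4" "y4 <= Y + 1" "y4 <= Im (A' z) - yb0" "!!W. Im (A' z) - yb0 < Im W ==> S4 W = flip (A' z) Hb0 W"
   "!!W. Y + 1 < Im W ==> cmod (S4 W - W) <= 1 / 8"
  using G2.std_upper[OF UNIV_I tangent_flip(1)[OF t(3)] e4] by blast
 define Hbi' ybi' where "Hbi' = flip (A z) S3" and "ybi' = Im (A z) - y3"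
 define Hb0' yb0' where "Hb0' = flip (A' z) S4" and "yb0' = Im (A' z) - y4"
 have fl: "cmod (flip c S W - W) = cmod (S (c - W) - (c - W))" for c S W
 proof -
  have "flip c S W - W = - (S (c - W) - (c - W))" by (simp add: flip_def)
  then show ?thesis by (metis norm_minus_cancel)
 qed
 have T3: "tangent_upper ybi' Hbi'" "ybi' <= Y + 2" "ybi' <= ybi" "!!W. ybi < Im W ==> Hbi' W = Hbi W"
   "!!W. Y + 2 < Im W ==> cmod (Hbi' W - W) <= 1 / 8"
  unfolding Hbi'_def ybi'_def fl using tangent_flip(1)[OF S3(1), of "A z"] S3 by (auto simp: flip_def)
 have T4: "tangent_lower yb0' Hb0'" "Im (A' z) - Y - 1 <= yb0'" "yb0 <= yb0'" "!!W. Im W < yb0 ==> Hb0' W = Hb0 W"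
   "!!W. Im W < Im (A' z) - Y - 1 ==> cmod (Hb0' W - W) <= 1 / 8"
  unfolding Hb0'_def yb0'_def fl using tangent_flip(2)[OF S4(1), of "A' z"] S4 by (auto simp: flip_def)
 define m where "m = Im (A z) / 2"
 interpret F: four_maps Ht0' Hti' Hb0' Hbi' yt0' yti' yb0' ybi' m "m - Y - M - 2"
  by unfold_locales (use T1 T2 T3 T4 Ab M0 Y0 in \<open>auto simp: m_def\<close>)
 have "F.central D"
 proof (rule F.centre[OF _ y12])
  fix W assume "y1 < Im W" "Im W < y2"
  from lk[OF this] obtain w v where wv: "w \<in> hstrip yti yt0" "v \<in> hstrip ybi yb0" "Ht0 w = W" "Hbi v = W + D" "Hti w = Hb0 v"
   unfolding linked_def by auto
  show "F.link D (W + D)"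
   unfolding linked_def
   by (rule exI[of _ w], rule exI[of _ v]) (use wv T1(3,4) T2(3,4) T3(3,4) T4(3,4) in auto)
 qed (use L in \<open>simp add: m_def\<close>)
 then obtain s where s: "\<bar>s - m\<bar> <= 9" and D: "cmod D <= 1 / 2" and C: "!!V. s - 1 < Im V ==> Im V < s + 1 ==>
   \<exists>w v. Ht0' w = V - D & Hbi' v = V & Hti' w = Hb0' v & cmod (v - V) <= 1 / 8 & cmod (w - v) <= 1 / 4"
  unfolding F.central_def by blast
 have sb: "m - 9 <= s" "s <= m + 9" using s by (auto simp: abs_le_iff)
 have s1: "Y + M + 4 < s - 1" "s + 1 < Im (A z) - Y - M - 4" using sb L unfolding m_def by linarith+
 define kg where "kg W = Hbi' W - D - W" for W
 define ug where "ug W = Hb0' W - W" for W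
 have kg: "per1 (upper_hp (Y + 2)) kg"
  unfolding per1_def kg_def using holomorphic_on_subset[OF tangentD(5)[OF T3(1)], of "upper_hp (Y + 2)"] tangentD(7)[OF T3(1)] T3(2)
  by (auto intro!: holomorphic_intros simp: subset_iff)
 have kgb: "cmod (kg W) <= 1" if "s - 1 / 2 < Im W" for W
  using T3(5)[of W] that s1 M0 D norm_triangle_ineq4[of "Hbi' W - W" D] by (simp add: kg_def algebra_simps)
 define yy where "yy = min yb0' (Im (A z) - Y - 2)"
 have ug: "per1 (lower_hp yy) ug"
  unfolding per1_def ug_def using holomorphic_on_subset[OF tangentD(1)[OF T4(1)], of "lower_hp yy"] tangentD(3)[OF T4(1)]
  by (auto intro!: holomorphic_intros simp: subset_iff yy_def)
 have ugt: "(ug \<longlongrightarrow> 0) (filtercomap Im at_bot)" unfolding ug_def[abs_def] by (rule tangentD(4)[OF T4(1)])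
 have rel: "kg v + (f z (v + kg v) + h z (v + kg v + f z (v + kg v))) = ug v" if v: "s - 1 / 2 < Im v" "Im v < s + 1 / 2" for v
 proof -
  define V where "V = Hbi' v"
  have nV: "cmod (V - v) <= 1 / 8" unfolding V_def using v s1 M0 by (intro T3(5)) auto
  then have V: "s - 1 < Im V" "Im V < s + 1" using Im_close[OF nV] v by auto
  obtain w v1 where w: "Ht0' w = V - D" "Hbi' v1 = V" "Hti' w = Hb0' v1" "cmod (v1 - V) <= 1 / 8" "cmod (w - v1) <= 1 / 4"
   using C[OF V] by blast
  have "v1 = v"
  proof (rule inj_onD[OF tangentD(6)[OF T3(1)]])
   show "Hbi' v1 = Hbi' v" using w by (simp add: V_def)
   show "v1 \<in> upper_hp ybi'" "v \<in> upper_hp ybi'" using Im_close[OF w(4)] V v s1 T3(2) M0 by auto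
  qed
  have iw: "Im w < Im (A z) - Y - 2" "Y + 1 < Im w" using Im_close[OF w(5)] Im_close[OF w(4)] V s1 M0 by auto
  have X: "v + kg v = V - D" by (simp add: kg_def V_def)
  have wf: "V - D + f z (V - D) = w" using T1(6)[OF iw(1)] w(1) by simp
  have "Hb0' v = w + h z w" using w(3) T2(6)[OF iw(2)] \<open>v1 = v\<close> by simp
  then have "ug v = (V - D + f z (V - D)) + h z (V - D + f z (V - D)) - v" unfolding wf by (simp add: ug_def)
  then show ?thesis unfolding X by (simp add: kg_def V_def)
 qed
 have "kg W = k z W & ug W = u z W" if "s - 1 / 2 < Im W" "Im W < s + 1 / 2" for W
  using factor_unique[OF z _ _ kg _ kgb ug _ ugt rel that] s1 M0 Y0 Ab T4(2) by (auto simp: yy_def)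
 note TU = this
 let ?T = "hstrip (s - 1 / 2) (s + 1 / 2)"
 have Tne: "?T \<noteq> {}"
 proof -
  have "\<i> * of_real s \<in> ?T" by simp
  then show ?thesis by blast
 qed
 have kk: "kg W = k z W" if "Y + 2 < Im W" for W
  by (rule analytic_continuation_open[of ?T "upper_hp (Y + 2)" kg "k z"])
    (use Tne s1 M0 TU that per1D(1)[OF kg] per1D(1)[OF per1_slices(3)[OF z]] in auto)
 have uu: "ug W = u z W" if "Im W < yy" for W
 proof (rule analytic_continuation_open[of ?T "lower_hp yy" ug "u z"])
  show "u z holomorphic_on lower_hp yy" by (rule holomorphic_on_subset[OF per1D(1)[OF per1_slices(4)[OF z]]]) (auto simp: yy_def)
 qed (use Tne s1 M0 Y0 Ab T4(2) TU that per1D(1)[OF ug] in \<open>auto simp: yy_def\<close>)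
 have yyb: "Im (A' z) - Y - M - 4 < yy" using T4(2) Ab M0 by (auto simp: yy_def)
 have yy0: "- (Y + M) < yy" using yyb Ab L Y0 M0 by linarith
 have Qb: "cmod (Qg W - W) <= 1" if "Im W < - Y" for W
 proof -
  have "exp (2 * pi * (Im W + Y)) <= 1" using that by (simp add: mult_le_0_iff)
  moreover have "cmod (Qg W - W) <= 1 / 1000 * exp (2 * pi * (Im W + Y))" using pclassD(4)[OF Qg, of 0 W] that by simp
  ultimately show ?thesis by linarith
 qed
 have Pb: "cmod (Pg W - W) <= 1" if "Y < Im W" for W
 proof -
  have "exp (- (2 * pi * (Im W - Y))) <= 1" using that by simp
  moreover have "cmod (Pg W - W) <= 1 / 1000 * exp (- (2 * pi * (Im W - Y)))" using pclassD(4)[OF Pg, of 0 W] that by simp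
  ultimately show ?thesis by linarith
 qed
 have hQ: "Qg holomorphic_on lower_hp (- Y)"
 proof -
  have "(%W. (Qg W - W) + W) holomorphic_on lower_hp (- Y)"
   by (intro holomorphic_intros hol2_holomorphic(2)[OF pclassD(1)[OF Qg], of _ 0]) auto
  then show ?thesis by simp
 qed
 have hP: "Pg holomorphic_on upper_hp Y"
 proof -
  have "(%W. (Pg W - W) + W) holomorphic_on upper_hp Y"
   by (intro holomorphic_intros hol2_holomorphic(2)[OF pclassD(1)[OF Pg], of _ 0]) auto
  then show ?thesis by simp
 qed
 show "Qg V = Qh z V" if V: "Im V < - (Y + M + 4)" for V
 proof -
  let ?S = "lower_hp (- (Y + M + 4))"
  have in1: "Im (Qg W) < yy" "Im (Qg W) < - Y" "Im (Qg W) < Im (A z) - Y - 3" if "Im W < - (Y + M + 4)" for W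
   using Im_close[OF Qb[of W]] that M0 Y0 yy0 L by auto
  have in2: "Im (W + A' z) < yy" if "Im W < - (Y + M + 4)" for W using that yyb by simp
  have hol0: "Hb0' holomorphic_on lower_hp yy" by (rule holomorphic_on_subset[OF tangentD(1)[OF T4(1)]]) (auto simp: yy_def)
  have "Hb0' (Qg V) = Hb0' (V + A' z) - A' z"
  proof (rule identity_lower[of "%V. Hb0' (Qg V)" "- (Y + M + 4)" "%V. Hb0' (V + A' z) - A' z" "min (yb0 - 1) (min (b3 - Im (A' z)) (yb0 - Im (A' z) - 1)) - 1"])
   show "(%V. Hb0' (Qg V)) holomorphic_on ?S"
    by (rule holomorphic_on_compose_gen[OF holomorphic_on_subset[OF hQ] hol0, unfolded o_def]) (use in1 M0 in auto)
   show "(%V. Hb0' (V + A' z) - A' z) holomorphic_on ?S"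
    by (intro holomorphic_on_diff holomorphic_on_const holomorphic_on_compose_gen[OF _ hol0, of "%V. V + A' z", unfolded o_def])
      (use in2 in \<open>auto intro!: holomorphic_intros\<close>)
   fix W assume W: "Im W <= min (yb0 - 1) (min (b3 - Im (A' z)) (yb0 - Im (A' z) - 1)) - 1" "Im W < - (Y + M + 4)"
   have "Im (Qg W) < yb0" using Im_close[OF Qb[of W]] W M0 by auto
   then show "Hb0' (Qg W) = Hb0' (W + A' z) - A' z" using b3[of "W + A' z"] T4(4) W by auto
  qed (rule V)
  then have "Qg V + u z (Qg V) = V + u z (V + A' z)"
   using uu[OF in1(1)[OF V]] uu[OF in2[OF V]] by (simp add: ug_def algebra_simps)
  also have "\<dots> = Qh z V + u z (Qh z V)" using Qh_eq[OF z V] by simp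
  finally have eqn: "Qg V - Qh z V = u z (Qh z V) - u z (Qg V)" by (simp add: algebra_simps)
  have "cmod (Qh z V - V) <= 1 / 4" using pclassD(4)[OF Qh, of z V] z V by simp
  then have "Im (Qh z V) < Im (A z) - Y - 3" using Im_close[of "Qh z V" V "1 / 4"] V L M0 Y0 by auto
  from lipschitz_bounds(4)[OF z this in1(3)[OF V]]
  have "cmod (Qg V - Qh z V) <= 18 / 1000 * cmod (Qg V - Qh z V)" unfolding eqn[symmetric] by (simp add: norm_minus_commute)
  then show ?thesis by simp
 qed
 show "Pg V = Ph z V" if V: "Y + M + 4 < Im V" for V
 proof -
  let ?S = "upper_hp (Y + M + 4)"
  have in1: "Y + 2 < Im (Pg W)" "Y + 3 <= Im (Pg W)" "Y + 3 < Im (Pg W)" if "Y + M + 4 < Im W" for W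
   using Im_close[OF Pb[of W]] that M0 Y0 by auto
  have in2: "Y + 2 < Im (W + A z)" if "Y + M + 4 < Im W" for W using that L Y0 M0 by simp
  have hol0: "Hbi' holomorphic_on upper_hp (Y + 2)" by (rule holomorphic_on_subset[OF tangentD(5)[OF T3(1)]]) (use T3(2) in auto)
  have "Hbi' (Pg V) = Hbi' (V + A z) - A z"
  proof (rule identity_upper[of "%V. Hbi' (Pg V)" "Y + M + 4" "%V. Hbi' (V + A z) - A z" "max (ybi + 1) (max (b4 - Im (A z)) (ybi - Im (A z) + 1)) + 1"])
   show "(%V. Hbi' (Pg V)) holomorphic_on ?S"
    by (rule holomorphic_on_compose_gen[OF holomorphic_on_subset[OF hP] hol0, unfolded o_def]) (use in1 M0 in auto)
   show "(%V. Hbi' (V + A z) - A z) holomorphic_on ?S"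
    by (intro holomorphic_on_diff holomorphic_on_const holomorphic_on_compose_gen[OF _ hol0, of "%V. V + A z", unfolded o_def])
      (use in2 in \<open>auto intro!: holomorphic_intros\<close>)
   fix W assume W: "max (ybi + 1) (max (b4 - Im (A z)) (ybi - Im (A z) + 1)) + 1 <= Im W" "Y + M + 4 < Im W"
   have "ybi < Im (Pg W)" using Im_close[OF Pb[of W]] W M0 by auto
   then show "Hbi' (Pg W) = Hbi' (W + A z) - A z" using b4[of "W + A z"] T3(4) W by auto
  qed (rule V)
  then have "Pg V + k z (Pg V) = V + k z (V + A z)"
   using kk[OF in1(1)[OF V]] kk[OF in2[OF V]] by (simp add: kg_def algebra_simps)
  also have "\<dots> = Ph z V + k z (Ph z V)" using Ph_eq[OF z V] by simp
  finally have eqn: "Pg V - Ph z V = k z (Ph z V) - k z (Pg V)" by (simp add: algebra_simps)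
  have "cmod (Ph z V - V) <= 1 / 4" using pclassD(4)[OF Ph, of z V] z V by simp
  then have "Y + 3 < Im (Ph z V)" using Im_close[of "Ph z V" V "1 / 4"] V L M0 Y0 by auto
  from lipschitz_bounds(3)[OF z this in1(3)[OF V]]
  have "cmod (Pg V - Ph z V) <= 18 / 1000 * cmod (Pg V - Ph z V)" unfolding eqn[symmetric] by (simp add: norm_minus_commute)
  then show ?thesis by simp
 qed
qed

end

section \<open>Gevrey expansions from flat differences\<close>

text \<open>The estimates are stated at one point, so that expansions on different sheets of the covering can be
 combined. The square of the factorial is the growth of order \<open>s = 1/2\<close>.\<close>

definition gevrey_at :: "complex => (nat => complex) => real => real => complex => bool" where
 "gevrey_at v b C A \<zeta> \<longleftrightarrow>
   (\<forall>N. cmod (v - (\<Sum>n<N. b n * exp \<zeta> ^ n)) <= C * A ^ N * cmod (exp \<zeta>) ^ N * (fact N)\<^sup>2)"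

definition flat_on :: "complex set => complex set => (complex => complex => complex) => bool" where
 "flat_on X K d \<longleftrightarrow>
   (\<exists>c>0. \<exists>C>0. \<forall>\<zeta>\<in>X. \<forall>W\<in>K. cmod (d \<zeta> W) <= C * exp (- (c / sqrt (cmod (exp \<zeta>)))))"

lemma gevrey_at_mono:
 assumes "gevrey_at v b C A \<zeta>" "0 <= C" "C <= C'" "0 <= A" "A <= A'"
 shows "gevrey_at v b C' A' \<zeta>"
 unfolding gevrey_at_def
proof
 fix N
 have "C * A ^ N * cmod (exp \<zeta>) ^ N * (fact N)\<^sup>2 <= C' * A' ^ N * cmod (exp \<zeta>) ^ N * (fact N)\<^sup>2"
  using assms by (intro mult_right_mono mult_mono power_mono) auto
 then show "cmod (v - (\<Sum>n<N. b n * exp \<zeta> ^ n)) <= C' * A' ^ N * cmod (exp \<zeta>) ^ N * (fact N)\<^sup>2"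
  using assms(1) unfolding gevrey_at_def by (blast intro: order_trans)
qed

lemma continuous_on_line:
 assumes "continuous_on {t. Im t = \<theta> & Re t <= L} \<phi>" "x <= L" "y <= L"
 shows "continuous_on (closed_segment (Complex x \<theta>) (Complex y \<theta>)) \<phi>"
 by (rule continuous_on_subset[OF assms(1)])
   (use assms in \<open>auto simp: closed_segment_same_Im closed_segment_eq_real_ivl split: if_splits\<close>)

text \<open>Integrals along the ray towards \<open>Re t = - \<infinity>\<close>, of functions that decay as \<open>exp (Re t)\<close> there.\<close>

lemma tail_integral:
 assumes c: "continuous_on {t. Im t = \<theta> & Re t <= L} \<phi>"
  and b: "!!t. Im t = \<theta> ==> Re t <= L ==> cmod (\<phi> t) <= c * exp (Re t)" and c0: "0 <= c"
 defines "I \<equiv> %j. contour_integral (linepath (Complex (L - real j) \<theta>) (Complex L \<theta>)) \<phi>"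
 shows "cmod (I j) <= 2 * c * exp L" "convergent I"
proof -
 define S where "S j = contour_integral (linepath (Complex (L - real (Suc j)) \<theta>) (Complex (L - real j) \<theta>)) \<phi>" for j
 have mem: "t \<in> closed_segment (Complex x \<theta>) (Complex y \<theta>) \<longleftrightarrow> Im t = \<theta> & x <= Re t & Re t <= y" if "x <= y" for x y t
  using that by (auto simp: closed_segment_same_Im closed_segment_eq_real_ivl)
 have step: "I (Suc j) = S j + I j" for j
  unfolding I_def S_def
  by (rule contour_integral_split_linepath[OF continuous_on_line[OF c]]) (auto simp: mem)
 have Sb: "cmod (S j) <= c * exp L * (1 / 2) ^ j" for j
 proof -
  have "cmod (S j) <= (c * exp (L - real j)) * cmod (Complex (L - real j) \<theta> - Complex (L - real (Suc j)) \<theta>)"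
   unfolding S_def
  proof (rule contour_integral_bound_linepath)
   show "\<phi> contour_integrable_on linepath (Complex (L - real (Suc j)) \<theta>) (Complex (L - real j) \<theta>)"
    by (rule contour_integrable_continuous_linepath[OF continuous_on_line[OF c]]) auto
   fix t assume "t \<in> closed_segment (Complex (L - real (Suc j)) \<theta>) (Complex (L - real j) \<theta>)"
   then have t: "Im t = \<theta>" "Re t <= L - real j" by (auto simp: mem)
   then have "cmod (\<phi> t) <= c * exp (Re t)" by (intro b) auto
   also have "\<dots> <= c * exp (L - real j)" using t c0 by (intro mult_left_mono) auto
   finally show "cmod (\<phi> t) <= c * exp (L - real j)" .
  qed (use c0 in auto)
  also have "cmod (Complex (L - real j) \<theta> - Complex (L - real (Suc j)) \<theta>) = 1"
   by (simp add: cmod_def complex_eq_iff minus_complex.code)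
  also have "exp (L - real j) <= exp L * (1 / 2) ^ j"
  proof -
   have "exp (- 1 :: real) <= 1 / 2"
    using exp_ge_add_one_self[of 1] by (simp add: exp_minus field_simps)
   then have "exp (- 1 :: real) ^ j <= (1 / 2) ^ j" by (intro power_mono) auto
   moreover have "exp (L - real j) = exp L * exp (- 1) ^ j"
    by (simp add: exp_of_nat_mult[symmetric] exp_add[symmetric])
   ultimately show ?thesis by simp
  qed
  finally show ?thesis using c0 by (simp add: mult_left_mono mult.assoc)
 qed
 have I0: "I 0 = 0" by (simp add: I_def)
 have Isum: "I j = (\<Sum>i<j. S i)" for j by (induction j) (auto simp: I0 step)
 have sm: "summable (%j. c * exp L * (1 / 2) ^ j)" by (intro summable_mult summable_geometric) auto
 have sS: "summable S" by (rule summable_comparison_test'[OF sm]) (use Sb in auto)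
 show "convergent I" unfolding Isum[abs_def] using sS by (simp add: summable_iff_convergent)
 have "cmod (I j) <= (\<Sum>i<j. c * exp L * (1 / 2) ^ i)" unfolding Isum by (rule sum_norm_le) (use Sb in auto)
 also have "\<dots> <= (\<Sum>i. c * exp L * (1 / 2) ^ i)" by (rule sum_le_suminf[OF sm]) (use c0 in auto)
 also have "\<dots> = c * exp L * 2" by (subst suminf_mult) (auto simp: suminf_geometric intro!: summable_geometric)
 finally show "cmod (I j) <= 2 * c * exp L" by simp
qed

lemma linepath_integral_shift:
 "contour_integral (linepath (a + c) (b + c)) f = contour_integral (linepath a b) (%t. f (t + c))"
proof -
 have "(f has_contour_integral i) (linepath (a + c) (b + c)) \<longleftrightarrow> ((%t. f (t + c)) has_contour_integral i) (linepath a b)" for i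
  unfolding has_contour_integral_linepath by (simp add: linepath_def algebra_simps scaleR_conv_of_real)
 then show ?thesis unfolding contour_integral_def contour_integrable_on_def by simp
qed

lemma cos_le_kappa:
 assumes "0 < \<kappa>" "\<kappa> < pi / 2" "\<kappa> <= x" "x <= 2 * pi - \<kappa>"
 shows "cos x <= cos \<kappa>"
proof (cases "x <= pi")
 case True then show ?thesis using assms by (intro cos_monotone_0_pi_le) auto
next
 case False
 have "cos x = cos (2 * pi - x)" by (metis cos_2pi_minus)
 also have "\<dots> <= cos \<kappa>" using assms False by (intro cos_monotone_0_pi_le) auto
 finally show ?thesis .
qed

text \<open>The distance of \<open>1\<close> to the sector of angles between \<open>\<kappa>\<close> and \<open>2 * pi - \<kappa>\<close> is \<open>sin \<kappa>\<close>.\<close>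

lemma one_minus_exp_bound:
 assumes "0 < \<kappa>" "\<kappa> < pi / 2" "\<kappa> <= Im w" "Im w <= 2 * pi - \<kappa>"
 shows "sin \<kappa> <= cmod (1 - exp w)"
proof -
 define r where "r = exp (Re w)"
 have r: "0 < r" by (simp add: r_def)
 have c: "cos (Im w) <= cos \<kappa>" by (rule cos_le_kappa[OF assms])
 have s0: "0 < sin \<kappa>" "0 < cos \<kappa>" using assms by (auto intro!: sin_gt_zero2 cos_gt_zero_pi)
 have sq: "(cmod (1 - exp w))\<^sup>2 = 1 - 2 * r * cos (Im w) + r\<^sup>2"
 proof -
  have "(cmod (1 - exp w))\<^sup>2 = (1 - r * cos (Im w))\<^sup>2 + (r * sin (Im w))\<^sup>2"
   by (simp add: cmod_power2 Re_exp Im_exp r_def)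
  also have "\<dots> = 1 - 2 * r * cos (Im w) + r\<^sup>2 * ((cos (Im w))\<^sup>2 + (sin (Im w))\<^sup>2)"
  proof -
   have "(1 - r * c)\<^sup>2 + (r * s)\<^sup>2 = 1 - 2 * r * c + r\<^sup>2 * (c\<^sup>2 + s\<^sup>2)" for c s :: real
    by (simp add: power2_eq_square algebra_simps)
   then show ?thesis .
  qed
  finally show ?thesis by simp
 qed
 have "2 * r * cos (Im w) <= 2 * r * cos \<kappa>" using c r by simp
 then have "1 - 2 * r * cos \<kappa> + r\<^sup>2 <= (cmod (1 - exp w))\<^sup>2" unfolding sq by simp
 moreover have "(sin \<kappa>)\<^sup>2 <= 1 - 2 * r * cos \<kappa> + r\<^sup>2"
 proof -
  have "0 <= (r - cos \<kappa>)\<^sup>2" by simp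
  then have "0 <= r\<^sup>2 - 2 * r * cos \<kappa> + (cos \<kappa>)\<^sup>2" by (simp add: power2_eq_square algebra_simps)
  then show ?thesis using sin_cos_squared_add[of \<kappa>] by linarith
 qed
 ultimately have "(sin \<kappa>)\<^sup>2 <= (cmod (1 - exp w))\<^sup>2" by linarith
 then show ?thesis by (rule power2_le_imp_le) simp
qed

text \<open>
 Cauchy's integral formula in the coordinate \<open>exp t\<close>, whose kernel \<open>exp t / (exp t - exp \<zeta>)\<close> is
 \<open>1 / (1 - exp (\<zeta> - t))\<close> with respect to \<open>t\<close>. Its only pole with
 \<open>\<bar>Im (t - \<zeta>)\<bar> < 2 * pi\<close> is \<open>\<zeta>\<close>.
\<close>

lemma cauchy_exp_rectangle:
 assumes g: "g holomorphic_on D" and D: "convex D" "open D" and sub: "cbox a1 a3 \<subseteq> D"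
  and \<zeta>: "\<zeta> \<in> box a1 a3" and sm: "!!t. t \<in> D ==> \<bar>Im (t - \<zeta>)\<bar> < 2 * pi"
 shows "contour_integral (rectpath a1 a3) (%t. g t / (1 - exp (\<zeta> - t))) = 2 * pi * \<i> * g \<zeta>"
proof -
 let ?e = "%t. 1 - exp (\<zeta> - t)"
 define h where "h t = (if t = \<zeta> then deriv ?e \<zeta> else (?e t - ?e \<zeta>) / (t - \<zeta>))" for t
 have h: "h holomorphic_on D"
  unfolding h_def by (rule pole_lemma_open[OF _ D(2)]) (intro holomorphic_intros)
 have "(?e has_field_derivative 1) (at \<zeta>)" by (auto intro!: derivative_eq_intros)
 then have h\<zeta>: "h \<zeta> = 1" by (simp add: h_def DERIV_imp_deriv)
 have ez: "?e t \<noteq> 0" if t: "t \<in> D" "t \<noteq> \<zeta>" for t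
 proof
  assume "?e t = 0"
  then have "exp (\<zeta> - t) = 1" by simp
  then obtain n :: int where n: "Im (\<zeta> - t) = of_int (2 * n) * pi" and r: "Re (\<zeta> - t) = 0"
   unfolding exp_eq_1 by blast
  have "\<bar>real_of_int n\<bar> * (2 * pi) < 1 * (2 * pi)"
   using sm[OF t(1)] n by (simp add: abs_mult abs_minus_commute[of "Im t"])
  then have "\<bar>real_of_int n\<bar> < 1" by (subst (asm) mult_less_cancel_right_pos) auto
  then have "n = 0" by linarith
  then show False using n r t by (simp add: complex_eq_iff)
 qed
 have hne: "h t \<noteq> 0" if "t \<in> D" for t using ez[OF that] h\<zeta> by (cases "t = \<zeta>") (auto simp: h_def)
 have G: "(%t. g t / h t) holomorphic_on D" using g h hne by (intro holomorphic_intros) auto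
 have le: "Re a1 <= Re a3" "Im a1 <= Im a3" using \<zeta> by (auto simp: in_box_complex_iff)
 have pi: "path_image (rectpath a1 a3) \<subseteq> D - {\<zeta>}"
 proof -
  have "path_image (rectpath a1 a3) = cbox a1 a3 - box a1 a3" by (rule path_image_rectpath_cbox_minus_box[OF le])
  then show ?thesis using sub \<zeta> by auto
 qed
 have \<zeta>D: "\<zeta> \<in> interior D" using sub \<zeta> box_subset_cbox[of a1 a3] D(2) by (auto simp: interior_open)
 have "((%t. (g t / h t) / (t - \<zeta>)) has_contour_integral (2 * pi * \<i> * winding_number (rectpath a1 a3) \<zeta> * (g \<zeta> / h \<zeta>))) (rectpath a1 a3)"
  by (rule Cauchy_integral_formula_convex_simple[OF D(1) G \<zeta>D _ pi]) auto
 then have "((%t. (g t / h t) / (t - \<zeta>)) has_contour_integral (2 * pi * \<i> * g \<zeta>)) (rectpath a1 a3)"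
  using winding_number_rectpath[OF \<zeta>] h\<zeta> by simp
 then have "((%t. g t / (1 - exp (\<zeta> - t))) has_contour_integral (2 * pi * \<i> * g \<zeta>)) (rectpath a1 a3)"
 proof (rule has_contour_integral_eq)
  fix t assume "t \<in> path_image (rectpath a1 a3)"
  then have "t \<noteq> \<zeta>" using pi by auto
  then show "g t / h t / (t - \<zeta>) = g t / (1 - exp (\<zeta> - t))" by (simp add: h_def)
 qed
 then show ?thesis by (rule contour_integral_unique)
qed

lemma fact_Suc_sq: "(fact (Suc N))\<^sup>2 <= 4 ^ N * (fact N :: real)\<^sup>2"
proof -
 have "Suc N <= 2 ^ N" by (metis Suc_leI less_exp)
 then have "real (Suc N) <= 2 ^ N" by (metis of_nat_le_iff of_nat_numeral of_nat_power)
 then have "(real (Suc N))\<^sup>2 <= (2 ^ N)\<^sup>2" by (intro power_mono) auto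
 also have "(2 ^ N)\<^sup>2 = (4::real) ^ N" by (simp add: power2_eq_square power_mult_distrib[symmetric])
 finally have "(real (Suc N))\<^sup>2 * (fact N)\<^sup>2 <= 4 ^ N * (fact N :: real)\<^sup>2" by (intro mult_right_mono) auto
 then show ?thesis by (simp add: power_mult_distrib)
qed

lemma geometric_kernel:
 fixes x :: complex
 assumes "x \<noteq> 1"
 shows "1 / (1 - x) = (\<Sum>n<N. x ^ n) + x ^ N / (1 - x)"
proof -
 have "(1 - x) * (\<Sum>n<N. x ^ n) = 1 - x ^ N" by (metis one_diff_power_eq)
 then show ?thesis using assms by (simp add: field_simps)
qed

lemma cmod_vertical: "cmod (Complex x b - Complex x a) = \<bar>b - a\<bar>"
 by (simp add: cmod_def minus_complex.code)

text \<open>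
 Cut the \<open>\<epsilon>\<close>-plane along the ray of argument \<open>\<theta>\<close> and apply Cauchy's formula to the disc of radius \<open>R\<close> with
 this cut. The circle contributes a convergent power series, and the two sides of the cut contribute
 the Cauchy integral of the jump. Expanding the kernel in powers of \<open>\<epsilon>\<close> gives the coefficients
 \<open>\<integral> J(t) t^(- n - 1) dt\<close>, of size \<open>(n!)\<^sup>2\<close> by flatness of the jump, and a remainder of the same kind.
 The angle \<open>\<kappa>\<close> keeps \<open>\<epsilon>\<close> away from the cut.
\<close>

lemma cauchy_heine:
 fixes g :: "complex => complex"
 assumes \<theta>: "\<theta>1 < \<theta>" "\<theta> + 2 * pi < \<theta>2" and R: "0 < R" "R < \<rho>"
  and g: "g holomorphic_on log_sector \<rho> \<theta>1 \<theta>2"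
  and B: "!!t. cmod (exp t) <= R ==> \<theta> <= Im t ==> Im t <= \<theta> + 2 * pi ==> cmod (g t) <= B"
  and J: "!!t N. Im t = \<theta> ==> Re t <= ln R ==> cmod (g (t + 2 * pi * \<i>) - g t) <= C * A ^ N * exp (Re t) ^ N * (fact N)\<^sup>2"
  and A: "0 < A" and C: "0 <= C" and \<kappa>: "0 < \<kappa>" "\<kappa> < pi / 2"
 shows "\<exists>\<beta>. \<forall>\<zeta>. cmod (exp \<zeta>) <= R / 2 --> \<theta> + \<kappa> <= Im \<zeta> --> Im \<zeta> <= \<theta> + 2 * pi - \<kappa> -->
  gevrey_at (g \<zeta>) \<beta> (2 * B + C * A * R / sin \<kappa>) (1 / R + 4 * A) \<zeta>"
proof -
 define L where "L = ln R"
 have eL: "exp L = R" using R by (simp add: L_def)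
 have \<theta>': "\<theta>1 < \<theta> + 2 * pi" "\<theta> < \<theta>2" using \<theta> pi_gt_zero by linarith+
 have inS: "t \<in> log_sector \<rho> \<theta>1 \<theta>2" if "Re t <= L" "\<theta>1 < Im t" "Im t < \<theta>2" for t
 proof -
  have "exp (Re t) <= exp L" using that by simp
  then show ?thesis using that R eL by (simp add: log_sector_def)
 qed
 have B': "cmod (g t) <= B" if "Re t <= L" "\<theta> <= Im t" "Im t <= \<theta> + 2 * pi" for t
 proof -
  have "exp (Re t) <= exp L" using that by simp
  then show ?thesis using that eL by (intro B) auto
 qed
 have B0: "0 <= B" using B'[of "Complex L \<theta>"] by (simp add: order_trans[OF norm_ge_zero])
 have gc: "continuous_on (log_sector \<rho> \<theta>1 \<theta>2) g" by (rule holomorphic_on_imp_continuous_on[OF g])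
 define Jf where "Jf t = g (t + 2 * pi * \<i>) - g t" for t
 have Jc: "continuous_on {t. Im t = \<theta> & Re t <= L} Jf"
  unfolding Jf_def
  by (intro continuous_intros continuous_on_compose2[OF gc]) (use \<theta> \<theta>' in \<open>auto intro!: inS\<close>)
 have Jb: "cmod (Jf t * exp (- (of_nat n * t))) <= (C * A ^ Suc n * (fact (Suc n))\<^sup>2) * exp (Re t)" if "Im t = \<theta>" "Re t <= L" for t n
 proof -
  have "cmod (Jf t) <= C * A ^ Suc n * exp (Re t) ^ Suc n * (fact (Suc n))\<^sup>2"
   using J[OF that(1), of "Suc n"] that(2) by (simp add: Jf_def L_def)
  moreover have "cmod (exp (- (of_nat n * t))) = exp (- (real n * Re t))" by simp
  ultimately have "cmod (Jf t * exp (- (of_nat n * t))) <= (C * A ^ Suc n * exp (Re t) ^ Suc n * (fact (Suc n))\<^sup>2) * exp (- (real n * Re t))"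
   unfolding norm_mult by (metis mult_right_mono exp_ge_zero)
  also have "exp (Re t) ^ Suc n = exp (Re t) * exp (real n * Re t)" by (simp add: exp_of_nat_mult)
  also have "(C * A ^ Suc n * (exp (Re t) * exp (real n * Re t)) * (fact (Suc n))\<^sup>2) * exp (- (real n * Re t))
    = (C * A ^ Suc n * (fact (Suc n))\<^sup>2) * exp (Re t) * (exp (real n * Re t) * exp (- (real n * Re t)))" by (simp add: mult_ac)
  finally show ?thesis by (simp add: exp_add[symmetric])
 qed
 define Rr where "Rr n = contour_integral (linepath (Complex L \<theta>) (Complex L (\<theta> + 2 * pi))) (%t. g t * exp (- (of_nat n * t)))" for n
 define I where "I n j = contour_integral (linepath (Complex (L - real j) \<theta>) (Complex L \<theta>)) (%t. Jf t * exp (- (of_nat n * t)))" for n j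
 have "convergent (I n)" for n
  unfolding I_def[abs_def]
  by (rule tail_integral(2)[where c = "C * A ^ Suc n * (fact (Suc n))\<^sup>2"])
    (use Jb A C in \<open>auto intro!: continuous_intros Jc\<close>)
 then have Ilim: "I n \<longlonglongrightarrow> lim (I n)" for n by (simp add: convergent_LIMSEQ_iff)
 define \<beta> where "\<beta> n = (Rr n - lim (I n)) / (2 * pi * \<i>)" for n
 have "cmod (g \<zeta> - (\<Sum>n<N. \<beta> n * exp \<zeta> ^ n)) <= (2 * B + C * A * R / sin \<kappa>) * (1 / R + 4 * A) ^ N * cmod (exp \<zeta>) ^ N * (fact N)\<^sup>2"
  if \<zeta>: "cmod (exp \<zeta>) <= R / 2" "\<theta> + \<kappa> <= Im \<zeta>" "Im \<zeta> <= \<theta> + 2 * pi - \<kappa>" for \<zeta> N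
 proof -
  define x where "x = cmod (exp \<zeta>)"
  have x0: "0 < x" by (simp add: x_def)
  have xe: "x = exp (Re \<zeta>)" by (simp add: x_def)
  have ReL: "Re \<zeta> < L"
  proof -
   have "exp (Re \<zeta>) < exp L" using \<zeta>(1) R eL by simp
   then show ?thesis by simp
  qed
  let ?k = "%t. 1 / (1 - exp (\<zeta> - t))"
  define s where "s = sin \<kappa>"
  have s0: "0 < s" unfolding s_def using \<kappa> by (intro sin_gt_zero2) auto
  have kb: "cmod (?k t) <= 1 / s" and kne: "exp (\<zeta> - t) \<noteq> 1" if "Im t = \<theta>" for t
  proof -
   have "s <= cmod (1 - exp (\<zeta> - t))" unfolding s_def using \<zeta> that by (intro one_minus_exp_bound[OF \<kappa>]) auto
   then show "cmod (?k t) <= 1 / s" "exp (\<zeta> - t) \<noteq> 1" using s0 by (auto simp: norm_divide divide_simps)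
  qed
  have kb_r: "cmod (?k t) <= 2" and kne_r: "exp (\<zeta> - t) \<noteq> 1" if "Re t = L" for t
  proof -
   have "cmod (exp (\<zeta> - t)) = x / R" unfolding xe using that eL by (simp add: exp_diff norm_divide)
   also have "\<dots> <= 1 / 2" using \<zeta>(1) R by (simp add: x_def field_simps)
   finally have e: "cmod (exp (\<zeta> - t)) <= 1 / 2" .
   show "exp (\<zeta> - t) \<noteq> 1"
   proof
    assume h: "exp (\<zeta> - t) = 1"
    show False using e unfolding h by simp
   qed
   have "1 / 2 <= cmod (1 - exp (\<zeta> - t))" using norm_triangle_ineq2[of 1 "exp (\<zeta> - t)"] e by simp
   then show "cmod (?k t) <= 2" by (auto simp: norm_divide divide_simps)
  qed
  \<comment> \<open>a finite geometric series for the kernel gives the partial sum and the remainder on each path\<close>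
  have expand: "\<phi> t * ?k t = (\<Sum>n<N. exp \<zeta> ^ n * (\<phi> t * exp (- (of_nat n * t)))) + exp \<zeta> ^ N * (\<phi> t * exp (- (of_nat N * t)) * ?k t)"
   if "exp (\<zeta> - t) \<noteq> 1" for \<phi> :: "complex => complex" and t
  proof -
   have p: "exp (\<zeta> - t) ^ n = exp \<zeta> ^ n * exp (- (of_nat n * t))" for n
    by (simp add: exp_of_nat_mult[symmetric] exp_add[symmetric] algebra_simps)
   have "?k t = (\<Sum>n<N. exp (\<zeta> - t) ^ n) + exp (\<zeta> - t) ^ N * ?k t"
    by (rule trans[OF geometric_kernel[OF that, of N]]) simp
   then have "\<phi> t * ?k t = \<phi> t * ((\<Sum>n<N. exp \<zeta> ^ n * exp (- (of_nat n * t))) + exp \<zeta> ^ N * exp (- (of_nat N * t)) * ?k t)"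
    unfolding p by metis
   then show ?thesis by (simp add: sum_distrib_left algebra_simps)
  qed
  have seg_b: "t \<in> closed_segment (Complex y \<theta>) (Complex L \<theta>) \<longleftrightarrow> Im t = \<theta> & y <= Re t & Re t <= L" if "y <= L" for y t
   using that by (auto simp: closed_segment_same_Im closed_segment_eq_real_ivl)
  have seg_r: "t \<in> closed_segment (Complex y \<theta>) (Complex y (\<theta> + 2 * pi)) \<longleftrightarrow> Re t = y & \<theta> <= Im t & Im t <= \<theta> + 2 * pi" for y t
   by (auto simp: closed_segment_same_Re closed_segment_eq_real_ivl)
  define Kb where "Kb j = contour_integral (linepath (Complex (L - real j) \<theta>) (Complex L \<theta>)) (%t. Jf t * exp (- (of_nat N * t)) * ?k t)" for j
  have kc: "continuous_on {t. Im t = \<theta> & Re t <= L} ?k" using kne by (intro continuous_intros) (auto simp: eq_commute[of 1])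
  have Jkc: "continuous_on {t. Im t = \<theta> & Re t <= L} (%t. Jf t * exp (- (of_nat n * t)) * ?k t)" for n
   by (intro continuous_on_mult Jc kc continuous_intros)
  have Kbb: "cmod (Kb j) <= 2 * (C * A ^ Suc N * (fact (Suc N))\<^sup>2 / s) * R" for j
   unfolding Kb_def eL[symmetric]
  proof (rule tail_integral(1)[OF Jkc])
   fix t assume t: "Im t = \<theta>" "Re t <= L"
   have "cmod (Jf t * exp (- (of_nat N * t))) * cmod (?k t) <= (C * A ^ Suc N * (fact (Suc N))\<^sup>2 * exp (Re t)) * (1 / s)"
    by (intro mult_mono Jb kb t) (use A C in auto)
   then show "cmod (Jf t * exp (- (of_nat N * t)) * ?k t) <= (C * A ^ Suc N * (fact (Suc N))\<^sup>2 / s) * exp (Re t)"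
    unfolding norm_mult by (simp add: mult_ac)
  qed (use A C s0 in auto)
  have bottom: "contour_integral (linepath (Complex (L - real j) \<theta>) (Complex L \<theta>)) (%t. Jf t * ?k t) = (\<Sum>n<N. exp \<zeta> ^ n * I n j) + exp \<zeta> ^ N * Kb j" for j
  proof -
   let ?l = "linepath (Complex (L - real j) \<theta>) (Complex L \<theta>)"
   have ci: "\<phi> contour_integrable_on ?l" if "continuous_on {t. Im t = \<theta> & Re t <= L} \<phi>" for \<phi>
    by (rule contour_integrable_continuous_linepath[OF continuous_on_line[OF that]]) auto
   have c1: "(%t. Jf t * exp (- (of_nat n * t))) contour_integrable_on ?l" for n
    by (intro ci continuous_on_mult Jc continuous_intros)
   have c2: "(%t. Jf t * exp (- (of_nat N * t)) * ?k t) contour_integrable_on ?l" by (rule ci[OF Jkc])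
   have "contour_integral ?l (%t. Jf t * ?k t) =
     contour_integral ?l (%t. (\<Sum>n<N. exp \<zeta> ^ n * (Jf t * exp (- (of_nat n * t)))) + exp \<zeta> ^ N * (Jf t * exp (- (of_nat N * t)) * ?k t))"
    by (rule contour_integral_eq) (use expand kne seg_b in auto)
   also have "\<dots> = contour_integral ?l (%t. (\<Sum>n<N. exp \<zeta> ^ n * (Jf t * exp (- (of_nat n * t))))) + contour_integral ?l (%t. exp \<zeta> ^ N * (Jf t * exp (- (of_nat N * t)) * ?k t))"
    by (intro contour_integral_add contour_integrable_sum contour_integrable_lmul c1 c2) auto
   also have "contour_integral ?l (%t. (\<Sum>n<N. exp \<zeta> ^ n * (Jf t * exp (- (of_nat n * t))))) = (\<Sum>n<N. contour_integral ?l (%t. exp \<zeta> ^ n * (Jf t * exp (- (of_nat n * t)))))"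
    by (rule contour_integral_sum) (auto intro!: contour_integrable_lmul c1)
   also have "\<dots> = (\<Sum>n<N. exp \<zeta> ^ n * I n j)"
    unfolding I_def by (intro sum.cong refl contour_integral_lmul c1)
   also have "contour_integral ?l (%t. exp \<zeta> ^ N * (Jf t * exp (- (of_nat N * t)) * ?k t)) = exp \<zeta> ^ N * Kb j"
    unfolding Kb_def by (rule contour_integral_lmul[OF c2])
   finally show ?thesis .
  qed
  define Kr where "Kr = contour_integral (linepath (Complex L \<theta>) (Complex L (\<theta> + 2 * pi))) (%t. g t * exp (- (of_nat N * t)) * ?k t)"
  let ?r = "linepath (Complex L \<theta>) (Complex L (\<theta> + 2 * pi))"
  have gr: "continuous_on (closed_segment (Complex L \<theta>) (Complex L (\<theta> + 2 * pi))) g"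
   by (rule continuous_on_subset[OF gc]) (use \<theta> seg_r in \<open>auto intro!: inS\<close>)
  have kr: "continuous_on (closed_segment (Complex L \<theta>) (Complex L (\<theta> + 2 * pi))) ?k"
   using kne_r seg_r by (intro continuous_intros) (auto simp: eq_commute[of 1])
  have c1: "(%t. g t * exp (- (of_nat n * t))) contour_integrable_on ?r" for n
   by (intro contour_integrable_continuous_linepath continuous_on_mult gr continuous_intros)
  have c2: "(%t. g t * exp (- (of_nat N * t)) * ?k t) contour_integrable_on ?r"
   by (intro contour_integrable_continuous_linepath continuous_on_mult gr kr continuous_intros)
  have right: "contour_integral ?r (%t. g t * ?k t) = (\<Sum>n<N. exp \<zeta> ^ n * Rr n) + exp \<zeta> ^ N * Kr"
  proof -
   have "contour_integral ?r (%t. g t * ?k t) =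
     contour_integral ?r (%t. (\<Sum>n<N. exp \<zeta> ^ n * (g t * exp (- (of_nat n * t)))) + exp \<zeta> ^ N * (g t * exp (- (of_nat N * t)) * ?k t))"
    by (rule contour_integral_eq) (use expand kne_r seg_r in auto)
   also have "\<dots> = contour_integral ?r (%t. (\<Sum>n<N. exp \<zeta> ^ n * (g t * exp (- (of_nat n * t))))) + contour_integral ?r (%t. exp \<zeta> ^ N * (g t * exp (- (of_nat N * t)) * ?k t))"
    by (intro contour_integral_add contour_integrable_sum contour_integrable_lmul c1 c2) auto
   also have "contour_integral ?r (%t. (\<Sum>n<N. exp \<zeta> ^ n * (g t * exp (- (of_nat n * t))))) = (\<Sum>n<N. contour_integral ?r (%t. exp \<zeta> ^ n * (g t * exp (- (of_nat n * t)))))"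
    by (rule contour_integral_sum) (auto intro!: contour_integrable_lmul c1)
   also have "\<dots> = (\<Sum>n<N. exp \<zeta> ^ n * Rr n)"
    unfolding Rr_def by (intro sum.cong refl contour_integral_lmul c1)
   also have "contour_integral ?r (%t. exp \<zeta> ^ N * (g t * exp (- (of_nat N * t)) * ?k t)) = exp \<zeta> ^ N * Kr"
    unfolding Kr_def by (rule contour_integral_lmul[OF c2])
   finally show ?thesis .
  qed
  have Krb: "cmod Kr <= (B * (1 / R) ^ N * 2) * (2 * pi)"
  proof -
   have "cmod Kr <= (B * (1 / R) ^ N * 2) * cmod (Complex L (\<theta> + 2 * pi) - Complex L \<theta>)"
    unfolding Kr_def
   proof (rule contour_integral_bound_linepath[OF c2])
    fix t assume "t \<in> closed_segment (Complex L \<theta>) (Complex L (\<theta> + 2 * pi))"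
    then have t: "Re t = L" "\<theta> <= Im t" "Im t <= \<theta> + 2 * pi" using seg_r by auto
    have "cmod (exp (- (of_nat N * t))) = (1 / R) ^ N"
    proof -
     have "cmod (exp (- (of_nat N * t))) = exp (real N * (- L))" using t by simp
     also have "\<dots> = exp (- L) ^ N" by (rule exp_of_nat_mult)
     also have "exp (- L) = 1 / R" using eL by (simp add: exp_minus inverse_eq_divide)
     finally show ?thesis .
    qed
    then have "cmod (g t) * cmod (exp (- (of_nat N * t))) * cmod (?k t) <= B * (1 / R) ^ N * 2"
     using R B0 t by (intro mult_mono B' kb_r) auto
    then show "cmod (g t * exp (- (of_nat N * t)) * ?k t) <= B * (1 / R) ^ N * 2" unfolding norm_mult by simp
   qed (use B0 R in auto)
   also have "cmod (Complex L (\<theta> + 2 * pi) - Complex L \<theta>) = 2 * pi" by (simp add: cmod_vertical)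
   finally show ?thesis .
  qed
  define Lf where "Lf j = contour_integral (linepath (Complex (L - real j) (\<theta> + 2 * pi)) (Complex (L - real j) \<theta>)) (%t. g t * ?k t)" for j
  define j0 where "j0 = nat \<lceil>L - Re \<zeta> + 1\<rceil>"
  have j0: "L - real j + 1 <= Re \<zeta>" if "j0 <= j" for j
  proof -
   have "L - Re \<zeta> + 1 <= real j0" unfolding j0_def by linarith
   then show ?thesis using that by linarith
  qed
  have k_l: "cmod (?k t) <= 2 * exp (L - real j - Re \<zeta>)" "exp (\<zeta> - t) \<noteq> 1" if "j0 <= j" "Re t = L - real j" for j t
  proof -
   define E where "E = exp (\<zeta> - t)"
   have nE: "cmod E = exp (Re \<zeta> - (L - real j))" unfolding E_def using that by simp
   have "2 <= 1 + (Re \<zeta> - (L - real j))" using j0[OF that(1)] by linarith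
   also have "\<dots> <= cmod E" unfolding nE by (rule exp_ge_add_one_self)
   finally have E2: "2 <= cmod E" .
   then show "exp (\<zeta> - t) \<noteq> 1" unfolding E_def[symmetric] by auto
   have "cmod E / 2 <= cmod (1 - E)" using norm_triangle_ineq2[of E 1] E2 by (simp add: norm_minus_commute)
   then have "1 / cmod (1 - E) <= 1 / (cmod E / 2)" using E2 by (intro divide_left_mono) (auto intro!: mult_pos_pos)
   also have "\<dots> = 2 * exp (L - real j - Re \<zeta>)" unfolding nE by (simp add: exp_diff mult_ac)
   finally show "cmod (?k t) <= 2 * exp (L - real j - Re \<zeta>)" by (simp add: norm_divide E_def)
  qed
  have gl: "continuous_on (closed_segment (Complex (L - real j) (\<theta> + 2 * pi)) (Complex (L - real j) \<theta>)) (%t. g t * ?k t)" if "j0 <= j" for j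
  proof (intro continuous_on_mult)
   let ?s = "closed_segment (Complex (L - real j) (\<theta> + 2 * pi)) (Complex (L - real j) \<theta>)"
   have m: "t \<in> ?s \<longleftrightarrow> Re t = L - real j & \<theta> <= Im t & Im t <= \<theta> + 2 * pi" for t
    using seg_r[of t "L - real j"] by (simp add: closed_segment_commute)
   show "continuous_on ?s g" by (rule continuous_on_subset[OF gc]) (use \<theta> \<theta>' m in \<open>auto intro!: inS\<close>)
   show "continuous_on ?s ?k" using k_l(2)[OF that] m by (intro continuous_intros) (auto simp: eq_commute[of 1])
  qed
  have Lfb: "cmod (Lf j) <= (B * (2 * exp (L - real j - Re \<zeta>))) * (2 * pi)" if j: "j0 <= j" for j
  proof -
   have "cmod (Lf j) <= (B * (2 * exp (L - real j - Re \<zeta>))) * cmod (Complex (L - real j) \<theta> - Complex (L - real j) (\<theta> + 2 * pi))"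
    unfolding Lf_def
   proof (rule contour_integral_bound_linepath)
    show "(%t. g t * ?k t) contour_integrable_on linepath (Complex (L - real j) (\<theta> + 2 * pi)) (Complex (L - real j) \<theta>)"
     by (rule contour_integrable_continuous_linepath[OF gl[OF j]])
    fix t assume "t \<in> closed_segment (Complex (L - real j) (\<theta> + 2 * pi)) (Complex (L - real j) \<theta>)"
    then have t: "Re t = L - real j" "\<theta> <= Im t" "Im t <= \<theta> + 2 * pi"
     using seg_r[of t "L - real j"] by (auto simp: closed_segment_commute)
    then have "cmod (g t) * cmod (?k t) <= B * (2 * exp (L - real j - Re \<zeta>))"
     using B0 by (intro mult_mono B' k_l j) auto
    then show "cmod (g t * ?k t) <= B * (2 * exp (L - real j - Re \<zeta>))" unfolding norm_mult by simp
   qed (use B0 in auto)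
   also have "cmod (Complex (L - real j) \<theta> - Complex (L - real j) (\<theta> + 2 * pi)) = 2 * pi" by (simp add: cmod_vertical)
   finally show ?thesis .
  qed
  have main: "2 * pi * \<i> * g \<zeta> = (\<Sum>n<N. exp \<zeta> ^ n * (Rr n - I n j)) + exp \<zeta> ^ N * (Kr - Kb j) + Lf j" if j: "j0 <= j" for j
  proof -
   let ?a1 = "Complex (L - real j) \<theta>" and ?a2 = "Complex L \<theta>" and ?a3 = "Complex L (\<theta> + 2 * pi)" and ?a4 = "Complex (L - real j) (\<theta> + 2 * pi)"
   let ?F = "%t. g t * ?k t"
   have jL: "L - real j <= L" by simp
   define \<mu> where "\<mu> = min \<kappa> (min (\<theta> - \<theta>1) (\<theta>2 - (\<theta> + 2 * pi)))"
   have \<mu>: "0 < \<mu>" "\<mu> <= \<kappa>" "\<theta>1 <= \<theta> - \<mu>" "\<theta> + 2 * pi + \<mu> <= \<theta>2" using \<kappa> \<theta> by (auto simp: \<mu>_def)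
   define D where "D = {t. Re t < ln \<rho>} \<inter> hstrip (\<theta> - \<mu>) (\<theta> + 2 * pi + \<mu>)"
   have D: "convex D" "open D" unfolding D_def
    by (auto intro!: convex_Int open_Int convex_halfspace_Re_lt open_halfspace_Re_lt)
   have DS: "D \<subseteq> log_sector \<rho> \<theta>1 \<theta>2"
   proof
    fix t assume t: "t \<in> D"
    then have "exp (Re t) < exp (ln \<rho>)" by (simp add: D_def)
    then show "t \<in> log_sector \<rho> \<theta>1 \<theta>2" using t R \<mu> by (auto simp: D_def log_sector_def)
   qed
   have Lrho: "L < ln \<rho>" unfolding L_def using R by simp
   have "contour_integral (rectpath ?a1 ?a3) (%t. g t / (1 - exp (\<zeta> - t))) = 2 * pi * \<i> * g \<zeta>"
   proof (rule cauchy_exp_rectangle[OF holomorphic_on_subset[OF g DS] D])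
    show "cbox ?a1 ?a3 \<subseteq> D" using Lrho \<mu> by (auto simp: D_def in_cbox_complex_iff)
    show "\<zeta> \<in> box ?a1 ?a3" using j0[OF j] ReL \<zeta> \<kappa> by (auto simp: in_box_complex_iff)
    show "\<bar>Im (t - \<zeta>)\<bar> < 2 * pi" if "t \<in> D" for t using that \<zeta> \<mu> by (auto simp: D_def abs_less_iff)
   qed
   then have total: "contour_integral (rectpath ?a1 ?a3) ?F = 2 * pi * \<i> * g \<zeta>" by simp
   have cb: "continuous_on (closed_segment ?a1 ?a2) ?F"
   proof (intro continuous_on_mult)
    show "continuous_on (closed_segment ?a1 ?a2) g"
     by (rule continuous_on_subset[OF gc]) (use \<theta> \<theta>' seg_b[OF jL] in \<open>auto intro!: inS\<close>)
    show "continuous_on (closed_segment ?a1 ?a2) ?k" by (rule continuous_on_subset[OF kc]) (use seg_b[OF jL] in auto)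
   qed
   have pk: "?k (t + 2 * pi * \<i>) = ?k t" for t
   proof -
    have "exp (\<zeta> - (t + 2 * pi * \<i>)) = exp (\<zeta> - t - 2 * of_real pi * \<i>)" by (simp add: algebra_simps)
    also have "\<dots> = exp (\<zeta> - t)" by (simp add: exp_diff)
    finally show ?thesis by simp
   qed
   have cb2: "continuous_on (closed_segment ?a1 ?a2) (%t. ?F (t + 2 * pi * \<i>))"
    unfolding pk
   proof (intro continuous_on_mult)
    show "continuous_on (closed_segment ?a1 ?a2) (%t. g (t + 2 * pi * \<i>))"
    proof (rule continuous_on_compose2[OF gc, where f = "%t. t + 2 * pi * \<i>"])
     show "(%t. t + 2 * pi * \<i>) ` closed_segment ?a1 ?a2 \<subseteq> log_sector \<rho> \<theta>1 \<theta>2"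
     proof (rule image_subsetI)
      fix t assume "t \<in> closed_segment ?a1 ?a2"
      then have "Im t = \<theta>" "Re t <= L" using seg_b[OF jL] by blast+
      then show "t + 2 * pi * \<i> \<in> log_sector \<rho> \<theta>1 \<theta>2" using \<theta> \<theta>' by (intro inS) simp_all
     qed
    qed (intro continuous_intros)
    show "continuous_on (closed_segment ?a1 ?a2) ?k" by (rule continuous_on_subset[OF kc]) (use seg_b[OF jL] in auto)
   qed
   have sh: "?a1 + 2 * pi * \<i> = ?a4" "?a2 + 2 * pi * \<i> = ?a3" by (auto simp: complex_eq_iff)
   have seg_t: "closed_segment ?a4 ?a3 = (%t. t + 2 * pi * \<i>) ` closed_segment ?a1 ?a2"
    unfolding sh[symmetric] by (simp only: add.commute[of _ "2 * pi * \<i>"] closed_segment_translation)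
   have ct: "continuous_on (closed_segment ?a4 ?a3) ?F"
   proof (intro continuous_on_mult)
    have m: "t \<in> closed_segment ?a4 ?a3 ==> Im t = \<theta> + 2 * pi & Re t <= L" for t
    proof -
     assume "t \<in> closed_segment ?a4 ?a3"
     then obtain t' where t': "t = t' + 2 * pi * \<i>" "t' \<in> closed_segment ?a1 ?a2" unfolding seg_t by blast
     have "Im t' = \<theta>" "Re t' <= L" using t'(2) seg_b[OF jL] by blast+
     then show "Im t = \<theta> + 2 * pi & Re t <= L" unfolding t'(1) by simp
    qed
    show "continuous_on (closed_segment ?a4 ?a3) g"
     by (rule continuous_on_subset[OF gc]) (use \<theta> \<theta>' m in \<open>auto intro!: inS\<close>)
    show "continuous_on (closed_segment ?a4 ?a3) ?k"
    proof (intro continuous_intros)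
     show "\<forall>t\<in>closed_segment ?a4 ?a3. 1 - exp (\<zeta> - t) \<noteq> 0"
     proof
      fix t assume "t \<in> closed_segment ?a4 ?a3"
      then obtain t' where t': "t = t' + 2 * pi * \<i>" "t' \<in> closed_segment ?a1 ?a2" unfolding seg_t by blast
      have "exp (\<zeta> - t) = exp (\<zeta> - t' - 2 * of_real pi * \<i>)" unfolding t' by (simp add: algebra_simps)
      also have "\<dots> = exp (\<zeta> - t')" by (simp add: exp_diff)
      finally show "1 - exp (\<zeta> - t) \<noteq> 0" using kne[of t'] t'(2) seg_b[OF jL] by auto
     qed
    qed
   qed
   have cr: "continuous_on (closed_segment ?a2 ?a3) ?F" by (intro continuous_on_mult gr kr)
   have int: "?F contour_integrable_on linepath ?a1 ?a2" "?F contour_integrable_on linepath ?a2 ?a3"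
    "?F contour_integrable_on linepath ?a3 ?a4" "?F contour_integrable_on linepath ?a4 ?a1"
    using cb cr ct gl[OF j] by (auto intro!: contour_integrable_continuous_linepath simp: closed_segment_commute)
   have "2 * pi * \<i> * g \<zeta> = contour_integral (linepath ?a1 ?a2) ?F + contour_integral (linepath ?a2 ?a3) ?F
     + contour_integral (linepath ?a3 ?a4) ?F + contour_integral (linepath ?a4 ?a1) ?F"
    unfolding total[symmetric] rectpath_def Let_def using int by simp
   also have "contour_integral (linepath ?a3 ?a4) ?F = - contour_integral (linepath ?a4 ?a3) ?F"
    using contour_integral_reverse_linepath[OF ct] by simp
   also have "contour_integral (linepath ?a4 ?a3) ?F = contour_integral (linepath ?a1 ?a2) (%t. ?F (t + 2 * pi * \<i>))"
    unfolding sh[symmetric] by (rule linepath_integral_shift)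
   finally have "2 * pi * \<i> * g \<zeta> = contour_integral (linepath ?a2 ?a3) ?F - (contour_integral (linepath ?a1 ?a2) (%t. ?F (t + 2 * pi * \<i>)) - contour_integral (linepath ?a1 ?a2) ?F)
     + contour_integral (linepath ?a4 ?a1) ?F" by (simp add: algebra_simps)
   also have "contour_integral (linepath ?a1 ?a2) (%t. ?F (t + 2 * pi * \<i>)) - contour_integral (linepath ?a1 ?a2) ?F
     = contour_integral (linepath ?a1 ?a2) (%t. ?F (t + 2 * pi * \<i>) - ?F t)"
    by (rule contour_integral_diff[symmetric, OF contour_integrable_continuous_linepath[OF cb2] contour_integrable_continuous_linepath[OF cb]])
   also have "(%t. ?F (t + 2 * pi * \<i>) - ?F t) = (%t. Jf t * ?k t)" unfolding pk Jf_def by (simp add: algebra_simps)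
   also have "contour_integral (linepath ?a4 ?a1) ?F = Lf j" by (simp add: Lf_def)
   finally show ?thesis unfolding bottom right by (simp add: algebra_simps sum_subtractf sum.distrib)
  qed
  define Bd where "Bd = x ^ N * ((B * (1 / R) ^ N * 2) * (2 * pi) + 2 * (C * A ^ Suc N * (fact (Suc N))\<^sup>2 / s) * R)"
  have est: "cmod (2 * pi * \<i> * g \<zeta> - (\<Sum>n<N. exp \<zeta> ^ n * (Rr n - lim (I n)))) <= Bd"
  proof (rule LIMSEQ_le[where X = "%j. cmod (2 * pi * \<i> * g \<zeta> - (\<Sum>n<N. exp \<zeta> ^ n * (Rr n - I n j)))"])
   show "(%j. cmod (2 * pi * \<i> * g \<zeta> - (\<Sum>n<N. exp \<zeta> ^ n * (Rr n - I n j)))) \<longlonglongrightarrow> cmod (2 * pi * \<i> * g \<zeta> - (\<Sum>n<N. exp \<zeta> ^ n * (Rr n - lim (I n))))"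
    by (intro tendsto_intros Ilim)
   have "(%j. exp (L - real j - Re \<zeta>)) \<longlonglongrightarrow> 0" by real_asymp
   then have "(%j. Bd + (B * (2 * exp (L - real j - Re \<zeta>))) * (2 * pi)) \<longlonglongrightarrow> Bd + (B * (2 * 0)) * (2 * pi)"
    by (intro tendsto_intros)
   then show "(%j. Bd + (B * (2 * exp (L - real j - Re \<zeta>))) * (2 * pi)) \<longlonglongrightarrow> Bd" by simp
   have "cmod (2 * pi * \<i> * g \<zeta> - (\<Sum>n<N. exp \<zeta> ^ n * (Rr n - I n j))) <= Bd + (B * (2 * exp (L - real j - Re \<zeta>))) * (2 * pi)" if j: "j0 <= j" for j
   proof -
    have "2 * pi * \<i> * g \<zeta> - (\<Sum>n<N. exp \<zeta> ^ n * (Rr n - I n j)) = exp \<zeta> ^ N * (Kr - Kb j) + Lf j" unfolding main[OF j] by simp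
    then have "cmod (2 * pi * \<i> * g \<zeta> - (\<Sum>n<N. exp \<zeta> ^ n * (Rr n - I n j))) <= cmod (exp \<zeta> ^ N * (Kr - Kb j)) + cmod (Lf j)"
     using norm_triangle_ineq by metis
    also have "cmod (exp \<zeta> ^ N * (Kr - Kb j)) = x ^ N * cmod (Kr - Kb j)" by (simp add: norm_mult norm_power x_def)
    also have "\<dots> <= Bd" unfolding Bd_def
     using norm_triangle_ineq4[of Kr "Kb j"] Krb Kbb[of j] x0 by (intro mult_left_mono) auto
    finally show ?thesis using Lfb[OF j] by linarith
   qed
   then show "\<exists>M. \<forall>j\<ge>M. cmod (2 * pi * \<i> * g \<zeta> - (\<Sum>n<N. exp \<zeta> ^ n * (Rr n - I n j))) <= Bd + (B * (2 * exp (L - real j - Re \<zeta>))) * (2 * pi)" by blast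
  qed
  have \<beta>s: "2 * pi * \<i> * (\<Sum>n<N. \<beta> n * exp \<zeta> ^ n) = (\<Sum>n<N. exp \<zeta> ^ n * (Rr n - lim (I n)))"
   unfolding sum_distrib_left by (rule sum.cong) (auto simp: \<beta>_def)
  have eq: "2 * pi * \<i> * (g \<zeta> - (\<Sum>n<N. \<beta> n * exp \<zeta> ^ n)) = 2 * pi * \<i> * g \<zeta> - (\<Sum>n<N. exp \<zeta> ^ n * (Rr n - lim (I n)))"
   unfolding right_diff_distrib \<beta>s ..
  have "2 * pi * cmod (g \<zeta> - (\<Sum>n<N. \<beta> n * exp \<zeta> ^ n)) = cmod (2 * pi * \<i> * (g \<zeta> - (\<Sum>n<N. \<beta> n * exp \<zeta> ^ n)))"
   by (simp add: norm_mult)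
  then have "2 * pi * cmod (g \<zeta> - (\<Sum>n<N. \<beta> n * exp \<zeta> ^ n)) <= Bd"
   using est unfolding eq by linarith
  then have "cmod (g \<zeta> - (\<Sum>n<N. \<beta> n * exp \<zeta> ^ n)) <= Bd / (2 * pi)" by (simp add: field_simps)
  also have "Bd / (2 * pi) = x ^ N * (2 * B * (1 / R) ^ N + (C * A ^ Suc N * (fact (Suc N))\<^sup>2 / s) * R / pi)"
   unfolding Bd_def by (simp add: field_simps)
  also have "\<dots> <= x ^ N * (2 * B * ((1 / R + 4 * A) ^ N * (fact N)\<^sup>2) + C * A * R / s * ((1 / R + 4 * A) ^ N * (fact N)\<^sup>2))"
  proof (intro mult_left_mono add_mono)
   have f1: "1 <= (fact N :: real)\<^sup>2" by (simp add: one_le_power)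
   have "(1 / R) ^ N * 1 <= (1 / R + 4 * A) ^ N * (fact N)\<^sup>2"
    using R A f1 by (intro mult_mono power_mono) auto
   then show "(1 / R) ^ N <= (1 / R + 4 * A) ^ N * (fact N)\<^sup>2" by simp
   have "A ^ N * (fact (Suc N))\<^sup>2 <= A ^ N * (4 ^ N * (fact N)\<^sup>2)" using A fact_Suc_sq by (intro mult_left_mono) auto
   also have "\<dots> = (4 * A) ^ N * (fact N)\<^sup>2" by (simp add: power_mult_distrib)
   also have "\<dots> <= (1 / R + 4 * A) ^ N * (fact N)\<^sup>2" using R A by (intro mult_right_mono power_mono) auto
   finally have m: "A ^ N * (fact (Suc N))\<^sup>2 <= (1 / R + 4 * A) ^ N * (fact N)\<^sup>2" .
   have "(C * A ^ Suc N * (fact (Suc N))\<^sup>2 / s) * R / pi <= (C * A ^ Suc N * (fact (Suc N))\<^sup>2 / s) * R / 1"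
    using C A s0 R pi_gt3 by (intro divide_left_mono) auto
   also have "\<dots> = C * A * R / s * (A ^ N * (fact (Suc N))\<^sup>2)" by simp
   also have "\<dots> <= C * A * R / s * ((1 / R + 4 * A) ^ N * (fact N)\<^sup>2)" using C A R s0 by (intro mult_left_mono m) auto
   finally show "(C * A ^ Suc N * (fact (Suc N))\<^sup>2 / s) * R / pi <= C * A * R / s * ((1 / R + 4 * A) ^ N * (fact N)\<^sup>2)" .
  qed (use B0 x0 in auto)
  also have "\<dots> = (2 * B + C * A * R / s) * (1 / R + 4 * A) ^ N * x ^ N * (fact N)\<^sup>2" by (simp add: algebra_simps)
  finally show ?thesis by (simp add: x_def s_def)
 qed
 then show ?thesis unfolding gevrey_at_def by blast
qed

lemma fact_double_le: "fact (2 * N) <= 4 ^ N * (fact N :: real)\<^sup>2"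
proof -
 have "fact (2 * N) = real ((2 * N) choose N) * (fact N)\<^sup>2"
  using binomial_fact_lemma[of N "2 * N"]
  by (metis (no_types, lifting) add_diff_cancel_right' le_add2 mult.commute mult_2 of_nat_fact of_nat_mult power2_eq_square)
 moreover have "real ((2 * N) choose N) <= 4 ^ N"
 proof -
  have "real ((2 * N) choose N) <= real (2 ^ (2 * N))" by (intro of_nat_mono binomial_le_pow2)
  also have "\<dots> = 4 ^ N" by (simp add: power_mult)
  finally show ?thesis .
 qed
 ultimately show ?thesis by (simp add: mult_right_mono)
qed

lemma power_over_fact_le_exp:
 assumes "0 <= (y::real)"
 shows "y ^ n / fact n <= exp y"
proof -
 have "(\<Sum>k\<in>{n}. inverse (fact k) *\<^sub>R y ^ k) <= (\<Sum>k. inverse (fact k) *\<^sub>R y ^ k)"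
  by (rule sum_le_suminf[OF summable_exp_generic]) (use assms in auto)
 then show ?thesis by (simp add: exp_def field_simps)
qed

text \<open>Functions of size \<open>exp (- c / sqrt \<bar>\<epsilon>\<bar>)\<close> are flat of Gevrey order two.\<close>

lemma exp_flat:
 assumes "0 < c"
 shows "\<exists>A>0. \<forall>x>0. \<forall>N. exp (- (c / sqrt x)) <= A ^ N * x ^ N * (fact N :: real)\<^sup>2"
proof (intro exI[of _ "4 / c\<^sup>2"] conjI allI impI)
 show "0 < 4 / c\<^sup>2" using assms by simp
 fix x :: real and N :: nat assume x: "0 < x"
 define y where "y = c / sqrt x"
 have y: "0 < y" using assms x by (simp add: y_def)
 have y2: "y ^ (2 * N) = (c\<^sup>2 / x) ^ N" using x by (simp add: y_def power_mult power_divide)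
 have p: "0 < (c\<^sup>2 / x) ^ N" using assms x by simp
 have "(c\<^sup>2 / x) ^ N / fact (2 * N) <= exp y" using power_over_fact_le_exp[of y "2 * N"] y y2 by simp
 then have "(c\<^sup>2 / x) ^ N <= exp y * fact (2 * N)" by (simp add: pos_divide_le_eq)
 then have "exp (- y) * (c\<^sup>2 / x) ^ N <= exp (- y) * (exp y * fact (2 * N))" by (intro mult_left_mono) auto
 also have "\<dots> = fact (2 * N)" by (simp add: exp_minus)
 also have "\<dots> <= 4 ^ N * (fact N)\<^sup>2" by (rule fact_double_le)
 finally have "exp (- y) <= 4 ^ N * (fact N)\<^sup>2 / (c\<^sup>2 / x) ^ N" using p by (simp add: pos_le_divide_eq)
 also have "\<dots> = (4 / c\<^sup>2) ^ N * x ^ N * (fact N)\<^sup>2" using x assms by (simp add: power_divide)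
 finally show "exp (- (c / sqrt x)) <= (4 / c\<^sup>2) ^ N * x ^ N * (fact N)\<^sup>2" by (simp add: y_def)
qed

text \<open>Each coefficient is the limit of a quotient formed with the preceding ones.\<close>

lemma asymptotic_coefficients_unique:
 fixes \<beta> \<beta>' :: "nat => complex"
 assumes 1: "!!\<zeta>. \<zeta> \<in> X ==> gevrey_at (\<phi> \<zeta>) \<beta> C A \<zeta>" and 2: "!!\<zeta>. \<zeta> \<in> X ==> gevrey_at (\<phi> \<zeta>) \<beta>' C' A' \<zeta>"
  and X: "!!r. 0 < r ==> \<exists>\<zeta>\<in>X. cmod (exp \<zeta>) < r"
 shows "\<beta> N = \<beta>' N"
proof (induction N rule: less_induct)
 case (less N)
 define c where "c = (C * A ^ Suc N + C' * A' ^ Suc N) * (fact (Suc N))\<^sup>2"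
 have key: "cmod (\<beta> N - \<beta>' N) <= c * cmod (exp \<zeta>)" if z: "\<zeta> \<in> X" for \<zeta>
 proof -
  define e where "e = exp \<zeta>"
  have e: "0 < cmod e" by (simp add: e_def)
  define U where "U = \<phi> \<zeta> - (\<Sum>n<N. \<beta> n * e ^ n)"
  have U': "U = \<phi> \<zeta> - (\<Sum>n<N. \<beta>' n * e ^ n)" unfolding U_def using less by simp
  have a: "cmod (U - \<beta> N * e ^ N) <= C * A ^ Suc N * cmod e ^ Suc N * (fact (Suc N))\<^sup>2"
   using 1[OF z, unfolded gevrey_at_def, THEN spec[of _ "Suc N"]] unfolding U_def e_def by (simp add: diff_diff_eq)
  have b: "cmod (U - \<beta>' N * e ^ N) <= C' * A' ^ Suc N * cmod e ^ Suc N * (fact (Suc N))\<^sup>2"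
   using 2[OF z, unfolded gevrey_at_def, THEN spec[of _ "Suc N"]] unfolding U' e_def by (simp add: diff_diff_eq)
  have "cmod (\<beta> N - \<beta>' N) * cmod e ^ N = cmod ((U - \<beta>' N * e ^ N) - (U - \<beta> N * e ^ N))"
   by (simp add: norm_mult[symmetric] norm_power[symmetric] algebra_simps)
  also have "\<dots> <= cmod (U - \<beta>' N * e ^ N) + cmod (U - \<beta> N * e ^ N)" by (rule norm_triangle_ineq4)
  also have "\<dots> <= C * A ^ Suc N * cmod e ^ Suc N * (fact (Suc N))\<^sup>2 + C' * A' ^ Suc N * cmod e ^ Suc N * (fact (Suc N))\<^sup>2"
   using a b by linarith
  also have "\<dots> = (c * cmod e) * cmod e ^ N" unfolding c_def by (simp only: power_Suc distrib_left distrib_right mult_ac)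
  finally show ?thesis using e by (simp add: e_def)
 qed
 have "cmod (\<beta> N - \<beta>' N) <= 0"
 proof (rule field_le_epsilon)
  fix \<eta> :: real assume \<eta>: "0 < \<eta>"
  define M where "M = \<bar>c\<bar> + 1"
  have M: "0 < M" "c <= M" unfolding M_def by linarith+
  obtain \<zeta> where z: "\<zeta> \<in> X" "cmod (exp \<zeta>) < \<eta> / M" using X[of "\<eta> / M"] \<eta> M by auto
  have "cmod (\<beta> N - \<beta>' N) <= M * cmod (exp \<zeta>)"
   using key[OF z(1)] M(2) by (meson mult_right_mono norm_ge_zero order_trans)
  also have "\<dots> <= \<eta>" using z(2) M by (simp add: field_simps)
  finally show "cmod (\<beta> N - \<beta>' N) <= 0 + \<eta>" by simp
 qed
 then show ?case by simp
qed

lemma log_sector_open: "open (log_sector \<rho> \<theta>1 \<theta>2)"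
proof -
 have "log_sector \<rho> \<theta>1 \<theta>2 = {\<zeta>. cmod (exp \<zeta>) < \<rho>} \<inter> {\<zeta>. \<theta>1 < Im \<zeta>} \<inter> {\<zeta>. Im \<zeta> < \<theta>2}" by (auto simp: log_sector_def)
 moreover have "open \<dots>" by (intro open_Int open_Collect_less continuous_intros)
 ultimately show ?thesis by simp
qed

text \<open>
 Estimates of Gevrey type near \<open>\<epsilon> = 0\<close> already determine a Gevrey sum: two consecutive estimates
 at one point bound a coefficient, each coefficient is a locally uniform limit of holomorphic
 functions, and away from \<open>\<epsilon> = 0\<close> the estimates follow from compactness.
\<close>

lemma gevrey_sumI:
 assumes op: "2 * pi < \<theta>2 - \<theta>1" and \<rho>: "0 < \<rho>" and D: "open D"
  and g: "hol2 (log_sector \<rho> \<theta>1 \<theta>2 \<times> D) g"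
  and est: "!!K \<theta>1' \<theta>2'. compact K ==> K \<subseteq> D ==> \<theta>1 < \<theta>1' ==> \<theta>1' < \<theta>2' ==> \<theta>2' < \<theta>2 ==>
   \<exists>R>0. \<exists>C>0. \<exists>A>0. \<forall>\<zeta>\<in>log_sector R \<theta>1' \<theta>2'. \<forall>W\<in>K. gevrey_at (g \<zeta> W) (%n. \<beta> n W) C A \<zeta>"
 shows "gevrey_sum (1/2) \<rho> \<theta>1 \<theta>2 D g \<beta>"
proof -
 define m where "m = (\<theta>1 + \<theta>2) / 2"
 have m: "\<theta>1 < m - 1" "m - 1 < m + 1" "m + 1 < \<theta>2" 
 proof -
  have "2 * m = \<theta>1 + \<theta>2" by (simp add: m_def)
  then show "\<theta>1 < m - 1" "m - 1 < m + 1" "m + 1 < \<theta>2" using op pi_gt3 by linarith+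
 qed
 have small: "\<exists>x0. \<forall>x\<le>x0. exp x < R" if "0 < R" for R :: real
 proof (intro exI allI impI)
  fix x assume "x <= ln R - 1"
  then have "exp x < exp (ln R)" by (subst exp_less_cancel_iff) linarith
  then show "exp x < R" using that by simp
 qed
 have sec: "Complex x m \<in> log_sector \<rho> \<theta>1 \<theta>2" if "exp x < \<rho>" for x using that m by (simp add: log_sector_def)
 have gW: "g \<zeta> holomorphic_on D" if "\<zeta> \<in> log_sector \<rho> \<theta>1 \<theta>2" for \<zeta>
  using hol2_holomorphic(2)[OF g, of D \<zeta>] that by auto
 have gz: "(%\<zeta>. g \<zeta> W) holomorphic_on log_sector \<rho> \<theta>1 \<theta>2" if "W \<in> D" for W
  using hol2_holomorphic(1)[OF g, of "log_sector \<rho> \<theta>1 \<theta>2" W] that by auto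
 have coeff: "\<exists>C>0. \<exists>A>0. \<forall>W\<in>K. \<forall>n. cmod (\<beta> n W) <= C * A ^ n * (fact n)\<^sup>2" if K: "compact K" "K \<subseteq> D" for K
 proof -
  obtain R C A where R: "0 < R" "0 < C" "0 < A"
   and e: "\<forall>\<zeta>\<in>log_sector R (m - 1) (m + 1). \<forall>W\<in>K. gevrey_at (g \<zeta> W) (%n. \<beta> n W) C A \<zeta>"
   using est[OF K m] by blast
  obtain x0 where x0: "exp x0 < R" using small[OF R(1)] by blast
  define x where "x = exp x0"
  have x: "0 < x" by (simp add: x_def)
  have "cmod (\<beta> N W) <= (C * (1 + A * x)) * (4 * A) ^ N * (fact N)\<^sup>2" if W: "W \<in> K" for W N
  proof -
   define e0 where "e0 = exp (Complex x0 m)"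
   have n: "cmod e0 = x" by (simp add: e0_def x_def)
   have E: "cmod (g (Complex x0 m) W - (\<Sum>n<N. \<beta> n W * e0 ^ n)) <= C * A ^ N * x ^ N * (fact N)\<^sup>2" for N
    using e[rule_format, of "Complex x0 m" W] x0 W by (simp add: gevrey_at_def log_sector_def e0_def x_def)
   have "\<beta> N W * e0 ^ N = (g (Complex x0 m) W - (\<Sum>n<N. \<beta> n W * e0 ^ n)) - (g (Complex x0 m) W - (\<Sum>n<Suc N. \<beta> n W * e0 ^ n))" by simp
   then have "cmod (\<beta> N W) * x ^ N <= cmod (g (Complex x0 m) W - (\<Sum>n<N. \<beta> n W * e0 ^ n)) + cmod (g (Complex x0 m) W - (\<Sum>n<Suc N. \<beta> n W * e0 ^ n))"
    using norm_triangle_ineq4 by (metis n norm_mult norm_power)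
   also have "\<dots> <= C * A ^ N * x ^ N * (fact N)\<^sup>2 + C * A ^ Suc N * x ^ Suc N * (fact (Suc N))\<^sup>2"
    by (intro add_mono E)
   also have "\<dots> <= C * A ^ N * x ^ N * (4 ^ N * (fact N)\<^sup>2) + C * A ^ Suc N * x ^ Suc N * (4 ^ N * (fact N)\<^sup>2)"
   proof (intro add_mono mult_left_mono fact_Suc_sq)
    show "(fact N :: real)\<^sup>2 <= 4 ^ N * (fact N)\<^sup>2" by (simp add: mult_le_cancel_right1)
   qed (use R x in auto)
   also have "\<dots> = ((C * (1 + A * x)) * (4 * A) ^ N * (fact N)\<^sup>2) * x ^ N" by (simp add: algebra_simps power_mult_distrib)
   finally show ?thesis using x by simp
  qed
  moreover have "0 < C * (1 + A * x)" "0 < 4 * A" using R x by (auto intro!: mult_pos_pos add_pos_pos)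
  ultimately show ?thesis by blast
 qed
 have \<beta>hol: "\<beta> N holomorphic_on D" for N
 proof (induction N rule: less_induct)
  case (less N)
  obtain x0 where x0: "!!x. x <= x0 ==> exp x < \<rho>" using small[OF \<rho>] by blast
  define \<zeta> where "\<zeta> j = Complex (x0 - real j) m" for j
  have \<zeta>S: "\<zeta> j \<in> log_sector \<rho> \<theta>1 \<theta>2" for j unfolding \<zeta>_def by (intro sec x0) simp
  define \<phi> where "\<phi> j W = (g (\<zeta> j) W - (\<Sum>n<N. \<beta> n W * exp (\<zeta> j) ^ n)) / exp (\<zeta> j) ^ N" for j W
  show ?case
  proof (rule holomorphic_uniform_sequence[OF D, where f = \<phi>])
   show "\<phi> j holomorphic_on D" for j
    unfolding \<phi>_def using less by (intro holomorphic_intros gW \<zeta>S) auto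
   fix W0 assume "W0 \<in> D"
   then obtain d where d: "0 < d" "cball W0 d \<subseteq> D" using D open_contains_cball by blast
   obtain R C A where R: "0 < R" "0 < C" "0 < A"
    and e: "\<forall>\<zeta>\<in>log_sector R (m - 1) (m + 1). \<forall>W\<in>cball W0 d. gevrey_at (g \<zeta> W) (%n. \<beta> n W) C A \<zeta>"
    using est[OF compact_cball d(2) m] by blast
   define M where "M = C * A ^ Suc N * (fact (Suc N))\<^sup>2"
   have lim0: "(%j. exp (x0 - real j)) \<longlonglongrightarrow> 0" by real_asymp
   have ul: "uniform_limit (cball W0 d) \<phi> (\<beta> N) sequentially"
    unfolding uniform_limit_iff
   proof (intro allI impI)
    fix \<eta> :: real assume \<eta>: "0 < \<eta>"
    have "(%j. M * exp (x0 - real j)) \<longlonglongrightarrow> M * 0" by (intro tendsto_intros lim0)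
    then have ev1: "\<forall>\<^sub>F j in sequentially. M * exp (x0 - real j) < \<eta>" using \<eta> by (auto elim: order_tendstoD)
    have ev2: "\<forall>\<^sub>F j in sequentially. exp (x0 - real j) < R" using lim0 R(1) by (rule order_tendstoD)
    show "\<forall>\<^sub>F j in sequentially. \<forall>W\<in>cball W0 d. dist (\<phi> j W) (\<beta> N W) < \<eta>"
     using ev1 ev2
    proof eventually_elim
     case (elim j)
     show ?case
     proof
      fix W assume W: "W \<in> cball W0 d"
      define e0 where "e0 = exp (\<zeta> j)"
      have ne: "e0 \<noteq> 0" by (simp add: e0_def)
      have nn: "cmod e0 = exp (x0 - real j)" by (simp add: e0_def \<zeta>_def)
      have E: "cmod (g (\<zeta> j) W - (\<Sum>n<Suc N. \<beta> n W * e0 ^ n)) <= M * cmod e0 ^ Suc N"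
      proof -
       have "\<zeta> j \<in> log_sector R (m - 1) (m + 1)" using elim(2) by (simp add: \<zeta>_def log_sector_def)
       then have "gevrey_at (g (\<zeta> j) W) (%n. \<beta> n W) C A (\<zeta> j)" using e W by blast
       then have "cmod (g (\<zeta> j) W - (\<Sum>n<Suc N. \<beta> n W * e0 ^ n)) <= C * A ^ Suc N * cmod e0 ^ Suc N * (fact (Suc N))\<^sup>2"
        unfolding gevrey_at_def e0_def by blast
       then show ?thesis unfolding M_def by (simp only: mult_ac)
      qed
      have "\<phi> j W - \<beta> N W = (g (\<zeta> j) W - (\<Sum>n<Suc N. \<beta> n W * e0 ^ n)) / e0 ^ N"
       unfolding \<phi>_def e0_def[symmetric] using ne by (simp add: field_simps)
      then have "cmod (\<phi> j W - \<beta> N W) = cmod (g (\<zeta> j) W - (\<Sum>n<Suc N. \<beta> n W * e0 ^ n)) / cmod e0 ^ N"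
       by (simp only: norm_divide norm_power)
      also have "\<dots> <= M * cmod e0 ^ Suc N / cmod e0 ^ N" by (rule divide_right_mono[OF E]) simp
      finally have "cmod (\<phi> j W - \<beta> N W) <= M * cmod e0 ^ Suc N / cmod e0 ^ N" .
      also have "\<dots> = M * cmod e0" using ne by simp
      also have "\<dots> < \<eta>" using elim(1) nn by simp
      finally show "dist (\<phi> j W) (\<beta> N W) < \<eta>" by (simp add: dist_norm)
     qed
    qed
   qed
   show "\<exists>d>0. cball W0 d \<subseteq> D & uniform_limit (cball W0 d) \<phi> (\<beta> N) sequentially" using d ul by blast
  qed
 qed
 have full: "\<exists>C>0. \<exists>A>0. \<forall>\<zeta>\<in>log_sector \<rho>' \<theta>1' \<theta>2'. \<forall>W\<in>K. \<forall>N.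
       cmod (g \<zeta> W - (\<Sum>n<N. \<beta> n W * exp \<zeta> ^ n)) < C * A ^ N * cmod (exp \<zeta>) ^ N * (fact N)\<^sup>2"
  if K: "compact K" "K \<subseteq> D" and r: "0 < \<rho>'" "\<rho>' < \<rho>" and t: "\<theta>1 < \<theta>1'" "\<theta>1' < \<theta>2'" "\<theta>2' < \<theta>2" for K \<rho>' \<theta>1' \<theta>2'
 proof -
  obtain R C A where R: "0 < R" "0 < C" "0 < A"
   and e: "\<forall>\<zeta>\<in>log_sector R \<theta>1' \<theta>2'. \<forall>W\<in>K. gevrey_at (g \<zeta> W) (%n. \<beta> n W) C A \<zeta>"
   using est[OF K t] by blast
  obtain Cb Ab where b: "0 < Cb" "0 < Ab" "!!W n. W \<in> K ==> cmod (\<beta> n W) <= Cb * Ab ^ n * (fact n)\<^sup>2" using coeff[OF K] by metis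
  define X where "X = cbox (Complex (ln R) \<theta>1') (Complex (ln \<rho>') \<theta>2')"
  have XS: "X \<subseteq> log_sector \<rho> \<theta>1 \<theta>2"
  proof
   fix \<zeta> assume "\<zeta> \<in> X"
   then have "Re \<zeta> <= ln \<rho>'" "\<theta>1' <= Im \<zeta>" "Im \<zeta> <= \<theta>2'" by (auto simp: X_def in_cbox_complex_iff)
   moreover then have "exp (Re \<zeta>) <= \<rho>'" using r by (metis exp_le_cancel_iff exp_ln)
   ultimately show "\<zeta> \<in> log_sector \<rho> \<theta>1 \<theta>2" using r t by (auto simp: log_sector_def)
  qed
  have "X \<times> K \<subseteq> log_sector \<rho> \<theta>1 \<theta>2 \<times> D" using XS K by blast
  then have "continuous_on (X \<times> K) (%(\<zeta>, W). g \<zeta> W)"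
   using continuous_on_subset[OF hol2D(2)[OF g]] unfolding case_prod_unfold by blast
  moreover have "compact (X \<times> K)" unfolding X_def by (intro compact_Times compact_cbox K)
  ultimately have "compact ((%(\<zeta>, W). g \<zeta> W) ` (X \<times> K))" by (rule compact_continuous_image)
  then obtain B where B: "!!\<zeta> W. \<zeta> \<in> X ==> W \<in> K ==> cmod (g \<zeta> W) <= B"
   using compact_imp_bounded[of "(%(\<zeta>, W). g \<zeta> W) ` (X \<times> K)"] unfolding bounded_iff by force
  define A' where "A' = A + 2 / R + 2 * Ab"
  define C' where "C' = C + \<bar>B\<bar> + Cb + 1"
  have A'0: "0 < A'" unfolding A'_def using R b r by (intro add_pos_pos mult_pos_pos) auto
  have C'0: "0 < C'" unfolding C'_def using R b by linarith
  have fN: "1 <= (fact N :: real)\<^sup>2" for N by (simp add: one_le_power)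
  have iR: "0 < 1 / R" "2 / R = 2 * (1 / R)" using R by auto
  have A'2: "A' = A + 2 * (1 / R) + 2 * Ab" by (simp add: A'_def)
  have A'A: "A <= A'" "1 / R <= A' / 2" "Ab <= A' / 2"
   using A'2 R(3) b(2) iR(1) by (linarith, linarith, linarith)
  have A'R: "1 / R <= A'" using A'A(2) A'0 by linarith
  have "cmod (g \<zeta> W - (\<Sum>n<N. \<beta> n W * exp \<zeta> ^ n)) < C' * A' ^ N * cmod (exp \<zeta>) ^ N * (fact N)\<^sup>2"
   if z: "\<zeta> \<in> log_sector \<rho>' \<theta>1' \<theta>2'" and W: "W \<in> K" for \<zeta> W N
  proof -
   define x where "x = cmod (exp \<zeta>)"
   have x: "0 < x" "x < \<rho>'" "\<theta>1' < Im \<zeta>" "Im \<zeta> < \<theta>2'" using z by (auto simp: x_def log_sector_def)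
   have P: "0 < A' ^ N * x ^ N * (fact N)\<^sup>2" using A'0 x by (auto intro!: mult_pos_pos)
   have "cmod (g \<zeta> W - (\<Sum>n<N. \<beta> n W * exp \<zeta> ^ n)) <= (C + \<bar>B\<bar> + Cb) * (A' ^ N * x ^ N * (fact N)\<^sup>2)"
   proof (cases "x < R")
    case True
    have "cmod (g \<zeta> W - (\<Sum>n<N. \<beta> n W * exp \<zeta> ^ n)) <= C * A ^ N * x ^ N * (fact N)\<^sup>2"
     using e[rule_format, of \<zeta> W] True x W by (simp add: gevrey_at_def log_sector_def x_def)
    also have "\<dots> = C * (A ^ N * x ^ N * (fact N)\<^sup>2)" by (simp add: mult_ac)
    also have "\<dots> <= (C + \<bar>B\<bar> + Cb) * (A' ^ N * x ^ N * (fact N)\<^sup>2)"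
     using R b x A'A by (intro mult_mono power_mono) auto
    finally show ?thesis .
   next
    case False
    have Rx: "R <= x" using False by simp
    have xe: "x = exp (Re \<zeta>)" by (simp add: x_def)
    have "ln R <= Re \<zeta>" using Rx R(1) unfolding xe by (metis exp_le_cancel_iff exp_ln)
    moreover have "Re \<zeta> <= ln \<rho>'" using x r(1) unfolding xe by (metis exp_less_cancel_iff exp_ln less_imp_le)
    ultimately have "\<zeta> \<in> X" using x by (simp add: X_def in_cbox_complex_iff)
    then have gB: "cmod (g \<zeta> W) <= B" using B W by blast
    have one: "1 <= (1 / R) * x" using Rx R by simp
    have "1 <= ((1 / R) * x) ^ N" using one by (rule one_le_power)
    also have "\<dots> <= (A' * x) ^ N" using A'R R x by (intro power_mono mult_right_mono) auto
    finally have one': "1 <= A' ^ N * x ^ N" by (simp add: power_mult_distrib)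
    have one'': "1 * 1 <= (A' ^ N * x ^ N) * (fact N)\<^sup>2" using one' fN[of N] by (intro mult_mono) auto
    have "cmod (\<Sum>n<N. \<beta> n W * exp \<zeta> ^ n) <= (\<Sum>n<N. Cb * (A' ^ N * x ^ N * (fact N)\<^sup>2) / 2 ^ N)"
    proof (rule sum_norm_le)
     fix n assume n: "n \<in> {..<N}"
     have "cmod (\<beta> n W * exp \<zeta> ^ n) = cmod (\<beta> n W) * x ^ n" by (simp add: norm_mult norm_power x_def)
     also have "\<dots> <= (Cb * Ab ^ n * (fact n)\<^sup>2) * x ^ n" using b(3)[OF W, of n] x by (intro mult_right_mono) auto
     also have "\<dots> = Cb * (Ab * x) ^ n * (fact n)\<^sup>2" by (simp add: power_mult_distrib)
     also have "\<dots> <= Cb * ((A' * x) ^ N / 2 ^ N) * (fact N)\<^sup>2"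
     proof (intro mult_mono)
      have h1: "1 <= A' / 2 * x"
      proof -
       have "1 / R * x <= A' / 2 * x" using A'A(2) x by (intro mult_right_mono) auto
       then show ?thesis using one by linarith
      qed
      have "(Ab * x) ^ n <= (A' / 2 * x) ^ n" using A'A(3) b x by (intro power_mono mult_right_mono) auto
      also have "\<dots> <= (A' / 2 * x) ^ N" using h1 n by (intro power_increasing) auto
      also have "\<dots> = (A' * x) ^ N / 2 ^ N" by (simp add: power_divide power_mult_distrib)
      finally show "(Ab * x) ^ n <= (A' * x) ^ N / 2 ^ N" .
      show "(fact n :: real)\<^sup>2 <= (fact N)\<^sup>2" using n by (intro power_mono fact_mono) auto
     qed (use b x A'0 in auto)
     finally show "cmod (\<beta> n W * exp \<zeta> ^ n) <= Cb * (A' ^ N * x ^ N * (fact N)\<^sup>2) / 2 ^ N" by (simp add: power_mult_distrib mult_ac)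
    qed
    also have "\<dots> = (real N / 2 ^ N) * (Cb * (A' ^ N * x ^ N * (fact N)\<^sup>2))" by simp
    also have "\<dots> <= 1 * (Cb * (A' ^ N * x ^ N * (fact N)\<^sup>2))"
    proof (rule mult_right_mono)
     have "real N <= 2 ^ N" by (metis less_exp less_imp_le of_nat_le_iff of_nat_numeral of_nat_power)
     then show "real N / 2 ^ N <= 1" by simp
    qed (use b P in auto)
    finally have s: "cmod (\<Sum>n<N. \<beta> n W * exp \<zeta> ^ n) <= Cb * (A' ^ N * x ^ N * (fact N)\<^sup>2)" by simp
    have "cmod (g \<zeta> W) <= \<bar>B\<bar> * 1" using gB by simp
    also have "\<dots> <= \<bar>B\<bar> * (A' ^ N * x ^ N * (fact N)\<^sup>2)" using one'' by (intro mult_left_mono) auto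
    finally have t1: "cmod (g \<zeta> W) <= \<bar>B\<bar> * (A' ^ N * x ^ N * (fact N)\<^sup>2)" .
    have "0 <= C * (A' ^ N * x ^ N * (fact N)\<^sup>2)" using R(2) P by simp
    then show ?thesis using norm_triangle_ineq4[of "g \<zeta> W" "\<Sum>n<N. \<beta> n W * exp \<zeta> ^ n"] s t1
     unfolding distrib_right by linarith
   qed
   also have "\<dots> < C' * (A' ^ N * x ^ N * (fact N)\<^sup>2)" unfolding C'_def using P by (intro mult_strict_right_mono) auto
   finally show ?thesis by (simp add: x_def mult_ac)
  qed
  then show ?thesis using A'0 C'0 by blast
 qed
 have pw: "fact n powr (1 / (1 / 2)) = (fact n :: real)\<^sup>2" for n by (simp add: powr_numeral)
 show ?thesis unfolding gevrey_sum_def pw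
  using op \<beta>hol gz gW coeff full by simp
qed

text \<open>
 Let \<open>g\<close> be a Gevrey sum, and let \<open>q\<close> agree with \<open>g\<close> where both are defined and be flatly close to
 the values of \<open>g\<close> over the same \<open>\<epsilon>\<close> on another sheet of the covering. Then \<open>g\<close> and \<open>q\<close> form a
 Gevrey sum of the same series on the union of the sectors, hence on each wide sector in it.
\<close>

lemma gevrey_sum_extend:
 assumes base: "gevrey_sum (1/2) \<rho> \<theta>1 \<theta>2 D g \<beta>" and g: "hol2 (log_sector \<rho> \<theta>1 \<theta>2 \<times> D) g"
  and D': "open D'" "D' \<subseteq> D" and R: "0 < R" "R <= \<rho>" and op: "2 * pi < \<phi>2 - \<phi>1"
  and q: "hol2 (log_sector R a1 a2 \<times> D') q"
  and agree: "!!\<zeta> W. \<zeta> \<in> log_sector R a1 a2 \<inter> log_sector \<rho> \<theta>1 \<theta>2 ==> W \<in> D' ==> q \<zeta> W = g \<zeta> W"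
  and flat: "!!K. compact K ==> K \<subseteq> D' ==> flat_on (log_sector R a1 a2) K (%\<zeta> W. q \<zeta> W - g (\<zeta> + s) W)"
  and s: "exp s = 1" and \<psi>: "\<theta>1 < \<psi>1" "\<psi>1 < \<psi>2" "\<psi>2 < \<theta>2"
  and cover: "!!x. \<phi>1 < x ==> x < \<phi>2 ==>
   (if a1 < x & x < a2 then \<psi>1 < x + Im s & x + Im s < \<psi>2 else \<psi>1 < x & x < \<psi>2)"
 shows "\<exists>g'. gevrey_sum (1/2) R \<phi>1 \<phi>2 D' g' \<beta>"
proof -
 define g' where "g' \<zeta> W = (if a1 < Im \<zeta> & Im \<zeta> < a2 then q \<zeta> W else g \<zeta> W)" for \<zeta> W
 let ?T = "log_sector R \<phi>1 \<phi>2" and ?U = "log_sector R a1 a2" and ?V = "log_sector R \<theta>1 \<theta>2"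
 have V: "?V \<subseteq> log_sector \<rho> \<theta>1 \<theta>2" using R by (auto simp: log_sector_def)
 have g': "hol2 (?T \<times> D') g'"
 proof (rule hol2_local)
  show "open (?T \<times> D')" by (intro open_Times log_sector_open D')
  fix z w assume zw: "(z, w) \<in> ?T \<times> D'"
  show "\<exists>E h. (z, w) \<in> E & hol2 E h & (\<forall>z w. (z, w) \<in> E --> g' z w = h z w)"
  proof (cases "z \<in> ?U")
   case True
   show ?thesis
   proof (rule exI[of _ "?U \<times> D'"], rule exI[of _ q], intro conjI allI impI)
    show "(z, w) \<in> ?U \<times> D'" using True zw by simp
    show "g' z w = q z w" if "(z, w) \<in> ?U \<times> D'" for z w using that by (simp add: g'_def log_sector_def)
   qed (rule q)
  next
   case False
   then have z: "z \<in> ?V" using zw cover[of "Im z"] \<psi> by (auto simp: log_sector_def)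
   show ?thesis
   proof (rule exI[of _ "?V \<times> D'"], rule exI[of _ g], intro conjI allI impI)
    show "(z, w) \<in> ?V \<times> D'" using z zw by simp
    show "hol2 (?V \<times> D') g" by (rule hol2_subset[OF g open_Times[OF log_sector_open D'(1)]]) (use V D' in blast)
    show "g' z w = g z w" if zw: "(z, w) \<in> ?V \<times> D'" for z w
    proof (cases "z \<in> ?U")
     case True
     then show ?thesis using agree[of z w] zw V by (auto simp: g'_def)
    qed (use zw in \<open>auto simp: g'_def log_sector_def\<close>)
   qed
  qed
 qed
 have "gevrey_sum (1/2) R \<phi>1 \<phi>2 D' g' \<beta>"
 proof (rule gevrey_sumI[OF op R(1) D'(1) g'])
  have pw: "fact n powr (1 / (1 / 2)) = (fact n :: real)\<^sup>2" for n by (simp add: powr_numeral)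
  fix K t1 t2 assume K: "compact K" "K \<subseteq> D'" and t: "\<phi>1 < t1" "t1 < t2" "t2 < \<phi>2"
  have r2: "0 < \<rho> / 2" "\<rho> / 2 < \<rho>" and KD: "K \<subseteq> D" using R K D' by auto
  have "\<exists>C>0. \<exists>A>0. \<forall>\<zeta>\<in>log_sector (\<rho> / 2) \<psi>1 \<psi>2. \<forall>W\<in>K. \<forall>N.
       cmod (g \<zeta> W - (\<Sum>n<N. \<beta> n W * exp \<zeta> ^ n)) < C * A ^ N * cmod (exp \<zeta>) ^ N * (fact N)\<^sup>2"
   using base[unfolded gevrey_sum_def pw] K(1) KD r2 \<psi> by blast
  then obtain C1 A1 where 1: "0 < C1" "0 < A1"
   and e1: "\<forall>\<zeta>\<in>log_sector (\<rho> / 2) \<psi>1 \<psi>2. \<forall>W\<in>K. gevrey_at (g \<zeta> W) (%n. \<beta> n W) C1 A1 \<zeta>"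
   unfolding gevrey_at_def by (meson less_imp_le)
  obtain c C where c: "0 < c" "0 < C" and fl: "\<forall>\<zeta>\<in>?U. \<forall>W\<in>K. cmod (q \<zeta> W - g (\<zeta> + s) W) <= C * exp (- (c / sqrt (cmod (exp \<zeta>))))"
   using flat[OF K] unfolding flat_on_def by blast
  obtain A2 where 2: "0 < A2" and e2: "\<forall>x>0. \<forall>N. exp (- (c / sqrt x)) <= A2 ^ N * x ^ N * (fact N :: real)\<^sup>2"
   using exp_flat[OF c(1)] by blast
  have "gevrey_at (g' \<zeta> W) (%n. \<beta> n W) (C + C1) (A1 + A2) \<zeta>"
   if z: "\<zeta> \<in> log_sector (min R (\<rho> / 2)) t1 t2" and W: "W \<in> K" for \<zeta> W
  proof (cases "\<zeta> \<in> ?U")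
   case True
   have ez: "exp (\<zeta> + s) = exp \<zeta>" by (simp add: exp_add s)
   then have "cmod (exp (\<zeta> + s)) < \<rho> / 2" using z unfolding ez by (simp add: log_sector_def)
   then have "\<zeta> + s \<in> log_sector (\<rho> / 2) \<psi>1 \<psi>2"
    using z True t cover[of "Im \<zeta>"] unfolding log_sector_def by auto
   then have "gevrey_at (g (\<zeta> + s) W) (%n. \<beta> n W) C1 A1 (\<zeta> + s)" using e1 W by blast
   then have a: "gevrey_at (g (\<zeta> + s) W) (%n. \<beta> n W) C1 (A1 + A2) (\<zeta> + s)"
    by (rule gevrey_at_mono) (use 1 2 in auto)
   show ?thesis
    unfolding gevrey_at_def
   proof
    fix N
    define x where "x = cmod (exp \<zeta>)"
    have x: "0 < x" by (simp add: x_def)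
    have "cmod (q \<zeta> W - g (\<zeta> + s) W) <= C * exp (- (c / sqrt x))" using fl True W by (simp add: x_def)
    also have "\<dots> <= C * (A2 ^ N * x ^ N * (fact N)\<^sup>2)" using e2 x c by (intro mult_left_mono) auto
    also have "\<dots> <= C * ((A1 + A2) ^ N * x ^ N * (fact N)\<^sup>2)"
     using 1 2 c x by (intro mult_left_mono mult_right_mono power_mono) auto
    finally have b: "cmod (q \<zeta> W - g (\<zeta> + s) W) <= C * ((A1 + A2) ^ N * x ^ N * (fact N)\<^sup>2)" .
    have "cmod (g (\<zeta> + s) W - (\<Sum>n<N. \<beta> n W * exp \<zeta> ^ n)) <= C1 * (A1 + A2) ^ N * x ^ N * (fact N)\<^sup>2"
     using a unfolding gevrey_at_def ez x_def by blast
    moreover have "g' \<zeta> W = q \<zeta> W" using True by (simp add: g'_def log_sector_def)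
    ultimately have "cmod (g' \<zeta> W - (\<Sum>n<N. \<beta> n W * exp \<zeta> ^ n)) <= C * ((A1 + A2) ^ N * x ^ N * (fact N)\<^sup>2) + C1 * (A1 + A2) ^ N * x ^ N * (fact N)\<^sup>2"
     using b norm_triangle_ineq[of "q \<zeta> W - g (\<zeta> + s) W" "g (\<zeta> + s) W - (\<Sum>n<N. \<beta> n W * exp \<zeta> ^ n)"] by simp
    then show "cmod (g' \<zeta> W - (\<Sum>n<N. \<beta> n W * exp \<zeta> ^ n)) <= (C + C1) * (A1 + A2) ^ N * cmod (exp \<zeta>) ^ N * (fact N)\<^sup>2"
     by (simp add: x_def algebra_simps)
   qed
  next
   case False
   then have "\<zeta> \<in> log_sector (\<rho> / 2) \<psi>1 \<psi>2" "g' \<zeta> W = g \<zeta> W"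
    using z t cover[of "Im \<zeta>"] by (auto simp: log_sector_def g'_def split: if_splits)
   then have "gevrey_at (g' \<zeta> W) (%n. \<beta> n W) C1 A1 \<zeta>" using e1 W by metis
   then show ?thesis by (rule gevrey_at_mono) (use 1 2 c in auto)
  qed
  moreover have "0 < min R (\<rho> / 2)" "0 < C + C1" "0 < A1 + A2" using R r2 c 1 2 by auto
  ultimately show "\<exists>R>0. \<exists>C>0. \<exists>A>0. \<forall>\<zeta>\<in>log_sector R t1 t2. \<forall>W\<in>K. gevrey_at (g' \<zeta> W) (%n. \<beta> n W) C A \<zeta>" by blast
 qed
 then show ?thesis by blast
qed

text \<open>
 A function on a sector of opening greater than \<open>2 * pi\<close> whose two values over the same \<open>\<epsilon>\<close>
 differ by a flat function is a Gevrey sum. The Cauchy-Heine expansions along different cuts have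
 the same coefficients, as they are asymptotic to the same function on the ray \<open>Im \<zeta> = pi\<close>.
\<close>

lemma gevrey_sum_of_flat_difference:
 assumes \<delta>: "0 < \<delta>" "\<delta> < pi / 2" and \<rho>: "0 < \<rho>" and D: "open D"
  and g: "hol2 (log_sector \<rho> (- \<delta>) (2 * pi + \<delta>) \<times> D) g"
  and bd: "!!K. compact K ==> K \<subseteq> D ==> \<exists>R>0. \<exists>B. \<forall>\<zeta>\<in>log_sector R (- \<delta>) (2 * pi + \<delta>). \<forall>W\<in>K. cmod (g \<zeta> W) <= B"
  and flat: "!!K. compact K ==> K \<subseteq> D ==>
   \<exists>R>0. flat_on (log_sector R (- \<delta>) \<delta>) K (%\<zeta> W. g (\<zeta> + 2 * pi * \<i>) W - g \<zeta> W)"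
 shows "\<exists>\<beta>. gevrey_sum (1/2) \<rho> (- \<delta>) (2 * pi + \<delta>) D g \<beta>"
proof -
 define expands where "expands \<theta> \<kappa> R C A W b \<longleftrightarrow> (\<forall>\<zeta>. cmod (exp \<zeta>) <= R --> \<theta> + \<kappa> <= Im \<zeta> --> Im \<zeta> <= \<theta> + 2 * pi - \<kappa> -->
   gevrey_at (g \<zeta> W) b C A \<zeta>)" for \<theta> \<kappa> R C A W b
 have piece: "\<exists>R>0. \<exists>C>0. \<exists>A>0. \<forall>W\<in>K. \<exists>b. expands \<theta> \<kappa> R C A W b"
  if K: "compact K" "K \<subseteq> D" and \<theta>: "- \<delta> < \<theta>" "\<theta> < \<delta>" and \<kappa>: "0 < \<kappa>" "\<kappa> < pi / 2" for K \<theta> \<kappa>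
 proof -
  obtain R0 B where R0: "0 < R0" and B: "\<forall>\<zeta>\<in>log_sector R0 (- \<delta>) (2 * pi + \<delta>). \<forall>W\<in>K. cmod (g \<zeta> W) <= B"
   using bd[OF K] by blast
  obtain R1 c C where R1: "0 < R1" "0 < c" "0 < C" and J: "\<forall>\<zeta>\<in>log_sector R1 (- \<delta>) \<delta>. \<forall>W\<in>K.
    cmod (g (\<zeta> + 2 * pi * \<i>) W - g \<zeta> W) <= C * exp (- (c / sqrt (cmod (exp \<zeta>))))"
   using flat[OF K] unfolding flat_on_def by blast
  obtain A where A: "0 < A" and e: "\<forall>x>0. \<forall>N. exp (- (c / sqrt x)) <= A ^ N * x ^ N * (fact N :: real)\<^sup>2"
   using exp_flat[OF R1(2)] by blast
  define R where "R = min (min R0 R1) \<rho> / 2"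
  have R: "0 < R" "R < \<rho>" "R < R0" "R < R1" using R0 R1 \<rho> by (auto simp: R_def)
  define B' where "B' = \<bar>B\<bar> + 1"
  have s0: "0 < sin \<kappa>" using \<kappa> by (intro sin_gt_zero2) auto
  have "0 < C * A * R / sin \<kappa>" "0 < B'" using R1 A R s0 by (auto simp: B'_def intro!: divide_pos_pos mult_pos_pos)
  moreover have "0 < 1 / R" using R by simp
  ultimately have pos: "0 < R / 2" "0 < 2 * B' + C * A * R / sin \<kappa>" "0 < 1 / R + 4 * A" using R(1) A by (linarith, linarith, linarith)
  have "\<exists>b. expands \<theta> \<kappa> (R / 2) (2 * B' + C * A * R / sin \<kappa>) (1 / R + 4 * A) W b" if W: "W \<in> K" for W
   unfolding expands_def
  proof (rule cauchy_heine[where g = "%\<zeta>. g \<zeta> W"])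
   show "(%\<zeta>. g \<zeta> W) holomorphic_on log_sector \<rho> (- \<delta>) (2 * pi + \<delta>)"
    by (rule hol2_holomorphic(1)[OF g]) (use W K in auto)
   show "cmod (g t W) <= B'" if "cmod (exp t) <= R" "\<theta> <= Im t" "Im t <= \<theta> + 2 * pi" for t
   proof -
    have "t \<in> log_sector R0 (- \<delta>) (2 * pi + \<delta>)" using that R \<theta> by (auto simp: log_sector_def)
    then show ?thesis using B W by (fastforce simp: B'_def)
   qed
   show "cmod (g (t + 2 * pi * \<i>) W - g t W) <= C * A ^ N * exp (Re t) ^ N * (fact N)\<^sup>2" if t: "Im t = \<theta>" "Re t <= ln R" for t N
   proof -
    have "exp (Re t) <= R" using t(2) R(1) by (metis exp_le_cancel_iff exp_ln)
    then have "t \<in> log_sector R1 (- \<delta>) \<delta>" using t \<theta> R by (simp add: log_sector_def)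
    then have "cmod (g (t + 2 * pi * \<i>) W - g t W) <= C * exp (- (c / sqrt (cmod (exp t))))" using J W by blast
    also have "\<dots> <= C * (A ^ N * cmod (exp t) ^ N * (fact N)\<^sup>2)" using R1 e by (intro mult_left_mono) auto
    finally show ?thesis by (simp add: mult_ac)
   qed
  qed (use \<theta> \<kappa> R R1 A in auto)
  then show ?thesis using pos by blast
 qed
 define good where "good W b \<longleftrightarrow> (\<exists>R>0. \<exists>C A. \<forall>\<zeta>. cmod (exp \<zeta>) <= R --> Im \<zeta> = pi --> gevrey_at (g \<zeta> W) b C A \<zeta>)" for W b
 have good_unique: "b = b'" if g1: "good W b" and g2: "good W b'" for W b b'
 proof
  fix N
  obtain R C A where 1: "0 < R" "\<forall>\<zeta>. cmod (exp \<zeta>) <= R --> Im \<zeta> = pi --> gevrey_at (g \<zeta> W) b C A \<zeta>"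
   using g1 unfolding good_def by blast
  obtain R' C' A' where 2: "0 < R'" "\<forall>\<zeta>. cmod (exp \<zeta>) <= R' --> Im \<zeta> = pi --> gevrey_at (g \<zeta> W) b' C' A' \<zeta>"
   using g2 unfolding good_def by blast
  show "b N = b' N"
  proof (rule asymptotic_coefficients_unique[where X = "{\<zeta>. cmod (exp \<zeta>) <= min R R' & Im \<zeta> = pi}" and \<phi> = "%\<zeta>. g \<zeta> W"])
   fix r :: real assume r: "0 < r"
   define s where "s = min (min R R') (r / 2)"
   have s: "0 < s" "s <= R" "s <= R'" "s < r" using 1(1) 2(1) r by (auto simp: s_def)
   show "\<exists>\<zeta>\<in>{\<zeta>. cmod (exp \<zeta>) <= min R R' & Im \<zeta> = pi}. cmod (exp \<zeta>) < r"
    by (rule bexI[of _ "Complex (ln s) pi"]) (use s in auto)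
  qed (use 1(2) 2(2) in auto)
 qed
 define \<beta> where "\<beta> n W = (THE b. good W b) n" for n W
 have \<beta>: "(%n. \<beta> n W) = b"
  if "expands \<theta> \<kappa> R C A W b" "0 < R" "\<theta> + \<kappa> <= pi" "pi <= \<theta> + 2 * pi - \<kappa>" for W b \<theta> \<kappa> R C A
 proof -
  have gd: "good W b" using that unfolding good_def expands_def by metis
  have "(THE b. good W b) = b" using gd good_unique[OF _ gd] by (rule the_equality[where P = "good W"])
  then show ?thesis by (simp add: \<beta>_def)
 qed
 have "gevrey_sum (1/2) \<rho> (- \<delta>) (2 * pi + \<delta>) D g \<beta>"
 proof (rule gevrey_sumI[OF _ \<rho> D g])
  show "2 * pi < 2 * pi + \<delta> - - \<delta>" using \<delta> by simp
  fix K t1 t2 assume K: "compact K" "K \<subseteq> D" and t: "- \<delta> < t1" "t1 < t2" "t2 < 2 * pi + \<delta>"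
  \<comment> \<open>the cuts \<open>Im \<zeta> = - \<delta>'\<close> and \<open>Im \<zeta> = \<delta>'\<close> together reach all of the subsector\<close>
  define m where "m = max 0 (max (- t1) (t2 - 2 * pi))"
  have m: "0 <= m" "- t1 <= m" "t2 - 2 * pi <= m" "m < \<delta>" using t \<delta> by (auto simp: m_def)
  define \<delta>' where "\<delta>' = (m + \<delta>) / 2"
  define \<kappa> where "\<kappa> = (\<delta> - m) / 2"
  have k: "0 < \<kappa>" "\<kappa> < pi / 2" "0 < \<delta>'" "\<delta>' < \<delta>" "\<delta>' - \<kappa> = m" "\<delta>' + \<kappa> = \<delta>" using m \<delta> unfolding \<delta>'_def \<kappa>_def by (auto simp: field_simps)
  have k2: "- \<delta> < - \<delta>'" "- \<delta>' < \<delta>" "- \<delta> < \<delta>'" using k by linarith+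
  obtain Ra Ca Aa where a: "0 < Ra" "0 < Ca" "0 < Aa" and ea: "\<forall>W\<in>K. \<exists>b. expands (- \<delta>') \<kappa> Ra Ca Aa W b"
   using piece[OF K k2(1,2) k(1,2)] by blast
  obtain Rb Cb Ab where b: "0 < Rb" "0 < Cb" "0 < Ab" and eb: "\<forall>W\<in>K. \<exists>b. expands \<delta>' \<kappa> Rb Cb Ab W b"
   using piece[OF K k2(3) k(4) k(1,2)] by blast
  have pa: "- \<delta>' + \<kappa> <= pi" "pi <= - \<delta>' + 2 * pi - \<kappa>" "\<delta>' + \<kappa> <= pi" "pi <= \<delta>' + 2 * pi - \<kappa>"
   using k \<delta> pi_gt_zero by linarith+
  have "gevrey_at (g \<zeta> W) (%n. \<beta> n W) (Ca + Cb) (Aa + Ab) \<zeta>"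
   if z: "\<zeta> \<in> log_sector (min Ra Rb) t1 t2" and W: "W \<in> K" for \<zeta> W
  proof -
   have x: "cmod (exp \<zeta>) <= Ra" "cmod (exp \<zeta>) <= Rb" "t1 < Im \<zeta>" "Im \<zeta> < t2" using z by (auto simp: log_sector_def)
   show ?thesis
   proof (cases "Im \<zeta> <= pi")
    case True
    obtain bb where bb: "expands (- \<delta>') \<kappa> Ra Ca Aa W bb" using ea W by blast
    have "- \<delta>' + \<kappa> <= Im \<zeta>" "Im \<zeta> <= - \<delta>' + 2 * pi - \<kappa>" using True x k m \<delta> pa by linarith+
    then have "gevrey_at (g \<zeta> W) bb Ca Aa \<zeta>" using bb x unfolding expands_def by blast
    then show ?thesis unfolding \<beta>[OF bb a(1) pa(1,2)] by (rule gevrey_at_mono) (use a b in auto)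
   next
    case False
    obtain bb where bb: "expands \<delta>' \<kappa> Rb Cb Ab W bb" using eb W by blast
    have "\<delta>' + \<kappa> <= Im \<zeta>" "Im \<zeta> <= \<delta>' + 2 * pi - \<kappa>" using False x k m \<delta> pa by linarith+
    then have "gevrey_at (g \<zeta> W) bb Cb Ab \<zeta>" using bb x unfolding expands_def by blast
    then show ?thesis unfolding \<beta>[OF bb b(1) pa(3,4)] by (rule gevrey_at_mono) (use a b in auto)
   qed
  qed
  moreover have "0 < min Ra Rb" "0 < Ca + Cb" "0 < Aa + Ab" using a b by auto
  ultimately show "\<exists>R>0. \<exists>C>0. \<exists>A>0. \<forall>\<zeta>\<in>log_sector R t1 t2. \<forall>W\<in>K. gevrey_at (g \<zeta> W) (%n. \<beta> n W) C A \<zeta>" by blast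
 qed
 then show ?thesis by blast
qed

section \<open>Continuation of the transition maps in the parameter\<close>

lemma upper_decay:
 assumes f: "per1 (upper_hp y) f" and lim: "(f \<longlongrightarrow> 0) (filtercomap Im at_top)"
  and c: "y < c" "c + 1 / 4 <= Im W" and B: "!!w. Im w = c ==> cmod (f w) <= B"
 shows "cmod (f W) <= 2 * B * exp (- (2 * pi * (Im W - c)))"
proof -
 have h: "(%w. f (- w)) holomorphic_on lower_hp (- y)"
  by (rule holomorphic_on_compose_gen[OF _ per1D(1)[OF f], of uminus, unfolded o_def]) (auto intro!: holomorphic_intros)
 have p: "f (- (w + 1)) = f (- w)" if "Im w < - y" for w
  using per1D(2)[OF f, of "- w - 1"] that by simp
 have "cmod (f (- (- W))) <= 2 * B * exp (- (2 * pi * (- c - Im (- W))))"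
 proof (rule lower_decay[where f = "%w. f (- w)" and y = "- y"])
  show "per1 (lower_hp (- y)) (%w. f (- w))" using h p by (auto simp: per1_def)
  show "((%w. f (- w)) \<longlongrightarrow> 0) (filtercomap Im at_bot)"
   unfolding tendsto_bot
  proof (intro allI impI)
   fix e :: real assume "0 < e"
   then obtain b where "!!W. b <= Im W ==> cmod (f W) < e" using lim unfolding tendsto_top by blast
   then show "\<exists>b. \<forall>W. Im W <= b --> cmod (f (- W)) < e" by (intro exI[of _ "- b"]) auto
  qed
 qed (use c B in auto)
 then show ?thesis by simp
qed

lemma per1_line_bound:
 assumes f: "per1 S f" and S: "!!W. Im W = c ==> W \<in> S"
  and B: "!!x. 0 <= x ==> x <= 1 ==> cmod (f (Complex x c)) <= B" and W: "Im W = c"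
 shows "cmod (f W) <= B"
proof -
 have nat: "f (V + of_nat n) = f V" if "Im V = c" for V n
 proof (induction n)
  case (Suc n)
  have "f ((V + of_nat n) + 1) = f (V + of_nat n)" by (rule per1D(2)[OF f]) (use S that in auto)
  then show ?case using Suc by (simp add: ac_simps)
 qed simp
 define V where "V = Complex (frac (Re W)) c"
 have V: "Im V = c" by (simp add: V_def)
 have "f W = f V"
 proof (cases "0 <= \<lfloor>Re W\<rfloor>")
  case True
  have "W = V + of_nat (nat \<lfloor>Re W\<rfloor>)" using True W by (simp add: V_def complex_eq_iff frac_def)
  then show ?thesis using nat[OF V] by metis
 next
  case False
  have "V = W + of_nat (nat (- \<lfloor>Re W\<rfloor>))" using False W by (simp add: V_def complex_eq_iff frac_def)
  then show ?thesis using nat[OF W] by metis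
 qed
 moreover have "cmod (f V) <= B" unfolding V_def by (rule B) (auto simp: frac_lt_1 less_imp_le)
 ultimately show ?thesis by simp
qed

lemma open_const_dom: "open \<Omega> ==> open (lowdom \<Omega> (%_. c))" "open \<Omega> ==> open (updom \<Omega> (%_. c))"
 using open_dom[of \<Omega> "%_. c" "%_. c"] by auto

text \<open>
 The classes are stable under the changes of variable that occur in gluing: a change of the
 parameter, a translation depending on the parameter, and the reflection (\<open>e = - 1\<close>).
\<close>

lemma pclass_affine:
 assumes u: "pclass D w u" and E: "open E" "!!z W. (z, W) \<in> E ==> (z, W + 1) \<in> E"
  and s: "hol2 E (%z _. s z)" and t: "hol2 E (%z _. t z)" and e: "e = 1 \<or> e = - 1"
  and D: "!!z W. (z, W) \<in> E ==> (s z, e * W + t z) \<in> D & w (s z) (e * W + t z) <= w' z W"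
  and v: "!!z W. (z, W) \<in> E ==> v z W = e * u (s z) (e * W + t z)"
 shows "pclass E w' v"
 unfolding pclass_def
proof (intro conjI allI impI)
 have "hol2 E (%z W. e * u (s z) (e * W + t z))"
  by (intro hol2_mult hol2_const[OF E(1)] hol2_compose[OF pclassD(1)[OF u] s] hol2_add t hol2_snd[OF E(1)]) (use D in auto)
 then show "hol2 E v" by (rule hol2_cong) (use v in auto)
 fix z W assume zW: "(z, W) \<in> E"
 then show W1: "(z, W + 1) \<in> E" by (rule E)
 have "u (s z) (e * (W + 1) + t z) = u (s z) (e * W + t z)"
  using e
 proof
  assume e: "e = 1"
  have "e * (W + 1) + t z = e * W + t z + 1" by (simp add: e)
  then show ?thesis using pclassD(3)[OF u] D[OF zW] by metis
 next
  assume e: "e = - 1"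
  have "e * (W + 1) + t z + 1 = e * W + t z" by (simp add: e)
  then show ?thesis using pclassD(3)[OF u] D[OF W1] by metis
 qed
 then show "v z (W + 1) = v z W" using v zW W1 by simp
 have "cmod (v z W) = cmod (u (s z) (e * W + t z))" using e v[OF zW] by (auto simp: norm_mult)
 also have "\<dots> <= w (s z) (e * W + t z)" using pclassD(4)[OF u] D[OF zW] by blast
 finally show "cmod (v z W) <= w' z W" using D[OF zW] by linarith
qed

lemma flat_on_pullback:
 assumes "flat_on X K d" "!!\<zeta>. \<zeta> \<in> X' ==> \<sigma> \<zeta> \<in> X & exp (\<sigma> \<zeta>) = exp \<zeta>"
  and "!!\<zeta> W. \<zeta> \<in> X' ==> W \<in> K' ==> \<exists>W'\<in>K. cmod (d' \<zeta> W) = cmod (d (\<sigma> \<zeta>) W')"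
 shows "flat_on X' K' d'"
proof -
 obtain c C where c: "0 < c" "0 < C" and f: "\<forall>\<zeta>\<in>X. \<forall>W\<in>K. cmod (d \<zeta> W) <= C * exp (- (c / sqrt (cmod (exp \<zeta>))))"
  using assms(1) unfolding flat_on_def by blast
 have "cmod (d' \<zeta> W) <= C * exp (- (c / sqrt (cmod (exp \<zeta>))))" if "\<zeta> \<in> X'" "W \<in> K'" for \<zeta> W
  using f assms(2)[OF that(1)] assms(3)[OF that] by metis
 then show ?thesis using c unfolding flat_on_def by blast
qed

lemma flat_on_subset: "flat_on X K d ==> X' \<subseteq> X ==> K' \<subseteq> K ==> flat_on X' K' d"
 unfolding flat_on_def by (meson subsetD)

text \<open>
 The properties of a representative that matter for summability, with \<open>b\<close> for \<open>2 * pi * \<i> * a\<close>. The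
 holomorphy of \<open>b\<close> is a consequence, as \<open>- b \<zeta>\<close> is the constant term of \<open>P0 \<zeta> W - W\<close>.
\<close>

locale modulus_data =
 fixes \<rho> \<delta> Y0 :: real and b :: "complex => complex" and Q0 P0 :: "complex => complex => complex"
 assumes \<delta>: "0 < \<delta>" "\<delta> < pi / 2" and Y0: "0 < Y0" and \<rho>: "0 < \<rho>"
  and Q0: "hol2 (log_sector \<rho> (- \<delta>) (2 * pi + \<delta>) \<times> lower_hp (- Y0)) Q0"
  and P0: "hol2 (log_sector \<rho> (- \<delta>) (2 * pi + \<delta>) \<times> upper_hp Y0) P0"
  and Q0_per: "!!\<zeta> W. \<zeta> \<in> log_sector \<rho> (- \<delta>) (2 * pi + \<delta>) ==> Im W < - Y0 ==> Q0 \<zeta> (W + 1) = Q0 \<zeta> W + 1"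
  and P0_per: "!!\<zeta> W. \<zeta> \<in> log_sector \<rho> (- \<delta>) (2 * pi + \<delta>) ==> Y0 < Im W ==> P0 \<zeta> (W + 1) = P0 \<zeta> W + 1"
  and Q0_lim: "!!\<zeta>. \<zeta> \<in> log_sector \<rho> (- \<delta>) (2 * pi + \<delta>) ==> ((%W. Q0 \<zeta> W - W) \<longlongrightarrow> 0) (filtercomap Im at_bot)"
  and P0_lim: "!!\<zeta>. \<zeta> \<in> log_sector \<rho> (- \<delta>) (2 * pi + \<delta>) ==> ((%W. P0 \<zeta> W - W + b \<zeta>) \<longlongrightarrow> 0) (filtercomap Im at_top)"
  and Q0_bdd: "!!K. compact K ==> K \<subseteq> lower_hp (- Y0) ==> \<exists>R>0. R <= \<rho> & (\<exists>B. \<forall>\<zeta>\<in>log_sector R (- \<delta>) (2 * pi + \<delta>). \<forall>W\<in>K. cmod (Q0 \<zeta> W) <= B)"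
  and P0_bdd: "!!K. compact K ==> K \<subseteq> upper_hp Y0 ==> \<exists>R>0. R <= \<rho> & (\<exists>B. \<forall>\<zeta>\<in>log_sector R (- \<delta>) (2 * pi + \<delta>). \<forall>W\<in>K. cmod (P0 \<zeta> W) <= B)"
  and b_per: "!!\<zeta>. b (\<zeta> + 2 * pi * \<i>) = b \<zeta>"
  and glue: "!!\<zeta>. \<zeta> \<in> log_sector \<rho> (- \<delta>) \<delta> ==>
   glued (pi * \<i> * exp (- \<zeta> / 2) + b \<zeta> / 2) (pi * \<i> * exp (- \<zeta> / 2) - b \<zeta> / 2)
    (Q0 (\<zeta> + 2 * pi * \<i>)) (%W. P0 (\<zeta> + 2 * pi * \<i>) W + b \<zeta>)
    (%W. Q0 \<zeta> (W - b \<zeta>) + b \<zeta>) (%W. P0 \<zeta> W + b \<zeta>)"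
begin

abbreviation "S \<equiv> log_sector \<rho> (- \<delta>) (2 * pi + \<delta>)"
abbreviation "A \<zeta> \<equiv> pi * \<i> * exp (- \<zeta> / 2) + b \<zeta> / 2"
abbreviation "A' \<zeta> \<equiv> pi * \<i> * exp (- \<zeta> / 2) - b \<zeta> / 2"

lemma Q0_holo: "\<zeta> \<in> S ==> Q0 \<zeta> holomorphic_on lower_hp (- Y0)"
 and P0_holo: "\<zeta> \<in> S ==> P0 \<zeta> holomorphic_on upper_hp Y0"
 by (rule hol2_holomorphic(2)[OF Q0]; simp) (rule hol2_holomorphic(2)[OF P0]; simp)

lemma Q0_per1: "\<zeta> \<in> S ==> per1 (lower_hp (- Y0)) (%W. Q0 \<zeta> W - W)"
 and P0_per1: "\<zeta> \<in> S ==> per1 (upper_hp Y0) (%W. P0 \<zeta> W - W + c)"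
 using Q0_per P0_per unfolding per1_def by (auto intro!: holomorphic_intros Q0_holo P0_holo)

text \<open>The constant term of \<open>P0 \<zeta> W - W\<close> is its mean over any horizontal segment of length one.\<close>

lemma b_mean:
 assumes z: "\<zeta> \<in> S" and c: "Y0 < Im c"
 shows "pmean c (%W. P0 \<zeta> W - W) = - b \<zeta>"
proof -
 have "cmod (pmean c (%W. P0 \<zeta> W - W) + b \<zeta>) <= 0"
 proof (rule field_le_epsilon)
  fix e :: real assume e: "0 < e"
  obtain t where t: "!!W. t <= Im W ==> cmod (P0 \<zeta> W - W + b \<zeta>) < e"
   using P0_lim[OF z] e unfolding tendsto_top by blast
  define c' where "c' = Complex 0 (max t (Im c + 1))"
  have c': "t <= Im c'" "Im c < Im c'" by (auto simp: c'_def)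
  let ?f = "%W. P0 \<zeta> W - W + 0"
  have sub: "hstrip Y0 (Im c' + 1) \<subseteq> upper_hp Y0" by auto
  have h: "?f holomorphic_on hstrip Y0 (Im c' + 1)" by (rule holomorphic_on_subset[OF per1D(1)[OF P0_per1[OF z]] sub])
  have "pmean c ?f = pmean c' ?f"
   by (rule pmean_indep[OF h]) (use c c' per1D(2)[OF P0_per1[OF z]] in auto)
  moreover have "pmean c' ?f - pmean c' (%W. - b \<zeta>) = pmean c' (%W. ?f W - (- b \<zeta>))"
   by (rule pmean_diff[symmetric, OF h]) (use c c' in auto)
  moreover have "pmean c' (%W. - b \<zeta>) = - b \<zeta>" by (simp add: pmean_def)
  moreover have "cmod (pmean c' (%W. ?f W - (- b \<zeta>))) <= e"
  proof (rule pmean_bound[where S = "hstrip Y0 (Im c' + 1)"])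
   show "(%W. ?f W - (- b \<zeta>)) holomorphic_on hstrip Y0 (Im c' + 1)" by (rule holomorphic_on_diff[OF h holomorphic_on_const])
   show "cmod (?f w - (- b \<zeta>)) <= e" if "Im w = Im c'" for w using t[of w] that c' by simp
  qed (use c c' in auto)
  ultimately show "cmod (pmean c (%W. P0 \<zeta> W - W) + b \<zeta>) <= 0 + e" by simp
 qed
 then have "pmean c (%W. P0 \<zeta> W - W) + b \<zeta> = 0" by simp
 then show ?thesis by (simp add: eq_neg_iff_add_eq_0)
qed

lemma b_holo: "b holomorphic_on S"
proof -
 define c where "c = Complex 0 (Y0 + 1)"
 have c: "Y0 < Im c" by (simp add: c_def)
 have "hol2 (S \<times> UNIV) (%\<zeta> w. integral {0..1} (%x. P0 \<zeta> (of_real x + c) - (of_real x + c)))"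
 proof (rule hol2_integral)
  show o: "open (S \<times> (UNIV :: complex set))" by (intro open_Times log_sector_open open_UNIV)
  show "continuous_on ({0..1} \<times> S \<times> (UNIV :: complex set)) (%p. P0 (fst (snd p)) (of_real (fst p) + c) - (of_real (fst p) + c))"
  proof (intro continuous_intros)
   show "continuous_on ({0..1} \<times> S \<times> (UNIV :: complex set)) (%p. P0 (fst (snd p)) (of_real (fst p) + c))"
    by (rule continuous_on_compose2[OF hol2D(2)[OF P0], where f = "%p. (fst (snd p), of_real (fst p) + c)", simplified])
      (use c in \<open>auto intro!: continuous_intros\<close>)
  qed
  show "hol2 (S \<times> UNIV) (%\<zeta> w. P0 \<zeta> (of_real t + c) - (of_real t + c))" if "t \<in> {0..1}" for t
   by (rule hol2_diff[OF hol2_compose[OF P0 hol2_fst[OF o] hol2_const[OF o]] hol2_const[OF o]]) (use c in auto)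
 qed
 from hol2_holomorphic(1)[OF this, of S 0]
 have "(%\<zeta>. integral {0..1} (%x. P0 \<zeta> (of_real x + c) - (of_real x + c))) holomorphic_on S" by simp
 then have "(%\<zeta>. - integral {0..1} (%x. P0 \<zeta> (of_real x + c) - (of_real x + c))) holomorphic_on S" by (rule holomorphic_on_minus)
 then show ?thesis
  by (rule holomorphic_transform) (use b_mean[OF _ c] in \<open>simp add: pmean_def\<close>)
qed

text \<open>
 Near \<open>\<epsilon> = 0\<close> the maps are bounded on one horizontal line, hence exponentially close to
 translations beyond it, uniformly in the parameter.
\<close>

lemma uniform_decay:
 "\<exists>R>0. \<exists>Y1\<ge>Y0. \<exists>M\<ge>0. R <= \<rho> & (\<forall>\<zeta>\<in>log_sector R (- \<delta>) (2 * pi + \<delta>). cmod (b \<zeta>) <= M) \<and>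
  pclass (lowdom (log_sector R (- \<delta>) (2 * pi + \<delta>)) (%_. - Y1)) (wlow Y1) (%\<zeta> W. Q0 \<zeta> W - W) \<and>
  pclass (updom (log_sector R (- \<delta>) (2 * pi + \<delta>)) (%_. Y1)) (wup Y1) (%\<zeta> W. P0 \<zeta> W - W + b \<zeta>)"
proof -
 let ?c = "Y0 + 1"
 define K1 where "K1 = closed_segment (Complex 0 (- ?c)) (Complex 1 (- ?c))"
 define K2 where "K2 = closed_segment (Complex 0 ?c) (Complex 1 ?c)"
 have K1: "W \<in> K1 \<longleftrightarrow> Im W = - ?c & 0 <= Re W & Re W <= 1" for W
  by (auto simp: K1_def closed_segment_same_Im closed_segment_eq_real_ivl)
 have K2: "W \<in> K2 \<longleftrightarrow> Im W = ?c & 0 <= Re W & Re W <= 1" for W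
  by (auto simp: K2_def closed_segment_same_Im closed_segment_eq_real_ivl)
 have sub: "K1 \<subseteq> lower_hp (- Y0)" "K2 \<subseteq> upper_hp Y0" using K1 K2 by auto
 have cpt: "compact K1" "compact K2" by (simp_all add: K1_def K2_def)
 obtain R1 B1 where 1: "0 < R1" "R1 <= \<rho>" "\<forall>\<zeta>\<in>log_sector R1 (- \<delta>) (2 * pi + \<delta>). \<forall>W\<in>K1. cmod (Q0 \<zeta> W) <= B1"
  using Q0_bdd[OF cpt(1) sub(1)] by blast
 obtain R2 B2 where 2: "0 < R2" "\<forall>\<zeta>\<in>log_sector R2 (- \<delta>) (2 * pi + \<delta>). \<forall>W\<in>K2. cmod (P0 \<zeta> W) <= B2"
  using P0_bdd[OF cpt(2) sub(2)] by blast
 define R where "R = min R1 R2"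
 have R: "0 < R" "R <= \<rho>" using 1 2 by (auto simp: R_def)
 define T where "T = log_sector R (- \<delta>) (2 * pi + \<delta>)"
 have T: "\<zeta> \<in> S" "\<zeta> \<in> log_sector R1 (- \<delta>) (2 * pi + \<delta>)" "\<zeta> \<in> log_sector R2 (- \<delta>) (2 * pi + \<delta>)" if "\<zeta> \<in> T" for \<zeta>
  using that R by (auto simp: T_def log_sector_def R_def)
 define B where "B = \<bar>B1\<bar> + \<bar>B2\<bar> + ?c + 1"
 have B: "0 < B" "B1 + (1 + ?c) <= B" "B2 + (1 + ?c) <= B" using Y0 unfolding B_def by linarith+
 have nW: "cmod W <= 1 + ?c" if "0 <= Re W" "Re W <= 1" "\<bar>Im W\<bar> = ?c" for W
  using cmod_le[of W] that by linarith
 have lineQ: "cmod (Q0 \<zeta> W - W) <= B" if z: "\<zeta> \<in> T" and W: "Im W = - ?c" for \<zeta> W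
 proof (rule per1_line_bound[OF Q0_per1[OF T(1)[OF z]] _ _ W])
  fix x :: real assume x: "0 <= x" "x <= 1"
  have "cmod (Q0 \<zeta> (Complex x (- ?c))) <= B1" using 1(3) T(2)[OF z] x K1[of "Complex x (- ?c)"] by auto
  moreover have "cmod (Complex x (- ?c)) <= 1 + ?c" using x Y0 by (intro nW) auto
  ultimately show "cmod (Q0 \<zeta> (Complex x (- ?c)) - Complex x (- ?c)) <= B"
   using norm_triangle_ineq4[of "Q0 \<zeta> (Complex x (- ?c))" "Complex x (- ?c)"] B(2) by linarith
 qed auto
 have lineP: "cmod (P0 \<zeta> W - W + 0) <= B" if z: "\<zeta> \<in> T" and W: "Im W = ?c" for \<zeta> W
 proof (rule per1_line_bound[OF P0_per1[OF T(1)[OF z]] _ _ W])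
  fix x :: real assume x: "0 <= x" "x <= 1"
  have "cmod (P0 \<zeta> (Complex x ?c)) <= B2" using 2(2) T(3)[OF z] x K2[of "Complex x ?c"] by auto
  moreover have "cmod (Complex x ?c) <= 1 + ?c" using x Y0 by (intro nW) auto
  ultimately have "cmod (P0 \<zeta> (Complex x ?c) - Complex x ?c) <= B"
   using norm_triangle_ineq4[of "P0 \<zeta> (Complex x ?c)" "Complex x ?c"] B(3) by linarith
  then show "cmod (P0 \<zeta> (Complex x ?c) - Complex x ?c + 0) <= B" by simp
 qed auto
 have bB: "cmod (b \<zeta>) <= B" if z: "\<zeta> \<in> T" for \<zeta>
 proof -
  have "cmod (pmean (Complex 0 ?c) (%W. P0 \<zeta> W - W + 0)) <= B"
   by (rule pmean_bound[OF per1D(1)[OF P0_per1[OF T(1)[OF z]]]]) (use lineP[OF z] in auto)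
  then show ?thesis using b_mean[OF T(1)[OF z], of "Complex 0 ?c"] by simp
 qed
 have linePb: "cmod (P0 \<zeta> W - W + b \<zeta>) <= 2 * B" if z: "\<zeta> \<in> T" and W: "Im W = ?c" for \<zeta> W
  using lineP[OF z W] bB[OF z] norm_triangle_ineq[of "P0 \<zeta> W - W" "b \<zeta>"] by simp
 define Y1 where "Y1 = Y0 + 2 + 4000 * B"
 have k: "4 * B * exp (- (2 * pi * (y - ?c))) <= 1 / 1000 * exp (- (2 * pi * (y - Y1)))" for y
 proof -
  have "4000 * B <= 1 * (4000 * B + 1)" by simp
  also have "\<dots> <= (2 * pi) * (4000 * B + 1)" using pi_gt3 B(1) by (intro mult_right_mono) auto
  also have "\<dots> <= exp (2 * pi * (4000 * B + 1))" using exp_ge_add_one_self[of "2 * pi * (4000 * B + 1)"] by linarith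
  finally have "4000 * B * exp (- (2 * pi * (y - ?c))) <= exp (2 * pi * (4000 * B + 1)) * exp (- (2 * pi * (y - ?c)))"
   by (intro mult_right_mono) auto
  also have "\<dots> = exp (- (2 * pi * (y - Y1)))" by (simp add: exp_add[symmetric] Y1_def algebra_simps)
  finally show ?thesis by simp
 qed
 have Y1: "Y0 <= Y1" using B by (simp add: Y1_def)
 have oT: "open T" by (simp add: T_def log_sector_open)
 have ol: "open (lowdom T (%_. - Y1))" and ou: "open (updom T (%_. Y1))" by (intro open_const_dom oT)+
 have "pclass (lowdom T (%_. - Y1)) (wlow Y1) (%\<zeta> W. Q0 \<zeta> W - W)"
  unfolding pclass_def
 proof (intro conjI allI impI)
  show "hol2 (lowdom T (%_. - Y1)) (%\<zeta> W. Q0 \<zeta> W - W)"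
   by (rule hol2_diff[OF hol2_subset[OF Q0 ol] hol2_snd[OF ol]]) (use T(1) Y1 in auto)
  fix \<zeta> W assume "(\<zeta>, W) \<in> lowdom T (%_. - Y1)"
  then have z: "\<zeta> \<in> T" and W: "Im W < - Y1" by auto
  show "(\<zeta>, W + 1) \<in> lowdom T (%_. - Y1)" using z W by simp
  show "Q0 \<zeta> (W + 1) - (W + 1) = Q0 \<zeta> W - W" using Q0_per[OF T(1)[OF z], of W] W Y1 by simp
  have W': "Im W <= - ?c - 1 / 4" using W B(1) unfolding Y1_def by linarith
  have "cmod (Q0 \<zeta> W - W) <= 2 * B * exp (- (2 * pi * (- ?c - Im W)))"
   by (rule lower_decay[OF Q0_per1[OF T(1)[OF z]] Q0_lim[OF T(1)[OF z]] _ W' lineQ[OF z]]) auto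
  also have "\<dots> <= 4 * B * exp (- (2 * pi * (- Im W - ?c)))" using B by (intro mult_mono) (auto simp: algebra_simps)
  also have "\<dots> <= 1 / 1000 * exp (- (2 * pi * (- Im W - Y1)))" by (rule k)
  also have "- (2 * pi * (- Im W - Y1)) = 2 * pi * (Im W + Y1)" by (simp add: algebra_simps)
  finally show "cmod (Q0 \<zeta> W - W) <= wlow Y1 \<zeta> W" .
 qed
 moreover have "pclass (updom T (%_. Y1)) (wup Y1) (%\<zeta> W. P0 \<zeta> W - W + b \<zeta>)"
  unfolding pclass_def
 proof (intro conjI allI impI)
  show "hol2 (updom T (%_. Y1)) (%\<zeta> W. P0 \<zeta> W - W + b \<zeta>)"
   by (rule hol2_add[OF hol2_diff[OF hol2_subset[OF P0 ou] hol2_snd[OF ou]] hol2_fst_holo[OF b_holo log_sector_open ou]])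
     (use T(1) Y1 in auto)
  fix \<zeta> W assume "(\<zeta>, W) \<in> updom T (%_. Y1)"
  then have z: "\<zeta> \<in> T" and W: "Y1 < Im W" by auto
  show "(\<zeta>, W + 1) \<in> updom T (%_. Y1)" using z W by simp
  show "P0 \<zeta> (W + 1) - (W + 1) + b \<zeta> = P0 \<zeta> W - W + b \<zeta>" using P0_per[OF T(1)[OF z], of W] W Y1 by simp
  have W': "?c + 1 / 4 <= Im W" using W B(1) unfolding Y1_def by linarith
  have "cmod (P0 \<zeta> W - W + b \<zeta>) <= 2 * (2 * B) * exp (- (2 * pi * (Im W - ?c)))"
   by (rule upper_decay[OF P0_per1[OF T(1)[OF z]] P0_lim[OF T(1)[OF z]] _ W' linePb[OF z]]) auto
  also have "\<dots> <= 1 / 1000 * exp (- (2 * pi * (Im W - Y1)))" using k by simp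
  finally show "cmod (P0 \<zeta> W - W + b \<zeta>) <= wup Y1 \<zeta> W" .
 qed
 moreover have "0 <= B" "\<forall>\<zeta>\<in>T. cmod (b \<zeta>) <= B" using B bB by auto
 ultimately show ?thesis using R Y1 unfolding T_def by blast
qed

text \<open>The real part of \<open>exp (- \<zeta> / 2)\<close> is its modulus times \<open>cos (Im \<zeta> / 2)\<close>.\<close>

lemma Im_A_lower:
 assumes \<kappa>: "0 < \<kappa>" "\<kappa> < pi" and z: "- pi + \<kappa> <= Im \<zeta>" "Im \<zeta> <= pi - \<kappa>" and b: "cmod (b \<zeta>) <= M"
 shows "pi * sin (\<kappa> / 2) / sqrt (cmod (exp \<zeta>)) - M <= Im (A \<zeta>)"
proof -
 have "sqrt (cmod (exp \<zeta>)) = exp (Re \<zeta> / 2)"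
  by (rule real_sqrt_unique) (simp_all add: power2_eq_square exp_add[symmetric])
 then have e: "1 / sqrt (cmod (exp \<zeta>)) = exp (- Re \<zeta> / 2)" by (simp add: exp_minus inverse_eq_divide)
 have "sin (\<kappa> / 2) = cos (pi / 2 - \<kappa> / 2)" by (simp add: cos_diff)
 also have "\<dots> <= cos \<bar>Im \<zeta> / 2\<bar>" using \<kappa> z by (intro cos_monotone_0_pi_le) (auto simp: abs_le_iff field_simps)
 also have "\<dots> = cos (Im \<zeta> / 2)" by (rule cos_abs_real)
 finally have c: "sin (\<kappa> / 2) <= cos (Im \<zeta> / 2)" .
 have "Im (A \<zeta>) = pi * (exp (- Re \<zeta> / 2) * cos (Im \<zeta> / 2)) + Im (b \<zeta>) / 2"
  by (simp add: Re_exp)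
 moreover have "- M <= Im (b \<zeta>) / 2" using abs_Im_le_cmod[of "b \<zeta>"] b norm_ge_zero[of "b \<zeta>"] by linarith
 moreover have "pi * (exp (- Re \<zeta> / 2) * sin (\<kappa> / 2)) <= pi * (exp (- Re \<zeta> / 2) * cos (Im \<zeta> / 2))" using c by simp
 moreover have "pi * sin (\<kappa> / 2) / sqrt (cmod (exp \<zeta>)) = pi * (exp (- Re \<zeta> / 2) * sin (\<kappa> / 2))" unfolding e[symmetric] by simp
 ultimately show ?thesis by linarith
qed

text \<open>Near \<open>\<epsilon> = 0\<close>, away from the negative axis of the sheet of \<open>\<zeta>\<close>, \<open>A\<close> has large imaginary part.\<close>

lemma Im_A_large:
 assumes \<kappa>: "0 < \<kappa>" "\<kappa> < pi"
 shows "\<exists>R>0. \<forall>\<zeta>. cmod (exp \<zeta>) < R --> - pi + \<kappa> <= Im \<zeta> --> Im \<zeta> <= pi - \<kappa> --> cmod (b \<zeta>) <= M --> N <= Im (A \<zeta>)"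
proof -
 define s where "s = pi * sin (\<kappa> / 2)"
 have s: "0 < s" unfolding s_def using \<kappa> by (intro mult_pos_pos sin_gt_zero) auto
 define k where "k = (\<bar>N\<bar> + \<bar>M\<bar> + 1) / s"
 have k: "0 < k" using s by (simp add: k_def add_nonneg_pos)
 have "N <= Im (A \<zeta>)" if z: "cmod (exp \<zeta>) < 1 / k\<^sup>2" "- pi + \<kappa> <= Im \<zeta>" "Im \<zeta> <= pi - \<kappa>" and b: "cmod (b \<zeta>) <= M" for \<zeta>
 proof -
  have "sqrt (cmod (exp \<zeta>)) <= sqrt (1 / k\<^sup>2)" using z(1) by (intro real_sqrt_le_mono) simp
  then have "sqrt (cmod (exp \<zeta>)) <= 1 / k" using k by (simp add: real_sqrt_divide)
  moreover have "0 < sqrt (cmod (exp \<zeta>))" by simp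
  ultimately have "k <= 1 / sqrt (cmod (exp \<zeta>))" using k by (simp add: field_simps)
  then have "s * k <= s * (1 / sqrt (cmod (exp \<zeta>)))" using s by (intro mult_left_mono) auto
  moreover have "s * k = \<bar>N\<bar> + \<bar>M\<bar> + 1" using s by (simp add: k_def)
  ultimately have "\<bar>N\<bar> + \<bar>M\<bar> + 1 <= pi * sin (\<kappa> / 2) / sqrt (cmod (exp \<zeta>))" by (simp add: s_def)
  then show ?thesis using Im_A_lower[OF \<kappa> z(2,3) b] by linarith
 qed
 moreover have "0 < 1 / k\<^sup>2" using k by simp
 ultimately show ?thesis by blast
qed

text \<open>Closeness of order \<open>exp (- pi * Im (A \<zeta>))\<close> is flatness in \<open>\<epsilon>\<close>.\<close>

lemma flat_of_Im_A:
 assumes \<kappa>: "0 < \<kappa>" "\<kappa> < pi"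
  and \<Omega>: "!!\<zeta>. \<zeta> \<in> \<Omega> ==> - pi + \<kappa> <= Im \<zeta> & Im \<zeta> <= pi - \<kappa> & cmod (b \<zeta>) <= M"
  and C: "0 < C" and le: "!!\<zeta> W. \<zeta> \<in> \<Omega> ==> W \<in> K ==> cmod (d \<zeta> W) <= C * exp (- (pi * Im (A \<zeta>)))"
 shows "flat_on \<Omega> K d"
 unfolding flat_on_def
proof (intro exI conjI ballI)
 show "0 < pi * (pi * sin (\<kappa> / 2))" using \<kappa> by (intro mult_pos_pos sin_gt_zero) auto
 show "0 < C * exp (pi * M)" using C by simp
 fix \<zeta> W assume z: "\<zeta> \<in> \<Omega>" "W \<in> K"
 have "pi * (pi * sin (\<kappa> / 2) / sqrt (cmod (exp \<zeta>)) - M) <= pi * Im (A \<zeta>)"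
  using Im_A_lower[OF \<kappa>] \<Omega>[OF z(1)] by (intro mult_left_mono) auto
 then have "exp (- (pi * Im (A \<zeta>))) <= exp (pi * M - pi * (pi * sin (\<kappa> / 2)) / sqrt (cmod (exp \<zeta>)))"
  by (subst exp_le_cancel_iff) (simp add: algebra_simps)
 also have "\<dots> = exp (pi * M) * exp (- (pi * (pi * sin (\<kappa> / 2)) / sqrt (cmod (exp \<zeta>))))" by (simp add: exp_add[symmetric])
 finally have "C * exp (- (pi * Im (A \<zeta>))) <= C * (exp (pi * M) * exp (- (pi * (pi * sin (\<kappa> / 2)) / sqrt (cmod (exp \<zeta>)))))"
  using C by simp
 then show "cmod (d \<zeta> W) <= C * exp (pi * M) * exp (- (pi * (pi * sin (\<kappa> / 2)) / sqrt (cmod (exp \<zeta>))))"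
  using le[OF z] by (simp add: mult.assoc)
qed

text \<open>
 Maps \<open>Q\<close>, \<open>P\<close> given for the parameters in \<open>\<Omega>\<close> have glued partners there. The partners are
 flatly close to \<open>Q\<close> and \<open>P\<close>, and no other maps can be glued to \<open>Q\<close> and \<open>P\<close>.
\<close>

lemma continuation:
 assumes \<kappa>: "0 < \<kappa>" "\<kappa> < pi" and o: "open \<Omega>" and b: "b holomorphic_on \<Omega>" and YM: "0 <= Y" "0 <= M"
  and \<Omega>: "!!\<zeta>. \<zeta> \<in> \<Omega> ==> - pi + \<kappa> <= Im \<zeta> & Im \<zeta> <= pi - \<kappa> & cmod (b \<zeta>) <= M"
  and ImA: "!!\<zeta>. \<zeta> \<in> \<Omega> ==> 2 * Y + 2 * M + 40 <= Im (A \<zeta>)"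
  and Q: "pclass (lowdom \<Omega> (%_. - Y)) (wlow Y) (%z W. Q z W - W)"
  and P: "pclass (updom \<Omega> (%_. Y)) (wup Y) (%z W. P z W - W)"
 shows "\<exists>Qh Ph. hol2 (lowdom \<Omega> (%_. - (Y + M + 4))) Qh & hol2 (updom \<Omega> (%_. Y + M + 4)) Ph \<and>
  (\<forall>Z\<ge>0. flat_on \<Omega> {W. - Z <= Im W & Im W < - (Y + M + 4)} (%z W. Qh z W - (Q z (W - b z) + b z))) \<and>
  (\<forall>Z\<ge>0. flat_on \<Omega> {W. Im W <= Z & Y + M + 4 < Im W} (%z W. Ph z W - P z W)) \<and>
  (\<forall>z\<in>\<Omega>. \<forall>Qg Pg. pclass (lowdom UNIV (%_. - Y)) (wlow Y) (%_ W. Qg W - W) -->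
    pclass (updom UNIV (%_. Y)) (wup Y) (%_ W. Pg W - W) --> glued (A z) (A' z) (Q z) (P z) Qg Pg -->
    (\<forall>W. Im W < - (Y + M + 4) --> Qg W = Qh z W) & (\<forall>W. Y + M + 4 < Im W --> Pg W = Ph z W))"
proof -
 have AA: "A \<zeta> - A' \<zeta> = b \<zeta>" for \<zeta> by simp
 have td: "transition_data \<Omega> A A' Y M Q P"
 proof
  show "A holomorphic_on \<Omega>" "A' holomorphic_on \<Omega>" by (intro holomorphic_intros b; simp)+
  show "cmod (A z - A' z) <= M" if "z \<in> \<Omega>" for z using \<Omega>[OF that] unfolding AA by blast
 qed (fact o YM ImA Q P)+
 obtain f h k u Qh Ph where gs: "gluing_system \<Omega> A A' Y M Q P f h k u Qh Ph"
  using transition_data.exists_gluing_system[OF td] by blast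
 interpret gluing_system \<Omega> A A' Y M Q P f h k u Qh Ph by (rule gs)
 have ol: "open (lowdom \<Omega> (%_. - (Y + M + 4)))" and ou: "open (updom \<Omega> (%_. Y + M + 4))" by (intro open_const_dom o)+
 show ?thesis
 proof (rule exI[of _ Qh], rule exI[of _ Ph], intro conjI allI impI)
  show "hol2 (lowdom \<Omega> (%_. - (Y + M + 4))) Qh" by (rule hol2_cong[OF hol2_add[OF pclassD(1)[OF Qh] hol2_snd[OF ol]]]) simp
  show "hol2 (updom \<Omega> (%_. Y + M + 4)) Ph" by (rule hol2_cong[OF hol2_add[OF pclassD(1)[OF Ph] hol2_snd[OF ou]]]) simp
  fix Z :: real assume Z: "0 <= Z"
  obtain C where C: "0 < C" and c: "\<forall>z\<in>\<Omega>. \<forall>W. - Z <= Im W --> Im W < - (Y + M + 4) -->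
    cmod (Qh z W - (Q z (W - (A z - A' z)) + (A z - A' z))) <= C * exp (- (pi * Im (A z)))" using Qh_close[OF Z] by blast
  show "flat_on \<Omega> {W. - Z <= Im W & Im W < - (Y + M + 4)} (%z W. Qh z W - (Q z (W - b z) + b z))"
   by (rule flat_of_Im_A[OF \<kappa> \<Omega> C]) (use c in \<open>unfold AA, auto\<close>)
 next
  fix Z :: real assume Z: "0 <= Z"
  obtain C where C: "0 < C" and c: "\<forall>z\<in>\<Omega>. \<forall>W. Im W <= Z --> Y + M + 4 < Im W -->
    cmod (Ph z W - P z W) <= C * exp (- (pi * Im (A z)))" using Ph_close[OF Z] by blast
  show "flat_on \<Omega> {W. Im W <= Z & Y + M + 4 < Im W} (%z W. Ph z W - P z W)"
   by (rule flat_of_Im_A[OF \<kappa> \<Omega> C]) (use c in auto)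
 qed (use glued_unique in blast)
qed

text \<open>
 \<open>q\<close>, \<open>p\<close> continue the maps to the sector \<open>a1 < Im \<zeta> < a2\<close>, staying flatly close to the values of the
 maps at \<open>\<zeta> + s\<close>.
\<close>

definition extends :: "real => real => real => real => complex => (complex => complex => complex) => (complex => complex => complex) => bool" where
 "extends R Y a1 a2 s q p \<longleftrightarrow> 0 < R & R <= \<rho> & Y0 <= Y \<and>
   hol2 (log_sector R a1 a2 \<times> lower_hp (- Y)) q & hol2 (log_sector R a1 a2 \<times> upper_hp Y) p \<and>
   (\<forall>\<zeta>\<in>log_sector R a1 a2 \<inter> S. (\<forall>W\<in>lower_hp (- Y). q \<zeta> W = Q0 \<zeta> W) & (\<forall>W\<in>upper_hp Y. p \<zeta> W = P0 \<zeta> W)) \<and>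
   (\<forall>Z\<ge>0. flat_on (log_sector R a1 a2) {W. - Z <= Im W & Im W < - Y} (%\<zeta> W. q \<zeta> W - Q0 (\<zeta> + s) W)) \<and>
   (\<forall>Z\<ge>0. flat_on (log_sector R a1 a2) {W. Im W <= Z & Y < Im W} (%\<zeta> W. p \<zeta> W - P0 (\<zeta> + s) W))"

text \<open>
 The maps at \<open>\<zeta> + 2 * pi * \<i>\<close> exist for \<open>- pi + \<kappa> < Im \<zeta>\<close>. The maps glued to them extend the given
 ones from \<open>- \<delta> < Im \<zeta>\<close> to all these \<open>\<zeta>\<close>.
\<close>

lemma continuation_below:
 assumes \<kappa>: "0 < \<kappa>" "\<kappa> < pi / 2"
 shows "\<exists>R Y q p. extends R Y (- pi + \<kappa>) \<delta> (2 * pi * \<i>) q p"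
proof -
 have \<kappa>': "0 < \<kappa>" "\<kappa> < pi" using \<kappa> by linarith+
 obtain R0 Y1 M where R0: "0 < R0" "R0 <= \<rho>" and Y1: "Y0 <= Y1" and M: "0 <= M"
  and bM: "\<forall>\<zeta>\<in>log_sector R0 (- \<delta>) (2 * pi + \<delta>). cmod (b \<zeta>) <= M"
  and Qd: "pclass (lowdom (log_sector R0 (- \<delta>) (2 * pi + \<delta>)) (%_. - Y1)) (wlow Y1) (%\<zeta> W. Q0 \<zeta> W - W)"
  and Pd: "pclass (updom (log_sector R0 (- \<delta>) (2 * pi + \<delta>)) (%_. Y1)) (wup Y1) (%\<zeta> W. P0 \<zeta> W - W + b \<zeta>)"
  using uniform_decay by blast
 define Y where "Y = Y1 + M"
 have Y: "Y0 <= Y" "Y1 <= Y" "0 <= Y" using Y1 M Y0 by (auto simp: Y_def)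
 obtain R1 where R1: "0 < R1"
  and ImA: "\<forall>\<zeta>. cmod (exp \<zeta>) < R1 --> - pi + \<kappa> <= Im \<zeta> --> Im \<zeta> <= pi - \<kappa> --> cmod (b \<zeta>) <= M --> 2 * Y + 2 * M + 40 <= Im (A \<zeta>)"
  using Im_A_large[OF \<kappa>', of M "2 * Y + 2 * M + 40"] by blast
 define R where "R = min R0 R1"
 have R: "0 < R" "R <= \<rho>" using R0 R1 by (auto simp: R_def)
 define \<Omega> where "\<Omega> = log_sector R (- pi + \<kappa>) \<delta>"
 have shift: "\<zeta> + 2 * pi * \<i> \<in> log_sector R0 (- \<delta>) (2 * pi + \<delta>)" if "\<zeta> \<in> \<Omega>" for \<zeta>
  using that \<kappa> \<delta> by (auto simp: \<Omega>_def R_def log_sector_def)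
 have \<Omega>: "- pi + \<kappa> <= Im \<zeta> & Im \<zeta> <= pi - \<kappa> & cmod (b \<zeta>) <= M" if "\<zeta> \<in> \<Omega>" for \<zeta>
  using that \<kappa> \<delta> bM[rule_format, OF shift[OF that]] unfolding b_per by (auto simp: \<Omega>_def log_sector_def)
 have oO: "open \<Omega>" by (simp add: \<Omega>_def log_sector_open)
 have bh: "b holomorphic_on \<Omega>"
 proof -
  have "\<zeta> + 2 * pi * \<i> \<in> S" if "\<zeta> \<in> \<Omega>" for \<zeta> using shift[OF that] R0 by (auto simp: log_sector_def)
  then have "(%\<zeta>. b (\<zeta> + 2 * pi * \<i>)) holomorphic_on \<Omega>"
   by (intro holomorphic_on_compose_gen[OF _ b_holo, of "%\<zeta>. \<zeta> + 2 * pi * \<i>", unfolded o_def])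
     (auto intro!: holomorphic_intros)
  then show ?thesis unfolding b_per .
 qed
 have Imb: "- M <= Im (b \<zeta>)" "Im (b \<zeta>) <= M" if "\<zeta> \<in> \<Omega>" for \<zeta>
  using \<Omega>[OF that] abs_Im_le_cmod[of "b \<zeta>"] by linarith+
 have ol: "open (lowdom \<Omega> (%_. - Y))" and ou: "open (updom \<Omega> (%_. Y))" by (intro open_const_dom oO)+
 note oU = open_const_dom(1)[OF open_UNIV, of "- Y"] open_const_dom(2)[OF open_UNIV, of Y]
 have ImA': "2 * Y + 2 * M + 40 <= Im (A \<zeta>)" if "\<zeta> \<in> \<Omega>" for \<zeta>
  using ImA \<Omega>[OF that] that by (simp add: \<Omega>_def R_def log_sector_def)
 have Q: "pclass (lowdom \<Omega> (%_. - Y)) (wlow Y) (%z W. Q0 (z + 2 * pi * \<i>) W - W)"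
  by (rule pclass_affine[OF Qd ol, where s = "%z. z + 2 * pi * \<i>" and t = "%_. 0" and e = 1])
    (use shift Y ol in \<open>auto intro!: hol2_intros\<close>)
 have P: "pclass (updom \<Omega> (%_. Y)) (wup Y) (%z W. P0 (z + 2 * pi * \<i>) W + b z - W)"
  by (rule pclass_affine[OF Pd ou, where s = "%z. z + 2 * pi * \<i>" and t = "%_. 0" and e = 1])
    (use shift Y ou in \<open>auto intro!: hol2_intros simp: b_per simp del: of_real_mult\<close>)
 obtain Qh Ph where
  Qh: "hol2 (lowdom \<Omega> (%_. - (Y + M + 4))) Qh" and Ph: "hol2 (updom \<Omega> (%_. Y + M + 4)) Ph" and
  Qc: "\<forall>Z\<ge>0. flat_on \<Omega> {W. - Z <= Im W & Im W < - (Y + M + 4)} (%z W. Qh z W - (Q0 (z + 2 * pi * \<i>) (W - b z) + b z))" and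
  Pc: "\<forall>Z\<ge>0. flat_on \<Omega> {W. Im W <= Z & Y + M + 4 < Im W} (%z W. Ph z W - (P0 (z + 2 * pi * \<i>) W + b z))" and
  uq: "\<forall>z\<in>\<Omega>. \<forall>Qg Pg. pclass (lowdom UNIV (%_. - Y)) (wlow Y) (%_ W. Qg W - W) -->
    pclass (updom UNIV (%_. Y)) (wup Y) (%_ W. Pg W - W) -->
    glued (A z) (A' z) (Q0 (z + 2 * pi * \<i>)) (%W. P0 (z + 2 * pi * \<i>) W + b z) Qg Pg -->
    (\<forall>W. Im W < - (Y + M + 4) --> Qg W = Qh z W) & (\<forall>W. Y + M + 4 < Im W --> Pg W = Ph z W)"
  using continuation[OF \<kappa>' oO bh Y(3) M \<Omega> ImA' Q P] by blast
 define Y2 where "Y2 = Y + 2 * M + 4"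
 define q where "q \<zeta> W = Qh \<zeta> (W + b \<zeta>) - b \<zeta>" for \<zeta> W
 define p where "p \<zeta> W = Ph \<zeta> W - b \<zeta>" for \<zeta> W
 have agree: "(\<forall>W. Im W < - (Y + M + 4) --> Q0 z (W - b z) + b z = Qh z W) & (\<forall>W. Y + M + 4 < Im W --> P0 z W + b z = Ph z W)"
  if z: "z \<in> \<Omega> \<inter> S" for z
 proof (rule uq[rule_format])
  show zO: "z \<in> \<Omega>" using z by simp
  have z0: "z \<in> log_sector R0 (- \<delta>) (2 * pi + \<delta>)" "z \<in> log_sector \<rho> (- \<delta>) \<delta>"
   using z R by (auto simp: \<Omega>_def R_def log_sector_def)
  note I = Imb[OF zO]
  show "pclass (lowdom UNIV (%_. - Y)) (wlow Y) (%_ W. Q0 z (W - b z) + b z - W)"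
   by (rule pclass_affine[OF Qd oU(1), where s = "%_. z" and t = "%_. - b z" and e = 1])
     (use z0 I oU in \<open>auto intro!: hol2_intros simp: Y_def\<close>)
  show "pclass (updom UNIV (%_. Y)) (wup Y) (%_ W. P0 z W + b z - W)"
   by (rule pclass_affine[OF Pd oU(2), where s = "%_. z" and t = "%_. 0" and e = 1])
     (use z0 Y oU in \<open>auto intro!: hol2_intros\<close>)
  show "glued (A z) (A' z) (Q0 (z + 2 * pi * \<i>)) (%W. P0 (z + 2 * pi * \<i>) W + b z) (%W. Q0 z (W - b z) + b z) (%W. P0 z W + b z)"
   by (rule glue[OF z0(2)])
 qed
 have imWb: "Im (W + b z) < - (Y + M + 4)" if "z \<in> \<Omega>" "Im W < - Y2" for z W
  using Imb[OF that(1)] that(2) unfolding Y2_def by auto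
 have oq: "open (\<Omega> \<times> lower_hp (- Y2))" and op: "open (\<Omega> \<times> upper_hp Y2)" using oO by (auto intro: open_Times)
 have bq: "hol2 (\<Omega> \<times> lower_hp (- Y2)) (%z W. b z)" and bp: "hol2 (\<Omega> \<times> upper_hp Y2) (%z W. b z)"
  by (rule hol2_fst_holo[OF bh oO]; use oq op in auto)+
 have "extends R Y2 (- pi + \<kappa>) \<delta> (2 * pi * \<i>) q p"
  unfolding extends_def \<Omega>_def[symmetric]
 proof (intro conjI ballI allI impI)
  show "hol2 (\<Omega> \<times> lower_hp (- Y2)) q" unfolding q_def
   by (rule hol2_diff[OF hol2_compose[OF Qh hol2_fst[OF oq] hol2_add[OF hol2_snd[OF oq] bq]] bq]) (use imWb in auto)
  show "hol2 (\<Omega> \<times> upper_hp Y2) p" unfolding p_def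
   by (rule hol2_diff[OF hol2_subset[OF Ph op] bp]) (use M in \<open>auto simp: Y2_def\<close>)
  show "q \<zeta> W = Q0 \<zeta> W" if "\<zeta> \<in> \<Omega> \<inter> S" "W \<in> lower_hp (- Y2)" for \<zeta> W
  proof -
   have "Q0 \<zeta> (W + b \<zeta> - b \<zeta>) + b \<zeta> = Qh \<zeta> (W + b \<zeta>)"
    using agree[OF that(1)] imWb[of \<zeta> W] that[simplified] by blast
   then have e: "Qh \<zeta> (W + b \<zeta>) = Q0 \<zeta> W + b \<zeta>" by simp
   show ?thesis unfolding q_def e by simp
  qed
  show "p \<zeta> W = P0 \<zeta> W" if "\<zeta> \<in> \<Omega> \<inter> S" "W \<in> upper_hp Y2" for \<zeta> W
  proof -
   have "Y + M + 4 < Im W" using that M by (simp add: Y2_def)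
   then show ?thesis using agree[OF that(1)] by (metis add_diff_cancel_right' p_def)
  qed
  fix Z :: real assume Z: "0 <= Z"
  have ZM: "0 <= Z + M" using Z M by simp
  show "flat_on \<Omega> {W. - Z <= Im W & Im W < - Y2} (%\<zeta> W. q \<zeta> W - Q0 (\<zeta> + 2 * pi * \<i>) W)"
  proof (rule flat_on_pullback[OF Qc[rule_format, OF ZM], where \<sigma> = "%\<zeta>. \<zeta>"])
   fix \<zeta> W assume z: "\<zeta> \<in> \<Omega>" and W: "W \<in> {W. - Z <= Im W & Im W < - Y2}"
   show "\<exists>W'\<in>{W. - (Z + M) <= Im W & Im W < - (Y + M + 4)}. cmod (q \<zeta> W - Q0 (\<zeta> + 2 * pi * \<i>) W) =
     cmod (Qh \<zeta> W' - (Q0 (\<zeta> + 2 * pi * \<i>) (W' - b \<zeta>) + b \<zeta>))"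
    by (rule bexI[of _ "W + b \<zeta>"]) (use Imb[OF z] imWb[OF z] W in \<open>auto simp: q_def diff_diff_eq2 algebra_simps\<close>)
  qed auto
  show "flat_on \<Omega> {W. Im W <= Z & Y2 < Im W} (%\<zeta> W. p \<zeta> W - P0 (\<zeta> + 2 * pi * \<i>) W)"
  proof (rule flat_on_pullback[OF Pc[rule_format, OF Z], where \<sigma> = "%\<zeta>. \<zeta>"])
   fix \<zeta> W assume "\<zeta> \<in> \<Omega>" and "W \<in> {W. Im W <= Z & Y2 < Im W}"
   then show "\<exists>W'\<in>{W. Im W <= Z & Y + M + 4 < Im W}. cmod (p \<zeta> W - P0 (\<zeta> + 2 * pi * \<i>) W) = cmod (Ph \<zeta> W' - (P0 (\<zeta> + 2 * pi * \<i>) W' + b \<zeta>))"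
    using M by (intro bexI[of _ W]) (auto simp: p_def Y2_def diff_diff_eq algebra_simps)
  qed auto
 qed (use R Y M in \<open>auto simp: Y2_def\<close>)
 then show ?thesis by blast
qed

text \<open>
 Dually, the maps at \<open>\<zeta> - 2 * pi * \<i>\<close> exist for \<open>Im \<zeta> < 3 * pi - \<kappa>\<close>, and the maps at \<open>\<zeta>\<close> are glued to
 them after the reflection \<open>W \<mapsto> - W\<close>, which exchanges the two ends and the two lifts.
\<close>

lemma continuation_above:
 assumes \<kappa>: "0 < \<kappa>" "\<kappa> < pi / 2"
 shows "\<exists>R Y q p. extends R Y (2 * pi - \<delta>) (3 * pi - \<kappa>) (- (2 * pi * \<i>)) q p"
proof -
 have \<kappa>': "0 < \<kappa>" "\<kappa> < pi" using \<kappa> by linarith+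
 obtain R0 Y1 M where R0: "0 < R0" "R0 <= \<rho>" and Y1: "Y0 <= Y1" and M: "0 <= M"
  and bM: "\<forall>\<zeta>\<in>log_sector R0 (- \<delta>) (2 * pi + \<delta>). cmod (b \<zeta>) <= M"
  and Qd: "pclass (lowdom (log_sector R0 (- \<delta>) (2 * pi + \<delta>)) (%_. - Y1)) (wlow Y1) (%\<zeta> W. Q0 \<zeta> W - W)"
  and Pd: "pclass (updom (log_sector R0 (- \<delta>) (2 * pi + \<delta>)) (%_. Y1)) (wup Y1) (%\<zeta> W. P0 \<zeta> W - W + b \<zeta>)"
  using uniform_decay by blast
 define Y where "Y = Y1 + M"
 have Y: "Y0 <= Y" "Y1 <= Y" "0 <= Y" using Y1 M Y0 by (auto simp: Y_def)
 obtain R1 where R1: "0 < R1"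
  and ImA: "\<forall>\<zeta>. cmod (exp \<zeta>) < R1 --> - pi + \<kappa> <= Im \<zeta> --> Im \<zeta> <= pi - \<kappa> --> cmod (b \<zeta>) <= M --> 2 * Y + 2 * M + 40 <= Im (A \<zeta>)"
  using Im_A_large[OF \<kappa>', of M "2 * Y + 2 * M + 40"] by blast
 define R where "R = min R0 R1"
 have R: "0 < R" "R <= \<rho>" using R0 R1 by (auto simp: R_def)
 define \<Omega> where "\<Omega> = log_sector R (- \<delta>) (pi - \<kappa>)"
 have in0: "\<zeta> \<in> log_sector R0 (- \<delta>) (2 * pi + \<delta>)" if "\<zeta> \<in> \<Omega>" for \<zeta>
  using that \<kappa> \<delta> by (auto simp: \<Omega>_def R_def log_sector_def)
 have \<Omega>: "- pi + \<kappa> <= Im \<zeta> & Im \<zeta> <= pi - \<kappa> & cmod (b \<zeta>) <= M" if "\<zeta> \<in> \<Omega>" for \<zeta>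
  using that \<kappa> \<delta> bM[rule_format, OF in0[OF that]] by (auto simp: \<Omega>_def log_sector_def)
 have oO: "open \<Omega>" by (simp add: \<Omega>_def log_sector_open)
 have bh: "b holomorphic_on \<Omega>"
  by (rule holomorphic_on_subset[OF b_holo]) (use in0 R0 in \<open>fastforce simp: log_sector_def\<close>)
 have Imb: "- M <= Im (b \<zeta>)" "Im (b \<zeta>) <= M" if "\<zeta> \<in> \<Omega>" for \<zeta>
  using \<Omega>[OF that] abs_Im_le_cmod[of "b \<zeta>"] by linarith+
 have ol: "open (lowdom \<Omega> (%_. - Y))" and ou: "open (updom \<Omega> (%_. Y))" by (intro open_const_dom oO)+
 note oU = open_const_dom(1)[OF open_UNIV, of "- Y"] open_const_dom(2)[OF open_UNIV, of Y]
 have bl: "hol2 (lowdom \<Omega> (%_. - Y)) (%z _. - b z)" and bu: "hol2 (updom \<Omega> (%_. Y)) (%z _. - b z)"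
  by (rule hol2_minus, rule hol2_fst_holo[OF bh oO]; use ol ou in auto)+
 define Q where "Q \<zeta> W = - (P0 \<zeta> (- W - b \<zeta>) + b \<zeta>) - b \<zeta>" for \<zeta> W
 define P where "P \<zeta> W = - (Q0 \<zeta> (- W - b \<zeta>) + b \<zeta>)" for \<zeta> W
 have refl: "- (2 * pi * (Im (- 1 * W + t) - Y1)) = 2 * pi * (Im W - Im t + Y1)"
  "2 * pi * (Im (- 1 * W + t) + Y1) = - (2 * pi * (Im W - Im t - Y1))" for W t by (simp_all add: algebra_simps)
 have ImA': "2 * Y + 2 * M + 40 <= Im (A \<zeta>)" if "\<zeta> \<in> \<Omega>" for \<zeta>
  using ImA \<Omega>[OF that] that by (simp add: \<Omega>_def R_def log_sector_def)
 have Qp: "pclass (lowdom \<Omega> (%_. - Y)) (wlow Y) (%z W. Q z W - W)"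
 proof (rule pclass_affine[OF Pd ol _ hol2_fst[OF ol] bl, where e = "- 1"])
  show "(z, - 1 * W + - b z) \<in> updom (log_sector R0 (- \<delta>) (2 * pi + \<delta>)) (%_. Y1) & wup Y1 z (- 1 * W + - b z) <= wlow Y z W"
   if "(z, W) \<in> lowdom \<Omega> (%_. - Y)" for z W
   unfolding refl using that in0[of z] Imb[of z] by (auto simp: Y_def)
 qed (auto simp: Q_def)
 have Pp: "pclass (updom \<Omega> (%_. Y)) (wup Y) (%z W. P z W - W)"
 proof (rule pclass_affine[OF Qd ou _ hol2_fst[OF ou] bu, where e = "- 1"])
  show "(z, - 1 * W + - b z) \<in> lowdom (log_sector R0 (- \<delta>) (2 * pi + \<delta>)) (%_. - Y1) & wlow Y1 z (- 1 * W + - b z) <= wup Y z W"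
   if "(z, W) \<in> updom \<Omega> (%_. Y)" for z W
   unfolding refl using that in0[of z] Imb[of z] by (auto simp: Y_def)
 qed (auto simp: P_def)
 obtain Qh Ph where
  Qh: "hol2 (lowdom \<Omega> (%_. - (Y + M + 4))) Qh" and Ph: "hol2 (updom \<Omega> (%_. Y + M + 4)) Ph" and
  Qc: "\<forall>Z\<ge>0. flat_on \<Omega> {W. - Z <= Im W & Im W < - (Y + M + 4)} (%z W. Qh z W - (Q z (W - b z) + b z))" and
  Pc: "\<forall>Z\<ge>0. flat_on \<Omega> {W. Im W <= Z & Y + M + 4 < Im W} (%z W. Ph z W - P z W)" and
  uq: "\<forall>z\<in>\<Omega>. \<forall>Qg Pg. pclass (lowdom UNIV (%_. - Y)) (wlow Y) (%_ W. Qg W - W) -->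
    pclass (updom UNIV (%_. Y)) (wup Y) (%_ W. Pg W - W) --> glued (A z) (A' z) (Q z) (P z) Qg Pg -->
    (\<forall>W. Im W < - (Y + M + 4) --> Qg W = Qh z W) & (\<forall>W. Y + M + 4 < Im W --> Pg W = Ph z W)"
  using continuation[OF \<kappa>' oO bh Y(3) M \<Omega> ImA' Qp Pp] by blast
 define \<sigma> where "\<sigma> \<zeta> = \<zeta> - 2 * pi * \<i>" for \<zeta>
 define Y2 where "Y2 = Y + 2 * M + 4"
 define q where "q \<zeta> W = - Ph (\<sigma> \<zeta>) (- W - b (\<sigma> \<zeta>)) - b (\<sigma> \<zeta>)" for \<zeta> W
 define p where "p \<zeta> W = - Qh (\<sigma> \<zeta>) (- W) - b (\<sigma> \<zeta>)" for \<zeta> W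
 have agree: "(\<forall>W. Im W < - (Y + M + 4) --> - (P0 z2 (- W) + b z) = Qh z W) \<and>
   (\<forall>W. Y + M + 4 < Im W --> - Q0 z2 (- W - b z) - b z = Ph z W)"
  if z: "z \<in> \<Omega>" "z2 \<in> S" and z2: "z2 = z + 2 * pi * \<i>" for z z2
 proof (rule uq[rule_format])
  show zO: "z \<in> \<Omega>" by fact
  have bz: "b z = b z2" unfolding z2 b_per ..
  have z0: "z2 \<in> log_sector R0 (- \<delta>) (2 * pi + \<delta>)" "z \<in> log_sector \<rho> (- \<delta>) \<delta>"
   using z R unfolding z2 by (auto simp: \<Omega>_def R_def log_sector_def)
  note I = Imb[OF zO]
  show "pclass (lowdom UNIV (%_. - Y)) (wlow Y) (%_ W. - (P0 z2 (- W) + b z) - W)"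
  proof (rule pclass_affine[OF Pd oU(1) _ hol2_const[OF oU(1)] hol2_const[OF oU(1)], where e = "- 1"])
   show "(z2, - 1 * W + 0) \<in> updom (log_sector R0 (- \<delta>) (2 * pi + \<delta>)) (%_. Y1) & wup Y1 z2 (- 1 * W + 0) <= wlow Y z' W"
    if "(z', W) \<in> lowdom UNIV (%_. - Y)" for z' :: complex and W
    unfolding refl using that z0 Y by auto
  qed (auto simp: bz)
  show "pclass (updom UNIV (%_. Y)) (wup Y) (%_ W. - Q0 z2 (- W - b z) - b z - W)"
  proof (rule pclass_affine[OF Qd oU(2) _ hol2_const[OF oU(2)] hol2_const[OF oU(2)], where e = "- 1"])
   show "(z2, - 1 * W + - b z) \<in> lowdom (log_sector R0 (- \<delta>) (2 * pi + \<delta>)) (%_. - Y1) & wlow Y1 z2 (- 1 * W + - b z) <= wup Y z' W"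
    if "(z', W) \<in> updom UNIV (%_. Y)" for z' :: complex and W
    unfolding refl using that z0 I by (auto simp: Y_def)
  qed auto
  have "A z - A' z = b z" by simp
  then show "glued (A z) (A' z) (Q z) (P z) (%W. - (P0 z2 (- W) + b z)) (%W. - Q0 z2 (- W - b z) - b z)"
   using glued_flip[OF glue[OF z0(2)], folded z2] unfolding Q_def[abs_def] P_def[abs_def] flip_def[abs_def] by simp
 qed
 define \<Omega>' where "\<Omega>' = log_sector R (2 * pi - \<delta>) (3 * pi - \<kappa>)"
 have \<sigma>: "\<sigma> \<zeta> \<in> \<Omega>" "exp (\<sigma> \<zeta>) = exp \<zeta>" "\<zeta> = \<sigma> \<zeta> + 2 * pi * \<i>" if "\<zeta> \<in> \<Omega>'" for \<zeta>
  using that by (auto simp: \<Omega>'_def \<Omega>_def log_sector_def \<sigma>_def exp_diff)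
 have imWb: "Y + M + 4 < Im (- W - b z)" if "z \<in> \<Omega>" "Im W < - Y2" for z W
  using Imb[OF that(1)] that(2) unfolding Y2_def by auto
 have oO': "open \<Omega>'" by (simp add: \<Omega>'_def log_sector_open)
 have oq: "open (\<Omega>' \<times> lower_hp (- Y2))" and op: "open (\<Omega>' \<times> upper_hp Y2)" using oO' by (auto intro: open_Times)
 have \<sigma>q: "hol2 (\<Omega>' \<times> lower_hp (- Y2)) (%\<zeta> W. \<sigma> \<zeta>)" and \<sigma>p: "hol2 (\<Omega>' \<times> upper_hp Y2) (%\<zeta> W. \<sigma> \<zeta>)"
  unfolding \<sigma>_def using oq op by (auto intro!: hol2_intros)
 have bq: "hol2 (\<Omega>' \<times> lower_hp (- Y2)) (%z W. b (\<sigma> z))" and bp: "hol2 (\<Omega>' \<times> upper_hp Y2) (%z W. b (\<sigma> z))"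
  by (rule hol2_holo[OF bh oO]; use \<sigma>q \<sigma>p \<sigma> in auto)+
 have "extends R Y2 (2 * pi - \<delta>) (3 * pi - \<kappa>) (- (2 * pi * \<i>)) q p"
  unfolding extends_def \<Omega>'_def[symmetric]
 proof (intro conjI ballI allI impI)
  show "hol2 (\<Omega>' \<times> lower_hp (- Y2)) q" unfolding q_def
   by (rule hol2_diff[OF hol2_minus[OF hol2_compose[OF Ph \<sigma>q hol2_diff[OF hol2_minus[OF hol2_snd[OF oq]] bq]]] bq])
     (use imWb \<sigma> in auto)
  show "hol2 (\<Omega>' \<times> upper_hp Y2) p" unfolding p_def
   by (rule hol2_diff[OF hol2_minus[OF hol2_compose[OF Qh \<sigma>p hol2_minus[OF hol2_snd[OF op]]]] bp])
     (use M \<sigma> in \<open>auto simp: Y2_def\<close>)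
  show "q \<zeta> W = Q0 \<zeta> W" if z: "\<zeta> \<in> \<Omega>' \<inter> S" and W: "W \<in> lower_hp (- Y2)" for \<zeta> W
  proof -
   have "- Q0 \<zeta> (- (- W - b (\<sigma> \<zeta>)) - b (\<sigma> \<zeta>)) - b (\<sigma> \<zeta>) = Ph (\<sigma> \<zeta>) (- W - b (\<sigma> \<zeta>))"
    using agree[of "\<sigma> \<zeta>" \<zeta>] \<sigma>[of \<zeta>] imWb[of "\<sigma> \<zeta>" W] z W[simplified] by blast
   then show ?thesis unfolding q_def by (simp flip: \<open>_ = Ph (\<sigma> \<zeta>) (- W - b (\<sigma> \<zeta>))\<close>)
  qed
  show "p \<zeta> W = P0 \<zeta> W" if z: "\<zeta> \<in> \<Omega>' \<inter> S" and W: "W \<in> upper_hp Y2" for \<zeta> W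
  proof -
   have "Im (- W) < - (Y + M + 4)" using W M by (simp add: Y2_def)
   then have "- (P0 \<zeta> (- (- W)) + b (\<sigma> \<zeta>)) = Qh (\<sigma> \<zeta>) (- W)" using agree[of "\<sigma> \<zeta>" \<zeta>] \<sigma>[of \<zeta>] z by blast
   then show ?thesis unfolding p_def by (simp flip: \<open>_ = Qh (\<sigma> \<zeta>) (- W)\<close>)
  qed
  fix Z :: real assume Z: "0 <= Z"
  have ZM: "0 <= Z + M" using Z M by simp
  have \<sigma>s: "\<zeta> + - (2 * pi * \<i>) = \<sigma> \<zeta>" for \<zeta> by (simp add: \<sigma>_def)
  show "flat_on \<Omega>' {W. - Z <= Im W & Im W < - Y2} (%\<zeta> W. q \<zeta> W - Q0 (\<zeta> + - (2 * pi * \<i>)) W)"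
   unfolding \<sigma>s
  proof (rule flat_on_pullback[OF Pc[rule_format, OF ZM], where \<sigma> = \<sigma>])
   fix \<zeta> W assume z: "\<zeta> \<in> \<Omega>'" and W: "W \<in> {W. - Z <= Im W & Im W < - Y2}"
   have "q \<zeta> W - Q0 (\<sigma> \<zeta>) W = - (Ph (\<sigma> \<zeta>) (- W - b (\<sigma> \<zeta>)) - P (\<sigma> \<zeta>) (- W - b (\<sigma> \<zeta>)))" unfolding q_def P_def by simp
   then have "cmod (q \<zeta> W - Q0 (\<sigma> \<zeta>) W) = cmod (Ph (\<sigma> \<zeta>) (- W - b (\<sigma> \<zeta>)) - P (\<sigma> \<zeta>) (- W - b (\<sigma> \<zeta>)))" by (simp only: norm_minus_cancel)
   then show "\<exists>W'\<in>{W. Im W <= Z + M & Y + M + 4 < Im W}. cmod (q \<zeta> W - Q0 (\<sigma> \<zeta>) W) = cmod (Ph (\<sigma> \<zeta>) W' - P (\<sigma> \<zeta>) W')"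
    by (rule bexI) (use Imb[OF \<sigma>(1)[OF z]] imWb[OF \<sigma>(1)[OF z]] W in auto)
  qed (use \<sigma> in auto)
  show "flat_on \<Omega>' {W. Im W <= Z & Y2 < Im W} (%\<zeta> W. p \<zeta> W - P0 (\<zeta> + - (2 * pi * \<i>)) W)"
   unfolding \<sigma>s
  proof (rule flat_on_pullback[OF Qc[rule_format, OF Z], where \<sigma> = \<sigma>])
   fix \<zeta> W assume z: "\<zeta> \<in> \<Omega>'" and W: "W \<in> {W. Im W <= Z & Y2 < Im W}"
   have "p \<zeta> W - P0 (\<sigma> \<zeta>) W = - (Qh (\<sigma> \<zeta>) (- W) - (Q (\<sigma> \<zeta>) (- W - b (\<sigma> \<zeta>)) + b (\<sigma> \<zeta>)))" unfolding p_def Q_def by simp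
   then have "cmod (p \<zeta> W - P0 (\<sigma> \<zeta>) W) = cmod (Qh (\<sigma> \<zeta>) (- W) - (Q (\<sigma> \<zeta>) (- W - b (\<sigma> \<zeta>)) + b (\<sigma> \<zeta>)))" by (simp only: norm_minus_cancel)
   then show "\<exists>W'\<in>{W. - Z <= Im W & Im W < - (Y + M + 4)}. cmod (p \<zeta> W - P0 (\<sigma> \<zeta>) W) = cmod (Qh (\<sigma> \<zeta>) W' - (Q (\<sigma> \<zeta>) (W' - b (\<sigma> \<zeta>)) + b (\<sigma> \<zeta>)))"
    by (rule bexI) (use W M in \<open>auto simp: Y2_def\<close>)
  qed (use \<sigma> in auto)
 qed (use R Y M in \<open>auto simp: Y2_def\<close>)
 then show ?thesis by blast
qed

end

section \<open>Flatness on compact sets\<close>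

text \<open>
 A family of periodic functions that is flat on one line and bounded on a second one is flat
 between them, by the three lines theorem. For periodic functions it is the maximum principle for
 \<open>j \<zeta> W * exp (2 * pi * \<i> * n * W)\<close>, with an integer \<open>n\<close> proportional to \<open>1 / sqrt \<bar>\<epsilon>\<bar>\<close>.
\<close>

lemma flat_interpolation:
 assumes per: "!!\<zeta>. \<zeta> \<in> X ==> per1 (lower_hp y) (j \<zeta>)" and y: "y2 < y1" "y1 < y"
  and B: "0 <= B" "!!\<zeta> W. \<zeta> \<in> X ==> Im W = y1 ==> cmod (j \<zeta> W) <= B"
  and flat: "flat_on X {W. Im W = y2} j"
  and \<eta>: "0 < \<eta>"
 shows "flat_on X {W. y2 <= Im W & Im W <= y1 - \<eta>} j"
proof -
 define t where "t \<zeta> = 1 / sqrt (cmod (exp \<zeta>))" for \<zeta> :: complex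
 have t: "0 <= t \<zeta>" for \<zeta> by (simp add: t_def)
 obtain c C where c: "0 < c" "0 < C" and fl: "!!\<zeta> W. \<zeta> \<in> X ==> Im W = y2 ==> cmod (j \<zeta> W) <= C * exp (- (c * t \<zeta>))"
  using flat unfolding flat_on_def t_def by auto
 define D where "D = y1 - y2"
 have D: "0 < D" using y by (simp add: D_def)
 define c2 where "c2 = c / (2 * pi * D)"
 have c2: "0 < c2" "2 * pi * c2 * D = c" using c D by (simp_all add: c2_def)
 have "cmod (j \<zeta> W) <= ((B + C) * exp (2 * pi * \<eta>)) * exp (- (2 * pi * c2 * \<eta> * t \<zeta>))"
  if z: "\<zeta> \<in> X" and W: "y2 <= Im W" "Im W <= y1 - \<eta>" for \<zeta> W
 proof -
  define n where "n = nat \<lfloor>c2 * t \<zeta>\<rfloor>"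
  have n: "real n <= c2 * t \<zeta>" "c2 * t \<zeta> - 1 <= real n" using t[of \<zeta>] c2 unfolding n_def by auto
  define e where "e w = exp (2 * of_real pi * \<i> * (of_nat n * w))" for w
  have ne: "cmod (e w) = exp (- (2 * pi * real n * Im w))" for w unfolding e_def norm_expi by (simp add: mult_ac)
  have eper: "e (w + 1) = e w" for w
  proof -
   have "e (w + 1) = e w * exp (2 * of_real pi * \<i> * of_nat n)" 
    unfolding e_def exp_add[symmetric] by (rule arg_cong[where f = exp]) (simp add: algebra_simps)
   also have "exp (2 * of_real pi * \<i> * of_nat n) = 1"
    unfolding exp_eq_1 by (auto intro!: exI[of _ "int n"])
   finally show ?thesis by simp
  qed
  have u: "per1 (hstrip (y2 - 1) y) (%w. j \<zeta> w * e w)"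
   unfolding per1_def
  proof (intro conjI ballI)
   have "j \<zeta> holomorphic_on hstrip (y2 - 1) y" by (rule holomorphic_on_subset[OF per1D(1)[OF per[OF z]]]) auto
   then show "(%w. j \<zeta> w * e w) holomorphic_on hstrip (y2 - 1) y" unfolding e_def by (intro holomorphic_intros)
   show "j \<zeta> (w + 1) * e (w + 1) = j \<zeta> w * e w" if "w \<in> hstrip (y2 - 1) y" for w
    using per1D(2)[OF per[OF z], of w] that eper by simp
  qed
  define Bd where "Bd = (B + C) * exp (- (2 * pi * real n * y1))"
  have nD: "2 * pi * real n * D <= c * t \<zeta>"
  proof -
   have "2 * pi * D * real n <= 2 * pi * D * (c2 * t \<zeta>)" using n(1) D by (intro mult_left_mono) auto
   also have "\<dots> = (2 * pi * c2 * D) * t \<zeta>" by simp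
   finally show ?thesis unfolding c2(2) by (simp add: mult_ac)
  qed
  have "cmod (j \<zeta> W * e W) <= Bd"
  proof (rule strip_max_modulus[OF u, of y2 y1])
   show "cmod (j \<zeta> w * e w) <= Bd" if w: "Im w = y2" for w
   proof -
    have "cmod (j \<zeta> w * e w) <= C * exp (- (c * t \<zeta>)) * exp (- (2 * pi * real n * y2))"
     unfolding norm_mult ne w using fl[OF z w] by (intro mult_right_mono) auto
    also have "\<dots> = C * exp (- (c * t \<zeta>) - 2 * pi * real n * y2)" by (simp add: exp_add[symmetric])
    also have "\<dots> <= C * exp (- (2 * pi * real n * y1))" using nD c by (simp add: D_def algebra_simps)
    also have "\<dots> <= Bd" unfolding Bd_def using B by (intro mult_right_mono) auto
    finally show ?thesis .
   qed
   show "cmod (j \<zeta> w * e w) <= Bd" if w: "Im w = y1" for w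
   proof -
    have "cmod (j \<zeta> w * e w) <= B * exp (- (2 * pi * real n * y1))"
     unfolding norm_mult ne w using B(2)[OF z w] by (intro mult_right_mono) auto
    also have "\<dots> <= Bd" unfolding Bd_def using c by (intro mult_right_mono) auto
    finally show ?thesis .
   qed
  qed (use y W \<eta> in auto)
  then have "cmod (j \<zeta> W) * exp (- (2 * pi * real n * Im W)) <= Bd" unfolding norm_mult ne .
  then have "cmod (j \<zeta> W) * exp (- (2 * pi * real n * Im W)) * exp (2 * pi * real n * Im W) <= Bd * exp (2 * pi * real n * Im W)"
   by (intro mult_right_mono) auto
  then have "cmod (j \<zeta> W) <= Bd * exp (2 * pi * real n * Im W)" by (simp add: mult.assoc exp_add[symmetric])
  also have "\<dots> = (B + C) * exp (- (2 * pi * (real n * (y1 - Im W))))"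
   unfolding Bd_def by (simp add: mult.assoc exp_add[symmetric] algebra_simps)
  also have "\<dots> <= (B + C) * exp (- (2 * pi * ((c2 * t \<zeta> - 1) * \<eta>)))"
  proof (intro mult_left_mono)
   have "(c2 * t \<zeta> - 1) * \<eta> <= real n * \<eta>" using n(2) \<eta> by (intro mult_right_mono) auto
   also have "\<dots> <= real n * (y1 - Im W)" using W by (intro mult_left_mono) auto
   finally show "exp (- (2 * pi * (real n * (y1 - Im W)))) <= exp (- (2 * pi * ((c2 * t \<zeta> - 1) * \<eta>)))" by simp
  qed (use B c in auto)
  also have "\<dots> = ((B + C) * exp (2 * pi * \<eta>)) * exp (- (2 * pi * c2 * \<eta> * t \<zeta>))"
   by (simp add: mult.assoc exp_add[symmetric] algebra_simps)
  finally show ?thesis .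
 qed
 moreover have "0 < (B + C) * exp (2 * pi * \<eta>)" "0 < 2 * pi * c2 * \<eta>" using B c c2 \<eta> by auto
 ultimately show ?thesis unfolding flat_on_def
  by - (rule exI[of _ "2 * pi * c2 * \<eta>"], rule conjI, assumption, rule exI[of _ "(B + C) * exp (2 * pi * \<eta>)"], simp add: t_def)
qed

lemma compact_lower_bounds:
 assumes K: "compact K" "K \<subseteq> lower_hp y"
 shows "\<exists>\<eta>>0. \<exists>Z\<ge>0. \<forall>W\<in>K. - Z <= Im W & Im W <= y - \<eta>"
proof (cases "K = {}")
 case False
 have c: "continuous_on K Im" by (intro continuous_intros)
 obtain u where u: "u \<in> K" "!!w. w \<in> K ==> Im w <= Im u" using continuous_attains_sup[OF K(1) False c] by blast
 obtain l where l: "l \<in> K" "!!w. w \<in> K ==> Im l <= Im w" using continuous_attains_inf[OF K(1) False c] by blast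
 have "0 < y - Im u" using u K by auto
 moreover have "- max 0 (- Im l) <= Im w" if "w \<in> K" for w using l(2)[OF that] by auto
 moreover have "Im w <= y - (y - Im u)" if "w \<in> K" for w using u(2)[OF that] by simp
 ultimately show ?thesis by (meson max.cobounded1)
qed (auto intro: exI[of _ 1])

text \<open>
 Flatness deep in the half plane, together with boundedness, gives flatness on all compact subsets.
\<close>

lemma flat_on_compact:
 assumes per: "!!\<zeta>. \<zeta> \<in> log_sector R0 a1 a2 ==> per1 (lower_hp y) (j \<zeta>)" and R0: "0 < R0"
  and bd: "!!K. compact K ==> K \<subseteq> lower_hp y ==> \<exists>R>0. \<exists>B. \<forall>\<zeta>\<in>log_sector R a1 a2. \<forall>W\<in>K. cmod (j \<zeta> W) <= B"
  and fl: "!!y2. y2 < y' ==> flat_on (log_sector R0 a1 a2) {W. Im W = y2} j"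
  and K: "compact K" "K \<subseteq> lower_hp y"
 shows "\<exists>R>0. flat_on (log_sector R a1 a2) K j"
proof -
 obtain \<eta> Z where \<eta>: "0 < \<eta>" "0 <= Z" and b: "\<forall>W\<in>K. - Z <= Im W & Im W <= y - \<eta>"
  using compact_lower_bounds[OF K] by blast
 define y1 where "y1 = y - \<eta> / 2"
 define y2 where "y2 = min (- Z) (min (y' - 1) (y1 - 1))"
 have y: "y2 < y1" "y1 < y" "y2 < y'" "y2 <= - Z" using \<eta> by (auto simp: y1_def y2_def)
 define Kl where "Kl = closed_segment (Complex 0 y1) (Complex 1 y1)"
 have Kl: "W \<in> Kl \<longleftrightarrow> Im W = y1 & 0 <= Re W & Re W <= 1" for W
  by (auto simp: Kl_def closed_segment_same_Im closed_segment_eq_real_ivl)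
 have "compact Kl" "Kl \<subseteq> lower_hp y" using Kl y by (auto simp: Kl_def)
 then obtain R1 B where R1: "0 < R1" and B: "\<forall>\<zeta>\<in>log_sector R1 a1 a2. \<forall>W\<in>Kl. cmod (j \<zeta> W) <= B" using bd by blast
 define X where "X = log_sector (min R0 R1) a1 a2"
 have X: "\<zeta> \<in> log_sector R0 a1 a2" "\<zeta> \<in> log_sector R1 a1 a2" if "\<zeta> \<in> X" for \<zeta> using that by (auto simp: X_def log_sector_def)
 have line: "cmod (j \<zeta> W) <= \<bar>B\<bar>" if z: "\<zeta> \<in> X" and W: "Im W = y1" for \<zeta> W
 proof (rule per1_line_bound[OF per[OF X(1)[OF z]] _ _ W])
  fix x :: real assume "0 <= x" "x <= 1"
  then have "cmod (j \<zeta> (Complex x y1)) <= B" using B X(2)[OF z] Kl by simp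
  then show "cmod (j \<zeta> (Complex x y1)) <= \<bar>B\<bar>" by linarith
 qed (use y in auto)
 have "flat_on X {W. y2 <= Im W & Im W <= y1 - \<eta> / 2} j"
  by (rule flat_interpolation[OF per[OF X(1)] y(1,2) _ line flat_on_subset[OF fl[OF y(3)]]]) (use \<eta> X in auto)
 then have "flat_on X K j"
  by (rule flat_on_subset) (use b y(4) in \<open>fastforce simp: y1_def\<close>)+
 then show ?thesis using R0 R1 unfolding X_def by (intro exI[of _ "min R0 R1"]) auto
qed

section \<open>Summability of the two components\<close>

lemma compact_upper_bounds:
 assumes K: "compact K" "K \<subseteq> upper_hp y"
 shows "\<exists>Z\<ge>0. \<forall>W\<in>K. Im W <= Z"
proof -
 have "compact (uminus ` K)" "uminus ` K \<subseteq> lower_hp (- y)" using compact_negations[OF K(1)] K(2) by (auto simp: image_def)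
 then obtain \<eta> Z where "0 <= Z" "\<forall>W\<in>uminus ` K. - Z <= Im W & Im W <= - y - \<eta>" using compact_lower_bounds by blast
 then show ?thesis by (intro exI[of _ Z]) auto
qed

context modulus_data
begin

text \<open>
 For parameters over the same \<open>\<epsilon>\<close> near the positive axis the maps differ by a flat function: near the
 end of the half plane by the first continuation, and then on all compact subsets.
\<close>

lemma flat_difference:
 shows "compact K ==> K \<subseteq> lower_hp (- Y0) ==> \<exists>R>0. flat_on (log_sector R (- \<delta>) \<delta>) K (%\<zeta> W. Q0 (\<zeta> + 2 * pi * \<i>) W - Q0 \<zeta> W)"
  and "compact K' ==> K' \<subseteq> upper_hp Y0 ==> \<exists>R>0. flat_on (log_sector R (- \<delta>) \<delta>) K' (%\<zeta> W. P0 (\<zeta> + 2 * pi * \<i>) W - P0 \<zeta> W)"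
proof -
 have \<kappa>: "0 < pi / 4" "pi / 4 < pi / 2" by auto
 obtain R Y q p where ex: "extends R Y (- pi + pi / 4) \<delta> (2 * pi * \<i>) q p" using continuation_below[OF \<kappa>] by blast
 let ?\<Omega> = "log_sector R (- pi + pi / 4) \<delta>" and ?X = "log_sector R (- \<delta>) \<delta>"
 have R: "0 < R" "R <= \<rho>" and Y: "Y0 <= Y"
  and fq: "\<forall>Z\<ge>0. flat_on ?\<Omega> {W. - Z <= Im W & Im W < - Y} (%\<zeta> W. q \<zeta> W - Q0 (\<zeta> + 2 * pi * \<i>) W)"
  and fp: "\<forall>Z\<ge>0. flat_on ?\<Omega> {W. Im W <= Z & Y < Im W} (%\<zeta> W. p \<zeta> W - P0 (\<zeta> + 2 * pi * \<i>) W)"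
  using ex unfolding extends_def by blast+
 have XS: "\<zeta> \<in> S" "\<zeta> + 2 * pi * \<i> \<in> S" "\<zeta> \<in> ?\<Omega> \<inter> S" if "\<zeta> \<in> ?X" for \<zeta>
  using that \<delta> R by (auto simp: log_sector_def)
 have bound: "\<exists>R>0. \<exists>B. \<forall>\<zeta>\<in>log_sector R (- \<delta>) \<delta>. \<forall>W\<in>K. cmod (g (\<zeta> + 2 * pi * \<i>) W - g \<zeta> W) <= B"
  if g: "\<exists>R>0. R <= \<rho> & (\<exists>B. \<forall>\<zeta>\<in>log_sector R (- \<delta>) (2 * pi + \<delta>). \<forall>W\<in>K. cmod (g \<zeta> W) <= B)" for g :: "complex => complex => complex" and K
 proof -
  obtain R B where R: "0 < R" and B: "\<forall>\<zeta>\<in>log_sector R (- \<delta>) (2 * pi + \<delta>). \<forall>W\<in>K. cmod (g \<zeta> W) <= B" using g by blast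
  have "cmod (g (\<zeta> + 2 * pi * \<i>) W - g \<zeta> W) <= B + B" if "\<zeta> \<in> log_sector R (- \<delta>) \<delta>" "W \<in> K" for \<zeta> W
  proof (intro order_trans[OF norm_triangle_ineq4] add_mono)
   show "cmod (g (\<zeta> + 2 * pi * \<i>) W) <= B" "cmod (g \<zeta> W) <= B" using B that \<delta> by (auto simp: log_sector_def)
  qed
  then show ?thesis using R by blast
 qed
 { assume K: "compact K" "K \<subseteq> lower_hp (- Y0)"
  show "\<exists>R>0. flat_on (log_sector R (- \<delta>) \<delta>) K (%\<zeta> W. Q0 (\<zeta> + 2 * pi * \<i>) W - Q0 \<zeta> W)"
  proof (rule flat_on_compact[OF _ R(1) bound[OF Q0_bdd] _ K, where y' = "- Y"])
   show "per1 (lower_hp (- Y0)) (%W. Q0 (\<zeta> + 2 * pi * \<i>) W - Q0 \<zeta> W)" if "\<zeta> \<in> ?X" for \<zeta>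
    using XS(1,2)[OF that] Q0_per unfolding per1_def by (auto intro!: holomorphic_on_diff Q0_holo)
   fix y2 assume y2: "y2 < - Y"
   have "0 <= - y2" using y2 Y Y0 by linarith
   from fq[rule_format, OF this] show "flat_on ?X {W. Im W = y2} (%\<zeta> W. Q0 (\<zeta> + 2 * pi * \<i>) W - Q0 \<zeta> W)"
   proof (rule flat_on_pullback[where \<sigma> = "%\<zeta>. \<zeta>"])
    fix \<zeta> W assume z: "\<zeta> \<in> ?X" and W: "W \<in> {W. Im W = y2}"
    have "q \<zeta> W = Q0 \<zeta> W" using ex XS(3)[OF z] W y2 unfolding extends_def by auto
    then show "\<exists>W'\<in>{W. - (- y2) <= Im W & Im W < - Y}. cmod (Q0 (\<zeta> + 2 * pi * \<i>) W - Q0 \<zeta> W) = cmod (q \<zeta> W' - Q0 (\<zeta> + 2 * pi * \<i>) W')"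
     using W y2 by (intro bexI[of _ W]) (auto simp: norm_minus_commute)
   qed (use XS in auto)
  qed
 }
 { assume K: "compact K'" "K' \<subseteq> upper_hp Y0"
  define j where "j \<zeta> W = P0 (\<zeta> + 2 * pi * \<i>) (- W) - P0 \<zeta> (- W)" for \<zeta> W
  have m: "compact (uminus ` K)" "K \<subseteq> lower_hp (- Y0) ==> uminus ` K \<subseteq> upper_hp Y0" "K \<subseteq> upper_hp Y0 ==> uminus ` K \<subseteq> lower_hp (- Y0)"
   if "compact K" for K :: "complex set" using that compact_negations[OF that] by (auto simp: image_def)
  have "\<exists>R>0. flat_on (log_sector R (- \<delta>) \<delta>) (uminus ` K') j"
  proof (rule flat_on_compact[OF _ R(1) _ _ m(1)[OF K(1)] m(3)[OF K], where y' = "- Y"])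
   show "per1 (lower_hp (- Y0)) (j \<zeta>)" if z: "\<zeta> \<in> ?X" for \<zeta>
    unfolding per1_def
   proof (intro conjI ballI)
    have h: "(%W. P0 \<xi> (- W)) holomorphic_on lower_hp (- Y0)" if "\<xi> \<in> S" for \<xi>
     by (intro holomorphic_on_compose_gen[OF _ P0_holo[OF that], of uminus, unfolded o_def]) (auto intro!: holomorphic_intros)
    show "j \<zeta> holomorphic_on lower_hp (- Y0)" unfolding j_def by (intro holomorphic_on_diff h XS(1,2)[OF z])
    fix W assume W: "W \<in> lower_hp (- Y0)"
    have "P0 \<xi> (- W) = P0 \<xi> (- (W + 1)) + 1" if "\<xi> \<in> S" for \<xi> using P0_per[OF that, of "- (W + 1)"] W by simp
    then show "j \<zeta> (W + 1) = j \<zeta> W" using XS(1,2)[OF z] unfolding j_def by simp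
   qed
   show "\<exists>R>0. \<exists>B. \<forall>\<zeta>\<in>log_sector R (- \<delta>) \<delta>. \<forall>W\<in>K. cmod (j \<zeta> W) <= B" if K: "compact K" "K \<subseteq> lower_hp (- Y0)" for K
    using bound[OF P0_bdd[OF m(1)[OF K(1)] m(2)[OF K]]] unfolding j_def by simp
   fix y2 assume y2: "y2 < - Y"
   have "0 <= - y2" using y2 Y Y0 by linarith
   from fp[rule_format, OF this] show "flat_on ?X {W. Im W = y2} j"
   proof (rule flat_on_pullback[where \<sigma> = "%\<zeta>. \<zeta>"])
    fix \<zeta> W assume z: "\<zeta> \<in> ?X" and W: "W \<in> {W. Im W = y2}"
    have "p \<zeta> (- W) = P0 \<zeta> (- W)" using ex XS(3)[OF z] W y2 unfolding extends_def by auto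
    then show "\<exists>W'\<in>{W. Im W <= - y2 & Y < Im W}. cmod (j \<zeta> W) = cmod (p \<zeta> W' - P0 (\<zeta> + 2 * pi * \<i>) W')"
     using W y2 by (intro bexI[of _ "- W"]) (auto simp: norm_minus_commute j_def)
   qed (use XS in auto)
  qed
  then obtain R where "0 < R" "flat_on (log_sector R (- \<delta>) \<delta>) (uminus ` K') j" by blast
  then show "\<exists>R>0. flat_on (log_sector R (- \<delta>) \<delta>) K' (%\<zeta> W. P0 (\<zeta> + 2 * pi * \<i>) W - P0 \<zeta> W)"
   unfolding flat_on_def j_def by auto
 }
qed

lemma gevrey_sum_Q0: "\<exists>\<beta>. gevrey_sum (1/2) \<rho> (- \<delta>) (2 * pi + \<delta>) (lower_hp (- Y0)) Q0 \<beta>"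
 by (rule gevrey_sum_of_flat_difference[OF \<delta> \<rho> _ Q0 _ flat_difference(1)]) (use Q0_bdd in blast)+

lemma gevrey_sum_P0: "\<exists>\<beta>. gevrey_sum (1/2) \<rho> (- \<delta>) (2 * pi + \<delta>) (upper_hp Y0) P0 \<beta>"
 by (rule gevrey_sum_of_flat_difference[OF \<delta> \<rho> _ P0 _ flat_difference(2)]) (use P0_bdd in blast)+

text \<open>
 A continuation beyond the sector turns the series into one that is summable in all directions
 which bisect a sector of opening greater than \<open>2 * pi\<close> inside the larger sector.
\<close>

lemma summable_of_extension:
 assumes ex: "extends R Y a1 a2 s q p" and s: "exp s = 1" and \<psi>: "- \<delta> < \<psi>1" "\<psi>1 < \<psi>2" "\<psi>2 < 2 * pi + \<delta>" and \<eta>: "0 < \<eta>"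
  and cover: "!!x. d - (pi + \<eta>) < x ==> x < d + (pi + \<eta>) ==>
   (if a1 < x & x < a2 then \<psi>1 < x + Im s & x + Im s < \<psi>2 else \<psi>1 < x & x < \<psi>2)"
 shows "gevrey_sum (1/2) \<rho> (- \<delta>) (2 * pi + \<delta>) (lower_hp (- Y0)) Q0 \<beta> ==> summable_in_direction (1/2) d (lower_hp (- Y)) \<beta>"
  and "gevrey_sum (1/2) \<rho> (- \<delta>) (2 * pi + \<delta>) (upper_hp Y0) P0 \<beta>' ==> summable_in_direction (1/2) d (upper_hp Y) \<beta>'"
proof -
 have R: "0 < R" "R <= \<rho>" and Y: "Y0 <= Y" and qp: "hol2 (log_sector R a1 a2 \<times> lower_hp (- Y)) q" "hol2 (log_sector R a1 a2 \<times> upper_hp Y) p"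
  and ag: "\<forall>\<zeta>\<in>log_sector R a1 a2 \<inter> S. (\<forall>W\<in>lower_hp (- Y). q \<zeta> W = Q0 \<zeta> W) & (\<forall>W\<in>upper_hp Y. p \<zeta> W = P0 \<zeta> W)"
  and fq: "\<forall>Z\<ge>0. flat_on (log_sector R a1 a2) {W. - Z <= Im W & Im W < - Y} (%\<zeta> W. q \<zeta> W - Q0 (\<zeta> + s) W)"
  and fp: "\<forall>Z\<ge>0. flat_on (log_sector R a1 a2) {W. Im W <= Z & Y < Im W} (%\<zeta> W. p \<zeta> W - P0 (\<zeta> + s) W)"
  using ex unfolding extends_def by blast+
 have op: "2 * pi < (d + (pi + \<eta>)) - (d - (pi + \<eta>))" using \<eta> by simp
 have fin: "summable_in_direction (1/2) d D \<gamma>" if "\<exists>g'. gevrey_sum (1/2) R (d - (pi + \<eta>)) (d + (pi + \<eta>)) D g' \<gamma>" for D \<gamma>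
  using that R \<eta> unfolding summable_in_direction_def by (intro exI[of _ \<eta>] conjI exI[of _ R]) auto
 { assume "gevrey_sum (1/2) \<rho> (- \<delta>) (2 * pi + \<delta>) (lower_hp (- Y0)) Q0 \<beta>"
  then show "summable_in_direction (1/2) d (lower_hp (- Y)) \<beta>"
  proof (rule fin[OF gevrey_sum_extend[OF _ Q0 _ _ R op qp(1) _ _ s \<psi> cover]])
   fix K assume K: "compact K" "K \<subseteq> lower_hp (- Y)"
   obtain Z where Z: "0 <= Z" "\<forall>W\<in>K. - Z <= Im W" using compact_lower_bounds[OF K] by blast
   show "flat_on (log_sector R a1 a2) K (%\<zeta> W. q \<zeta> W - Q0 (\<zeta> + s) W)"
    by (rule flat_on_subset[OF fq[rule_format, OF Z(1)]]) (use Z K in auto)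
  qed (use ag Y in auto)
 }
 { assume "gevrey_sum (1/2) \<rho> (- \<delta>) (2 * pi + \<delta>) (upper_hp Y0) P0 \<beta>'"
  then show "summable_in_direction (1/2) d (upper_hp Y) \<beta>'"
  proof (rule fin[OF gevrey_sum_extend[OF _ P0 _ _ R op qp(2) _ _ s \<psi> cover]])
   fix K assume K: "compact K" "K \<subseteq> upper_hp Y"
   obtain Z where Z: "0 <= Z" "\<forall>W\<in>K. Im W <= Z" using compact_upper_bounds[OF K] by blast
   show "flat_on (log_sector R a1 a2) K (%\<zeta> W. p \<zeta> W - P0 (\<zeta> + s) W)"
    by (rule flat_on_subset[OF fp[rule_format, OF Z(1)]]) (use Z K in auto)
  qed (use ag Y in auto)
 }
qed

text \<open>
 Narrowing makes the values of \<open>\<zeta> + s\<close> stay in a closed subsector, on which the Gevrey estimates of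
 the given maps are uniform.
\<close>

lemma extends_narrow:
 assumes "extends R Y a1 a2 s q p" "a1 <= a1'" "a2' <= a2"
 shows "extends R Y a1' a2' s q p"
proof -
 have sub: "log_sector R a1' a2' \<subseteq> log_sector R a1 a2" using assms by (auto simp: log_sector_def)
 have hol: "hol2 (log_sector R a1' a2' \<times> D) f" if "hol2 (log_sector R a1 a2 \<times> D) f" "open D" for f D
  by (rule hol2_subset[OF that(1) open_Times[OF log_sector_open that(2)]]) (use sub in auto)
 have fl: "flat_on (log_sector R a1' a2') K d" if "flat_on (log_sector R a1 a2) K d" for K d
  by (rule flat_on_subset[OF that sub]) simp
 show ?thesis using assms(1) sub unfolding extends_def by (auto intro!: hol fl)
qed

text \<open>
 For \<open>d \<le> pi\<close> the sector bisected by \<open>d\<close> leaves the given one only below, for \<open>d > pi\<close> only above. The angle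
 \<open>\<kappa>\<close> that the continuation loses and \<open>\<eta>\<close> fit into the distance of \<open>d\<close> to the positive axis.
\<close>

lemma summable_directions:
 assumes \<beta>: "gevrey_sum (1/2) \<rho> (- \<delta>) (2 * pi + \<delta>) (lower_hp (- Y0)) Q0 \<beta>"
  and \<beta>': "gevrey_sum (1/2) \<rho> (- \<delta>) (2 * pi + \<delta>) (upper_hp Y0) P0 \<beta>'"
  and d: "0 < d" "d < 2 * pi"
 shows "\<exists>Y\<ge>Y0. summable_in_direction (1/2) d (lower_hp (- Y)) \<beta> & summable_in_direction (1/2) d (upper_hp Y) \<beta>'"
proof -
 have \<psi>: "- \<delta> < - (3 / 4 * \<delta>)" "- (3 / 4 * \<delta>) < 2 * pi + 3 / 4 * \<delta>" "2 * pi + 3 / 4 * \<delta> < 2 * pi + \<delta>"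
  using \<delta> pi_gt_zero by linarith+
 define \<kappa> where "\<kappa> = min d (2 * pi - d) / 3"
 have \<kappa>: "0 < \<kappa>" "3 * \<kappa> <= d" "3 * \<kappa> <= 2 * pi - d" using d by (auto simp: \<kappa>_def)
 have \<kappa>2: "\<kappa> < pi / 2" using \<kappa> d by linarith
 define \<eta> where "\<eta> = min \<kappa> (\<delta> / 2)"
 have \<eta>: "0 < \<eta>" "\<eta> <= \<kappa>" "\<eta> <= \<delta> / 2" using \<kappa> \<delta> by (auto simp: \<eta>_def)
 have Y: "Y0 <= Y" if "extends R Y a1 a2 s q p" for R Y a1 a2 s q p using that unfolding extends_def by blast
 show ?thesis
 proof (cases "d <= pi")
  case True
  obtain R Y q p where ex0: "extends R Y (- pi + \<kappa>) \<delta> (2 * pi * \<i>) q p" using continuation_below[OF \<kappa>(1) \<kappa>2] by blast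
  have ex: "extends R Y (- pi + \<kappa>) (\<delta> / 2) (2 * pi * \<i>) q p" by (rule extends_narrow[OF ex0]) (use \<delta> in auto)
  have cover: "if - pi + \<kappa> < x & x < \<delta> / 2 then - (3 / 4 * \<delta>) < x + Im (2 * pi * \<i>) & x + Im (2 * pi * \<i>) < 2 * pi + 3 / 4 * \<delta>
    else - (3 / 4 * \<delta>) < x & x < 2 * pi + 3 / 4 * \<delta>" if "d - (pi + \<eta>) < x" "x < d + (pi + \<eta>)" for x
   using that True \<kappa> \<eta> \<delta> by auto
  have "exp (2 * pi * \<i>) = 1" by simp
  note sm = summable_of_extension[OF ex this \<psi> \<eta>(1) cover]
  show ?thesis using sm(1)[OF _ _ \<beta>] sm(2)[OF _ _ \<beta>'] Y[OF ex] by blast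
 next
  case False
  obtain R Y q p where ex0: "extends R Y (2 * pi - \<delta>) (3 * pi - \<kappa>) (- (2 * pi * \<i>)) q p" using continuation_above[OF \<kappa>(1) \<kappa>2] by blast
  have ex: "extends R Y (2 * pi - \<delta> / 2) (3 * pi - \<kappa>) (- (2 * pi * \<i>)) q p" by (rule extends_narrow[OF ex0]) (use \<delta> in auto)
  have cover: "if 2 * pi - \<delta> / 2 < x & x < 3 * pi - \<kappa> then - (3 / 4 * \<delta>) < x + Im (- (2 * pi * \<i>)) & x + Im (- (2 * pi * \<i>)) < 2 * pi + 3 / 4 * \<delta>
    else - (3 / 4 * \<delta>) < x & x < 2 * pi + 3 / 4 * \<delta>" if "d - (pi + \<eta>) < x" "x < d + (pi + \<eta>)" for x
   using that False \<kappa> \<eta> \<delta> by auto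
  have "exp (- (2 * pi * \<i>)) = 1" by (simp add: exp_minus)
  note sm = summable_of_extension[OF ex this \<psi> \<eta>(1) cover]
  show ?thesis using sm(1)[OF _ _ \<beta>] sm(2)[OF _ _ \<beta>'] Y[OF ex] by blast
 qed
qed

end

section \<open>The modulus of a family\<close>

lemma hol2_of_family:
 assumes f: "analytic_family \<rho> \<delta> D \<Psi>" and D: "open D"
  and h: "!!\<zeta>. \<zeta> \<in> log_sector \<rho> (- \<delta>) (2 * pi + \<delta>) ==> \<Psi> (Some \<zeta>) holomorphic_on D"
 shows "hol2 (log_sector \<rho> (- \<delta>) (2 * pi + \<delta>) \<times> D) (%\<zeta>. \<Psi> (Some \<zeta>))"
proof -
 let ?S = "log_sector \<rho> (- \<delta>) (2 * pi + \<delta>)"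
 have 1: "\<forall>W\<in>D. (%\<zeta>. \<Psi> (Some \<zeta>) W) holomorphic_on ?S" and 2: "continuous_on (?S \<times> D) (%(\<zeta>, W). \<Psi> (Some \<zeta>) W)"
  using f unfolding analytic_family_def by blast+
 show ?thesis
  unfolding hol2_def
 proof (intro conjI ballI)
  show "open (?S \<times> D)" by (intro open_Times log_sector_open D)
  show "continuous_on (?S \<times> D) (%p. \<Psi> (Some (fst p)) (snd p))" using 2 by (simp add: case_prod_unfold)
  fix p assume "p \<in> ?S \<times> D"
  then have p: "fst p \<in> ?S" "snd p \<in> D" by auto
  show "(%\<zeta>. \<Psi> (Some \<zeta>) (snd p)) field_differentiable at (fst p)"
   using 1 p by (meson holomorphic_on_imp_differentiable_at log_sector_open)
  show "\<Psi> (Some (fst p)) field_differentiable at (snd p)"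
   using h[OF p(1)] p D by (meson holomorphic_on_imp_differentiable_at)
 qed
qed

lemma bounded_of_family:
 assumes f: "analytic_family \<rho> \<delta> D \<Psi>" and c: "continuous_on D (\<Psi> None)" and K: "compact K" "K \<subseteq> D" and \<rho>: "0 < \<rho>"
 shows "\<exists>R>0. R <= \<rho> & (\<exists>B. \<forall>\<zeta>\<in>log_sector R (- \<delta>) (2 * pi + \<delta>). \<forall>W\<in>K. cmod (\<Psi> (Some \<zeta>) W) <= B)"
proof -
 have "uniform_limit K (%\<zeta>. \<Psi> (Some \<zeta>)) (\<Psi> None)
     (inf (filtercomap Re at_bot) (principal (log_sector \<rho> (- \<delta>) (2 * pi + \<delta>))))"
  using f K unfolding analytic_family_def by blast
 then have "\<forall>\<^sub>F \<zeta> in inf (filtercomap Re at_bot) (principal (log_sector \<rho> (- \<delta>) (2 * pi + \<delta>))). \<forall>W\<in>K. dist (\<Psi> (Some \<zeta>) W) (\<Psi> None W) < 1"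
  unfolding uniform_limit_iff by simp
 then obtain L where L: "!!\<zeta>. Re \<zeta> <= L ==> \<zeta> \<in> log_sector \<rho> (- \<delta>) (2 * pi + \<delta>) ==> \<forall>W\<in>K. dist (\<Psi> (Some \<zeta>) W) (\<Psi> None W) < 1"
  unfolding eventually_inf_principal eventually_filtercomap eventually_at_bot_linorder by blast
 have "compact (\<Psi> None ` K)" using c K by (intro compact_continuous_image) (auto intro: continuous_on_subset)
 then have "bounded (\<Psi> None ` K)" by (rule compact_imp_bounded)
 then obtain B where B: "\<forall>x\<in>\<Psi> None ` K. cmod x <= B" unfolding bounded_iff by blast
 have "cmod (\<Psi> (Some \<zeta>) W) <= B + 1" if z: "\<zeta> \<in> log_sector (min \<rho> (exp L)) (- \<delta>) (2 * pi + \<delta>)" "W \<in> K" for \<zeta> W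
 proof -
  have "\<zeta> \<in> log_sector \<rho> (- \<delta>) (2 * pi + \<delta>)" "Re \<zeta> <= L" using z by (auto simp: log_sector_def)
  then have "cmod (\<Psi> (Some \<zeta>) W - \<Psi> None W) < 1" using L[of \<zeta>] z by (simp add: dist_norm)
  then show ?thesis using B[rule_format, OF imageI[OF z(2)]] norm_triangle_sub[of "\<Psi> (Some \<zeta>) W" "\<Psi> None W"] by linarith
 qed
 moreover have "0 < min \<rho> (exp L)" "min \<rho> (exp L) <= \<rho>" using \<rho> by auto
 ultimately show ?thesis by blast
qed

lemma tangent_shift:
 shows "tangent_lower y H ==> tangent_lower (y + Im c) (%W. H (W - c) + c)"
  and "tangent_upper y H ==> tangent_upper (y + Im c) (%W. H (W - c) + c)"
proof -
 have hol: "(%W. H (W - c) + c) holomorphic_on T" if "H holomorphic_on S" "!!W. W \<in> T ==> W - c \<in> S" for S T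
  by (intro holomorphic_on_add holomorphic_on_const holomorphic_on_compose_gen[OF _ that(1), of "%W. W - c", unfolded o_def])
    (use that(2) in \<open>auto intro!: holomorphic_intros\<close>)
 have inj: "inj_on (%W. H (W - c) + c) T" if "inj_on H S" "!!W. W \<in> T ==> W - c \<in> S" for S T
  using that unfolding inj_on_def by (metis add_right_imp_eq diff_add_cancel)
 have per: "H (W + 1 - c) + c = H (W - c) + c + 1" if "H (W - c + 1) = H (W - c) + 1" for W
  using that by (simp add: algebra_simps)
 show "tangent_lower (y + Im c) (%W. H (W - c) + c)" if t: "tangent_lower y H"
  unfolding tangent_lower_def
 proof (intro conjI ballI)
  show "(%W. H (W - c) + c) holomorphic_on lower_hp (y + Im c)" by (rule hol[OF tangentD(1)[OF t]]) auto
  show "inj_on (%W. H (W - c) + c) (lower_hp (y + Im c))" by (rule inj[OF tangentD(2)[OF t]]) auto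
  show "H (W + 1 - c) + c = H (W - c) + c + 1" if "W \<in> lower_hp (y + Im c)" for W
   by (rule per, rule tangentD(3)[OF t]) (use that in auto)
  show "((%W. H (W - c) + c - W) \<longlongrightarrow> 0) (filtercomap Im at_bot)"
   unfolding tendsto_bot
  proof (intro allI impI)
   fix e :: real assume "0 < e"
   then obtain b where b: "!!W. Im W <= b ==> cmod (H W - W) < e" using tangentD(4)[OF t] unfolding tendsto_bot by blast
   have "cmod (H (W - c) + c - W) < e" if "Im W <= b + Im c" for W using b[of "W - c"] that by (simp add: algebra_simps)
   then show "\<exists>b. \<forall>W. Im W <= b --> cmod (H (W - c) + c - W) < e" by blast
  qed
 qed
 show "tangent_upper (y + Im c) (%W. H (W - c) + c)" if t: "tangent_upper y H"
  unfolding tangent_upper_def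
 proof (intro conjI ballI)
  show "(%W. H (W - c) + c) holomorphic_on upper_hp (y + Im c)" by (rule hol[OF tangentD(5)[OF t]]) auto
  show "inj_on (%W. H (W - c) + c) (upper_hp (y + Im c))" by (rule inj[OF tangentD(6)[OF t]]) auto
  show "H (W + 1 - c) + c = H (W - c) + c + 1" if "W \<in> upper_hp (y + Im c)" for W
   by (rule per, rule tangentD(7)[OF t]) (use that in auto)
  show "((%W. H (W - c) + c - W) \<longlongrightarrow> 0) (filtercomap Im at_top)"
   unfolding tendsto_top
  proof (intro allI impI)
   fix e :: real assume "0 < e"
   then obtain b where b: "!!W. b <= Im W ==> cmod (H W - W) < e" using tangentD(8)[OF t] unfolding tendsto_top by blast
   have "cmod (H (W - c) + c - W) < e" if "b + Im c <= Im W" for W using b[of "W - c"] that by (simp add: algebra_simps)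
   then show "\<exists>b. \<forall>W. b <= Im W --> cmod (H (W - c) + c - W) < e" by blast
  qed
 qed
qed

text \<open>
 The compatibility condition becomes \<open>glued\<close> once the maps at \<open>\<zeta>\<close> are conjugated with the translation
 by \<open>2 * pi * \<i> * a\<close>, which absorbs the translation between the two sides of the condition.
\<close>

lemma glued_of_compatible:
 assumes "compatible_at f \<Psi>0 \<Psi>inf \<zeta>" and b: "b = 2 * of_real pi * \<i> * a_inv f (exp \<zeta>)"
 shows "glued (pi * \<i> * exp (- \<zeta> / 2) + b / 2) (pi * \<i> * exp (- \<zeta> / 2) - b / 2)
   (\<Psi>0 (Some (\<zeta> + 2 * pi * \<i>))) (%W. \<Psi>inf (Some (\<zeta> + 2 * pi * \<i>)) W + b)
   (%W. \<Psi>0 (Some \<zeta>) (W - b) + b) (%W. \<Psi>inf (Some \<zeta>) W + b)"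
proof -
 define A where "A = pi * \<i> * exp (- \<zeta> / 2) + b / 2"
 define A' where "A' = pi * \<i> * exp (- \<zeta> / 2) - b / 2"
 have AA: "A = A' + b" by (simp add: A_def A'_def)
 let ?eb = "Some \<zeta>" and ?et = "Some (\<zeta> + 2 * of_real pi * \<i>)"
 have e2: "exp (\<zeta> + 2 * of_real pi * \<i>) = exp \<zeta>" by (simp add: exp_add)
 have s2: "exp ((\<zeta> + 2 * of_real pi * \<i>) / 2) = - exp (\<zeta> / 2)"
  by (simp add: add_divide_distrib exp_add)
 have inv: "exp (- \<zeta> / 2) = 1 / exp (\<zeta> / 2)" by (simp add: exp_minus inverse_eq_divide)
 have ne: "exp (\<zeta> / 2) \<noteq> 0" by simp
 have al: "alpha0 f ?et = A" "alphainf f ?et = A'" "alpha0 f ?eb = - A'" "alphainf f ?eb = - A"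
  unfolding alphainf_def alpha0_def eps_of.simps sqrt_of.simps e2 s2 A_def A'_def inv b using ne by (simp_all add: field_simps)
 obtain Ht0 Hti Hb0 Hbi yt0 yti yb0 ybi D' y1 y2 where
  t: "tangent_lower yt0 Ht0" "tangent_upper yti Hti" "tangent_lower yb0 Hb0" "tangent_upper ybi Hbi"
  and h: "\<forall>\<^sub>F W in filtercomap Im at_bot. Ht0 (\<Psi>0 ?et W + A) = Ht0 W + A"
   "\<forall>\<^sub>F W in filtercomap Im at_top. Hti (\<Psi>inf ?et W + A) = Hti W + A'"
   "\<forall>\<^sub>F W in filtercomap Im at_bot. Hb0 (\<Psi>0 ?eb (W + - A')) = Hb0 W + - A'"
   "\<forall>\<^sub>F W in filtercomap Im at_top. Hbi (\<Psi>inf ?eb (W + - A')) = Hbi W + - A"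
  and y: "y1 < y2" and st: "\<forall>W. y1 < Im W --> Im W < y2 -->
       W \<in> Ht0 ` (lower_hp yt0 \<inter> upper_hp yti) \<and>
       W + D' \<in> Hbi ` (upper_hp ybi \<inter> lower_hp yb0) \<and>
       Hti (inv_into (lower_hp yt0) Ht0 W) = Hb0 (inv_into (upper_hp ybi) Hbi (W + D')) + b"
  using assms(1) unfolding compatible_at_def Let_def al b[symmetric] by blast
 obtain b3 b4 where b3: "!!W. Im W <= b3 ==> Hb0 (\<Psi>0 ?eb (W + - A')) = Hb0 W + - A'"
  and b4: "!!W. b4 <= Im W ==> Hbi (\<Psi>inf ?eb (W + - A')) = Hbi W + - A"
  using h(3,4) unfolding ev_bot ev_top by blast
 obtain b2 where b2: "!!W. b2 <= Im W ==> Hti (\<Psi>inf ?et W + A) = Hti W + A'" using h(2) unfolding ev_top by blast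
 let ?Hh0 = "%W. Hb0 (W - b) + b" and ?Hhi = "%W. Hbi (W - b) + b"
 have "glued A A' (\<Psi>0 ?et) (%W. \<Psi>inf ?et W + b) (%W. \<Psi>0 ?eb (W - b) + b) (%W. \<Psi>inf ?eb W + b)"
  unfolding glued_def
 proof (rule exI[of _ Ht0], rule exI[of _ Hti], rule exI[of _ ?Hh0], rule exI[of _ ?Hhi], rule exI[of _ yt0], rule exI[of _ yti],
   rule exI[of _ "yb0 + Im b"], rule exI[of _ "ybi + Im b"], rule exI[of _ "D' + b"], rule exI[of _ y1], rule exI[of _ y2], intro conjI allI impI)
  show "tangent_lower yt0 Ht0" "tangent_upper yti Hti" by fact+
  show "tangent_lower (yb0 + Im b) ?Hh0" by (rule tangent_shift(1)[OF t(3)])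
  show "tangent_upper (ybi + Im b) ?Hhi" by (rule tangent_shift(2)[OF t(4)])
  show "\<forall>\<^sub>F W in filtercomap Im at_bot. Ht0 (\<Psi>0 ?et W + A) = Ht0 W + A" by (rule h)
  show "\<forall>\<^sub>F W in filtercomap Im at_top. Hti (\<Psi>inf ?et W + b + A') = Hti W + A'"
   using h(2) unfolding AA by (simp add: add.assoc add.commute[of b])
  have "Hb0 (\<Psi>0 ?eb (W - A' - b) + b - b) + b = Hb0 (W - b) + b - A'" if "Im W <= b3 + Im b" for W
   using b3[of "W - b"] that by (simp add: algebra_simps)
  then show "\<forall>\<^sub>F W in filtercomap Im at_bot. Hb0 (\<Psi>0 ?eb (W - A' - b) + b - b) + b = Hb0 (W - b) + b - A'"
   unfolding ev_bot by blast
  have "Hbi (\<Psi>inf ?eb (W - A) + b - b) + b = Hbi (W - b) + b - A" if "b4 + Im b <= Im W" for W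
   using b4[of "W - b"] that by (simp add: AA algebra_simps)
  then show "\<forall>\<^sub>F W in filtercomap Im at_top. Hbi (\<Psi>inf ?eb (W - A) + b - b) + b = Hbi (W - b) + b - A"
   unfolding ev_top by blast
  show "y1 < y2" by (rule y)
  fix W assume W: "y1 < Im W" "Im W < y2"
  obtain w where w: "W = Ht0 w" "w \<in> lower_hp yt0" "w \<in> upper_hp yti" using st W by blast
  obtain v where v: "W + D' = Hbi v" "v \<in> upper_hp ybi" "v \<in> lower_hp yb0" using st W by blast
  have "Hti (inv_into (lower_hp yt0) Ht0 (Ht0 w)) = Hb0 (inv_into (upper_hp ybi) Hbi (Hbi v)) + b"
   using st W unfolding v(1)[symmetric] w(1)[symmetric] by blast
  then have e: "Hti w = Hb0 v + b"
   unfolding inv_into_f_f[OF tangentD(2)[OF t(1)] w(2)] inv_into_f_f[OF tangentD(6)[OF t(4)] v(2)] .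
  show "linked Ht0 Hti ?Hh0 ?Hhi (hstrip yti yt0) (hstrip (ybi + Im b) (yb0 + Im b)) (D' + b) (W + (D' + b))"
   unfolding linked_def
  proof (rule exI[of _ w], rule exI[of _ "v + b"], intro conjI)
   show "Hbi (v + b - b) + b = W + (D' + b)" using v(1) by (simp add: add.assoc[symmetric])
  qed (use w v e in auto)
 qed
 then show ?thesis unfolding A_def A'_def by simp
qed

theorem corollary4p9:
  fixes f :: "complex \<Rightarrow> complex \<Rightarrow> complex"
    and \<Psi>0 \<Psi>inf :: "cover \<Rightarrow> complex \<Rightarrow> complex"
    and r \<rho> \<delta> Y\<^sub>0 :: real
  assumes "0 < \<delta>" "\<delta> < pi / 2"
    and "prepared_family f r \<rho>"
    and "modulus_representative f r \<rho> \<delta> Y\<^sub>0 \<Psi>0 \<Psi>inf"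
    and "\<forall>\<zeta>\<in>log_sector \<rho> (- \<delta>) \<delta>. compatible_at f \<Psi>0 \<Psi>inf \<zeta>"
  shows "(\<exists>\<beta>. gevrey_sum (1/2) \<rho> (- \<delta>) (2 * pi + \<delta>) (lower_hp (- Y\<^sub>0)) (\<lambda>\<zeta>. \<Psi>0 (Some \<zeta>)) \<beta> \<and>
           (\<forall>d. 0 < d \<longrightarrow> d < 2 * pi \<longrightarrow>
              (\<exists>Y\<ge>Y\<^sub>0. summable_in_direction (1/2) d (lower_hp (- Y)) \<beta>))) \<and>
         (\<exists>\<beta>. gevrey_sum (1/2) \<rho> (- \<delta>) (2 * pi + \<delta>) (upper_hp Y\<^sub>0) (\<lambda>\<zeta>. \<Psi>inf (Some \<zeta>)) \<beta> \<and>
           (\<forall>d. 0 < d \<longrightarrow> d < 2 * pi \<longrightarrow>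
              (\<exists>Y\<ge>Y\<^sub>0. summable_in_direction (1/2) d (upper_hp Y) \<beta>)))"
proof -
 let ?S = "log_sector \<rho> (- \<delta>) (2 * pi + \<delta>)"
 define b where "b \<zeta> = 2 * of_real pi * \<i> * a_inv f (exp \<zeta>)" for \<zeta>
 have Y0: "0 < Y\<^sub>0" and nt: "!!e. e \<in> V_dom \<rho> \<delta> ==> normalized_transition f r Y\<^sub>0 e (\<Psi>0 e) (\<Psi>inf e)"
  and fam: "analytic_family \<rho> \<delta> (lower_hp (- Y\<^sub>0)) \<Psi>0" "analytic_family \<rho> \<delta> (upper_hp Y\<^sub>0) \<Psi>inf"
  using assms(4) unfolding modulus_representative_def by blast+
 have hol: "\<Psi>0 e holomorphic_on lower_hp (- Y\<^sub>0)" "\<Psi>inf e holomorphic_on upper_hp Y\<^sub>0"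
  and per: "!!W. W \<in> lower_hp (- Y\<^sub>0) ==> \<Psi>0 e (W + 1) = \<Psi>0 e W + 1" "!!W. W \<in> upper_hp Y\<^sub>0 ==> \<Psi>inf e (W + 1) = \<Psi>inf e W + 1"
  and lim: "((%W. \<Psi>0 e W - W) \<longlongrightarrow> 0) (filtercomap Im at_bot)"
   "((%W. \<Psi>inf e W - W) \<longlongrightarrow> - 2 * of_real pi * \<i> * a_inv f (eps_of e)) (filtercomap Im at_top)"
  if "e \<in> V_dom \<rho> \<delta>" for e
  using nt[OF that] unfolding normalized_transition_def transition_on_def by blast+
 have \<rho>: "0 < \<rho>" using assms(3) unfolding prepared_family_def by blast
 have inV: "Some \<zeta> \<in> V_dom \<rho> \<delta>" if "\<zeta> \<in> ?S" for \<zeta> using that by (simp add: V_dom_def)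
 have noneV: "None \<in> V_dom \<rho> \<delta>" by (simp add: V_dom_def)
 interpret modulus_data \<rho> \<delta> Y\<^sub>0 b "%\<zeta>. \<Psi>0 (Some \<zeta>)" "%\<zeta>. \<Psi>inf (Some \<zeta>)"
 proof
  show "0 < \<delta>" "\<delta> < pi / 2" "0 < Y\<^sub>0" by fact+
  show "0 < \<rho>" by (rule \<rho>)
  show "hol2 (?S \<times> lower_hp (- Y\<^sub>0)) (%\<zeta>. \<Psi>0 (Some \<zeta>))" by (rule hol2_of_family[OF fam(1)]) (auto intro: hol inV)
  show "hol2 (?S \<times> upper_hp Y\<^sub>0) (%\<zeta>. \<Psi>inf (Some \<zeta>))" by (rule hol2_of_family[OF fam(2)]) (auto intro: hol inV)
  show "\<Psi>0 (Some \<zeta>) (W + 1) = \<Psi>0 (Some \<zeta>) W + 1" if "\<zeta> \<in> ?S" "Im W < - Y\<^sub>0" for \<zeta> W using per(1)[OF inV] that by simp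
  show "\<Psi>inf (Some \<zeta>) (W + 1) = \<Psi>inf (Some \<zeta>) W + 1" if "\<zeta> \<in> ?S" "Y\<^sub>0 < Im W" for \<zeta> W using per(2)[OF inV] that by simp
  show "((%W. \<Psi>0 (Some \<zeta>) W - W) \<longlongrightarrow> 0) (filtercomap Im at_bot)" if "\<zeta> \<in> ?S" for \<zeta> by (rule lim(1)[OF inV[OF that]])
  show "((%W. \<Psi>inf (Some \<zeta>) W - W + b \<zeta>) \<longlongrightarrow> 0) (filtercomap Im at_top)" if "\<zeta> \<in> ?S" for \<zeta>
   using tendsto_add[OF lim(2)[OF inV[OF that]] tendsto_const[of "b \<zeta>"]] by (simp add: b_def)
  show "\<exists>R>0. R <= \<rho> & (\<exists>B. \<forall>\<zeta>\<in>log_sector R (- \<delta>) (2 * pi + \<delta>). \<forall>W\<in>K. cmod (\<Psi>0 (Some \<zeta>) W) <= B)" if "compact K" "K \<subseteq> lower_hp (- Y\<^sub>0)" for K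
   by (rule bounded_of_family[OF fam(1) holomorphic_on_imp_continuous_on[OF hol(1)[OF noneV]] that \<rho>])
  show "\<exists>R>0. R <= \<rho> & (\<exists>B. \<forall>\<zeta>\<in>log_sector R (- \<delta>) (2 * pi + \<delta>). \<forall>W\<in>K. cmod (\<Psi>inf (Some \<zeta>) W) <= B)" if "compact K" "K \<subseteq> upper_hp Y\<^sub>0" for K
   by (rule bounded_of_family[OF fam(2) holomorphic_on_imp_continuous_on[OF hol(2)[OF noneV]] that \<rho>])
  show "b (\<zeta> + 2 * pi * \<i>) = b \<zeta>" for \<zeta> by (simp add: b_def exp_add)
  show "glued (pi * \<i> * exp (- \<zeta> / 2) + b \<zeta> / 2) (pi * \<i> * exp (- \<zeta> / 2) - b \<zeta> / 2)
    (\<Psi>0 (Some (\<zeta> + 2 * pi * \<i>))) (%W. \<Psi>inf (Some (\<zeta> + 2 * pi * \<i>)) W + b \<zeta>)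
    (%W. \<Psi>0 (Some \<zeta>) (W - b \<zeta>) + b \<zeta>) (%W. \<Psi>inf (Some \<zeta>) W + b \<zeta>)"
   if "\<zeta> \<in> log_sector \<rho> (- \<delta>) \<delta>" for \<zeta>
   by (rule glued_of_compatible[OF _ b_def]) (use assms(5) that in blast)
 qed
 obtain \<beta> where \<beta>: "gevrey_sum (1/2) \<rho> (- \<delta>) (2 * pi + \<delta>) (lower_hp (- Y\<^sub>0)) (%\<zeta>. \<Psi>0 (Some \<zeta>)) \<beta>" using gevrey_sum_Q0 by blast
 obtain \<beta>' where \<beta>': "gevrey_sum (1/2) \<rho> (- \<delta>) (2 * pi + \<delta>) (upper_hp Y\<^sub>0) (%\<zeta>. \<Psi>inf (Some \<zeta>)) \<beta>'" using gevrey_sum_P0 by blast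
 show ?thesis using \<beta> \<beta>' summable_directions[OF \<beta> \<beta>'] by blast
qed

end
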